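(* The Fréchet derivative $I'_{\lambda,\beta}(W)\in H_0^3(R)$ of the functional $I_{\lambda,\beta}(W)=J_{\lambda,\beta}(W+G)$ exists for every point $W\in\overline{B_0(2d)}$ and for all $\lambda,\beta>0$. Let $\lambda_1=\lambda_1(\alpha,\varepsilon,d)$ be the number from the strict convexity result for $J_{\lambda,\beta}$ recalled in the context, and denote $\lambda_2=\lambda_1(\alpha,\varepsilon,3d)\ge\lambda_1$. Let $\lambda\ge\lambda_2$ and let $\beta\in[2e^{-\lambda\alpha T},1)$. Then the functional $I_{\lambda,\beta}(W)$ is strictly convex on the ball $\overline{B_0(2d)}\subset H_0^3(R)$. More precisely, the following estimate holds for all $W_1,W_2\in\overline{B_0(2d)}$ and all $\lambda\ge\lambda_2$: $$\begin{aligned}&I_{\lambda,\beta}(W_2)-I_{\lambda,\beta}(W_1)-I'_{\lambda,\beta}(W_1)(W_2-W_1)\ \ge\ C_1e^{-2\lambda(2\alpha-\varepsilon)}\|W_2-W_1\|^2_{H^1(Tr_{\alpha,\varepsilon})}\\ &\qquad+C_1e^{-2\lambda(2\alpha-\varepsilon)}\|W_2(x,0)-W_1(x,0)\|^2_{H^1(0,2\alpha-\varepsilon)}+\frac{\beta}{2}\|W_2-W_1\|^2_{H^3(R)},\end{aligned}$$ where $C_1=C_1(\alpha,\varepsilon,d)>0$ depends only on the listed parameters. Furthermore, there exists a unique minimizer $W_{\min,\lambda,\beta}\in\overline{B_0(2d)}$ of the functional $I_{\lambda,\beta}(W)$ on $\overline{B_0(2d)}$, and the following inequality holds: $$I'_{\lambda,\beta}(W_{\min,\lambda,\beta})(W-W_{\min,\lambda,\beta})\ge0,\qquad\forall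 W\in\overline{B_0(2d)}.$$
   Context: All functions are real valued. $R=(0,1)\times(0,T)$ with $T\ge2$; $\alpha\in(0,1/2)$, $\varepsilon\in(0,2\alpha)$, and $d>0$ is an arbitrary number. The Carleman weight is $\varphi_\lambda(x,t)=\exp(-2\lambda(x+\alpha t))$, and $Tr_{\alpha,\varepsilon}=\{(x,t):x+\alpha t<2\alpha-\varepsilon;\ x,t>0\}$. Operator and functional: $$L(w)=w_{xx}-2w_{xt}+2w_x\int_0^tw_x(x,\tau)d\tau-2w_xw-2w_t\int_0^tw_x(x,\tau)d\tau,$$ $$J_{\lambda,\beta}(w)=\int_R[L(w)]^2\varphi_\lambda\,dxdt+\beta\|w\|^2_{H^3(R)}.$$ Sets: for functions $p_0,p_1$ of $t$ and $D>0$, $$B(D,p_0,p_1)=\{w\in H^3(R): w(0,t)=p_0(t),\ w_x(0,t)=p_1(t),\ w_x(1,t)=0,\ \|w\|_{H^3(R)}<D\};$$ $H_0^2(R)=\{u\in H^2(R):u(0,t)=u_x(0,t)=0\}$, $H_0^3(R)=H^3(R)\cap H_0^2(R)$, and $$B_0(D)=\{U\in H_0^3(R):\|U\|_{H^3(R)}<D\}.$$ Overlines denote closures in $H^3(R)$. For a Fréchet derivative $J'_{\lambda,\beta}(w)\in H_0^3(R)$ (respectively $I'_{\lambda,\beta}(W)\in H_0^3(R)$), its value on an increment $h\in H_0^3(R)$ is the $H^3(R)$ scalar product with $h$. Data and the function $G$: for a coefficient $a\in C^1(\mathbb R)$ with $a\ge0$ on $(0,1)$ and $a=0$ outside $(0,1)$,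 let $u$ solve $u_{tt}=u_{xx}+a(x)u$ for $x\in\mathbb R$, $t>0$, with $u(x,0)=0$, $u_t(x,0)=\delta(x)$; the corresponding function is $w(x,t)=\partial_t\ln u(x,t+x)$ for $x,t>0$. The inverse problem data are $f_0(t)=u(0,t)$, $f_1(t)=u_x(0,t)$, and $p_0=f_0'/f_0$, $p_1=\frac{d}{dt}[(f_0'+f_1)/f_0]$. It is assumed that there is an exact coefficient $a^*$ with these properties whose noiseless data give $p_0^*,p_1^*$ and whose corresponding function $w^*$ lies in $B(d,p_0^*,p_1^* )$. Let $p_0,p_1$ be the (noisy) data, $\xi\in(0,1)$ the noise level, $G^*\in B(d,p_0^*,p_1^* )$, and suppose that $G\in B(d,p_0,p_1)$ is a function with $\|G-G^*\|_{H^3(R)}<\xi$. Then $I_{\lambda,\beta}(W)=J_{\lambda,\beta}(W+G)$ for $W\in\overline{B_0(2d)}$. The number $\lambda_1$. First, there are constants $C=C(\alpha)>0$ and $\lambda_0=\lambda_0(\alpha)\ge1$ such that for all $u\in H_0^2(R)$ and all $\lambda\ge\lambda_0$ the following Carleman estimate holds: $$\begin{aligned}&\int_R(u_{xx}-2u_{xt})^2\varphi_\lambda dxdt\ge C\lambda\int_R(u_x^2+u_t^2)\varphi_\lambda dxdt+C\lambda^3\int_Ru^2\varphi_\lambda dxdt+C\lambda\int_0^1u_x^2(x,0)e^{-2\lambda x}dx\\&\quad+C\lambda^3\int_0^1u^2(x,0)e^{-2\lambda x}dx-C\lambda e^{-2\lambda\alpha T}\int_0^1u_x^2(x,T)dx-C\lambda^3e^{-2\lambda\alpha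 T}\int_0^1u^2(x,T)dx.\end{aligned}$$ Strict convexity result for $J_{\lambda,\beta}$: for any $\lambda,\beta>0$ and any $w\in\overline{B(d,p_0,p_1)}$ the Fréchet derivative $J'_{\lambda,\beta}(w)\in H_0^3(R)$ exists, and for every $d>0$ there exist a sufficiently large number $\lambda_1=\lambda_1(\alpha,\varepsilon,d)\ge\lambda_0$ and a number $C_1=C_1(\alpha,\varepsilon,d)>0$, both depending only on the listed parameters, such that for all $\lambda\ge\lambda_1$, all $\beta\in[2e^{-\lambda\alpha T},1)$ and all $w_1,w_2\in\overline{B(d,p_0,p_1)}$, $$\begin{aligned}&J_{\lambda,\beta}(w_2)-J_{\lambda,\beta}(w_1)-J'_{\lambda,\beta}(w_1)(w_2-w_1)\ge C_1e^{-2\lambda(2\alpha-\varepsilon)}\|w_2-w_1\|^2_{H^1(Tr_{\alpha,\varepsilon})}\\ &\qquad+C_1e^{-2\lambda(2\alpha-\varepsilon)}\|w_2(x,0)-w_1(x,0)\|^2_{H^1(0,2\alpha-\varepsilon)}+\frac{\beta}{2}\|w_2-w_1\|^2_{H^3(R)}.\end{aligned}$$ $\lambda_1(\alpha,\varepsilon,d)$ denotes this number, and $\lambda_1(\alpha,\varepsilon,3d)$ is the same number with $d$ replaced by $3d$. The symbol $C_1$ denotes different positive numbers depending only on $\alpha,\varepsilon,d$.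
   Formalization: The numbers λ0, λ1, λ2, C and C_1 are allowed to depend also on the fixed T≥2 (the domain R), not only on α, ε, d: uniformity in T fails, since ∫_0^t w_x dτ can grow like √T and violates the convexity estimate at any fixed λ. *)

theory Defs
  imports "HOL-Analysis.Analysis" "HOL-Library.Function_Algebras"
begin

text \<open>Points of the plane are pairs (x, t). Elements of Lebesgue and Sobolev spaces are
  represented by functions, so equality in these spaces is equality almost everywhere.\<close>

section \<open>Square integrable functions and weak derivatives\<close>

definition L2 :: "'a::euclidean_space set \<Rightarrow> ('a \<Rightarrow> real) set" where
  "L2 \<Omega> = {u. u \<in> borel_measurable (lebesgue_on \<Omega>) \<and> integrable (lebesgue_on \<Omega>) (\<lambda>z. (u z)\<^sup>2)}"

text \<open>In a smooth jet, \<open>D 0 0\<close> is a \<open>C\<^sup>\<infinity>\<close> function on the plane and \<open>D i j\<close> is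
  its partial derivative of order i in x and order j in t. Every \<open>C\<^sup>\<infinity>\<close> function has exactly
  one such jet.\<close>

definition smooth_jet :: "(nat \<Rightarrow> nat \<Rightarrow> real \<times> real \<Rightarrow> real) \<Rightarrow> bool" where
  "smooth_jet D \<longleftrightarrow>
     (\<forall>i j z. (D i j has_derivative (\<lambda>(h, k). D (Suc i) j z * h + D i (Suc j) z * k)) (at z))"

definition smooth_jet1 :: "(nat \<Rightarrow> real \<Rightarrow> real) \<Rightarrow> bool" where
  "smooth_jet1 D \<longleftrightarrow> (\<forall>i x. (D i has_real_derivative D (Suc i) x) (at x))"

definition compact_support_in :: "'a::topological_space set \<Rightarrow> ('a \<Rightarrow> real) \<Rightarrow> bool" where
  "compact_support_in \<Omega> f \<longleftrightarrow> (\<exists>K. compact K \<and> K \<subseteq> \<Omega> \<and> (\<forall>z. z \<notin> K \<longrightarrow> f z = 0))"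

definition has_wderiv ::
  "(real \<times> real) set \<Rightarrow> nat \<Rightarrow> nat \<Rightarrow> (real \<times> real \<Rightarrow> real) \<Rightarrow> (real \<times> real \<Rightarrow> real) \<Rightarrow> bool" where
  "has_wderiv \<Omega> i j u v \<longleftrightarrow>
     (\<forall>D. smooth_jet D \<and> compact_support_in \<Omega> (D 0 0) \<longrightarrow>
        (LINT z|lebesgue_on \<Omega>. u z * D i j z) = (-1) ^ (i + j) * (LINT z|lebesgue_on \<Omega>. v z * D 0 0 z))"

definition wderiv ::
  "(real \<times> real) set \<Rightarrow> nat \<Rightarrow> nat \<Rightarrow> (real \<times> real \<Rightarrow> real) \<Rightarrow> real \<times> real \<Rightarrow> real" where
  "wderiv \<Omega> i j u = (SOME v. v \<in> L2 \<Omega> \<and> has_wderiv \<Omega> i j u v)"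

definition has_wderiv1 :: "real set \<Rightarrow> (real \<Rightarrow> real) \<Rightarrow> (real \<Rightarrow> real) \<Rightarrow> bool" where
  "has_wderiv1 S u v \<longleftrightarrow>
     (\<forall>D. smooth_jet1 D \<and> compact_support_in S (D 0) \<longrightarrow>
        (LINT x|lebesgue_on S. u x * D 1 x) = - (LINT x|lebesgue_on S. v x * D 0 x))"

definition wderiv1 :: "real set \<Rightarrow> (real \<Rightarrow> real) \<Rightarrow> real \<Rightarrow> real" where
  "wderiv1 S u = (SOME v. v \<in> L2 S \<and> has_wderiv1 S u v)"

section \<open>Sobolev spaces\<close>

definition sobolev :: "nat \<Rightarrow> (real \<times> real) set \<Rightarrow> (real \<times> real \<Rightarrow> real) set" where
  "sobolev k \<Omega> = {u \<in> L2 \<Omega>. \<forall>i j. i + j \<le> k \<longrightarrow> (\<exists>v \<in> L2 \<Omega>. has_wderiv \<Omega> i j u v)}"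

definition sob_inner ::
  "nat \<Rightarrow> (real \<times> real) set \<Rightarrow> (real \<times> real \<Rightarrow> real) \<Rightarrow> (real \<times> real \<Rightarrow> real) \<Rightarrow> real" where
  "sob_inner k \<Omega> u v =
     (\<Sum>(i, j) \<in> {(i, j). i + j \<le> k}. LINT z|lebesgue_on \<Omega>. wderiv \<Omega> i j u z * wderiv \<Omega> i j v z)"

definition sob_norm :: "nat \<Rightarrow> (real \<times> real) set \<Rightarrow> (real \<times> real \<Rightarrow> real) \<Rightarrow> real" where
  "sob_norm k \<Omega> u = sqrt (sob_inner k \<Omega> u u)"

definition H1_norm1 :: "real set \<Rightarrow> (real \<Rightarrow> real) \<Rightarrow> real" where
  "H1_norm1 S u = sqrt ((LINT x|lebesgue_on S. (u x)\<^sup>2) + (LINT x|lebesgue_on S. (wderiv1 S u x)\<^sup>2))"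

text \<open>Traces of functions from \<open>H\<^sup>1(\<Omega>)\<close> on a segment \<open>\<gamma> ` S\<close> of the boundary, obtained
  by extending the restriction operator continuously from smooth functions.\<close>

definition has_trace ::
  "(real \<times> real) set \<Rightarrow> (real \<Rightarrow> real \<times> real) \<Rightarrow> real set \<Rightarrow>
   (real \<times> real \<Rightarrow> real) \<Rightarrow> (real \<Rightarrow> real) \<Rightarrow> bool" where
  "has_trace \<Omega> \<gamma> S u g \<longleftrightarrow> u \<in> sobolev 1 \<Omega> \<and> g \<in> L2 S \<and>
     (\<exists>D. (\<forall>n. smooth_jet (D n) \<and> D n 0 0 \<in> sobolev 1 \<Omega>) \<and>
       (\<lambda>n. sob_norm 1 \<Omega> (D n 0 0 - u)) \<longlonglongrightarrow> 0 \<and>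
       (\<lambda>n. LINT s|lebesgue_on S. (D n 0 0 (\<gamma> s) - g s)\<^sup>2) \<longlonglongrightarrow> 0)"

definition trace_on ::
  "(real \<times> real) set \<Rightarrow> (real \<Rightarrow> real \<times> real) \<Rightarrow> real set \<Rightarrow>
   (real \<times> real \<Rightarrow> real) \<Rightarrow> real \<Rightarrow> real" where
  "trace_on \<Omega> \<gamma> S u = (SOME g. has_trace \<Omega> \<gamma> S u g)"

section \<open>The domain and the function sets\<close>

definition rect :: "real \<Rightarrow> (real \<times> real) set" where
  "rect T = {0<..<1} \<times> {0<..<T}"

definition Tr :: "real \<Rightarrow> real \<Rightarrow> (real \<times> real) set" where
  "Tr \<alpha> \<epsilon> = {(x, t). x + \<alpha> * t < 2 * \<alpha> - \<epsilon> \<and> x > 0 \<and> t > 0}"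

abbreviation H3 :: "real \<Rightarrow> (real \<times> real \<Rightarrow> real) set" where
  "H3 T \<equiv> sobolev 3 (rect T)"

abbreviation H3_norm :: "real \<Rightarrow> (real \<times> real \<Rightarrow> real) \<Rightarrow> real" where
  "H3_norm T \<equiv> sob_norm 3 (rect T)"

abbreviation H3_inner :: "real \<Rightarrow> (real \<times> real \<Rightarrow> real) \<Rightarrow> (real \<times> real \<Rightarrow> real) \<Rightarrow> real" where
  "H3_inner T \<equiv> sob_inner 3 (rect T)"

definition has_trace_x :: "real \<Rightarrow> real \<Rightarrow> (real \<times> real \<Rightarrow> real) \<Rightarrow> (real \<Rightarrow> real) \<Rightarrow> bool" where
  "has_trace_x T c u g \<longleftrightarrow> has_trace (rect T) (\<lambda>t. (c, t)) {0<..<T} u g"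

definition trace_t :: "real \<Rightarrow> real \<Rightarrow> (real \<times> real \<Rightarrow> real) \<Rightarrow> real \<Rightarrow> real" where
  "trace_t T c u = trace_on (rect T) (\<lambda>x. (x, c)) {0<..<1} u"

definition B :: "real \<Rightarrow> real \<Rightarrow> (real \<Rightarrow> real) \<Rightarrow> (real \<Rightarrow> real) \<Rightarrow> (real \<times> real \<Rightarrow> real) set" where
  "B T D p0 p1 = {w \<in> H3 T.
     has_trace_x T 0 w p0 \<and>
     has_trace_x T 0 (wderiv (rect T) 1 0 w) p1 \<and>
     has_trace_x T 1 (wderiv (rect T) 1 0 w) (\<lambda>t. 0) \<and>
     H3_norm T w < D}"

definition H20 :: "real \<Rightarrow> (real \<times> real \<Rightarrow> real) set" where
  "H20 T = {u \<in> sobolev 2 (rect T).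
     has_trace_x T 0 u (\<lambda>t. 0) \<and> has_trace_x T 0 (wderiv (rect T) 1 0 u) (\<lambda>t. 0)}"

definition H30 :: "real \<Rightarrow> (real \<times> real \<Rightarrow> real) set" where
  "H30 T = H3 T \<inter> H20 T"

definition B0 :: "real \<Rightarrow> real \<Rightarrow> (real \<times> real \<Rightarrow> real) set" where
  "B0 T D = {U \<in> H30 T. H3_norm T U < D}"

definition H3_closure :: "real \<Rightarrow> (real \<times> real \<Rightarrow> real) set \<Rightarrow> (real \<times> real \<Rightarrow> real) set" where
  "H3_closure T S = {w \<in> H3 T. \<forall>e>0. \<exists>v\<in>S. H3_norm T (w - v) < e}"

section \<open>Operator and functional\<close>

definition carleman_weight :: "real \<Rightarrow> real \<Rightarrow> real \<times> real \<Rightarrow> real" where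
  "carleman_weight \<alpha> lam = (\<lambda>(x, t). exp (- 2 * lam * (x + \<alpha> * t)))"

definition Lop :: "real \<Rightarrow> (real \<times> real \<Rightarrow> real) \<Rightarrow> real \<times> real \<Rightarrow> real" where
  "Lop T w = (\<lambda>(x, t).
     let w_x = wderiv (rect T) 1 0 w; w_t = wderiv (rect T) 0 1 w;
         w_xx = wderiv (rect T) 2 0 w; w_xt = wderiv (rect T) 1 1 w;
         S = (LINT \<tau>|lebesgue_on {0..t}. w_x (x, \<tau>))
     in w_xx (x, t) - 2 * w_xt (x, t) + 2 * w_x (x, t) * S
        - 2 * w_x (x, t) * w (x, t) - 2 * w_t (x, t) * S)"

definition J :: "real \<Rightarrow> real \<Rightarrow> real \<Rightarrow> real \<Rightarrow> (real \<times> real \<Rightarrow> real) \<Rightarrow> real" where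
  "J T \<alpha> lam \<beta> w =
     (LINT z|lebesgue_on (rect T). (Lop T w z)\<^sup>2 * carleman_weight \<alpha> lam z) + \<beta> * (H3_norm T w)\<^sup>2"

text \<open>Frechet derivative along the space \<open>H30 T\<close>, identified with an element of that space
  through the \<open>H\<^sup>3\<close> scalar product.\<close>

definition has_gradient ::
  "real \<Rightarrow> ((real \<times> real \<Rightarrow> real) \<Rightarrow> real) \<Rightarrow> (real \<times> real \<Rightarrow> real) \<Rightarrow> (real \<times> real \<Rightarrow> real) \<Rightarrow> bool" where
  "has_gradient T F w g \<longleftrightarrow> g \<in> H30 T \<and>
     (\<forall>e>0. \<exists>\<delta>>0. \<forall>h\<in>H30 T. H3_norm T h < \<delta> \<longrightarrow>
        \<bar>F (w + h) - F w - H3_inner T g h\<bar> \<le> e * H3_norm T h)"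

definition gradient ::
  "real \<Rightarrow> ((real \<times> real \<Rightarrow> real) \<Rightarrow> real) \<Rightarrow> (real \<times> real \<Rightarrow> real) \<Rightarrow> real \<times> real \<Rightarrow> real" where
  "gradient T F w = (SOME g. has_gradient T F w g)"

section \<open>Carleman estimate and convexity estimate\<close>

definition carleman_estimate :: "real \<Rightarrow> real \<Rightarrow> real \<Rightarrow> real \<Rightarrow> bool" where
  "carleman_estimate T \<alpha> C lam0 \<longleftrightarrow>
     (\<forall>u\<in>H20 T. \<forall>lam\<ge>lam0.
        let u_x = wderiv (rect T) 1 0 u; u_t = wderiv (rect T) 0 1 u;
            u_xx = wderiv (rect T) 2 0 u; u_xt = wderiv (rect T) 1 1 u;
            \<phi> = carleman_weight \<alpha> lam
        in (LINT z|lebesgue_on (rect T). (u_xx z - 2 * u_xt z)\<^sup>2 * \<phi> z) \<ge>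
             C * lam * (LINT z|lebesgue_on (rect T). ((u_x z)\<^sup>2 + (u_t z)\<^sup>2) * \<phi> z)
           + C * lam ^ 3 * (LINT z|lebesgue_on (rect T). (u z)\<^sup>2 * \<phi> z)
           + C * lam * (LINT x|lebesgue_on {0<..<1}. (trace_t T 0 u_x x)\<^sup>2 * exp (- 2 * lam * x))
           + C * lam ^ 3 * (LINT x|lebesgue_on {0<..<1}. (trace_t T 0 u x)\<^sup>2 * exp (- 2 * lam * x))
           - C * lam * exp (- 2 * lam * \<alpha> * T) * (LINT x|lebesgue_on {0<..<1}. (trace_t T T u_x x)\<^sup>2)
           - C * lam ^ 3 * exp (- 2 * lam * \<alpha> * T) * (LINT x|lebesgue_on {0<..<1}. (trace_t T T u x)\<^sup>2))"

definition convexity_bound ::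
  "real \<Rightarrow> real \<Rightarrow> real \<Rightarrow> real \<Rightarrow> real \<Rightarrow> real \<Rightarrow> ((real \<times> real \<Rightarrow> real) \<Rightarrow> real) \<Rightarrow>
   (real \<times> real \<Rightarrow> real) \<Rightarrow> (real \<times> real \<Rightarrow> real) \<Rightarrow> bool" where
  "convexity_bound T \<alpha> \<epsilon> lam \<beta> C F w1 w2 \<longleftrightarrow>
     F w2 - F w1 - H3_inner T (gradient T F w1) (w2 - w1) \<ge>
       C * exp (- 2 * lam * (2 * \<alpha> - \<epsilon>)) * (sob_norm 1 (Tr \<alpha> \<epsilon>) (w2 - w1))\<^sup>2
     + C * exp (- 2 * lam * (2 * \<alpha> - \<epsilon>)) * (H1_norm1 {0<..<2 * \<alpha> - \<epsilon>} (trace_t T 0 (w2 - w1)))\<^sup>2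
     + \<beta> / 2 * (H3_norm T (w2 - w1))\<^sup>2"

definition J_strict_convexity :: "real \<Rightarrow> real \<Rightarrow> real \<Rightarrow> real \<Rightarrow> real \<Rightarrow> real \<Rightarrow> bool" where
  "J_strict_convexity T \<alpha> \<epsilon> d lam1 C1 \<longleftrightarrow>
     (\<forall>p0 p1.
        (\<forall>lam>0. \<forall>\<beta>>0. \<forall>w\<in>H3_closure T (B T d p0 p1). \<exists>g. has_gradient T (J T \<alpha> lam \<beta>) w g) \<and>
        (\<forall>lam\<ge>lam1. \<forall>\<beta>\<in>{2 * exp (- lam * \<alpha> * T)..<1}.
           \<forall>w1\<in>H3_closure T (B T d p0 p1). \<forall>w2\<in>H3_closure T (B T d p0 p1).
             convexity_bound T \<alpha> \<epsilon> lam \<beta> C1 (J T \<alpha> lam \<beta>) w1 w2))"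

definition strictly_convex_on ::
  "real \<Rightarrow> (real \<times> real \<Rightarrow> real) set \<Rightarrow> ((real \<times> real \<Rightarrow> real) \<Rightarrow> real) \<Rightarrow> bool" where
  "strictly_convex_on T K F \<longleftrightarrow>
     (\<forall>V\<in>K. \<forall>W\<in>K. \<not> (AE z in lebesgue_on (rect T). V z = W z) \<longrightarrow>
        (\<forall>\<theta>\<in>{0<..<1}. F (\<lambda>z. (1 - \<theta>) * V z + \<theta> * W z) < (1 - \<theta>) * F V + \<theta> * F W))"

definition is_minimizer ::
  "(real \<times> real \<Rightarrow> real) set \<Rightarrow> ((real \<times> real \<Rightarrow> real) \<Rightarrow> real) \<Rightarrow> (real \<times> real \<Rightarrow> real) \<Rightarrow> bool" where
  "is_minimizer K F V \<longleftrightarrow> V \<in> K \<and> (\<forall>W\<in>K. F V \<le> F W)"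

section \<open>The inverse problem data\<close>

definition admissible_coefficient :: "(real \<Rightarrow> real) \<Rightarrow> bool" where
  "admissible_coefficient a \<longleftrightarrow>
     a C1_differentiable_on UNIV \<and> (\<forall>x\<in>{0<..<1}. a x \<ge> 0) \<and> (\<forall>x. x \<notin> {0<..<1} \<longrightarrow> a x = 0)"

definition C2_on :: "(real \<times> real) set \<Rightarrow> (real \<times> real \<Rightarrow> real) \<Rightarrow> bool" where
  "C2_on S u \<longleftrightarrow>
     (\<exists>D. (\<forall>z\<in>S. D (0::nat) (0::nat) z = u z) \<and>
       (\<forall>i j. i + j \<le> 1 \<longrightarrow> (\<forall>z\<in>S. (D i j has_derivative
          (\<lambda>(h, k). D (Suc i) j z * h + D i (Suc j) z * k)) (at z within S))) \<and>
       (\<forall>i j. i + j = 2 \<longrightarrow> continuous_on S (D i j)))"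

text \<open>The Cauchy problem \<open>u\<^sub>t\<^sub>t = u\<^sub>x\<^sub>x + a(x) u\<close>, \<open>u(x,0) = 0\<close>, \<open>u\<^sub>t(x,0) = \<delta>(x)\<close> in its weak
  form: two integrations by parts in t against a test function produce the value of the test
  function at the origin. The solution jumps across the characteristics \<open>|x| = t\<close>; the condition
  \<open>C2_on\<close> selects the classical representative inside the cone \<open>|x| < t\<close>, the only place where
  pointwise values of u are used below.\<close>

definition solves_wave_problem :: "(real \<Rightarrow> real) \<Rightarrow> (real \<times> real \<Rightarrow> real) \<Rightarrow> bool" where
  "solves_wave_problem a u \<longleftrightarrow>
     (\<forall>K. compact K \<longrightarrow> integrable (lebesgue_on (K \<inter> {z. snd z > 0})) u) \<and>
     (\<forall>D. smooth_jet D \<and> compact_support_in UNIV (D 0 0) \<longrightarrow>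
        (LINT z|lebesgue_on {z. snd z > 0}. u z * (D 0 2 z - D 2 0 z - a (fst z) * D 0 0 z)) = D 0 0 (0, 0)) \<and>
     C2_on {(x, t). \<bar>x\<bar> < t} u"

definition f0_of :: "(real \<times> real \<Rightarrow> real) \<Rightarrow> real \<Rightarrow> real" where
  "f0_of u t = u (0, t)"

definition f1_of :: "(real \<times> real \<Rightarrow> real) \<Rightarrow> real \<Rightarrow> real" where
  "f1_of u t = deriv (\<lambda>x. u (x, t)) 0"

definition p0_of :: "(real \<times> real \<Rightarrow> real) \<Rightarrow> real \<Rightarrow> real" where
  "p0_of u t = deriv (f0_of u) t / f0_of u t"

definition p1_of :: "(real \<times> real \<Rightarrow> real) \<Rightarrow> real \<Rightarrow> real" where
  "p1_of u = deriv (\<lambda>t. (deriv (f0_of u) t + f1_of u t) / f0_of u t)"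

definition w_of :: "(real \<times> real \<Rightarrow> real) \<Rightarrow> real \<times> real \<Rightarrow> real" where
  "w_of u = (\<lambda>(x, t). deriv (\<lambda>s. ln (u (x, s + x))) t)"

end

theory Submission
 imports Defs "HOL-Real_Asymp.Real_Asymp"
begin

text \<open>The operator has the form \<open>L(w) = F w + N(w, w)\<close> with the principal part \<open>F w = w\<^sub>x\<^sub>x - 2 w\<^sub>x\<^sub>t\<close> and
 the bilinear form \<open>N(a, b) = 2 a\<^sub>x S(b) - 2 a\<^sub>x b - 2 a\<^sub>t S(b)\<close>, where S(b) is the integral of \<open>b\<^sub>x\<close> over
 \<open>[0, t]\<close>. Therefore \<open>J(w + h) = J(w) + l(h) + r(h)\<close> holds exactly, where l is a bounded linear functional on
 \<open>H\<^sup>3\<close> and the remainder is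
 \<open>r(h) = \<integral> (F h + N(w, h) + N(h, w) + N(h, h))\<^sup>2 \<phi> + 2 \<integral> L(w) N(h, h) \<phi> + \<beta> \<parallel>h\<parallel>\<^sup>2\<close>
 (\<open>J_expand\<close>). The remainder is of second order, so l is the Frechet derivative, and its Riesz
 representative in the closed space of increments is the gradient (\<open>J_has_gradient\<close>). The convexity
 estimate is thus a lower bound for \<open>r(h)\<close> (\<open>rem_part_lower\<close>).

 That bound comes from \<open>(F h + R)\<^sup>2 \<ge> (F h)\<^sup>2/2 - R\<^sup>2\<close>. The Carleman estimate bounds \<open>\<integral> (F h)\<^sup>2 \<phi>\<close> from below by
 \<open>C\<lambda> E(h)\<close> with \<open>E(h) = \<integral> (h\<^sub>x\<^sup>2 + h\<^sub>t\<^sup>2) \<phi>\<close>, and further favourable terms. All the other terms are at most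
 \<open>\<Gamma> E(h)\<close> with \<open>\<Gamma>\<close> independent of \<open>\<lambda>\<close> (\<open>quadratic_part_lower\<close>): in N(h, w) and N(h, h) the coefficients S and b are
 bounded functions; in N(w, h) and in the product of L(w) with N(h, h) an unbounded coefficient, which is
 square integrable on almost every line, meets h or S(h), and these are controlled on lines by weighted
 integrals of \<open>h\<^sub>x\<close> because the weight decreases in x and in t (\<open>trilinear_weighted\<close>). A large \<open>\<lambda>\<close> absorbs
 \<open>\<Gamma> E(h)\<close>. The boundary terms at \<open>t = T\<close> of the Carleman estimate have the factor \<open>exp(-2\<lambda>\<alpha>T)\<close> and are absorbed
 by half of \<open>\<beta> \<parallel>h\<parallel>\<^sup>2\<close>, which is the role of the lower bound for \<open>\<beta>\<close> (\<open>absorption\<close>). Since \<open>\<phi>\<close> is at least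
 \<open>exp(-2\<lambda>(2\<alpha> - \<epsilon>))\<close> on the triangle, what remains dominates the norms in the theorem.

 The Carleman estimate rests on the factorisation \<open>F = (\<partial>\<^sub>x - 2\<partial>\<^sub>t) \<partial>\<^sub>x\<close>: an energy estimate for the transport
 operator (\<open>transport_estimate\<close>), in which the derivative of the weight along the characteristics has a sign
 because \<open>\<alpha> < 1/2\<close>, is used for \<open>u\<^sub>x\<close> and for u (\<open>carleman\<close>).

 The integrations by parts take place in Sobolev spaces with traces as limits of boundary values of smooth
 functions. Their existence and the Green formulas follow from the density of smooth functions in \<open>H\<^sup>1\<close> of the
 rectangle (\<open>smooth_dense\<close>), which is proved by duality: a function orthogonal to all products of cosines
 with zero normal derivative vanishes.

 For the minimizer, \<open>W + G\<close> has norm at most 3d for W in the closed ball of radius 2d, so the convexity bound holds on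
 this ball for \<open>\<lambda>\<close> beyond the threshold of 3d. The term \<open>\<beta>/2 \<parallel>W\<^sub>2 - W\<^sub>1\<parallel>\<^sup>2\<close> makes the functional strongly convex;
 minimizing sequences are then Cauchy sequences, \<open>H\<^sup>3\<close> is complete, and the minimizer is unique almost
 everywhere and satisfies the variational inequality.\<close>

abbreviation tends :: "(nat => 'a::topological_space) => 'a => bool" (infix "\<leadsto>" 60)
 where "X \<leadsto> l \<equiv> X \<longlonglongrightarrow> l"
type_synonym pfun = "real \<times> real => real"

section \<open>Smooth functions of one variable and bump functions\<close>

definition smooth1 :: "(real => real) => bool" where
 "smooth1 f \<longleftrightarrow> (\<exists>D. smooth_jet1 D \<and> D 0 = f)"

text \<open>A class of functions that is closed under taking derivatives consists of smooth functions; this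
 produces the whole sequence of derivatives at once.\<close>

lemma smooth1_coinduct:
 assumes "f \<in> S" and "\<And>g. g \<in> S ==> \<exists>g'\<in>S. \<forall>x. (g has_real_derivative g' x) (at x)"
 shows "smooth1 f"
proof -
 obtain d where d: "\<And>g. g \<in> S ==> d g \<in> S" "\<And>g x. g \<in> S ==> (g has_real_derivative d g x) (at x)"
  using assms(2) by metis
 have S: "(d ^^ n) f \<in> S" for n by (induction n) (auto simp: d assms(1))
 have "smooth_jet1 (\<lambda>n. (d ^^ n) f)"
  unfolding smooth_jet1_def using d(2)[OF S] by auto
 then show ?thesis unfolding smooth1_def by (intro exI[of _ "\<lambda>n. (d ^^ n) f"]) simp
qed

lemma smooth_jet1_shift: "smooth_jet1 D ==> smooth_jet1 (\<lambda>n. D (n + k))"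
 by (simp add: smooth_jet1_def)

lemma smooth1_jet: assumes "smooth1 f" obtains D where "smooth_jet1 D" "D 0 = f"
 using assms unfolding smooth1_def by blast

lemma smooth_jet1_smooth1: "smooth_jet1 D ==> smooth1 (D n)"
 unfolding smooth1_def using smooth_jet1_shift[of D n] by (intro exI[of _ "\<lambda>i. D (i + n)"]) simp

text \<open>The finite sums of products of derivatives of the two factors form a class closed under
 differentiation.\<close>

lemma smooth1_mult:
 assumes "smooth1 f" "smooth1 g" shows "smooth1 (\<lambda>x. f x * g x)"
proof -
 obtain F G where F: "smooth_jet1 F" "F 0 = f" and G: "smooth_jet1 G" "G 0 = g"
  using assms by (metis smooth1_jet)
 define S where "S = {h. \<exists>I::(nat \<times> nat) list. h = (\<lambda>x. \<Sum>(i, j)\<leftarrow>I. F i x * G j x)}"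
 have base: "(\<lambda>x. F i x * G j x) \<in> S" for i j
  unfolding S_def by (auto intro!: exI[of _ "[(i, j)]"])
 have "\<exists>h'\<in>S. \<forall>x. (h has_real_derivative h' x) (at x)" if hS: "h \<in> S" for h
 proof -
  obtain I :: "(nat \<times> nat) list" where h: "h = (\<lambda>x. \<Sum>(i, j)\<leftarrow>I. F i x * G j x)"
   using hS unfolding S_def by blast
  let ?I = "concat (map (\<lambda>(i, j). [(Suc i, j), (i, Suc j)]) I)"
  have "((\<lambda>x. \<Sum>(i, j)\<leftarrow>I. F i x * G j x) has_real_derivative
    (\<Sum>(i, j)\<leftarrow>?I. F i x * G j x)) (at x)" for x
  proof (induction I)
   case (Cons p I)
   show ?case
    using F(1) G(1) Cons unfolding smooth_jet1_def
    by (cases p) (auto intro!: derivative_eq_intros simp: algebra_simps)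
  qed simp
  then have d: "\<forall>x. (h has_real_derivative (\<Sum>(i, j)\<leftarrow>?I. F i x * G j x)) (at x)" unfolding h by blast
  have m: "(\<lambda>x. \<Sum>(i, j)\<leftarrow>?I. F i x * G j x) \<in> S" unfolding S_def by blast
  show ?thesis by (rule bexI[OF _ m]) (rule d)
 qed
 from smooth1_coinduct[OF base[of 0 0] this] show ?thesis using F G by simp
qed

lemma smooth1_affine:
 assumes "smooth1 f" shows "smooth1 (\<lambda>x. f (c * x + d))"
proof -
 obtain F where F: "smooth_jet1 F" "F 0 = f" using assms by (metis smooth1_jet)
 have "smooth_jet1 (\<lambda>n x. c ^ n * F n (c * x + d))"
  unfolding smooth_jet1_def
 proof (intro allI)
  fix i x
  have "(F i has_real_derivative F (Suc i) (c * x + d)) (at (c * x + d))"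
   using F(1) by (auto simp: smooth_jet1_def)
  then have "((\<lambda>x. F i (c * x + d)) has_real_derivative F (Suc i) (c * x + d) * c) (at x)"
   by (rule DERIV_chain2) (auto intro!: derivative_eq_intros)
  then have "((\<lambda>x. c ^ i * F i (c * x + d)) has_real_derivative c ^ i * (F (Suc i) (c * x + d) * c)) (at x)"
   by (rule DERIV_cmult)
  then show "((\<lambda>x. c ^ i * F i (c * x + d)) has_real_derivative c ^ Suc i * F (Suc i) (c * x + d)) (at x)"
   by (simp add: algebra_simps)
 qed
 then show ?thesis unfolding smooth1_def using F(2) by (intro exI[of _ "\<lambda>n x. c ^ n * F n (c * x + d)"]) auto
qed

lemma smooth1_trig: "smooth1 (\<lambda>x. A * cos (k * x) + P * sin (k * x))"
proof (rule smooth1_coinduct[where S = "{\<lambda>x. A * cos (k * x) + P * sin (k * x) | A P. True}"])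
 fix g assume "g \<in> {\<lambda>x. A * cos (k * x) + P * sin (k * x) | A P. True}"
 then obtain A P where g: "g = (\<lambda>x. A * cos (k * x) + P * sin (k * x))" by blast
 have "\<forall>x. (g has_real_derivative (k * P) * cos (k * x) + (- k * A) * sin (k * x)) (at x)"
  unfolding g by (auto intro!: derivative_eq_intros simp: algebra_simps)
 then show "\<exists>g'\<in>{\<lambda>x. A * cos (k * x) + P * sin (k * x) | A P. True}. \<forall>x. (g has_real_derivative g' x) (at x)"
  by (intro bexI[of _ "\<lambda>x. (k * P) * cos (k * x) + (- k * A) * sin (k * x)"]) blast+
qed blast

lemma smooth1_cos: "smooth1 (\<lambda>x. cos (k * x))" and smooth1_sin: "smooth1 (\<lambda>x. sin (k * x))"
 using smooth1_trig[of 1 k 0] smooth1_trig[of 0 k 1] by simp_all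

lemma smooth1_poly: "smooth1 (\<lambda>x. A * x + P)"
proof (rule smooth1_coinduct[where S = "{\<lambda>x. A * x + P | A P. True}"])
 fix g :: "real => real" assume "g \<in> {\<lambda>x. A * x + P | A P. True}"
 then obtain A P where g: "g = (\<lambda>x. A * x + P)" by blast
 have "\<forall>x. (g has_real_derivative (0 * x + A)) (at x)"
  unfolding g by (auto intro!: derivative_eq_intros)
 then show "\<exists>g'\<in>{\<lambda>x. A * x + P | A P. True}. \<forall>x. (g has_real_derivative g' x) (at x)"
  by (intro bexI[of _ "\<lambda>x. 0 * x + A"]) blast+
qed blast

definition flat_exp :: "real => real" where
 "flat_exp x = (if x > 0 then exp (- inverse x) else 0)"

lemma poly_times_exp_tendsto_0:
 "((\<lambda>y::real. y ^ k * poly p y * exp (- y)) \<longlongrightarrow> 0) at_top"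
proof (induction p arbitrary: k)
 case (pCons a p)
 have "((\<lambda>y::real. a * (y ^ k / exp y) + y ^ Suc k * poly p y * exp (- y)) \<longlongrightarrow> a * 0 + 0) at_top"
  by (intro tendsto_intros tendsto_power_div_exp_0 pCons)
 then show ?case by (simp add: algebra_simps exp_minus divide_inverse)
qed simp

text \<open>The functions that equal a polynomial in the reciprocal of x times exp(-1/x) for positive x, and 0
 elsewhere, form a class closed under differentiation.\<close>

lemma smooth1_flat_exp: "smooth1 flat_exp"
proof -
 define e where "e p x = (if x > 0 then poly p (inverse x) * exp (- inverse x) else (0::real))" for p x
 have base: "flat_exp \<in> range e" unfolding flat_exp_def e_def by (auto intro!: image_eqI[of _ _ 1])
 have "\<exists>g'\<in>range e. \<forall>x. (g has_real_derivative g' x) (at x)" if gS: "g \<in> range e" for g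
 proof -
  obtain p where g: "g = e p" using gS by blast
  let ?q = "monom 1 2 * (p - pderiv p)"
  have "(e p has_real_derivative e ?q x) (at x)" for x
  proof (cases x "0::real" rule: linorder_cases)
   case less
   have "((\<lambda>_. 0) has_real_derivative 0) (at x)" by simp
   then have "(e p has_real_derivative 0) (at x)"
    by (rule has_field_derivative_transform_within_open[where S = "{..<0}"]) (use less in \<open>auto simp: e_def\<close>)
   then show ?thesis using less by (simp add: e_def)
  next
   case greater
   have "((\<lambda>x. poly p (inverse x) * exp (- inverse x)) has_real_derivative e ?q x) (at x)"
    using greater
    by (auto intro!: derivative_eq_intros DERIV_chain2[OF poly_DERIV] simp: e_def poly_monom field_simps power2_eq_square)
   then show ?thesis
    by (rule has_field_derivative_transform_within_open[where S = "{0<..}"]) (use greater in \<open>auto simp: e_def\<close>)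
  next
   case equal
   have "((\<lambda>y. y ^ 1 * poly p y * exp (- y)) \<longlongrightarrow> 0) at_top" by (rule poly_times_exp_tendsto_0)
   then have "((\<lambda>h. inverse h ^ 1 * poly p (inverse h) * exp (- inverse h)) \<longlongrightarrow> 0) (at_right (0::real))"
    by (rule filterlim_compose[OF _ filterlim_inverse_at_top_right])
   then have r: "((\<lambda>h. e p h / h) \<longlongrightarrow> 0) (at_right 0)"
    by (rule Lim_transform_eventually) (rule eventually_at_rightI[of 0 1], auto simp: e_def field_simps)
   have l: "((\<lambda>h. e p h / h) \<longlongrightarrow> 0) (at_left 0)"
    by (rule Lim_transform_eventually[OF tendsto_const])
     (rule eventually_at_leftI[of "-1" 0], auto simp: e_def)
   from l r have "((\<lambda>h. e p h / h) \<longlongrightarrow> 0) (at 0)" by (rule filterlim_split_at)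
   then show ?thesis using equal by (simp add: DERIV_def e_def)
  qed
  then show ?thesis using g by blast
 qed
 from smooth1_coinduct[OF base this] show ?thesis .
qed

lemma flat_exp_bounds: "0 \<le> flat_exp x" "flat_exp x \<le> 1"
 by (auto simp: flat_exp_def)

lemma flat_exp_DERIV:
 "(flat_exp has_real_derivative (if x > 0 then exp (- inverse x) / x^2 else 0)) (at x)"
proof -
 obtain F where F: "smooth_jet1 F" "F 0 = flat_exp" by (metis smooth1_flat_exp smooth1_jet)
 then have D: "(flat_exp has_real_derivative F 1 x) (at x)" for x by (metis One_nat_def smooth_jet1_def)
 have pos: "F 1 x = exp (- inverse x) / x^2" if "x > 0" for x
 proof (rule DERIV_unique[OF D])
  have "((\<lambda>x. exp (- inverse x)) has_real_derivative exp (- inverse x) / x^2) (at x)"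
   using that by (auto intro!: derivative_eq_intros simp: field_simps power2_eq_square)
  then show "(flat_exp has_real_derivative exp (- inverse x) / x^2) (at x)"
   by (rule has_field_derivative_transform_within_open[where S = "{0<..}"]) (use that in \<open>auto simp: flat_exp_def\<close>)
 qed
 have npos: "F 1 x = 0" if "x \<le> 0" for x
 proof (rule DERIV_local_min[OF D, of 1])
  show "\<forall>y. \<bar>x - y\<bar> < 1 \<longrightarrow> flat_exp x \<le> flat_exp y" using that by (auto simp: flat_exp_def)
 qed simp
 show ?thesis using D[of x] pos[of x] npos[of x] by (cases "x > 0") auto
qed

text \<open>With growing n these functions increase to the indicator function of the open interval; the
 parameter n does the double duty of shrinking the margin and steepening the slope.\<close>

definition bump :: "real => real => nat => real => real" where
 "bump a b n x = flat_exp (n * (x - a) - 1) * flat_exp (n * (b - x) - 1)"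

lemma smooth1_bump: "smooth1 (bump a b n)"
proof -
 have "smooth1 (\<lambda>x. flat_exp (real n * x + (- real n * a - 1)) * flat_exp ((- real n) * x + (real n * b - 1)))"
  by (intro smooth1_mult smooth1_affine smooth1_flat_exp)
 then show ?thesis unfolding bump_def by (simp add: algebra_simps)
qed

lemma bump_bounds: "0 \<le> bump a b n x" "bump a b n x \<le> 1"
 unfolding bump_def using flat_exp_bounds by (auto intro: mult_le_one)

lemma bump_support: "x \<notin> {a + inverse n .. b - inverse n} ==> bump a b n x = 0"
 by (cases "n = 0") (auto simp: bump_def flat_exp_def field_simps not_le)

lemma bump_support_subset: "{a + inverse (real n) .. b - inverse n} \<subseteq> {a<..<b}" if "n > 0"
proof -
 have i: "inverse (real n) > 0" using that by simp
 show ?thesis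
 proof
  fix x assume "x \<in> {a + inverse (real n) .. b - inverse n}"
  then have "a + inverse (real n) \<le> x" "x \<le> b - inverse (real n)" by simp_all
  with i have "a < x" "x < b" by linarith+
  then show "x \<in> {a<..<b}" by simp
 qed
qed

lemma bump_eventually_pos:
 assumes "a < x" shows "filterlim (\<lambda>n. real n * (x - a) - 1) at_top sequentially"
 using assms by real_asymp

lemma flat_exp_tendsto_1: "(flat_exp \<longlongrightarrow> 1) at_top"
proof -
 have "((\<lambda>x::real. exp (- inverse x)) \<longlongrightarrow> exp (- 0)) at_top"
  by (intro tendsto_intros tendsto_inverse_0_at_top filterlim_ident)
 then have "((\<lambda>x::real. exp (- inverse x)) \<longlongrightarrow> 1) at_top" by simp
 then show ?thesis
  by (rule Lim_transform_eventually) (auto simp: flat_exp_def eventually_at_top_dense intro!: exI[of _ 0])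
qed

lemma bump_tendsto_1: assumes "a < x" "x < b" shows "(\<lambda>n. bump a b n x) \<leadsto> 1"
proof -
 have "(\<lambda>n. flat_exp (n * (x - a) - 1) * flat_exp (n * (b - x) - 1)) \<leadsto> 1 * 1"
  by (intro tendsto_mult filterlim_compose[OF flat_exp_tendsto_1] bump_eventually_pos assms)
 then show ?thesis by (simp add: bump_def)
qed

lemma bump_outside: "x \<notin> {a<..<b} ==> bump a b n x = 0"
proof -
 assume "x \<notin> {a<..<b}"
 then have "real n * (x - a) - 1 \<le> 0 \<or> real n * (b - x) - 1 \<le> 0"
  by (auto simp: not_less) (smt (verit) mult_nonneg_nonpos of_nat_0_le_iff)+
 then show ?thesis by (auto simp: bump_def flat_exp_def)
qed

lemma bump_tendsto: "(\<lambda>n. bump a b n x) \<leadsto> indicator {a<..<b} x"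
 by (cases "x \<in> {a<..<b}") (auto simp: bump_tendsto_1 bump_outside)

text \<open>The derivative of the flat function is at most 3/(x + 1). After rescaling, this makes the derivative
 of a bump at most a constant divided by the distance to the end points, uniformly in n.\<close>

lemma inverse_exp_bound: "exp (- inverse x) / x^2 * (x + 1) \<le> 3" if "x > 0" for x :: real
proof -
 let ?s = "inverse x"
 have s: "?s > 0" using that by simp
 have a: "1 + ?s + ?s^2 / 2 \<le> exp ?s" using exp_lower_Taylor_quadratic[of ?s] s by simp
 have "?s + ?s^2 \<le> 3 * exp ?s" using a s zero_le_power2[of ?s] by linarith
 then have "(?s + ?s^2) * exp (- ?s) \<le> 3" by (simp add: exp_minus field_simps)
 moreover have "exp (- inverse x) / x^2 * (x + 1) = (?s + ?s^2) * exp (- ?s)"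
  using that by (simp add: field_simps power2_eq_square)
 ultimately show ?thesis by simp
qed

section \<open>Smooth jets in the plane\<close>

lemma smooth_jet_tensor:
 assumes "smooth_jet1 f" "smooth_jet1 g"
 shows "smooth_jet (\<lambda>i j z. f i (fst z) * g j (snd z))"
 unfolding smooth_jet_def
proof (intro allI)
 fix i j and z :: "real \<times> real"
 have f: "(f i has_derivative (*) (f (Suc i) (fst z))) (at (fst z))"
  and g: "(g j has_derivative (*) (g (Suc j) (snd z))) (at (snd z))"
  using assms by (auto simp: smooth_jet1_def has_field_derivative_def)
 have f': "((\<lambda>z. f i (fst z)) has_derivative (\<lambda>h. f (Suc i) (fst z) * fst h)) (at z)"
  using has_derivative_compose[OF has_derivative_fst[OF has_derivative_ident] f] by simp
 have g': "((\<lambda>z. g j (snd z)) has_derivative (\<lambda>h. g (Suc j) (snd z) * snd h)) (at z)"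
  using has_derivative_compose[OF has_derivative_snd[OF has_derivative_ident] g] by simp
 show "((\<lambda>z. f i (fst z) * g j (snd z)) has_derivative
   (\<lambda>(h, k). f (Suc i) (fst z) * g j (snd z) * h + f i (fst z) * g (Suc j) (snd z) * k)) (at z)"
  using has_derivative_mult[OF f' g'] by (simp add: case_prod_unfold algebra_simps)
qed

lemma smooth_jet_shift: "smooth_jet D ==> smooth_jet (\<lambda>i j. D (i + a) (j + b))"
 by (simp add: smooth_jet_def)

lemma smooth_jet_add: "smooth_jet D ==> smooth_jet E ==> smooth_jet (\<lambda>i j z. D i j z + E i j z)"
 unfolding smooth_jet_def
proof (intro allI)
 fix i j z
 assume D: "\<forall>i j z. (D i j has_derivative (\<lambda>(h, k). D (Suc i) j z * h + D i (Suc j) z * k)) (at z)"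
  and E: "\<forall>i j z. (E i j has_derivative (\<lambda>(h, k). E (Suc i) j z * h + E i (Suc j) z * k)) (at z)"
 from has_derivative_add[OF D[rule_format, of i j z] E[rule_format, of i j z]]
 show "((\<lambda>z. D i j z + E i j z) has_derivative
   (\<lambda>(h, k). (D (Suc i) j z + E (Suc i) j z) * h + (D i (Suc j) z + E i (Suc j) z) * k)) (at z)"
  by (simp add: case_prod_unfold algebra_simps)
qed

lemma smooth_jet_scale: "smooth_jet D ==> smooth_jet (\<lambda>i j z. c * D i j z)"
 unfolding smooth_jet_def
proof (intro allI)
 fix i j z
 assume D: "\<forall>i j z. (D i j has_derivative (\<lambda>(h, k). D (Suc i) j z * h + D i (Suc j) z * k)) (at z)"
 from has_derivative_mult_right[OF D[rule_format, of i j z], of c]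
 show "((\<lambda>z. c * D i j z) has_derivative (\<lambda>(h, k). c * D (Suc i) j z * h + c * D i (Suc j) z * k)) (at z)"
  by (simp add: case_prod_unfold algebra_simps)
qed

lemma smooth_jet_zero: "smooth_jet (\<lambda>i j z. 0)"
 by (simp add: smooth_jet_def case_prod_unfold)

lemma smooth_jet_swap: "smooth_jet D ==> smooth_jet (\<lambda>i j z. D j i (prod.swap z))"
 unfolding smooth_jet_def
proof (intro allI)
 fix i j and z :: "real \<times> real"
 assume D: "\<forall>i j z. (D i j has_derivative (\<lambda>(h, k). D (Suc i) j z * h + D i (Suc j) z * k)) (at z)"
 have s: "(prod.swap has_derivative prod.swap) (at z)"
  unfolding prod.swap_def by (auto intro!: derivative_eq_intros)
 from has_derivative_compose[OF s D[rule_format, of j i "prod.swap z"]]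
 show "((\<lambda>z. D j i (prod.swap z)) has_derivative
   (\<lambda>(h, k). D j (Suc i) (prod.swap z) * h + D (Suc j) i (prod.swap z) * k)) (at z)"
  by (simp add: case_prod_unfold algebra_simps)
qed

lemma smooth_jet_continuous: assumes "smooth_jet D" shows "continuous_on S (D i j)"
 using assms unfolding smooth_jet_def
 by (meson continuous_at_imp_continuous_on has_derivative_continuous)

lemma smooth_jet_partial_fst:
 assumes "smooth_jet D"
 shows "((\<lambda>x. D i j (x, t)) has_real_derivative D (Suc i) j (x, t)) (at x)"
proof -
 have D: "(D i j has_derivative (\<lambda>(h, k). D (Suc i) j (x, t) * h + D i (Suc j) (x, t) * k)) (at (x, t))"
  using assms unfolding smooth_jet_def by blast
 have "((\<lambda>x. (x, t)) has_derivative (\<lambda>h. (h, 0))) (at x)"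
  by (auto intro!: derivative_eq_intros)
 from has_derivative_compose[OF this D] show ?thesis
  by (simp add: has_field_derivative_def mult_commute_abs)
qed

text \<open>The complement of a closed set is open, so vanishing there passes to each derivative in turn.\<close>

lemma smooth_jet_vanish:
 assumes "smooth_jet D" "closed K" "\<And>z. z \<notin> K ==> D 0 0 z = 0" "z \<notin> K"
 shows "D i j z = 0"
proof -
 have step: "(\<forall>z. z \<notin> K \<longrightarrow> D (Suc i) j z = 0) \<and> (\<forall>z. z \<notin> K \<longrightarrow> D i (Suc j) z = 0)"
  if v: "\<And>z. z \<notin> K ==> D i j z = 0" for i j
 proof -
  have "D (Suc i) j z = 0 \<and> D i (Suc j) z = 0" if z: "z \<notin> K" for z
  proof -
   have D: "(D i j has_derivative (\<lambda>(h, k). D (Suc i) j z * h + D i (Suc j) z * k)) (at z)"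
    using assms(1) unfolding smooth_jet_def by blast
   have "((\<lambda>_. 0) has_derivative (\<lambda>_. 0)) (at z)" by simp
   then have "(D i j has_derivative (\<lambda>_. 0)) (at z)"
    by (rule has_derivative_transform_within_open[where s = "- K"]) (use z assms(2) v in auto)
   from has_derivative_unique[OF D this] have e: "(\<lambda>(h, k). D (Suc i) j z * h + D i (Suc j) z * k) = (\<lambda>_. 0)" .
   show ?thesis using fun_cong[OF e, of "(1, 0)"] fun_cong[OF e, of "(0, 1)"] by auto
  qed
  then show ?thesis by blast
 qed
 have "\<forall>z. z \<notin> K \<longrightarrow> D i 0 z = 0" for i by (induction i) (use assms(3) step in auto)
 then have "\<forall>z. z \<notin> K \<longrightarrow> D i j z = 0" by (induction j) (use step in auto)
 then show ?thesis using assms(4) by blast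
qed

section \<open>Spaces with a semidefinite scalar product\<close>

lemma linear_coeff_zero:
 fixes a b :: real
 assumes "\<And>t. 0 \<le> a * t + b * t^2" shows "a = 0"
proof (rule ccontr)
 assume a: "a \<noteq> 0"
 show False
 proof (cases "b > 0")
  case True
  have "0 \<le> a * (- a / (2 * b)) + b * (- a / (2 * b))^2" by (rule assms)
  also have "\<dots> = - (a^2 / (4 * b))" using True by (simp add: field_simps power2_eq_square)
  finally show False using a True by (simp add: divide_le_0_iff not_less)
 next
  case False
  have "0 \<le> a * (- a) + b * (- a)^2" by (rule assms)
  moreover have "b * (- a)^2 \<le> 0" using False by (simp add: mult_nonpos_nonneg)
  moreover have "a * a > 0" using a by (metis not_real_square_gt_zero)
  ultimately show False by linarith
 qed
qed

text \<open>Functions that agree almost everywhere are not identified, so the scalar products are only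
 semidefinite; limits and minimizers are unique up to norm zero.\<close>

locale ip_space =
 fixes V :: "('a => real) set" and ip :: "('a => real) => ('a => real) => real"
 assumes zero: "(\<lambda>_. 0) \<in> V"
  and lin: "u \<in> V ==> v \<in> V ==> (\<lambda>z. a * u z + b * v z) \<in> V"
  and sym: "u \<in> V ==> v \<in> V ==> ip u v = ip v u"
  and ip_lin: "u \<in> V ==> v \<in> V ==> w \<in> V ==> ip (\<lambda>z. a * u z + b * v z) w = a * ip u w + b * ip v w"
  and nonneg: "u \<in> V ==> 0 \<le> ip u u"
begin

definition nrm :: "('a => real) => real" where "nrm u = sqrt (ip u u)"

lemma nrm_nonneg: "u \<in> V ==> 0 \<le> nrm u" by (simp add: nrm_def nonneg)
lemma nrm_sq: "u \<in> V ==> (nrm u)^2 = ip u u" by (simp add: nrm_def nonneg)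

lemma add: "u \<in> V ==> v \<in> V ==> u + v \<in> V" using lin[of u v 1 1] by (simp add: plus_fun_def)
lemma diff: "u \<in> V ==> v \<in> V ==> u - v \<in> V" using lin[of u v 1 "-1"] by (simp add: fun_diff_def)
lemma scale: "u \<in> V ==> (\<lambda>z. c * u z) \<in> V" using lin[of u u c 0] by simp

lemma ip_lin2: "u \<in> V ==> v \<in> V ==> w \<in> V ==> ip w (\<lambda>z. a * u z + b * v z) = a * ip w u + b * ip w v"
 using ip_lin[of u v w a b] sym[of w] lin[of u v a b] by simp

lemma ip_diff: "u \<in> V ==> v \<in> V ==> w \<in> V ==> ip (u - v) w = ip u w - ip v w"
 using ip_lin[of u v w 1 "-1"] by (simp add: fun_diff_def)
lemma ip_diff2: "u \<in> V ==> v \<in> V ==> w \<in> V ==> ip w (u - v) = ip w u - ip w v"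
 using ip_lin2[of u v w 1 "-1"] by (simp add: fun_diff_def)
lemma ip_scale: "u \<in> V ==> w \<in> V ==> ip (\<lambda>z. c * u z) w = c * ip u w"
 using ip_lin[of u u w c 0] by simp
lemma ip_scale2: "u \<in> V ==> w \<in> V ==> ip w (\<lambda>z. c * u z) = c * ip w u"
 using ip_lin2[of u u w c 0] by simp

lemma ip_lincomb:
 assumes "u \<in> V" "v \<in> V"
 shows "ip (\<lambda>z. a * u z + b * v z) (\<lambda>z. a * u z + b * v z) = a^2 * ip u u + 2 * a * b * ip u v + b^2 * ip v v"
 using assms by (simp add: ip_lin ip_lin2 lin sym[of v u] algebra_simps power2_eq_square)

lemma cauchy_schwarz_sq:
 assumes u: "u \<in> V" and v: "v \<in> V" shows "(ip u v)^2 \<le> ip u u * ip v v"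
proof -
 have q: "0 \<le> ip u u + 2 * c * ip u v + c^2 * ip v v" for c
  using ip_lincomb[OF u v, of 1 c] nonneg[OF lin[OF u v, of 1 c]] by simp
 show ?thesis
 proof (cases "ip v v = 0")
  case True
  have "ip u v = 0"
  proof (rule ccontr)
   assume "ip u v \<noteq> 0"
   then show False using q[of "- (ip u u + 1) / (2 * ip u v)"] True by (simp add: field_simps)
  qed
  then show ?thesis using True by simp
 next
  case False
  then have p: "ip v v > 0" using nonneg[OF v] by simp
  have "0 \<le> ip u u + 2 * (- ip u v / ip v v) * ip u v + (- ip u v / ip v v)^2 * ip v v" by (rule q)
  also have "\<dots> = ip u u - (ip u v)\<^sup>2 / ip v v" using p by (simp add: field_simps power2_eq_square)
  finally show ?thesis using p by (simp add: field_simps)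
 qed
qed

lemma cauchy_schwarz: assumes "u \<in> V" "v \<in> V" shows "\<bar>ip u v\<bar> \<le> nrm u * nrm v"
 using real_sqrt_le_mono[OF cauchy_schwarz_sq[OF assms]] by (simp add: nrm_def real_sqrt_mult)

lemma nrm_scale: "u \<in> V ==> nrm (\<lambda>z. c * u z) = \<bar>c\<bar> * nrm u"
 using ip_lincomb[of u u c 0] by (simp add: nrm_def real_sqrt_mult)

lemma nrm_triangle: assumes u: "u \<in> V" and v: "v \<in> V" shows "nrm (u + v) \<le> nrm u + nrm v"
proof (rule power2_le_imp_le)
 have "(nrm (u + v))^2 = ip u u + 2 * ip u v + ip v v"
  using ip_lincomb[OF u v, of 1 1] unfolding nrm_sq[OF add[OF u v]] by (simp add: plus_fun_def)
 also have "\<dots> \<le> ip u u + 2 * (nrm u * nrm v) + ip v v" using cauchy_schwarz[OF u v] by simp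
 also have "\<dots> = (nrm u + nrm v)^2" by (simp add: power2_sum nrm_sq u v)
 finally show "(nrm (u + v))^2 \<le> (nrm u + nrm v)^2" .
qed (simp add: nrm_nonneg u v)

lemma nrm_minus_commute: assumes "u \<in> V" "v \<in> V" shows "nrm (u - v) = nrm (v - u)"
 using nrm_scale[OF diff[OF assms], of "-1"] by (simp add: fun_diff_def)

lemma nrm_triangle_diff: assumes "u \<in> V" "v \<in> V" "w \<in> V" shows "nrm (u - w) \<le> nrm (u - v) + nrm (v - w)"
 using nrm_triangle[OF diff diff, of u v v w] assms by simp

lemma nrm_triangle_rev: assumes "u \<in> V" "v \<in> V" shows "\<bar>nrm u - nrm v\<bar> \<le> nrm (u - v)"
 using nrm_triangle[of "u - v" v] nrm_triangle[of "v - u" u] assms diff[of u v] diff[of v u]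
  nrm_minus_commute[of u v] by (simp add: abs_le_iff)

lemma nrm_tendsto:
 assumes "\<And>n. f n \<in> V" "l \<in> V" "(\<lambda>n. nrm (f n - l)) \<leadsto> 0"
 shows "(\<lambda>n. nrm (f n)) \<leadsto> nrm l"
proof -
 have "(\<lambda>n. nrm (f n) - nrm l) \<leadsto> 0"
  by (rule Lim_null_comparison[OF _ assms(3)]) (use nrm_triangle_rev assms in auto)
 then show ?thesis by (simp add: LIM_zero_iff)
qed

lemma ip_tendsto:
 assumes "\<And>n. f n \<in> V" "l \<in> V" "(\<lambda>n. nrm (f n - l)) \<leadsto> 0" "w \<in> V"
 shows "(\<lambda>n. ip (f n) w) \<leadsto> ip l w"
proof -
 have "(\<lambda>n. nrm (f n - l) * nrm w) \<leadsto> 0 * nrm w" by (intro tendsto_intros assms)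
 then have z: "(\<lambda>n. nrm (f n - l) * nrm w) \<leadsto> 0" by simp
 have "(\<lambda>n. ip (f n) w - ip l w) \<leadsto> 0"
  by (rule Lim_null_comparison[OF _ z])
   (use assms diff in \<open>auto simp flip: ip_diff intro!: always_eventually cauchy_schwarz\<close>)
 then show ?thesis by (simp add: LIM_zero_iff)
qed

text \<open>Linear combinations are continuous in the seminorm; applied to the norms inside and on the sides.\<close>

lemma lincomb_tendsto:
 assumes f: "\<And>n::nat. f n \<in> V" "u \<in> V" "(\<lambda>n. nrm (f n - u)) \<leadsto> 0"
  and g: "\<And>n::nat. g n \<in> V" "v \<in> V" "(\<lambda>n. nrm (g n - v)) \<leadsto> 0"
 shows "(\<lambda>n. nrm ((\<lambda>z. p * f n z + q * g n z) - (\<lambda>z. p * u z + q * v z))) \<leadsto> 0" (is "?d \<leadsto> 0")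
proof (rule Lim_null_comparison)
 have e: "(\<lambda>z. p * f n z + q * g n z) - (\<lambda>z. p * u z + q * v z) = (\<lambda>z. p * (f n - u) z) + (\<lambda>z. q * (g n - v) z)" for n
  by (auto simp: fun_eq_iff algebra_simps)
 have F: "f n - u \<in> V" and G: "g n - v \<in> V" for n by (intro diff f g)+
 show "\<forall>\<^sub>F n in sequentially. norm (?d n) \<le> \<bar>p\<bar> * nrm (f n - u) + \<bar>q\<bar> * nrm (g n - v)"
 proof (intro always_eventually allI)
  fix n
  have "0 \<le> ?d n" unfolding e by (rule nrm_nonneg[OF add[OF scale[OF F] scale[OF G]]])
  moreover have "?d n \<le> \<bar>p\<bar> * nrm (f n - u) + \<bar>q\<bar> * nrm (g n - v)"
   unfolding e using nrm_triangle[OF scale[OF F] scale[OF G], of p n q n] unfolding nrm_scale[OF F] nrm_scale[OF G] .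
  ultimately show "norm (?d n) \<le> \<bar>p\<bar> * nrm (f n - u) + \<bar>q\<bar> * nrm (g n - v)" by simp
 qed
 have "(\<lambda>n. \<bar>p\<bar> * nrm (f n - u) + \<bar>q\<bar> * nrm (g n - v)) \<leadsto> \<bar>p\<bar> * 0 + \<bar>q\<bar> * 0" by (intro tendsto_intros f g)
 then show "(\<lambda>n. \<bar>p\<bar> * nrm (f n - u) + \<bar>q\<bar> * nrm (g n - v)) \<leadsto> 0" by simp
qed

lemma ip_self_expand:
 assumes "u \<in> V" "v \<in> V" shows "ip (u + v) (u + v) = ip u u + 2 * ip u v + ip v v"
  and "ip (u - v) (u - v) = ip u u - 2 * ip u v + ip v v"
 using ip_lincomb[OF assms, of 1 1] ip_lincomb[OF assms, of 1 "-1"] by (simp_all add: plus_fun_def fun_diff_def)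

end

locale complete_ip_space = ip_space +
 assumes complete: "(\<And>n::nat. f n \<in> V) ==> (\<And>e. e > 0 ==> \<exists>N. \<forall>m\<ge>N. \<forall>n\<ge>N. nrm (f m - f n) < e) ==>
   \<exists>l\<in>V. (\<lambda>n. nrm (f n - l)) \<leadsto> 0"
begin

text \<open>Uniform convexity, in the form of a gain at some point that need not be the midpoint itself, makes
 every minimizing sequence a Cauchy sequence.\<close>

theorem minimizer_exists:
 assumes K: "K \<subseteq> V" "K \<noteq> {}"
  and closed: "\<And>f l. (\<And>n::nat. f n \<in> K) ==> l \<in> V ==> (\<lambda>n. nrm (f n - l)) \<leadsto> 0 ==> l \<in> K"
  and below: "\<And>u. u \<in> K ==> m \<le> F u"
  and c: "c > 0"
  and mid: "\<And>u v. u \<in> K ==> v \<in> K ==> \<exists>w\<in>K. F w \<le> (F u + F v) / 2 - c * (nrm (u - v))^2"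
  and cont: "\<And>f l. (\<And>n::nat. f n \<in> K) ==> l \<in> K ==> (\<lambda>n. nrm (f n - l)) \<leadsto> 0 ==> (\<lambda>n. F (f n)) \<leadsto> F l"
 shows "\<exists>l\<in>K. \<forall>u\<in>K. F l \<le> F u"
proof -
 define i where "i = Inf (F ` K)"
 have bdd: "bdd_below (F ` K)" using below by (auto intro!: bdd_belowI[of _ m])
 have lower: "i \<le> F u" if "u \<in> K" for u unfolding i_def using bdd that by (auto intro: cInf_lower)
 have "\<exists>u\<in>K. F u < i + e" if "e > 0" for e
  using cInf_less_iff[of "F ` K" "i + e"] bdd K(2) that unfolding i_def by auto
 then have "\<forall>n. \<exists>u\<in>K. F u < i + inverse (real (Suc n))" by simp
 then obtain f where f: "\<And>n. f n \<in> K" "\<And>n. F (f n) < i + inverse (real (Suc n))" by metis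
 have aux: "x \<le> p ==> y \<le> p ==> 2 * w \<le> a + b - 2 * q ==> i \<le> w ==> a < i + x ==> b < i + y ==>
   p < r ==> q < r" for x y p w a b q r i :: real by linarith
 have cau: "\<exists>N. \<forall>m\<ge>N. \<forall>n\<ge>N. nrm (f m - f n) < e" if e: "e > 0" for e
 proof -
  obtain N where N: "inverse (real (Suc N)) < c * e^2"
   using reals_Archimedean[of "c * e^2"] c e by auto
  have "nrm (f m - f n) < e" if "m \<ge> N" "n \<ge> N" for m n
  proof -
   obtain w where w: "w \<in> K" "F w \<le> (F (f m) + F (f n)) / 2 - c * (nrm (f m - f n))^2"
    using mid f(1) by blast
   have w2: "2 * F w \<le> F (f m) + F (f n) - 2 * (c * (nrm (f m - f n))^2)" using w(2) unfolding add_divide_distrib by linarith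
   have "inverse (real (Suc m)) \<le> inverse (real (Suc N))" "inverse (real (Suc n)) \<le> inverse (real (Suc N))"
    using that by (simp_all add: field_simps)
   then have "c * (nrm (f m - f n))^2 < c * e^2"
    using aux[OF _ _ w2 lower[OF w(1)] f(2)[of m] f(2)[of n] N] by simp
   then have "(nrm (f m - f n))^2 < e^2" using c by simp
   then show ?thesis using e by (simp add: power_less_imp_less_base)
  qed
  then show ?thesis by blast
 qed
 obtain l where l: "l \<in> V" "(\<lambda>n. nrm (f n - l)) \<leadsto> 0"
  using complete[of f, OF _ cau] f(1) K(1) by blast
 then have lK: "l \<in> K" using closed[of f l] f(1) by blast
 have "(\<lambda>n. i + inverse (real (Suc n))) \<leadsto> i + 0"
  by (intro tendsto_intros LIMSEQ_inverse_real_of_nat)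
 then have "F l \<le> i"
  using LIMSEQ_le[OF cont[OF f(1) lK l(2)], of "\<lambda>n. i + inverse (real (Suc n))" i] f(2) less_imp_le by auto
 then show ?thesis using lower lK by (intro bexI[of _ l]) (auto intro: order_trans)
qed

text \<open>The representing element is the minimizer of half the squared norm minus the functional on the
 closed subspace.\<close>

theorem riesz:
 assumes M: "M \<subseteq> V" and M0: "(\<lambda>_. 0) \<in> M"
  and Mlin: "\<And>u v a b. u \<in> M ==> v \<in> M ==> (\<lambda>z. a * u z + b * v z) \<in> M"
  and closed: "\<And>f l. (\<And>n::nat. f n \<in> M) ==> l \<in> V ==> (\<lambda>n. nrm (f n - l)) \<leadsto> 0 ==> l \<in> M"
  and llin: "\<And>u v a b. u \<in> M ==> v \<in> M ==> l (\<lambda>z. a * u z + b * v z) = a * l u + b * l v"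
  and bdd: "\<And>u. u \<in> M ==> \<bar>l u\<bar> \<le> C * nrm u"
 shows "\<exists>g\<in>M. \<forall>h\<in>M. ip g h = l h"
proof -
 define F where "F u = ip u u / 2 - l u" for u
 have V: "u \<in> V" if "u \<in> M" for u using that M by blast
 have ldiff: "l (u - v) = l u - l v" if "u \<in> M" "v \<in> M" for u v
  using llin[OF that, of 1 "-1"] by (simp add: fun_diff_def)
 have Mdiff: "u - v \<in> M" if "u \<in> M" "v \<in> M" for u v
  using Mlin[OF that, of 1 "-1"] by (simp add: fun_diff_def)
 have "\<exists>g\<in>M. \<forall>u\<in>M. F g \<le> F u"
 proof (rule minimizer_exists[where m = "- C\<^sup>2 / 2" and c = "1/8"])
  show "M \<noteq> {}" using M0 by blast
  fix u assume u: "u \<in> M"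
  have "l u \<le> C * nrm u" using bdd[OF u] by simp
  moreover have "0 \<le> (nrm u - C)^2" by simp
  ultimately show "- C\<^sup>2 / 2 \<le> F u"
   unfolding F_def nrm_sq[OF V[OF u], symmetric] by (simp add: power2_diff algebra_simps)
  fix v assume v: "v \<in> M"
  let ?w = "\<lambda>z. (1/2) * u z + (1/2) * v z"
  have eq: "F ?w = (F u + F v) / 2 - (1/8) * (nrm (u - v))^2"
   unfolding F_def nrm_sq[OF diff[OF V[OF u] V[OF v]]] ip_self_expand[OF V[OF u] V[OF v]]
    ip_lincomb[OF V[OF u] V[OF v]] llin[OF u v] by (simp add: power2_eq_square field_simps)
  show "\<exists>w\<in>M. F w \<le> (F u + F v) / 2 - (1/8) * (nrm (u - v))^2"
   by (rule bexI[where x = ?w]) (rule eq_refl[OF eq], rule Mlin[OF u v])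
 next
  fix f g assume f: "\<And>n::nat. f n \<in> M" and g: "g \<in> M" and lim: "(\<lambda>n. nrm (f n - g)) \<leadsto> 0"
  have a: "(\<lambda>n. (nrm (f n))^2 / 2) \<leadsto> (nrm g)^2 / 2"
   by (intro tendsto_intros nrm_tendsto lim V f g) simp
  have "(\<lambda>n. C * nrm (f n - g)) \<leadsto> C * 0" by (intro tendsto_intros lim)
  then have z: "(\<lambda>n. C * nrm (f n - g)) \<leadsto> 0" by simp
  have "(\<lambda>n. l (f n) - l g) \<leadsto> 0"
   by (rule Lim_null_comparison[OF _ z])
    (use f g Mdiff in \<open>auto simp flip: ldiff intro!: always_eventually bdd\<close>)
  then have b: "(\<lambda>n. l (f n)) \<leadsto> l g" by (simp add: LIM_zero_iff)
  show "(\<lambda>n. F (f n)) \<leadsto> F g"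
   using tendsto_diff[OF a b] by (simp add: F_def nrm_sq V f g)
 qed (use M closed in auto)
 then obtain g where g: "g \<in> M" "\<And>u. u \<in> M ==> F g \<le> F u" by blast
 have "ip g h = l h" if h: "h \<in> M" for h
 proof -
  have "0 \<le> (ip g h - l h) * t + ip h h / 2 * t^2" for t
   using g(2)[OF Mlin[OF g(1) h, of 1 t]] unfolding F_def ip_lincomb[OF V[OF g(1)] V[OF h]] llin[OF g(1) h]
   by (simp add: algebra_simps)
  then have "ip g h - l h = 0" by (rule linear_coeff_zero)
  then show ?thesis by simp
 qed
 then show ?thesis using g(1) by blast
qed

end

section \<open>Square integrable functions\<close>

definition Lsq :: "'a measure => ('a => real) set" where
 "Lsq M = {u. u \<in> borel_measurable M \<and> integrable M (\<lambda>z. (u z)^2)}"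

lemma L2_Lsq: "L2 S = Lsq (lebesgue_on S)" by (simp add: L2_def Lsq_def)

lemma Lsq_measurable: "u \<in> Lsq M ==> u \<in> borel_measurable M" by (simp add: Lsq_def)

lemma Lsq_integrable_sq: "u \<in> Lsq M ==> integrable M (\<lambda>z. (u z)^2)" by (simp add: Lsq_def)

lemma abs_mult_le_squares: "\<bar>a * b\<bar> \<le> a^2 + b^2" for a b :: real
proof -
 have "0 \<le> (\<bar>a\<bar> - \<bar>b\<bar>)^2" by simp
 then have "2 * \<bar>a * b\<bar> \<le> a^2 + b^2" by (simp add: power2_diff abs_mult)
 then show ?thesis using abs_ge_zero[of "a * b"] by linarith
qed

lemma Lsq_integrable_mult:
 assumes "u \<in> Lsq M" "v \<in> Lsq M" shows "integrable M (\<lambda>z. u z * v z)"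
proof (rule Bochner_Integration.integrable_bound)
 show "integrable M (\<lambda>z. (u z)^2 + (v z)^2)" using assms by (simp add: Lsq_def)
 show "(\<lambda>z. u z * v z) \<in> borel_measurable M" using assms by (auto simp: Lsq_def)
qed (use abs_mult_le_squares in \<open>auto intro!: order_trans[OF _ abs_ge_self]\<close>)

lemma Lsq_lin: assumes "u \<in> Lsq M" "v \<in> Lsq M" shows "(\<lambda>z. a * u z + b * v z) \<in> Lsq M"
proof -
 have "integrable M (\<lambda>z. a^2 * (u z)^2 + 2 * a * b * (u z * v z) + b^2 * (v z)^2)"
  using assms Lsq_integrable_mult[OF assms] by (intro Bochner_Integration.integrable_add integrable_mult_right) (auto simp: Lsq_def)
 then have "integrable M (\<lambda>z. (a * u z + b * v z)^2)" by (simp add: power2_sum algebra_simps)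
 then show ?thesis using assms by (auto simp: Lsq_def)
qed

lemma Lsq_zero: "(\<lambda>_. 0) \<in> Lsq M" by (simp add: Lsq_def)

lemma Lsq_bounded_mult:
 assumes u: "u \<in> Lsq M" and g: "g \<in> borel_measurable M" "AE z in M. \<bar>g z\<bar> \<le> c"
 shows "(\<lambda>z. u z * g z) \<in> Lsq M"
proof -
 have "integrable M (\<lambda>z. (u z * g z)^2)"
 proof (rule Bochner_Integration.integrable_bound)
  show "integrable M (\<lambda>z. c^2 * (u z)^2)" using u by (simp add: Lsq_def)
  show "AE z in M. norm ((u z * g z)^2) \<le> norm (c^2 * (u z)^2)"
   using g(2)
  proof eventually_elim
   fix z assume "\<bar>g z\<bar> \<le> c"
   then have "(g z)^2 \<le> c^2" by (metis abs_ge_zero power2_abs power_mono)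
   then show "norm ((u z * g z)^2) \<le> norm (c^2 * (u z)^2)"
    by (simp add: power_mult_distrib mult.commute mult_right_mono)
  qed
 qed (use u g in \<open>auto simp: Lsq_def\<close>)
 then show ?thesis using u g by (auto simp: Lsq_def)
qed

interpretation Lsq: ip_space "Lsq M" "\<lambda>u v. LINT z|M. u z * v z" for M :: "'a measure"
proof
 fix u v w :: "'a => real" and a b :: real
 show "(\<lambda>_. 0) \<in> Lsq M" by (rule Lsq_zero)
 assume u: "u \<in> Lsq M"
 show "0 \<le> (LINT z|M. u z * u z)" by simp
 assume v: "v \<in> Lsq M"
 show "(\<lambda>z. a * u z + b * v z) \<in> Lsq M" by (rule Lsq_lin[OF u v])
 show "(LINT z|M. u z * v z) = (LINT z|M. v z * u z)" by (simp add: mult.commute)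
 assume w: "w \<in> Lsq M"
 have "(LINT z|M. (a * u z + b * v z) * w z) = (LINT z|M. a * (u z * w z) + b * (v z * w z))"
  by (simp add: algebra_simps)
 also have "\<dots> = a * (LINT z|M. u z * w z) + b * (LINT z|M. v z * w z)"
  using Lsq_integrable_mult[OF u w] Lsq_integrable_mult[OF v w] by simp
 finally show "(LINT z|M. (a * u z + b * v z) * w z) = \<dots>" .
qed

abbreviation l2 :: "'a measure => ('a => real) => real" where "l2 \<equiv> Lsq.nrm"

lemma l2_sq: "(l2 M u)^2 = (LINT z|M. (u z)^2)"
 by (simp add: Lsq.nrm_def power2_eq_square)

lemma l2_def: "l2 M u = sqrt (LINT z|M. (u z)^2)"
 by (simp add: Lsq.nrm_def power2_eq_square)

lemma l2_zero_iff: assumes "u \<in> Lsq M" shows "l2 M u = 0 \<longleftrightarrow> (AE z in M. u z = 0)"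
 using integral_nonneg_eq_0_iff_AE[OF Lsq_integrable_sq[OF assms]] by (simp add: l2_def)

lemma l2_cong_AE:
 assumes "AE z in M. u z = v z" "u \<in> borel_measurable M" "v \<in> borel_measurable M"
 shows "l2 M u = l2 M v"
 unfolding l2_def by (intro arg_cong[where f = sqrt] integral_cong_AE) (use assms in auto)

lemma l2_AE_subseq:
 assumes "\<And>n. f n \<in> Lsq M" "l \<in> Lsq M" "(\<lambda>n. l2 M (f n - l)) \<leadsto> 0"
 shows "\<exists>r::nat => nat. strict_mono r \<and> (AE x in M. (\<lambda>n. f (r n) x) \<leadsto> l x)"
proof -
 have "(\<lambda>n. (l2 M (f n - l))^2) \<leadsto> 0^2" by (intro tendsto_intros assms)
 then have "(\<lambda>n. LINT z|M. norm ((f n z - l z)^2)) \<leadsto> 0" by (simp add: l2_sq)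
 moreover have "integrable M (\<lambda>z. (f n z - l z)^2)" for n
  using Lsq.diff[OF assms(1,2)] by (simp add: Lsq_def)
 ultimately obtain r where r: "strict_mono r" "AE x in M. (\<lambda>n. (f (r n) x - l x)^2) \<leadsto> 0"
  using tendsto_L1_AE_subseq[of M "\<lambda>n z. (f n z - l z)^2"] by blast
 have "AE x in M. (\<lambda>n. f (r n) x) \<leadsto> l x"
  using r(2)
 proof eventually_elim
  fix x assume "(\<lambda>n. (f (r n) x - l x)^2) \<leadsto> 0"
  then have "(\<lambda>n. sqrt ((f (r n) x - l x)^2)) \<leadsto> sqrt 0" by (rule tendsto_real_sqrt)
  then show "(\<lambda>n. f (r n) x) \<leadsto> l x" by (simp add: tendsto_rabs_zero_iff LIM_zero_iff)
 qed
 then show ?thesis using r(1) by blast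
qed

text \<open>Riesz--Fischer. A subsequence with norms of the increments below \<open>2\<^sup>-\<^sup>n\<close> converges almost
 everywhere, because the sum of \<open>2\<^sup>n\<close> times the squared increments has a finite integral; Fatou's lemma
 then identifies the pointwise limit as the limit in norm.\<close>

lemma Lsq_complete:
 assumes f: "\<And>n::nat. f n \<in> Lsq M"
  and cau: "\<And>e. e > 0 ==> \<exists>N. \<forall>m\<ge>N. \<forall>n\<ge>N. l2 M (f m - f n) < e"
 shows "\<exists>l\<in>Lsq M. (\<lambda>n. l2 M (f n - l)) \<leadsto> 0"
proof -
 have [measurable]: "f n \<in> borel_measurable M" for n using f by (simp add: Lsq_def)
 have fd: "f m - f n \<in> Lsq M" for m n using f by (intro Lsq.diff)
 have "\<forall>n. \<exists>N. \<forall>m\<ge>N. \<forall>k\<ge>N. l2 M (f m - f k) < (1/2) ^ n" using cau by simp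
 then obtain N where N: "\<And>n m k. m \<ge> N n ==> k \<ge> N n ==> l2 M (f m - f k) < (1/2) ^ n" by metis
 define r where "r n = (\<Sum>i\<le>n. N i) + n" for n
 have rN: "r n \<ge> N n" for n unfolding r_def by (simp add: member_le_sum trans_le_add1)
 have rmono: "r n \<le> r (Suc n)" for n unfolding r_def by simp
 have rge: "r n \<ge> n" for n unfolding r_def by simp
 define g where "g n = f (r (Suc n)) - f (r n)" for n
 have g: "g n \<in> Lsq M" for n unfolding g_def by (rule fd)
 have [measurable]: "g n \<in> borel_measurable M" for n using g by (simp add: Lsq_def)
 have gb: "(LINT z|M. (g n z)^2) \<le> (1/4) ^ n" for n
 proof -
  have "l2 M (g n) < (1/2) ^ n" unfolding g_def using N rN rmono order_trans by blast
  then have "(l2 M (g n))^2 \<le> ((1/2) ^ n)^2" by (intro power_mono Lsq.nrm_nonneg g) simp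
  also have "((1/2) ^ n)^2 = (1/4 :: real) ^ n" by (simp add: power2_eq_square flip: power_mult_distrib)
  finally show ?thesis by (simp add: l2_sq)
 qed
 have "(\<integral>\<^sup>+ z. (\<Sum>n. ennreal (2 ^ n * (g n z)^2)) \<partial>M) = (\<Sum>n. \<integral>\<^sup>+ z. ennreal (2 ^ n * (g n z)^2) \<partial>M)"
  by (rule nn_integral_suminf) measurable
 also have "\<dots> \<le> (\<Sum>n. ennreal ((1/2) ^ n))"
 proof (rule suminf_le)
  fix n
  have "(\<integral>\<^sup>+ z. ennreal (2 ^ n * (g n z)^2) \<partial>M) = ennreal (LINT z|M. 2 ^ n * (g n z)^2)"
   by (rule nn_integral_eq_integral) (use g in \<open>auto simp: Lsq_def\<close>)
  also have "\<dots> \<le> ennreal (2 ^ n * (1/4) ^ n)"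
   by (intro ennreal_leI) (use gb[of n] in \<open>simp\<close>)
  also have "2 ^ n * (1/4) ^ n = (1/2 :: real) ^ n" by (simp flip: power_mult_distrib)
  finally show "(\<integral>\<^sup>+ z. ennreal (2 ^ n * (g n z)^2) \<partial>M) \<le> ennreal ((1/2) ^ n)" .
 qed auto
 also have "\<dots> = ennreal (\<Sum>n. (1/2) ^ n)" by (intro suminf_ennreal2) (auto intro: summable_geometric)
 also have "\<dots> < \<infinity>" by simp
 finally have "AE z in M. (\<Sum>n. ennreal (2 ^ n * (g n z)^2)) \<noteq> \<infinity>"
  by (intro nn_integral_PInf_AE) auto
 then have conv: "AE z in M. convergent (\<lambda>n. f (r n) z)"
 proof eventually_elim
  fix z assume "(\<Sum>n. ennreal (2 ^ n * (g n z)^2)) \<noteq> \<infinity>"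
  then have s: "summable (\<lambda>n. 2 ^ n * (g n z)^2)" by (intro summable_suminf_not_top) auto
  have "summable (\<lambda>n. g n z)"
  proof (rule summable_comparison_test')
   show "summable (\<lambda>n. (1/2) ^ n + 2 ^ n * (g n z)^2)" by (intro summable_add s summable_geometric) simp
   fix n :: nat
   define q where "q = sqrt (2 ^ n)"
   have q: "q > 0" "q^2 = 2 ^ n" by (auto simp: q_def)
   have "inverse q * (q * g n z) = g n z" using q(1) by simp
   then have "\<bar>g n z\<bar> = \<bar>inverse q * (q * g n z)\<bar>" by (rule arg_cong[OF sym])
   also have "\<dots> \<le> (inverse q)^2 + (q * g n z)^2" by (rule abs_mult_le_squares)
   also have "\<dots> = (1/2) ^ n + 2 ^ n * (g n z)^2"
    using q by (simp add: power_mult_distrib power_inverse power_one_over inverse_eq_divide)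
   finally show "norm (g n z) \<le> (1/2) ^ n + 2 ^ n * (g n z)^2" by simp
  qed
  then have c: "convergent (\<lambda>n. f (r 0) z + (\<Sum>k<n. g k z))"
   by (intro convergent_add convergent_const) (simp add: summable_iff_convergent)
  have "(\<Sum>k<n. g k z) = f (r n) z - f (r 0) z" for n
   unfolding g_def by (induction n) auto
  then show "convergent (\<lambda>n. f (r n) z)" using c by simp
 qed
 define l where "l z = lim (\<lambda>n. f (r n) z)" for z
 have lm [measurable]: "l \<in> borel_measurable M" unfolding l_def by measurable
 have lim: "AE z in M. (\<lambda>n. f (r n) z) \<leadsto> l z"
  using conv by eventually_elim (auto simp: l_def convergent_LIMSEQ_iff)
 have key: "f m - l \<in> Lsq M \<and> l2 M (f m - l) \<le> e"
  if e: "e > 0" and Ne: "\<And>m k. m \<ge> N' ==> k \<ge> N' ==> l2 M (f m - f k) < e" and m: "m \<ge> N'" for m e N'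
 proof -
  have "(\<integral>\<^sup>+ z. ennreal ((f m z - l z)^2) \<partial>M) = (\<integral>\<^sup>+ z. liminf (\<lambda>n. ennreal ((f m z - f (r n) z)^2)) \<partial>M)"
  proof (rule nn_integral_cong_AE)
   show "AE z in M. ennreal ((f m z - l z)^2) = liminf (\<lambda>n. ennreal ((f m z - f (r n) z)^2))"
    using lim
   proof eventually_elim
    fix z assume "(\<lambda>n. f (r n) z) \<leadsto> l z"
    then have "(\<lambda>n. ennreal ((f m z - f (r n) z)^2)) \<leadsto> ennreal ((f m z - l z)^2)"
     by (intro tendsto_intros)
    then show "ennreal ((f m z - l z)^2) = liminf (\<lambda>n. ennreal ((f m z - f (r n) z)^2))"
     by (intro lim_imp_Liminf[symmetric]) auto
   qed
  qed
  also have "\<dots> \<le> liminf (\<lambda>n. \<integral>\<^sup>+ z. ennreal ((f m z - f (r n) z)^2) \<partial>M)"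
   by (rule nn_integral_liminf) measurable
  also have "\<dots> \<le> liminf (\<lambda>n. ennreal (e^2))"
  proof (rule Liminf_mono)
   show "\<forall>\<^sub>F n in sequentially. (\<integral>\<^sup>+ z. ennreal ((f m z - f (r n) z)^2) \<partial>M) \<le> ennreal (e^2)"
    using eventually_ge_at_top[of N']
   proof eventually_elim
    fix n assume n: "n \<ge> N'"
    have "(\<integral>\<^sup>+ z. ennreal ((f m z - f (r n) z)^2) \<partial>M) = ennreal ((l2 M (f m - f (r n)))^2)"
     unfolding l2_sq by (subst nn_integral_eq_integral[symmetric]) (use fd[of m "r n"] in \<open>auto simp: Lsq_def\<close>)
    also have "\<dots> \<le> ennreal (e^2)"
     using Ne[OF m order_trans[OF n rge]]
     by (intro ennreal_leI power_mono Lsq.nrm_nonneg fd) simp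
    finally show "(\<integral>\<^sup>+ z. ennreal ((f m z - f (r n) z)^2) \<partial>M) \<le> ennreal (e^2)" .
   qed
  qed
  also have "\<dots> = ennreal (e^2)" by (simp add: Liminf_const)
  finally have b: "(\<integral>\<^sup>+ z. ennreal ((f m z - l z)^2) \<partial>M) \<le> ennreal (e^2)" .
  then have i: "integrable M (\<lambda>z. (f m z - l z)^2)"
   by (intro integrableI_bounded) (auto simp: le_less_trans)
  have "ennreal (LINT z|M. (f m z - l z)^2) \<le> ennreal (e^2)"
   using b by (subst nn_integral_eq_integral[symmetric]) (use i in auto)
  then have "(l2 M (f m - l))^2 \<le> e^2" by (simp add: l2_sq)
  then have "l2 M (f m - l) \<le> e" by (rule power2_le_imp_le) (use e in simp)
  moreover have "f m - l \<in> borel_measurable M" unfolding fun_diff_def by measurable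
  ultimately show ?thesis using i by (simp add: Lsq_def)
 qed
 obtain N1 where N1: "\<And>m k. m \<ge> N1 ==> k \<ge> N1 ==> l2 M (f m - f k) < 1" using cau[OF zero_less_one] by (metis (no_types))
 have "f N1 - l \<in> Lsq M" using key[OF zero_less_one N1 order_refl] by blast
 from Lsq.diff[OF f[of N1] this] have lL: "l \<in> Lsq M" by (simp add: fun_diff_def)
 have "(\<lambda>n. l2 M (f n - l)) \<leadsto> 0"
 proof (rule LIMSEQ_I)
  fix e :: real assume "e > 0"
  then have e: "e / 2 > 0" by simp
  obtain N' where N': "\<And>m k. m \<ge> N' ==> k \<ge> N' ==> l2 M (f m - f k) < e / 2" using cau[OF e] by (metis (no_types))
  have "l2 M (f m - l) < e" if "m \<ge> N'" for m using key[OF e N' that] \<open>e > 0\<close> by simp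
  moreover have "l2 M (f m - l) \<ge> 0" for m by (intro Lsq.nrm_nonneg Lsq.diff f lL)
  ultimately show "\<exists>N'. \<forall>m\<ge>N'. norm (l2 M (f m - l) - 0) < e" by auto
 qed
 then show ?thesis using lL by blast
qed

section \<open>Lebesgue measurable functions, slices and the exchange of variables\<close>

lemma AE_lebesgue_on_iff:
 "S \<in> sets borel ==> (AE x in lebesgue_on S. P x) \<longleftrightarrow> (AE x in lborel. x \<in> S \<longrightarrow> P x)"
 by (simp add: AE_restrict_space_iff AE_completion_iff)

text \<open>Measurability on a product set says nothing about individual slices of a function measurable in the
 sense of Lebesgue. All product arguments are therefore made for a Borel representative.\<close>

lemma lebesgue_on_borel_rep:
 fixes f :: "'a::euclidean_space => real"
 assumes f: "f \<in> borel_measurable (lebesgue_on S)" and S: "S \<in> sets borel"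
 obtains g where "g \<in> borel_measurable borel" "AE x in lebesgue_on S. f x = g x" "\<And>x. x \<notin> S ==> g x = 0"
proof -
 have "(\<lambda>x. indicator S x * f x) \<in> borel_measurable lebesgue"
  using f S borel_measurable_restrict_space_iff[of S lebesgue f] by simp
 then obtain g where g: "g \<in> borel_measurable borel" "AE x in lborel. indicator S x * f x = g x"
  using completion_ex_borel_measurable_real[of _ lborel] by auto
 show ?thesis
 proof (rule that)
  show "(\<lambda>x. indicator S x * g x) \<in> borel_measurable borel" using g(1) S by measurable
  show "AE x in lebesgue_on S. f x = indicator S x * g x"
   unfolding AE_lebesgue_on_iff[OF S] using g(2) by eventually_elim auto
 qed auto
qed

lemma measurable_lebesgue_on_AE:
 fixes f g :: "'a::euclidean_space => real"
 assumes g: "g \<in> borel_measurable (lebesgue_on S)" and ae: "AE x in lebesgue_on S. g x = f x" and S: "S \<in> sets borel"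
 shows "f \<in> borel_measurable (lebesgue_on S)"
proof -
 have "(\<lambda>x. indicator S x *\<^sub>R g x) \<in> borel_measurable lebesgue"
  using g S borel_measurable_restrict_space_iff[of S lebesgue g] by simp
 moreover have "AE x in lebesgue. indicator S x *\<^sub>R g x = indicator S x *\<^sub>R f x"
  using ae S by (auto simp: AE_restrict_space_iff indicator_def elim!: AE_mp)
 ultimately have "(\<lambda>x. indicator S x *\<^sub>R f x) \<in> borel_measurable lebesgue" by (rule borel_measurable_AE)
 then show ?thesis using S borel_measurable_restrict_space_iff[of S lebesgue f] by simp
qed

lemma lebesgue_on_borel:
 fixes g :: "'a::euclidean_space => real"
 assumes g[measurable]: "g \<in> borel_measurable borel" and S[measurable]: "S \<in> sets borel"
 shows "integrable (lebesgue_on S) g \<longleftrightarrow> integrable lborel (\<lambda>x. indicator S x * g x)"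
  and "(LINT x|lebesgue_on S. g x) = (LINT x|lborel. indicator S x * g x)"
  and "g \<in> borel_measurable (lebesgue_on S)"
proof -
 have m: "(\<lambda>x. indicator S x * g x) \<in> borel_measurable lborel" by measurable
 show "integrable (lebesgue_on S) g \<longleftrightarrow> integrable lborel (\<lambda>x. indicator S x * g x)"
  using integrable_completion[OF m] by (simp add: integrable_restrict_space S)
 show "(LINT x|lebesgue_on S. g x) = (LINT x|lborel. indicator S x * g x)"
  using integral_completion[OF m] by (simp add: integral_restrict_space S)
 show "g \<in> borel_measurable (lebesgue_on S)"
  using g by (simp add: measurable_completion measurable_restrict_space1)
qed

lemma AE_slice:
 fixes A B :: "real set"
 assumes AB: "A \<in> sets borel" "P \<in> sets borel" and ae: "AE z in lebesgue_on (A \<times> P). Q z"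
 shows "AE x in lebesgue_on A. AE t in lebesgue_on P. Q (x, t)"
proof -
 have [simp]: "A \<times> P \<in> sets borel" using AB by (metis borel_prod pair_measureI)
 have "AE z in lborel. z \<in> A \<times> P \<longrightarrow> Q z" using ae AB by (simp add: AE_lebesgue_on_iff)
 then have "AE z in lborel \<Otimes>\<^sub>M lborel. z \<in> A \<times> P \<longrightarrow> Q z" by (subst lborel_prod)
 from lborel_pair.AE_pair[OF this] have "AE x in lborel. AE t in lborel. (x, t) \<in> A \<times> P \<longrightarrow> Q (x, t)" .
 then show ?thesis unfolding AE_lebesgue_on_iff[OF AB(1)] AE_lebesgue_on_iff[OF AB(2)]
  by (rule eventually_mono) (auto elim: eventually_mono)
qed

theorem fubini_lebesgue_on:
 fixes A P :: "real set" and f :: "pfun"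
 assumes A[measurable]: "A \<in> sets borel" and P[measurable]: "P \<in> sets borel"
  and f: "integrable (lebesgue_on (A \<times> P)) f"
 shows "AE x in lebesgue_on A. integrable (lebesgue_on P) (\<lambda>t. f (x, t))"
  and "integrable (lebesgue_on A) (\<lambda>x. LINT t|lebesgue_on P. f (x, t))"
  and "(LINT x|lebesgue_on A. LINT t|lebesgue_on P. f (x, t)) = (LINT z|lebesgue_on (A \<times> P). f z)"
proof -
 have AP[simp, measurable]: "A \<times> P \<in> sets borel" using A P by (metis borel_prod pair_measureI)
 obtain g where g[measurable]: "g \<in> borel_measurable borel"
  and ae: "AE z in lebesgue_on (A \<times> P). f z = g z" and g0: "\<And>z. z \<notin> A \<times> P ==> g z = 0"
  using lebesgue_on_borel_rep[OF borel_measurable_integrable[OF f] AP] by blast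
 have ig: "indicator (A \<times> P) z * g z = g z" for z by (cases "z \<in> A \<times> P") (simp_all add: g0)
 have gM: "g \<in> borel_measurable (lebesgue_on (A \<times> P))" by (rule lebesgue_on_borel(3)) measurable
 have "integrable (lebesgue_on (A \<times> P)) g"
  by (rule integrable_cong_AE_imp[OF f gM]) (use ae in auto)
 then have gi: "integrable lborel g" by (simp add: lebesgue_on_borel(1)[OF g AP] ig)
 then have gi': "integrable (lborel \<Otimes>\<^sub>M lborel) g" by (simp add: lborel_prod)
 have gx[measurable]: "(\<lambda>t. g (x, t)) \<in> borel_measurable borel" for x
  using measurable_compose[OF _ g, of "\<lambda>t. (x, t)" borel] by (simp add: borel_prod[symmetric])
 have g0x: "indicator P t * g (x, t) = g (x, t)" for x t using g0 by (auto simp: indicator_def)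
 have sl: "AE x in lebesgue_on A. AE t in lebesgue_on P. f (x, t) = g (x, t)"
  by (rule AE_slice[OF A P ae])
 have i1: "AE x in lborel. integrable lborel (\<lambda>t. g (x, t))" by (rule lborel_pair.AE_integrable_fst'[OF gi'])
 then have i1': "AE x in lebesgue_on A. integrable lborel (\<lambda>t. g (x, t))"
  by (auto simp: AE_lebesgue_on_iff elim!: AE_mp)
 have both: "AE x in lebesgue_on A. integrable (lebesgue_on P) (\<lambda>t. f (x, t)) \<and>
   (LINT t|lebesgue_on P. f (x, t)) = (LINT t|lborel. g (x, t))"
  using sl i1'
 proof eventually_elim
  fix x assume e: "AE t in lebesgue_on P. f (x, t) = g (x, t)" and i: "integrable lborel (\<lambda>t. g (x, t))"
  have m: "(\<lambda>t. f (x, t)) \<in> borel_measurable (lebesgue_on P)"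
   by (rule measurable_lebesgue_on_AE[OF lebesgue_on_borel(3)[OF gx P]]) (use e in \<open>auto simp: eq_commute\<close>)
  have gm: "(\<lambda>t. g (x, t)) \<in> borel_measurable (lebesgue_on P)" by (rule lebesgue_on_borel(3)) measurable
  have "integrable (lebesgue_on P) (\<lambda>t. g (x, t))" using i by (simp add: lebesgue_on_borel(1)[OF gx P] g0x)
  then have "integrable (lebesgue_on P) (\<lambda>t. f (x, t))"
   using integrable_cong_AE[OF m gm e] by simp
  moreover have "(LINT t|lebesgue_on P. f (x, t)) = (LINT t|lebesgue_on P. g (x, t))"
   by (rule integral_cong_AE[OF m gm e])
  ultimately show "integrable (lebesgue_on P) (\<lambda>t. f (x, t)) \<and>
   (LINT t|lebesgue_on P. f (x, t)) = (LINT t|lborel. g (x, t))"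
   by (simp add: lebesgue_on_borel(2)[OF gx P] g0x)
 qed
 then show "AE x in lebesgue_on A. integrable (lebesgue_on P) (\<lambda>t. f (x, t))" by (rule AE_mp) auto
 define G where "G x = (LINT t|lborel. g (x, t))" for x
 have Gm[measurable]: "G \<in> borel_measurable borel"
  unfolding G_def using lborel.borel_measurable_lebesgue_integral[of "\<lambda>x t. g (x, t)" borel]
  by (simp add: borel_prod measurable_cong_sets[of "borel \<Otimes>\<^sub>M lborel" "borel \<Otimes>\<^sub>M borel"])
 have G0: "indicator A x * G x = G x" for x
  unfolding G_def using g0 by (auto simp: indicator_def)
 have Gi: "integrable lborel G" unfolding G_def by (rule lborel_pair.integrable_fst'[OF gi'])
 have GiA: "integrable (lebesgue_on A) G" using Gi by (simp add: lebesgue_on_borel(1)[OF Gm A] G0)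
 have GmA: "G \<in> borel_measurable (lebesgue_on A)" by (rule borel_measurable_integrable[OF GiA])
 have aeG: "AE x in lebesgue_on A. G x = (LINT t|lebesgue_on P. f (x, t))"
  using both by (rule AE_mp) (auto simp: G_def)
 have Fm: "(\<lambda>x. LINT t|lebesgue_on P. f (x, t)) \<in> borel_measurable (lebesgue_on A)"
  by (rule measurable_lebesgue_on_AE[OF GmA aeG A])
 show "integrable (lebesgue_on A) (\<lambda>x. LINT t|lebesgue_on P. f (x, t))"
  by (rule integrable_cong_AE_imp[OF GiA Fm]) (use aeG in \<open>auto simp: eq_commute\<close>)
 have "(LINT x|lebesgue_on A. LINT t|lebesgue_on P. f (x, t)) = (LINT x|lebesgue_on A. G x)"
  by (rule integral_cong_AE[OF Fm GmA]) (use aeG in \<open>auto simp: eq_commute\<close>)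
 also have "\<dots> = (LINT x|lborel. G x)" by (simp add: lebesgue_on_borel(2)[OF Gm A] G0)
 also have "\<dots> = (LINT z|(lborel \<Otimes>\<^sub>M lborel). g z)" unfolding G_def by (rule lborel_pair.integral_fst'[OF gi'])
 also have "\<dots> = (LINT z|lborel. g z)" by (simp add: lborel_prod)
 also have "\<dots> = (LINT z|lebesgue_on (A \<times> P). g z)" by (simp add: lebesgue_on_borel(2)[OF g AP] ig)
 also have "\<dots> = (LINT z|lebesgue_on (A \<times> P). f z)"
  by (rule integral_cong_AE[OF gM borel_measurable_integrable[OF f]]) (use ae in \<open>auto simp: eq_commute\<close>)
 finally show "(LINT x|lebesgue_on A. LINT t|lebesgue_on P. f (x, t)) = (LINT z|lebesgue_on (A \<times> P). f z)" .
qed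

lemma lborel_swap: "distr lborel borel prod.swap = (lborel :: (real \<times> real) measure)"
proof -
 have "distr (lborel \<Otimes>\<^sub>M lborel) (lborel \<Otimes>\<^sub>M lborel) prod.swap = (lborel \<Otimes>\<^sub>M lborel :: (real \<times> real) measure)"
  using lborel_pair.distr_pair_swap[symmetric] unfolding prod.swap_def split_def by simp
 then have "distr lborel lborel prod.swap = (lborel :: (real \<times> real) measure)" unfolding lborel_prod .
 moreover have "distr lborel borel prod.swap = (distr lborel lborel prod.swap :: (real \<times> real) measure)"
  by (rule distr_cong) auto
 ultimately show ?thesis by simp
qed

lemma swap_borel[measurable]: "prod.swap \<in> (borel :: (real \<times> real) measure) \<rightarrow>\<^sub>M borel"
 unfolding prod.swap_def by (auto intro!: borel_measurable_continuous_onI continuous_intros)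

lemma lebesgue_swap:
 shows "prod.swap \<in> (lebesgue :: (real \<times> real) measure) \<rightarrow>\<^sub>M lebesgue"
  and "distr lebesgue lebesgue prod.swap = (lebesgue :: (real \<times> real) measure)"
proof -
 have m: "prod.swap \<in> (lebesgue :: (real \<times> real) measure) \<rightarrow>\<^sub>M borel" by (rule measurable_completion) simp
 then have m': "prod.swap \<in> (lebesgue :: (real \<times> real) measure) \<rightarrow>\<^sub>M lborel" by simp
 have d: "distr lebesgue lborel prod.swap = (lborel :: (real \<times> real) measure)"
  using lborel_swap distr_completion[of prod.swap "lborel :: (real \<times> real) measure" lborel]
  by (simp cong: distr_cong)
 have null: "null_sets (distr lebesgue lborel prod.swap) = null_sets (lborel :: (real \<times> real) measure)" by (simp add: d)
 show "distr lebesgue lebesgue prod.swap = (lebesgue :: (real \<times> real) measure)"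
  using completion.completion_distr_eq[OF m' null] d by simp
 show "prod.swap \<in> (lebesgue :: (real \<times> real) measure) \<rightarrow>\<^sub>M lebesgue"
  by (rule completion.measurable_completion2[OF m']) (simp add: d)
qed

lemma lebesgue_on_swap:
 fixes A P :: "real set" and f :: "pfun"
 assumes A[measurable]: "A \<in> sets borel" and P[measurable]: "P \<in> sets borel"
 shows "f \<in> borel_measurable (lebesgue_on (A \<times> P)) ==> (\<lambda>z. f (prod.swap z)) \<in> borel_measurable (lebesgue_on (P \<times> A))"
  and "f \<in> borel_measurable (lebesgue_on (A \<times> P)) ==>
   integrable (lebesgue_on (P \<times> A)) (\<lambda>z. f (prod.swap z)) \<longleftrightarrow> integrable (lebesgue_on (A \<times> P)) f"
  and "f \<in> borel_measurable (lebesgue_on (A \<times> P)) ==>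
   (LINT z|lebesgue_on (P \<times> A). f (prod.swap z)) = (LINT z|lebesgue_on (A \<times> P). f z)"
  and "(AE z in lebesgue_on (A \<times> P). Q z) ==> (AE z in lebesgue_on (P \<times> A). Q (prod.swap z))"
proof -
 have [simp]: "A \<times> P \<in> sets borel" "P \<times> A \<in> sets borel" using A P by (metis borel_prod pair_measureI)+
 have [simp]: "indicator (P \<times> A) z = (indicator (A \<times> P) (prod.swap z) :: real)" for z
  by (cases z) (auto simp: indicator_def)
 let ?g = "\<lambda>z. indicator (A \<times> P) z * f z"
 { assume "f \<in> borel_measurable (lebesgue_on (A \<times> P))"
  then have g: "?g \<in> borel_measurable lebesgue"
   using borel_measurable_restrict_space_iff[of "A \<times> P" lebesgue f] by simp
  have gs: "(\<lambda>z. ?g (prod.swap z)) \<in> borel_measurable lebesgue"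
   using measurable_compose[OF lebesgue_swap(1) g] .
  then show "(\<lambda>z. f (prod.swap z)) \<in> borel_measurable (lebesgue_on (P \<times> A))"
   using borel_measurable_restrict_space_iff[of "P \<times> A" lebesgue "\<lambda>z. f (prod.swap z)"] by simp
  have g': "?g \<in> borel_measurable (distr lebesgue lebesgue prod.swap)" using g by (simp add: lebesgue_swap)
  show "integrable (lebesgue_on (P \<times> A)) (\<lambda>z. f (prod.swap z)) \<longleftrightarrow> integrable (lebesgue_on (A \<times> P)) f"
   using integrable_distr_eq[OF lebesgue_swap(1) g] by (simp add: integrable_restrict_space lebesgue_swap)
  show "(LINT z|lebesgue_on (P \<times> A). f (prod.swap z)) = (LINT z|lebesgue_on (A \<times> P). f z)"
   using integral_distr[OF lebesgue_swap(1) g] by (simp add: integral_restrict_space lebesgue_swap) }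
 assume "AE z in lebesgue_on (A \<times> P). Q z"
 then have "AE z in lebesgue. z \<in> A \<times> P \<longrightarrow> Q z" by (simp add: AE_restrict_space_iff)
 then have "AE z in distr lebesgue lebesgue prod.swap. z \<in> A \<times> P \<longrightarrow> Q z" by (subst lebesgue_swap(2))
 from AE_distrD[OF lebesgue_swap(1) this] show "AE z in lebesgue_on (P \<times> A). Q (prod.swap z)"
  by (auto simp: AE_restrict_space_iff elim!: AE_mp)
qed

section \<open>The fundamental lemma of the calculus of variations\<close>

text \<open>Boxes are stable under intersection and generate the Borel sets, so the integral vanishes over every
 Borel set, in particular over the sets where the function is positive and where it is negative.\<close>

lemma AE_zero_from_boxes_lborel:
 fixes h :: "'a::euclidean_space => real"
 assumes h: "integrable lborel h" and z: "\<And>c d. (LINT x|lborel. indicator (box c d) x * h x) = 0"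
  and tot: "(LINT x|lborel. h x) = 0"
 shows "AE x in lborel. h x = 0"
proof -
 have [measurable]: "h \<in> borel_measurable borel" using borel_measurable_integrable[OF h] by simp
 have ii: "integrable lborel (\<lambda>x. indicator A x * h x)" if "A \<in> sets borel" for A
  using integrable_mult_indicator[OF _ h, of A] that by simp
 let ?G = "range (\<lambda>(a, b). box a b :: 'a set)"
 have sig: "sigma_sets UNIV ?G = sets borel" unfolding borel_eq_box by simp
 have all: "(LINT x|lborel. indicator A x * h x) = 0" if "A \<in> sets borel" for A
 proof -
  have "Int_stable ?G" by (auto simp: Int_stable_def box_Int_box)
  moreover have "?G \<subseteq> Pow UNIV" by simp
  moreover have "A \<in> sigma_sets UNIV ?G" using that sig by simp
  ultimately show ?thesis
  proof (induction rule: sigma_sets_induct_disjoint)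
   case (basic A) then show ?case using z by auto
  next
   case (compl A)
   have A: "A \<in> sets borel" using compl(1) sig by simp
   have "(LINT x|lborel. indicator (UNIV - A) x * h x) = (LINT x|lborel. h x - indicator A x * h x)"
    by (rule Bochner_Integration.integral_cong) (auto simp: indicator_def)
   also have "\<dots> = 0" using h ii[OF A] compl(2) tot by simp
   finally show ?case .
  next
   case (union A)
   have A: "A i \<in> sets borel" for i using union(2) sig by auto
   have "(LINT x|lborel. indicator (\<Union>i. A i) x * h x) = (\<Sum>i. LINT x|lborel. indicator (A i) x * h x)"
    using lebesgue_integral_countable_add[of A lborel h] union(1) A ii[of "\<Union>i. A i"] h
    by (simp add: set_lebesgue_integral_def set_integrable_def disjoint_family_on_def)
   then show ?case using union(3) by simp
  qed simp_all
 qed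
 have P: "{x. h x > 0} \<in> sets borel" and N: "{x. h x < 0} \<in> sets borel" by measurable
 have "AE x in lborel. indicator {x. h x > 0} x * h x = 0"
  using integral_nonneg_eq_0_iff_AE[OF ii[OF P]] all[OF P] by (auto simp: indicator_def)
 moreover have "AE x in lborel. - (indicator {x. h x < 0} x * h x) = 0"
  using integral_nonneg_eq_0_iff_AE[OF integrable_minus[OF ii[OF N]]] all[OF N] by (auto simp: indicator_def)
 ultimately show ?thesis
  by eventually_elim (auto simp: indicator_def split: if_splits)
qed

text \<open>An open set is a countable union of boxes, which makes the assertion local.\<close>

lemma AE_zero_from_boxes:
 fixes v :: "'a::euclidean_space => real"
 assumes Om: "open \<Omega>" and v: "v \<in> borel_measurable (lebesgue_on \<Omega>)"
  and i: "\<And>c d. box c d \<subseteq> \<Omega> ==> integrable (lebesgue_on (box c d)) v"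
  and z: "\<And>c d. box c d \<subseteq> \<Omega> ==> (LINT x|lebesgue_on (box c d). v x) = 0"
 shows "AE x in lebesgue_on \<Omega>. v x = 0"
proof -
 have b: "AE x in lborel. x \<in> box a b \<longrightarrow> v x = 0" if ab: "box a b \<subseteq> \<Omega>" for a b
 proof -
  obtain g where g[measurable]: "g \<in> borel_measurable borel"
   and ae: "AE z in lebesgue_on (box a b). v z = g z" and g0: "\<And>z. z \<notin> box a b ==> g z = 0"
   using lebesgue_on_borel_rep[OF borel_measurable_integrable[OF i[OF ab]]] by auto
  have gi: "integrable lborel g"
  proof -
   have "integrable (lebesgue_on (box a b)) g"
    by (rule integrable_cong_AE_imp[OF i[OF ab] lebesgue_on_borel(3)]) (use ae in auto)
   moreover have "indicator (box a b) x * g x = g x" for x using g0 by (auto simp: indicator_def)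
   ultimately show ?thesis by (simp add: lebesgue_on_borel)
  qed
  have bx: "(LINT x|lborel. indicator (box c d) x * g x) = 0" for c d
  proof -
   obtain e f where ef: "box a b \<inter> box c d = box e f" using box_Int_box[of a b c d] by blast
   have s: "box e f \<subseteq> box a b" using ef by blast
   have "AE x in lebesgue_on (box e f). v x = g x"
    using ae unfolding AE_lebesgue_on_iff[OF borel_open[OF open_box]] by (rule eventually_mono) (use s in blast)
   then have "(LINT x|lebesgue_on (box e f). v x) = (LINT x|lebesgue_on (box e f). g x)"
    using borel_measurable_integrable[OF i[of e f]] s ab
    by (intro integral_cong_AE[OF _ lebesgue_on_borel(3)[OF g]]) auto
   then have "(LINT x|lborel. indicator (box e f) x * g x) = 0"
    using z[of e f] s ab by (simp add: lebesgue_on_borel)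
   moreover have "indicator (box e f) x * g x = indicator (box c d) x * g x" for x
    using g0[of x] ef by (auto simp: indicator_def)
   ultimately show ?thesis by simp
  qed
  have "(LINT x|lborel. g x) = 0"
  proof -
   have "(\<lambda>x. indicator (box a b) x * g x) = g" using g0 by (auto simp: indicator_def fun_eq_iff)
   then show ?thesis using bx[of a b] by metis
  qed
  from AE_zero_from_boxes_lborel[OF gi bx this]
  have "AE x in lborel. g x = 0" .
  moreover have "AE x in lborel. x \<in> box a b \<longrightarrow> v x = g x" using ae by (simp add: AE_lebesgue_on_iff)
  ultimately show ?thesis by eventually_elim auto
 qed
 obtain \<D> where D: "countable \<D>" "\<And>X. X \<in> \<D> ==> X \<subseteq> \<Omega> \<and> (\<exists>a b. X = box a b)" "\<Union>\<D> = \<Omega>"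
  using open_countable_Union_open_box[OF Om] by (metis Pow_iff subset_iff)
 have "AE x in lborel. \<forall>X\<in>\<D>. x \<in> X \<longrightarrow> v x = 0"
  unfolding AE_ball_countable[OF D(1)] using b D(2) by blast
 then have "AE x in lborel. x \<in> \<Omega> \<longrightarrow> v x = 0"
  by (rule AE_mp) (use D(3) in \<open>auto intro!: AE_I2\<close>)
 then show ?thesis using Om by (simp add: AE_lebesgue_on_iff)
qed

lemma AE_zero_from_bumps:
 fixes v :: "'a::euclidean_space => real" and \<psi> :: "'a => 'a => nat => 'a => real"
 assumes Om: "open \<Omega>" and v: "v \<in> L2 \<Omega>"
  and m: "\<And>c d n. \<psi> c d n \<in> borel_measurable borel"
  and bd: "\<And>c d n x. \<bar>\<psi> c d n x\<bar> \<le> indicator (box c d) x"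
  and lim: "\<And>c d x. (\<lambda>n. \<psi> c d n x) \<leadsto> indicator (box c d) x"
  and z: "\<And>c d n. box c d \<subseteq> \<Omega> ==> n > 0 ==> (LINT x|lebesgue_on \<Omega>. v x * \<psi> c d n x) = 0"
 shows "AE x in lebesgue_on \<Omega>. v x = 0"
proof (rule AE_zero_from_boxes[OF Om])
 have OmB: "\<Omega> \<in> sets borel" using Om by simp
 show vm: "v \<in> borel_measurable (lebesgue_on \<Omega>)" using v by (simp add: L2_def)
 fix c d :: 'a assume cd: "box c d \<subseteq> \<Omega>"
 have ind: "indicator (box c d) \<in> L2 \<Omega>"
 proof -
  have "integrable lborel (indicator (box c d) :: 'a => real)" by (rule integrable_real_indicator) (auto intro!: emeasure_bounded_finite bounded_box simp flip: infinity_ennreal_def)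
  then have "integrable (lebesgue_on \<Omega>) (indicator (box c d) :: 'a => real)"
   using cd lebesgue_on_borel(1)[of "indicator (box c d)" \<Omega>] OmB
   by (simp add: indicator_inter_arith[symmetric] Int_absorb1)
  moreover have "(indicator (box c d) x :: real)^2 = indicator (box c d) x" for x by (simp add: indicator_def)
  ultimately show ?thesis by (auto simp: L2_def intro!: borel_measurable_integrable)
 qed
 have vi: "integrable (lebesgue_on \<Omega>) (\<lambda>x. v x * indicator (box c d) x)"
  using Lsq_integrable_mult[of v "lebesgue_on \<Omega>"] v ind by (simp add: L2_Lsq)
 have e: "indicator \<Omega> x * (v x * indicator (box c d) x) = indicator (box c d) x * v x" for x
  using cd by (auto simp: indicator_def)
 show "integrable (lebesgue_on (box c d)) v"
  using vi OmB by (simp add: integrable_restrict_space e)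
 have "(\<lambda>n. LINT x|lebesgue_on \<Omega>. v x * \<psi> c d n x) \<leadsto> (LINT x|lebesgue_on \<Omega>. v x * indicator (box c d) x)"
 proof (rule integral_dominated_convergence[where w = "\<lambda>x. \<bar>v x * indicator (box c d) x\<bar>"])
  show "(\<lambda>x. v x * \<psi> c d n x) \<in> borel_measurable (lebesgue_on \<Omega>)" for n
   using vm lebesgue_on_borel(3)[OF m OmB] by measurable
  show "(\<lambda>x. v x * indicator (box c d) x) \<in> borel_measurable (lebesgue_on \<Omega>)"
   using vi by (rule borel_measurable_integrable)
  show "integrable (lebesgue_on \<Omega>) (\<lambda>x. \<bar>v x * indicator (box c d) x\<bar>)" using vi by (rule integrable_abs)
  show "AE x in lebesgue_on \<Omega>. norm (v x * \<psi> c d n x) \<le> \<bar>v x * indicator (box c d) x\<bar>" for n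
   using bd[of c d n] by (auto simp: abs_mult intro!: mult_left_mono)
  show "AE x in lebesgue_on \<Omega>. (\<lambda>n. v x * \<psi> c d n x) \<leadsto> v x * indicator (box c d) x"
   by (intro AE_I2 tendsto_intros lim)
 qed
 moreover have "(\<lambda>n. LINT x|lebesgue_on \<Omega>. v x * \<psi> c d n x) \<leadsto> 0"
  by (rule Lim_transform_eventually[OF tendsto_const])
   (use z[OF cd] in \<open>auto intro!: eventually_sequentiallyI[of 1]\<close>)
 ultimately have "(LINT x|lebesgue_on \<Omega>. v x * indicator (box c d) x) = 0"
  using LIMSEQ_unique by blast
 then show "(LINT x|lebesgue_on (box c d). v x) = 0"
  using OmB by (simp add: integral_restrict_space e)
qed

lemma box_plane: "box c d = {fst c<..<fst d} \<times> {snd c<..<snd d}" for c d :: "real \<times> real"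
 by (cases c; cases d) (auto simp: box_def Basis_prod_def)

theorem fundamental_lemma_plane:
 assumes Om: "open \<Omega>" and v: "v \<in> L2 \<Omega>"
  and z: "\<And>D. smooth_jet D ==> compact_support_in \<Omega> (D 0 0) ==> (LINT z|lebesgue_on \<Omega>. v z * D 0 0 z) = 0"
 shows "AE z in lebesgue_on \<Omega>. v z = 0"
proof (rule AE_zero_from_bumps[OF Om v,
  where \<psi> = "\<lambda>c d n z. bump (fst c) (fst d) n (fst z) * bump (snd c) (snd d) n (snd z)"])
 fix c d :: "real \<times> real" and n :: nat
 have cont: "continuous_on UNIV (bump a b n)" for a b
  using smooth1_bump[of a b n] unfolding smooth1_def smooth_jet1_def
  by (metis DERIV_isCont continuous_at_imp_continuous_on)
 show "(\<lambda>z. bump (fst c) (fst d) n (fst z) * bump (snd c) (snd d) n (snd z)) \<in> borel_measurable borel"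
  by (intro borel_measurable_continuous_onI continuous_intros continuous_on_compose2[OF cont]) auto
 have ind: "indicator (box c d) z = (indicator {fst c<..<fst d} (fst z) * indicator {snd c<..<snd d} (snd z) :: real)" for z
  by (cases c; cases d; cases z) (auto simp: box_plane indicator_def)
 show "\<bar>bump (fst c) (fst d) n (fst z) * bump (snd c) (snd d) n (snd z)\<bar> \<le> indicator (box c d) z" for z
  unfolding ind abs_mult
  by (intro mult_mono) (auto simp: bump_bounds bump_outside indicator_def)
 show "(\<lambda>n. bump (fst c) (fst d) n (fst z) * bump (snd c) (snd d) n (snd z)) \<leadsto> indicator (box c d) z" for z
  unfolding ind by (intro tendsto_mult bump_tendsto)
 assume cd: "box c d \<subseteq> \<Omega>" and n: "n > 0"
 obtain f g where f: "smooth_jet1 f" "f 0 = bump (fst c) (fst d) n" and g: "smooth_jet1 g" "g 0 = bump (snd c) (snd d) n"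
  using smooth1_jet[OF smooth1_bump] by metis
 let ?K = "{fst c + inverse n .. fst d - inverse n} \<times> {snd c + inverse n .. snd d - inverse n}"
 have "compact_support_in \<Omega> (\<lambda>z. f 0 (fst z) * g 0 (snd z))"
  unfolding compact_support_in_def
 proof (intro exI[of _ ?K] conjI allI impI)
  show "compact ?K" by (intro compact_Times) auto
  have "?K \<subseteq> {fst c<..<fst d} \<times> {snd c<..<snd d}" using bump_support_subset[OF n] by blast
  also have "\<dots> = box c d" by (cases c; cases d) (auto simp: box_plane)
  finally show "?K \<subseteq> \<Omega>" using cd by blast
  show "f 0 (fst z) * g 0 (snd z) = 0" if "z \<notin> ?K" for z
   using that bump_support f(2) g(2) by (cases z) auto
 qed
 from z[OF smooth_jet_tensor[OF f(1) g(1)] this]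
 show "(LINT z|lebesgue_on \<Omega>. v z * (bump (fst c) (fst d) n (fst z) * bump (snd c) (snd d) n (snd z))) = 0"
  by (simp add: f(2) g(2))
qed

theorem fundamental_lemma_line:
 assumes Om: "open S" and v: "v \<in> L2 S"
  and z: "\<And>D. smooth_jet1 D ==> compact_support_in S (D 0) ==> (LINT x|lebesgue_on S. v x * D 0 x) = 0"
 shows "AE x in lebesgue_on S. v x = (0::real)"
proof (rule AE_zero_from_bumps[OF Om v, where \<psi> = bump])
 fix c d :: real and n :: nat
 have cont: "continuous_on UNIV (bump c d n)"
  using smooth1_bump[of c d n] unfolding smooth1_def smooth_jet1_def
  by (metis DERIV_isCont continuous_at_imp_continuous_on)
 show "bump c d n \<in> borel_measurable borel" by (intro borel_measurable_continuous_onI cont)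
 have ind: "indicator (box c d) x = (indicator {c<..<d} x :: real)" for x
  by (auto simp: indicator_def box_real)
 show "\<bar>bump c d n x\<bar> \<le> indicator (box c d) x" for x
  unfolding ind by (auto simp: bump_bounds bump_outside indicator_def)
 show "(\<lambda>n. bump c d n x) \<leadsto> indicator (box c d) x" for x unfolding ind by (rule bump_tendsto)
 assume cd: "box c d \<subseteq> S" and n: "n > 0"
 obtain f where f: "smooth_jet1 f" "f 0 = bump c d n" using smooth1_jet[OF smooth1_bump] by metis
 have "compact_support_in S (f 0)"
  unfolding compact_support_in_def f(2)
  using cd bump_support_subset[OF n, of c d] bump_support[of _ c n d]
  by (intro exI[of _ "{c + inverse n .. d - inverse n}"]) (auto simp: box_real)
 from z[OF f(1) this] show "(LINT x|lebesgue_on S. v x * bump c d n x) = 0" by (simp add: f(2))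
qed

section \<open>Weak derivatives and Sobolev spaces on a bounded domain\<close>

lemma L2_zero: "(\<lambda>_. 0) \<in> L2 S"
 by (simp add: L2_Lsq Lsq_zero)

lemma L2_lin: "u \<in> L2 S ==> v \<in> L2 S ==> (\<lambda>z. a * u z + b * v z) \<in> L2 S"
 by (simp add: L2_Lsq Lsq_lin)

lemma L2_integrable_mult: "u \<in> L2 S ==> v \<in> L2 S ==> integrable (lebesgue_on S) (\<lambda>z. u z * v z)"
 by (simp add: L2_Lsq Lsq_integrable_mult)

lemma L2_measurable: "u \<in> L2 S ==> u \<in> borel_measurable (lebesgue_on S)"
 by (simp add: L2_def)

lemma continuous_measurable_lebesgue_on:
 fixes f :: "'a::euclidean_space => real"
 assumes "continuous_on UNIV f" "S \<in> sets borel" shows "f \<in> borel_measurable (lebesgue_on S)"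
 by (intro lebesgue_on_borel(3) borel_measurable_continuous_onI assms)

lemma continuous_bounded_on:
 fixes f :: "'a::euclidean_space => real"
 assumes "continuous_on UNIV f" "bounded S" obtains M where "M \<ge> 0" "\<And>x. x \<in> S ==> \<bar>f x\<bar> \<le> M"
proof -
 have "compact (closure S)" using assms(2) by (simp add: compact_closure)
 then have "bounded (f ` closure S)"
  using assms(1) by (meson compact_continuous_image compact_imp_bounded continuous_on_subset subset_UNIV)
 then obtain M where M: "\<And>x. x \<in> closure S ==> norm (f x) \<le> M" by (auto simp: bounded_iff)
 show ?thesis
 proof (rule that[of "max M 0"])
  fix x assume "x \<in> S"
  then show "\<bar>f x\<bar> \<le> max M 0" using M closure_subset[of S] by fastforce
 qed simp
qed

lemma finite_measure_bounded:
 fixes S :: "'a::euclidean_space set"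
 assumes "bounded S" "S \<in> sets borel" shows "finite_measure (lebesgue_on S)"
proof -
 have "S \<in> sets lebesgue" using assms(2) by simp
 then have "S \<in> lmeasurable" using assms(1) bounded_set_imp_lmeasurable by blast
 then show ?thesis by (rule finite_measure_lebesgue_on)
qed

lemma bounded_L2:
 fixes f :: "'a::euclidean_space => real"
 assumes "f \<in> borel_measurable (lebesgue_on S)" "AE x in lebesgue_on S. \<bar>f x\<bar> \<le> M" "bounded S" "S \<in> sets borel"
 shows "f \<in> L2 S"
proof -
 interpret finite_measure "lebesgue_on S" by (rule finite_measure_bounded[OF assms(3,4)])
 have "(\<lambda>_. 1) \<in> Lsq (lebesgue_on S)" by (simp add: Lsq_def)
 from Lsq_bounded_mult[OF this assms(1,2)] show ?thesis by (simp add: L2_Lsq)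
qed

lemma continuous_L2:
 fixes f :: "'a::euclidean_space => real"
 assumes "continuous_on UNIV f" "bounded S" "S \<in> sets borel" shows "f \<in> L2 S"
proof -
 obtain M where M: "\<And>x. x \<in> S ==> \<bar>f x\<bar> \<le> M" using continuous_bounded_on[OF assms(1,2)] by blast
 show ?thesis
  by (rule bounded_L2[OF continuous_measurable_lebesgue_on[OF assms(1,3)] _ assms(2,3), of M])
   (auto intro!: AE_I2 M)
qed

lemma L2_integrable:
 assumes "u \<in> L2 S" "bounded S" "S \<in> sets borel" shows "integrable (lebesgue_on S) u"
 using L2_integrable_mult[OF assms(1) continuous_L2[of "\<lambda>_. 1", OF _ assms(2,3)]] by simp

lemma finite_sob_index: "finite {(i, j). i + j \<le> (k::nat)}"
proof (rule finite_subset)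
 show "{(i, j). i + j \<le> k} \<subseteq> {..k} \<times> {..k}" by auto
qed simp

lemma sob_norm_sq_sum: "(sob_norm k \<Omega> u)^2 = (\<Sum>(i, j)\<in>{(i, j). i + j \<le> k}. (l2 (lebesgue_on \<Omega>) (wderiv \<Omega> i j u))^2)"
proof -
 have "sob_inner k \<Omega> u u = (\<Sum>(i, j)\<in>{(i, j). i + j \<le> k}. (l2 (lebesgue_on \<Omega>) (wderiv \<Omega> i j u))^2)"
  unfolding sob_inner_def l2_sq by (simp add: power2_eq_square)
 moreover have "\<dots> \<ge> 0" by (intro sum_nonneg) auto
 ultimately show ?thesis unfolding sob_norm_def by simp
qed

lemma l2_wderiv_le_sob_norm:
 assumes "i + j \<le> k" shows "l2 (lebesgue_on \<Omega>) (wderiv \<Omega> i j u) \<le> sob_norm k \<Omega> u"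
proof (rule power2_le_imp_le)
 have "(l2 (lebesgue_on \<Omega>) (wderiv \<Omega> i j u))^2 \<le>
   (\<Sum>(i, j)\<in>{(i, j). i + j \<le> k}. (l2 (lebesgue_on \<Omega>) (wderiv \<Omega> i j u))^2)"
  using member_le_sum[of "(i, j)" "{(i, j). i + j \<le> k}" "\<lambda>(i, j). (l2 (lebesgue_on \<Omega>) (wderiv \<Omega> i j u))^2"]
   finite_sob_index[of k] assms by auto
 then show "(l2 (lebesgue_on \<Omega>) (wderiv \<Omega> i j u))^2 \<le> (sob_norm k \<Omega> u)^2" by (simp add: sob_norm_sq_sum)
 have "0 \<le> sob_inner k \<Omega> u u" unfolding sob_inner_def by (intro sum_nonneg) (auto intro!: integral_nonneg_AE)
 then show "0 \<le> sob_norm k \<Omega> u" by (simp add: sob_norm_def)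
qed

lemma sob_norm_mono: assumes "k \<le> m" shows "sob_norm k \<Omega> u \<le> sob_norm m \<Omega> u"
proof -
 have "(\<Sum>(i, j)\<in>{(i, j). i + j \<le> k}. (l2 (lebesgue_on \<Omega>) (wderiv \<Omega> i j u))^2) \<le>
   (\<Sum>(i, j)\<in>{(i, j). i + j \<le> m}. (l2 (lebesgue_on \<Omega>) (wderiv \<Omega> i j u))^2)"
  using assms by (intro sum_mono2 finite_sob_index) auto
 then have s: "(sob_norm k \<Omega> u)^2 \<le> (sob_norm m \<Omega> u)^2" by (simp add: sob_norm_sq_sum)
 have "0 \<le> sob_inner m \<Omega> u u" unfolding sob_inner_def by (intro sum_nonneg) (auto intro!: integral_nonneg_AE)
 then have "0 \<le> sob_norm m \<Omega> u" by (simp add: sob_norm_def)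
 with s show ?thesis by (rule power2_le_imp_le)
qed

lemma sobolev_mono: "k \<le> m ==> u \<in> sobolev m \<Omega> ==> u \<in> sobolev k \<Omega>"
 unfolding sobolev_def by auto

lemma sobolev_L2: "u \<in> sobolev k \<Omega> ==> u \<in> L2 \<Omega>"
 unfolding sobolev_def by auto

lemma wderiv_L2: "u \<in> sobolev k \<Omega> ==> i + j \<le> k ==> wderiv \<Omega> i j u \<in> L2 \<Omega>"
 and has_wderiv_wderiv: "u \<in> sobolev k \<Omega> ==> i + j \<le> k ==> has_wderiv \<Omega> i j u (wderiv \<Omega> i j u)"
proof -
 assume "u \<in> sobolev k \<Omega>" "i + j \<le> k"
 then have "\<exists>v. v \<in> L2 \<Omega> \<and> has_wderiv \<Omega> i j u v" unfolding sobolev_def by blast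
 then have "wderiv \<Omega> i j u \<in> L2 \<Omega> \<and> has_wderiv \<Omega> i j u (wderiv \<Omega> i j u)"
  unfolding wderiv_def by (rule someI_ex)
 then show "wderiv \<Omega> i j u \<in> L2 \<Omega>" "has_wderiv \<Omega> i j u (wderiv \<Omega> i j u)" by auto
qed

lemma sobolevI: "u \<in> L2 \<Omega> ==> (\<And>i j. i + j \<le> k ==> \<exists>v\<in>L2 \<Omega>. has_wderiv \<Omega> i j u v) ==> u \<in> sobolev k \<Omega>"
 unfolding sobolev_def by auto

lemma has_wderiv_00: "has_wderiv \<Omega> 0 0 u u"
 unfolding has_wderiv_def by simp

locale dom =
 fixes \<Omega> :: "(real \<times> real) set"
 assumes open_dom: "open \<Omega>" and bounded_dom: "bounded \<Omega>"
begin

lemma borel_dom[simp, measurable]: "\<Omega> \<in> sets borel" using open_dom by simp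

abbreviation "M \<equiv> lebesgue_on \<Omega>"

lemma jet_L2: "smooth_jet D ==> D i j \<in> L2 \<Omega>"
 by (intro continuous_L2 bounded_dom borel_dom smooth_jet_continuous)

lemma jet_test: "smooth_jet D ==> u \<in> L2 \<Omega> ==> integrable M (\<lambda>z. u z * D i j z)"
 by (rule L2_integrable_mult[OF _ jet_L2])

lemma has_wderiv_unique:
 assumes "has_wderiv \<Omega> i j u v" "has_wderiv \<Omega> i j u w" "v \<in> L2 \<Omega>" "w \<in> L2 \<Omega>"
 shows "AE z in M. v z = w z"
proof -
 have "AE z in M. v z - w z = 0"
 proof (rule fundamental_lemma_plane[OF open_dom])
  show "(\<lambda>z. v z - w z) \<in> L2 \<Omega>" using L2_lin[OF assms(3,4), of 1 "-1"] by simp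
  fix D assume D: "smooth_jet D" "compact_support_in \<Omega> (D 0 0)"
  have "(-1) ^ (i + j) * (LINT z|M. v z * D 0 0 z) = (-1) ^ (i + j) * (LINT z|M. w z * D 0 0 z)"
   using assms(1)[unfolded has_wderiv_def, rule_format, OF conjI[OF D]]
    assms(2)[unfolded has_wderiv_def, rule_format, OF conjI[OF D]] by (rule trans[OF sym])
  then have "(LINT z|M. v z * D 0 0 z) = (LINT z|M. w z * D 0 0 z)" by simp
  then show "(LINT z|M. (v z - w z) * D 0 0 z) = 0"
   using jet_test[OF D(1) assms(3)] jet_test[OF D(1) assms(4)] by (simp add: left_diff_distrib)
 qed
 then show ?thesis by eventually_elim auto
qed

lemma wderiv_eq:
 assumes "v \<in> L2 \<Omega>" "has_wderiv \<Omega> i j u v" shows "AE z in M. wderiv \<Omega> i j u z = v z"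
proof -
 have "\<exists>v. v \<in> L2 \<Omega> \<and> has_wderiv \<Omega> i j u v" using assms by blast
 then have "wderiv \<Omega> i j u \<in> L2 \<Omega> \<and> has_wderiv \<Omega> i j u (wderiv \<Omega> i j u)"
  unfolding wderiv_def by (rule someI_ex)
 then show ?thesis using has_wderiv_unique assms by blast
qed

lemma wderiv_00: "u \<in> L2 \<Omega> ==> AE z in M. wderiv \<Omega> 0 0 u z = u z"
 by (rule wderiv_eq[OF _ has_wderiv_00])

lemma has_wderiv_lin:
 assumes "has_wderiv \<Omega> i j u1 v1" "has_wderiv \<Omega> i j u2 v2"
  and L: "u1 \<in> L2 \<Omega>" "u2 \<in> L2 \<Omega>" "v1 \<in> L2 \<Omega>" "v2 \<in> L2 \<Omega>"
 shows "has_wderiv \<Omega> i j (\<lambda>z. a * u1 z + b * u2 z) (\<lambda>z. a * v1 z + b * v2 z)"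
 unfolding has_wderiv_def
proof (intro allI impI)
 fix D assume D: "smooth_jet D \<and> compact_support_in \<Omega> (D 0 0)"
 note t = jet_test[OF conjunct1[OF D]]
 have "(LINT z|M. (a * u1 z + b * u2 z) * D i j z) = (LINT z|M. a * (u1 z * D i j z) + b * (u2 z * D i j z))"
  by (simp add: algebra_simps)
 also have "\<dots> = a * (LINT z|M. u1 z * D i j z) + b * (LINT z|M. u2 z * D i j z)"
  using t L by simp
 also have "\<dots> = a * ((-1) ^ (i + j) * (LINT z|M. v1 z * D 0 0 z)) + b * ((-1) ^ (i + j) * (LINT z|M. v2 z * D 0 0 z))"
  using assms(1,2) D unfolding has_wderiv_def by simp
 also have "\<dots> = (-1) ^ (i + j) * (LINT z|M. a * (v1 z * D 0 0 z) + b * (v2 z * D 0 0 z))"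
  using t L by (simp add: algebra_simps)
 also have "\<dots> = (-1) ^ (i + j) * (LINT z|M. (a * v1 z + b * v2 z) * D 0 0 z)"
  by (simp add: algebra_simps)
 finally show "(LINT z|M. (a * u1 z + b * u2 z) * D i j z) = \<dots>" .
qed

lemma has_wderiv_cong_AE:
 assumes "AE z in M. u z = u' z" "u \<in> borel_measurable M" "u' \<in> borel_measurable M"
 shows "has_wderiv \<Omega> i j u v \<longleftrightarrow> has_wderiv \<Omega> i j u' v"
proof -
 have "(LINT z|M. u z * D i j z) = (LINT z|M. u' z * D i j z)" if D: "smooth_jet D" for D
 proof (rule integral_cong_AE)
  have [measurable]: "D i j \<in> borel_measurable M" by (intro L2_measurable jet_L2 D)
  show "(\<lambda>z. u z * D i j z) \<in> borel_measurable M" "(\<lambda>z. u' z * D i j z) \<in> borel_measurable M"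
   using assms(2,3) by measurable
  show "AE z in M. u z * D i j z = u' z * D i j z" using assms(1) by eventually_elim auto
 qed
 then show ?thesis unfolding has_wderiv_def by auto
qed

lemma wderiv_cong_AE:
 assumes "AE z in M. u z = u' z" "u \<in> borel_measurable M" "u' \<in> borel_measurable M"
 shows "wderiv \<Omega> i j u = wderiv \<Omega> i j u'"
 unfolding wderiv_def has_wderiv_cong_AE[OF assms] ..

lemma wderiv_lin:
 assumes "u \<in> sobolev k \<Omega>" "v \<in> sobolev k \<Omega>" "i + j \<le> k"
 shows "AE z in M. wderiv \<Omega> i j (\<lambda>z. a * u z + b * v z) z = a * wderiv \<Omega> i j u z + b * wderiv \<Omega> i j v z"
 using assms
 by (intro wderiv_eq has_wderiv_lin L2_lin has_wderiv_wderiv wderiv_L2) (auto intro: sobolev_L2)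

lemma wderiv_diff:
 assumes "u \<in> sobolev k \<Omega>" "v \<in> sobolev k \<Omega>" "i + j \<le> k"
 shows "AE z in M. wderiv \<Omega> i j (u - v) z = wderiv \<Omega> i j u z - wderiv \<Omega> i j v z"
 using wderiv_lin[OF assms, of 1 "-1"] by (simp add: fun_diff_def)

lemma sobolev_lin:
 assumes "u \<in> sobolev k \<Omega>" "v \<in> sobolev k \<Omega>" shows "(\<lambda>z. a * u z + b * v z) \<in> sobolev k \<Omega>"
proof (rule sobolevI)
 show "(\<lambda>z. a * u z + b * v z) \<in> L2 \<Omega>" by (intro L2_lin sobolev_L2[OF assms(1)] sobolev_L2[OF assms(2)])
 fix i j assume ij: "i + j \<le> k"
 show "\<exists>w\<in>L2 \<Omega>. has_wderiv \<Omega> i j (\<lambda>z. a * u z + b * v z) w"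
  using has_wderiv_lin[OF has_wderiv_wderiv[OF assms(1) ij] has_wderiv_wderiv[OF assms(2) ij]
    sobolev_L2[OF assms(1)] sobolev_L2[OF assms(2)] wderiv_L2[OF assms(1) ij] wderiv_L2[OF assms(2) ij]]
   L2_lin[OF wderiv_L2[OF assms(1) ij] wderiv_L2[OF assms(2) ij]] by blast
qed

text \<open>Differentiating the test function first transfers part of the derivative to it.\<close>

lemma has_wderiv_step:
 assumes "has_wderiv \<Omega> i j u v" "has_wderiv \<Omega> (a + i) (b + j) u w"
 shows "has_wderiv \<Omega> a b v w"
 unfolding has_wderiv_def
proof (intro allI impI)
 fix D assume D: "smooth_jet D \<and> compact_support_in \<Omega> (D 0 0)"
 then obtain K where K: "compact K" "K \<subseteq> \<Omega>" "\<And>z. z \<notin> K ==> D 0 0 z = 0"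
  unfolding compact_support_in_def by auto
 let ?E = "\<lambda>i j. D (i + a) (j + b)"
 have E: "smooth_jet ?E" using D by (intro smooth_jet_shift) simp
 have "compact_support_in \<Omega> (?E 0 0)"
  unfolding compact_support_in_def
  using smooth_jet_vanish[OF conjunct1[OF D] compact_imp_closed[OF K(1)] K(3)] K by auto
 then have "(LINT z|M. u z * D (i + a) (j + b) z) = (-1) ^ (i + j) * (LINT z|M. v z * D a b z)"
  using assms(1) E unfolding has_wderiv_def by force
 moreover have "(LINT z|M. u z * D (i + a) (j + b) z) = (-1) ^ (i + j) * ((-1) ^ (a + b) * (LINT z|M. w z * D 0 0 z))"
  using assms(2) D unfolding has_wderiv_def by (simp add: add.commute power_add mult_ac)
 ultimately show "(LINT z|M. v z * D a b z) = (-1) ^ (a + b) * (LINT z|M. w z * D 0 0 z)" by simp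
qed

lemma sobolev_wderiv:
 assumes u: "u \<in> sobolev m \<Omega>" and m: "k + i + j \<le> m" shows "wderiv \<Omega> i j u \<in> sobolev k \<Omega>"
proof (rule sobolevI)
 show "wderiv \<Omega> i j u \<in> L2 \<Omega>" using m by (intro wderiv_L2[OF u]) simp
 fix a b assume "a + b \<le> k"
 then have ab: "(a + i) + (b + j) \<le> m" using m by simp
 show "\<exists>v\<in>L2 \<Omega>. has_wderiv \<Omega> a b (wderiv \<Omega> i j u) v"
  using has_wderiv_step[OF has_wderiv_wderiv[OF u] has_wderiv_wderiv[OF u ab]] ab wderiv_L2[OF u ab] by auto
qed

lemma wderiv_wderiv:
 assumes u: "u \<in> sobolev m \<Omega>" and m: "(a + i) + (b + j) \<le> m"
 shows "AE z in M. wderiv \<Omega> a b (wderiv \<Omega> i j u) z = wderiv \<Omega> (a + i) (b + j) u z"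
 using m by (intro wderiv_eq wderiv_L2[OF u m] has_wderiv_step[OF has_wderiv_wderiv[OF u] has_wderiv_wderiv[OF u m]]) simp

lemma l2_wderiv_diff:
 assumes "u \<in> sobolev k \<Omega>" "v \<in> sobolev k \<Omega>" "i + j \<le> k"
 shows "l2 M (wderiv \<Omega> i j (u - v)) = l2 M (wderiv \<Omega> i j u - wderiv \<Omega> i j v)"
proof (rule l2_cong_AE)
 show "AE z in M. wderiv \<Omega> i j (u - v) z = (wderiv \<Omega> i j u - wderiv \<Omega> i j v) z"
  using wderiv_diff[OF assms] by simp
 have "u - v \<in> sobolev k \<Omega>" using sobolev_lin[OF assms(1,2), of 1 "-1"] by (simp add: fun_diff_def)
 then show "wderiv \<Omega> i j (u - v) \<in> borel_measurable M" by (rule L2_measurable[OF wderiv_L2[OF _ assms(3)]])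
 show "wderiv \<Omega> i j u - wderiv \<Omega> i j v \<in> borel_measurable M"
  using Lsq.diff[of "wderiv \<Omega> i j u" M "wderiv \<Omega> i j v"] wderiv_L2[OF assms(1,3)] wderiv_L2[OF assms(2,3)]
  by (simp add: L2_Lsq Lsq_def)
qed

lemma sob_inner_lin:
 assumes u: "u \<in> sobolev k \<Omega>" and v: "v \<in> sobolev k \<Omega>" and w: "w \<in> sobolev k \<Omega>"
 shows "sob_inner k \<Omega> (\<lambda>z. a * u z + b * v z) w = a * sob_inner k \<Omega> u w + b * sob_inner k \<Omega> v w"
proof -
 have "(LINT z|M. wderiv \<Omega> i j (\<lambda>z. a * u z + b * v z) z * wderiv \<Omega> i j w z) =
   a * (LINT z|M. wderiv \<Omega> i j u z * wderiv \<Omega> i j w z) + b * (LINT z|M. wderiv \<Omega> i j v z * wderiv \<Omega> i j w z)"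
  if ij: "i + j \<le> k" for i j
 proof -
  note L = wderiv_L2[OF u ij] wderiv_L2[OF v ij] wderiv_L2[OF w ij] wderiv_L2[OF sobolev_lin[OF u v, of a b] ij]
  note I = L2_integrable_mult[OF L(1,3)] L2_integrable_mult[OF L(2,3)] L2_integrable_mult[OF L(4,3)]
  have "(LINT z|M. wderiv \<Omega> i j (\<lambda>z. a * u z + b * v z) z * wderiv \<Omega> i j w z) =
    (LINT z|M. a * (wderiv \<Omega> i j u z * wderiv \<Omega> i j w z) + b * (wderiv \<Omega> i j v z * wderiv \<Omega> i j w z))"
  proof (rule integral_cong_AE)
   show "AE z in M. wderiv \<Omega> i j (\<lambda>z. a * u z + b * v z) z * wderiv \<Omega> i j w z =
     a * (wderiv \<Omega> i j u z * wderiv \<Omega> i j w z) + b * (wderiv \<Omega> i j v z * wderiv \<Omega> i j w z)"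
    using wderiv_lin[OF u v ij, of a b] by eventually_elim (simp add: algebra_simps)
  qed (use I in \<open>auto intro!: borel_measurable_integrable\<close>)
  then show ?thesis using I by simp
 qed
 then show ?thesis
  unfolding sob_inner_def by (simp add: sum_distrib_left sum.distrib[symmetric] case_prod_unfold)
qed

lemma sob_ip_space: "ip_space (sobolev k \<Omega>) (sob_inner k \<Omega>)"
proof
 show "(\<lambda>_. 0) \<in> sobolev k \<Omega>"
  by (rule sobolevI[OF L2_zero]) (auto simp: has_wderiv_def intro!: bexI[of _ "\<lambda>_. 0"] L2_zero)
 fix u v w :: "pfun" and a b :: real
 assume u: "u \<in> sobolev k \<Omega>"
 show "0 \<le> sob_inner k \<Omega> u u"
  unfolding sob_inner_def by (intro sum_nonneg) (auto intro!: integral_nonneg_AE)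
 assume v: "v \<in> sobolev k \<Omega>"
 show "(\<lambda>z. a * u z + b * v z) \<in> sobolev k \<Omega>" by (rule sobolev_lin[OF u v])
 show "sob_inner k \<Omega> u v = sob_inner k \<Omega> v u" unfolding sob_inner_def by (simp add: mult.commute)
 assume w: "w \<in> sobolev k \<Omega>"
 show "sob_inner k \<Omega> (\<lambda>z. a * u z + b * v z) w = a * sob_inner k \<Omega> u w + b * sob_inner k \<Omega> v w"
  by (rule sob_inner_lin[OF u v w])
qed

text \<open>All weak derivatives of a Cauchy sequence converge in the square mean, and the defining identity of a
 weak derivative is continuous in both of its functions.\<close>

lemma sob_complete_ip_space: "complete_ip_space (sobolev k \<Omega>) (sob_inner k \<Omega>)"
proof -
 interpret S: ip_space "sobolev k \<Omega>" "sob_inner k \<Omega>" by (rule sob_ip_space)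
 have nrm: "S.nrm = sob_norm k \<Omega>" by (simp add: fun_eq_iff S.nrm_def sob_norm_def)
 show ?thesis
 proof
  fix f :: "nat => pfun"
  assume f: "\<And>n. f n \<in> sobolev k \<Omega>"
   and cau: "\<And>e. e > 0 ==> \<exists>N. \<forall>m\<ge>N. \<forall>n\<ge>N. S.nrm (f m - f n) < e"
  have ex: "\<exists>l\<in>L2 \<Omega>. (\<lambda>n. l2 M (wderiv \<Omega> i j (f n) - l)) \<leadsto> 0" if ij: "i + j \<le> k" for i j
   unfolding L2_Lsq
  proof (rule Lsq_complete)
   show "wderiv \<Omega> i j (f n) \<in> Lsq M" for n using wderiv_L2[OF f ij] by (simp add: L2_Lsq)
   fix e :: real assume "e > 0"
   then obtain N where N: "\<forall>m\<ge>N. \<forall>n\<ge>N. sob_norm k \<Omega> (f m - f n) < e" using cau unfolding nrm by blast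
   have "l2 M (wderiv \<Omega> i j (f m) - wderiv \<Omega> i j (f n)) < e" if "m \<ge> N" "n \<ge> N" for m n
    using l2_wderiv_le_sob_norm[OF ij, of \<Omega> "f m - f n"] l2_wderiv_diff[OF f f ij, of m n] N that by force
   then show "\<exists>N. \<forall>m\<ge>N. \<forall>n\<ge>N. l2 M (wderiv \<Omega> i j (f m) - wderiv \<Omega> i j (f n)) < e" by blast
  qed
  define g where "g i j = (SOME l. l \<in> L2 \<Omega> \<and> (\<lambda>n. l2 M (wderiv \<Omega> i j (f n) - l)) \<leadsto> 0)" for i j
  have g': "g i j \<in> L2 \<Omega> \<and> (\<lambda>n. l2 M (wderiv \<Omega> i j (f n) - g i j)) \<leadsto> 0" if "i + j \<le> k" for i j
   using someI_ex[OF ex[OF that, unfolded Bex_def]] unfolding g_def .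
  have g: "g i j \<in> L2 \<Omega>" "(\<lambda>n. l2 M (wderiv \<Omega> i j (f n) - g i j)) \<leadsto> 0" if "i + j \<le> k" for i j
   using g'[OF that] by auto
  define l where "l = g 0 0"
  have l: "l \<in> L2 \<Omega>" using g(1)[of 0 0] by (simp add: l_def)
  have wl: "has_wderiv \<Omega> i j l (g i j)" if ij: "i + j \<le> k" for i j
   unfolding has_wderiv_def
  proof (intro allI impI)
   fix D assume D: "smooth_jet D \<and> compact_support_in \<Omega> (D 0 0)"
   have JL: "D a b \<in> Lsq M" for a b using jet_L2[OF conjunct1[OF D]] by (simp add: L2_Lsq)
   have c: "(\<lambda>n. LINT z|M. wderiv \<Omega> a b (f n) z * D p q z) \<leadsto> (LINT z|M. g a b z * D p q z)"
    if "a + b \<le> k" for a b p q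
    using wderiv_L2[OF f that] g(1)[OF that] by (intro Lsq.ip_tendsto g JL that) (simp_all add: L2_Lsq)
   have "(LINT z|M. wderiv \<Omega> 0 0 (f n) z * D i j z) = (LINT z|M. f n z * D i j z)" for n
   proof (rule integral_cong_AE)
    show "AE z in M. wderiv \<Omega> 0 0 (f n) z * D i j z = f n z * D i j z"
     using wderiv_00[OF sobolev_L2[OF f[of n]]] by eventually_elim simp
   qed (use L2_integrable_mult[OF wderiv_L2[OF f, of 0 0] jet_L2[OF conjunct1[OF D]]]
     L2_integrable_mult[OF sobolev_L2[OF f] jet_L2[OF conjunct1[OF D]]] in \<open>auto intro!: borel_measurable_integrable\<close>)
   moreover have "(LINT z|M. f n z * D i j z) = (-1) ^ (i + j) * (LINT z|M. wderiv \<Omega> i j (f n) z * D 0 0 z)" for n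
    using has_wderiv_wderiv[OF f ij] D unfolding has_wderiv_def by blast
   ultimately have "(\<lambda>n. LINT z|M. wderiv \<Omega> 0 0 (f n) z * D i j z) \<leadsto> (-1) ^ (i + j) * (LINT z|M. g i j z * D 0 0 z)"
    using tendsto_mult_left[OF c[OF ij, of 0 0], of "(-1) ^ (i + j)"] by simp
   then show "(LINT z|M. l z * D i j z) = (-1) ^ (i + j) * (LINT z|M. g i j z * D 0 0 z)"
    unfolding l_def by (rule LIMSEQ_unique[OF c[of 0 0 i j, simplified]])
  qed
  have lS: "l \<in> sobolev k \<Omega>" using wl g(1) by (intro sobolevI l) blast
  have "(\<lambda>n. \<Sum>(i, j)\<in>{(i, j). i + j \<le> k}. (l2 M (wderiv \<Omega> i j (f n - l)))^2) \<leadsto> (\<Sum>(i, j)\<in>{(i, j). i + j \<le> k}. 0^2)"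
  proof (rule tendsto_sum)
   fix p :: "nat \<times> nat" assume "p \<in> {(i, j). i + j \<le> k}"
   then obtain i j where p: "p = (i, j)" and ij: "i + j \<le> k" by auto
   have "l2 M (wderiv \<Omega> i j (f n - l)) = l2 M (wderiv \<Omega> i j (f n) - g i j)" for n
    unfolding l2_wderiv_diff[OF f lS ij]
   proof (rule l2_cong_AE)
    show "AE z in M. (wderiv \<Omega> i j (f n) - wderiv \<Omega> i j l) z = (wderiv \<Omega> i j (f n) - g i j) z"
     using wderiv_eq[OF g(1)[OF ij] wl[OF ij]] by eventually_elim auto
   qed (use wderiv_L2[OF f ij, of n] wderiv_L2[OF lS ij] g(1)[OF ij] in \<open>auto simp: L2_Lsq fun_diff_def dest!: Lsq_measurable\<close>)
   then have "(\<lambda>n. (l2 M (wderiv \<Omega> i j (f n - l)))^2) \<leadsto> 0^2"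
    using g(2)[OF ij] by (intro tendsto_power) simp
   then show "(\<lambda>n. case p of (i, j) => (l2 M (wderiv \<Omega> i j (f n - l)))^2) \<leadsto> (case p of (i, j) => 0^2)"
    by (simp add: p)
  qed
  then have "(\<lambda>n. (sob_norm k \<Omega> (f n - l))^2) \<leadsto> 0" by (simp add: sob_norm_sq_sum)
  then have "(\<lambda>n. sqrt ((sob_norm k \<Omega> (f n - l))^2)) \<leadsto> sqrt 0" by (rule tendsto_real_sqrt)
  then have "(\<lambda>n. \<bar>sob_norm k \<Omega> (f n - l)\<bar>) \<leadsto> 0" by simp
  then have "(\<lambda>n. sob_norm k \<Omega> (f n - l)) \<leadsto> 0" by (simp add: tendsto_rabs_zero_iff)
  then show "\<exists>l\<in>sobolev k \<Omega>. (\<lambda>n. S.nrm (f n - l)) \<leadsto> 0" unfolding nrm using lS by blast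
 qed
qed

lemma sob_norm_zero_iff:
 assumes "u \<in> sobolev k \<Omega>" shows "sob_norm k \<Omega> u = 0 \<longleftrightarrow> (AE z in M. u z = 0)"
proof
 assume "sob_norm k \<Omega> u = 0"
 then have "l2 M (wderiv \<Omega> 0 0 u) \<le> 0" using l2_wderiv_le_sob_norm[of 0 0 k \<Omega> u] by simp
 moreover have "wderiv \<Omega> 0 0 u \<in> Lsq M" using wderiv_L2[OF assms, of 0 0] by (simp add: L2_Lsq)
 ultimately have "AE z in M. wderiv \<Omega> 0 0 u z = 0"
  using l2_zero_iff[of "wderiv \<Omega> 0 0 u" M] Lsq.nrm_nonneg[of "wderiv \<Omega> 0 0 u" M] by force
 then show "AE z in M. u z = 0" using wderiv_00[OF sobolev_L2[OF assms]] by eventually_elim simp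
next
 assume z: "AE z in M. u z = 0"
 interpret S: ip_space "sobolev k \<Omega>" "sob_inner k \<Omega>" by (rule sob_ip_space)
 have "wderiv \<Omega> i j u = wderiv \<Omega> i j (\<lambda>_. 0)" for i j
  by (rule wderiv_cong_AE[OF z L2_measurable[OF sobolev_L2[OF assms]]]) simp
 then have "sob_inner k \<Omega> u u = sob_inner k \<Omega> (\<lambda>_. 0) (\<lambda>_. 0)" by (simp add: sob_inner_def)
 also have "\<dots> = 0" using S.ip_scale[OF S.zero S.zero, of 0] by simp
 finally show "sob_norm k \<Omega> u = 0" by (simp add: sob_norm_def)
qed

end

definition rc :: "real => real => (real \<times> real) set" where "rc a b = {0<..<a} \<times> {0<..<b}"

abbreviation "Mrc a b \<equiv> lebesgue_on (rc a b)"
abbreviation "Mi a \<equiv> lebesgue_on {0<..<a::real}"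
abbreviation "Hs k a b \<equiv> sobolev k (rc a b)"
abbreviation "hn k a b \<equiv> sob_norm k (rc a b)"
abbreviation "Dx a b \<equiv> wderiv (rc a b) 1 0"
abbreviation "Dt a b \<equiv> wderiv (rc a b) 0 1"

lemma dom_rc: "dom (rc a b)"
 unfolding rc_def by unfold_locales (auto intro: open_Times bounded_Times)

interpretation rc: dom "rc a b" for a b by (rule dom_rc)

interpretation Sob: complete_ip_space "Hs k a b" "sob_inner k (rc a b)"
 rewrites "ip_space.nrm (sob_inner k (rc a b)) = hn k a b" for k a b
proof -
 show "complete_ip_space (Hs k a b) (sob_inner k (rc a b))" by (rule rc.sob_complete_ip_space)
 then interpret complete_ip_space "Hs k a b" "sob_inner k (rc a b)" .
 show "ip_space.nrm (sob_inner k (rc a b)) = hn k a b"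
  by (simp add: fun_eq_iff nrm_def sob_norm_def)
qed

lemma rect_rc: "rect T = rc 1 T" by (simp add: rect_def rc_def)

lemma sob_index_1: "{(i, j). i + j \<le> (1::nat)} = {(0, 0), (1, 0), (0, 1)}"
 by auto

lemma sob_norm_1_sq:
 "(sob_norm 1 \<Omega> u)^2 = (l2 (lebesgue_on \<Omega>) (wderiv \<Omega> 0 0 u))^2 + (l2 (lebesgue_on \<Omega>) (wderiv \<Omega> 1 0 u))^2
  + (l2 (lebesgue_on \<Omega>) (wderiv \<Omega> 0 1 u))^2"
 unfolding sob_norm_sq_sum sob_index_1 by simp

section \<open>Smooth functions are dense in the first Sobolev space of a rectangle\<close>

lemma borel_rc[simp, measurable]: "rc a b \<in> sets borel" by simp

lemma borel_open_rectangle[simp, measurable]: "{p<..<q} \<times> {r<..<s} \<in> sets (borel :: (real \<times> real) measure)"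
 by (intro borel_open open_Times) auto

lemma bounded_rc: "bounded (rc a b)" by (rule rc.bounded_dom)

lemma ftc_Ioo:
 fixes g g' :: "real => real"
 assumes "c \<le> d" "\<And>x. (g has_real_derivative g' x) (at x)" "continuous_on UNIV g'"
 shows "(LINT x|lebesgue_on {c<..<d}. g' x) = g d - g c"
proof -
 have "(g' has_integral g d - g c) {c..d}"
  by (rule fundamental_theorem_of_calculus[OF assms(1)])
   (use assms(2) in \<open>auto simp: has_real_derivative_iff_has_vector_derivative[symmetric] intro: has_field_derivative_at_within\<close>)
 then have i: "(g' has_integral g d - g c) {c<..<d}" by (simp add: has_integral_Icc_iff_Ioo)
 have "g' \<in> L2 {c<..<d}" by (intro continuous_L2 assms) auto
 then have "integrable (lebesgue_on {c<..<d}) g'" by (rule L2_integrable) auto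
 then have "(LINT x|lebesgue_on {c<..<d}. g' x) = integral {c<..<d} g'"
  by (intro lebesgue_integral_eq_integral) auto
 then show ?thesis using i by (simp add: integral_unique)
qed

lemma green_x_classical:
 fixes F F' :: "pfun"
 assumes "a \<ge> 0" "\<And>x t. ((\<lambda>x. F (x, t)) has_real_derivative F' (x, t)) (at x)" "continuous_on UNIV F'"
 shows "(LINT z|Mrc a b. F' z) = (LINT t|Mi b. F (a, t) - F (0, t))"
proof -
 have L: "F' \<in> L2 (rc a b)" by (intro continuous_L2 assms bounded_rc) auto
 have m: "F' \<in> borel_measurable (lebesgue_on ({0<..<a} \<times> {0<..<b}))" using L2_measurable[OF L] by (simp add: rc_def)
 have i: "integrable (lebesgue_on ({0<..<b} \<times> {0<..<a})) (\<lambda>z. F' (prod.swap z))"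
  using lebesgue_on_swap(2)[OF _ _ m] L2_integrable[OF L bounded_rc borel_rc] by (simp add: rc_def)
 have "(LINT z|Mrc a b. F' z) = (LINT z|lebesgue_on ({0<..<b} \<times> {0<..<a}). F' (prod.swap z))"
  using lebesgue_on_swap(3)[OF _ _ m] by (simp add: rc_def)
 also have "\<dots> = (LINT t|Mi b. LINT x|Mi a. F' (x, t))"
  using fubini_lebesgue_on(3)[OF _ _ i] by simp
 also have "\<dots> = (LINT t|Mi b. F (a, t) - F (0, t))"
 proof (rule Bochner_Integration.integral_cong[OF refl])
  fix t show "(LINT x|Mi a. F' (x, t)) = F (a, t) - F (0, t)"
   by (rule ftc_Ioo[OF assms(1,2)]) (intro continuous_on_compose2[OF assms(3)] continuous_intros, auto)
 qed
 finally show ?thesis .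
qed

lemma jet_has_wderiv_x:
 assumes D: "smooth_jet D" and a: "a \<ge> 0"
 shows "has_wderiv (rc a b) 1 0 (D 0 0) (D 1 0)"
 unfolding has_wderiv_def
proof (intro allI impI)
 fix E assume E: "smooth_jet E \<and> compact_support_in (rc a b) (E 0 0)"
 then have E0: "E 0 0 z = 0" if "z \<notin> rc a b" for z using that unfolding compact_support_in_def by blast
 have c: "continuous_on UNIV (\<lambda>z. D i j z * E k l z + D m n z * E p q z)" for i j k l m n p q
  by (intro continuous_intros smooth_jet_continuous[OF D] smooth_jet_continuous[OF conjunct1[OF E]])
 have I: "integrable (Mrc a b) (\<lambda>z. D i j z * E k l z)" for i j k l
  by (intro L2_integrable_mult rc.jet_L2 D conjunct1[OF E])
 have "(LINT z|Mrc a b. D 0 0 z * E 1 0 z + D 1 0 z * E 0 0 z) =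
   (LINT t|Mi b. D 0 0 (a, t) * E 0 0 (a, t) - D 0 0 (0, t) * E 0 0 (0, t))"
 proof (rule green_x_classical[where F = "\<lambda>z. D 0 0 z * E 0 0 z", OF a])
  fix x t show "((\<lambda>x. D 0 0 (x, t) * E 0 0 (x, t)) has_real_derivative
    D 0 0 (x, t) * E 1 0 (x, t) + D 1 0 (x, t) * E 0 0 (x, t)) (at x)"
   using DERIV_mult[OF smooth_jet_partial_fst[OF D, of 0 0 t x] smooth_jet_partial_fst[OF conjunct1[OF E], of 0 0 t x]]
   by (simp add: algebra_simps)
 qed (rule c)
 also have "\<dots> = 0" by (simp add: E0 rc_def)
 finally show "(LINT z|Mrc a b. D 0 0 z * E 1 0 z) = (-1) ^ (1 + 0) * (LINT z|Mrc a b. D 1 0 z * E 0 0 z)"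
  using I by simp
qed

abbreviation "sw u \<equiv> \<lambda>z. u (prod.swap z)"

lemma has_wderiv_swap:
 assumes u: "u \<in> L2 (rc a b)" and v: "v \<in> L2 (rc a b)" and w: "has_wderiv (rc a b) i j u v"
 shows "has_wderiv (rc b a) j i (sw u) (sw v)"
 unfolding has_wderiv_def
proof (intro allI impI)
 fix D assume D: "smooth_jet D \<and> compact_support_in (rc b a) (D 0 0)"
 let ?E = "\<lambda>i j z. D j i (prod.swap z)"
 have E: "smooth_jet ?E" using D by (intro smooth_jet_swap) simp
 obtain K where K: "compact K" "K \<subseteq> rc b a" "\<And>z. z \<notin> K ==> D 0 0 z = 0"
  using D unfolding compact_support_in_def by auto
 have c: "compact_support_in (rc a b) (?E 0 0)"
  unfolding compact_support_in_def
 proof (intro exI[of _ "prod.swap ` K"] conjI allI impI)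
  show "compact (prod.swap ` K)"
   by (intro compact_continuous_image K) (auto simp: prod.swap_def intro!: continuous_intros)
  show "prod.swap ` K \<subseteq> rc a b" using K(2) by (auto simp: rc_def)
  fix z :: "real \<times> real" assume "z \<notin> prod.swap ` K"
  then have "prod.swap z \<notin> K" by (metis image_eqI swap_swap)
  then show "D 0 0 (prod.swap z) = 0" by (rule K(3))
 qed
 have sw: "(LINT z|lebesgue_on (rc b a). f (prod.swap z) * D p q z) = (LINT z|Mrc a b. f z * ?E q p z)"
  if f: "f \<in> L2 (rc a b)" for f p q
 proof -
  have "(\<lambda>z. f z * ?E q p z) \<in> borel_measurable (lebesgue_on ({0<..<a} \<times> {0<..<b}))"
   using borel_measurable_integrable[OF rc.jet_test[OF E f]] by (simp add: rc_def)
  from lebesgue_on_swap(3)[OF _ _ this] show ?thesis by (simp add: rc_def)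
 qed
 show "(LINT z|lebesgue_on (rc b a). u (prod.swap z) * D j i z) =
   (-1) ^ (j + i) * (LINT z|lebesgue_on (rc b a). v (prod.swap z) * D 0 0 z)"
  unfolding sw[OF u] sw[OF v] using w[unfolded has_wderiv_def, rule_format, OF conjI[OF E c]] by (simp add: add.commute)
qed

lemma jet_has_wderiv:
 assumes D: "smooth_jet D" and a: "a \<ge> 0" and b: "b \<ge> 0"
 shows "has_wderiv (rc a b) 1 0 (D 0 0) (D 1 0)" and "has_wderiv (rc a b) 0 1 (D 0 0) (D 0 1)"
proof -
 show "has_wderiv (rc a b) 1 0 (D 0 0) (D 1 0)" by (rule jet_has_wderiv_x[OF D a])
 have E: "smooth_jet (\<lambda>i j. sw (D j i))" by (rule smooth_jet_swap[OF D])
 show "has_wderiv (rc a b) 0 1 (D 0 0) (D 0 1)"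
  using has_wderiv_swap[OF rc.jet_L2[OF E] rc.jet_L2[OF E] jet_has_wderiv_x[OF E b]] by simp
qed

lemma nat_sum_le_1_cases: "i + j \<le> (1::nat) ==> (i = 0 \<and> j = 0) \<or> (i = 1 \<and> j = 0) \<or> (i = 0 \<and> j = 1)"
 by auto

lemma sobolev_1I:
 assumes "u \<in> L2 \<Omega>" "ux \<in> L2 \<Omega>" "ut \<in> L2 \<Omega>" "has_wderiv \<Omega> 1 0 u ux" "has_wderiv \<Omega> 0 1 u ut"
 shows "u \<in> sobolev 1 \<Omega>"
proof (rule sobolevI[OF assms(1)])
 fix i j :: nat assume "i + j \<le> 1"
 from nat_sum_le_1_cases[OF this] show "\<exists>v\<in>L2 \<Omega>. has_wderiv \<Omega> i j u v"
  using assms has_wderiv_00[of \<Omega> u] by (elim disjE conjE) blast+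
qed

lemma jet_sobolev_1:
 assumes D: "smooth_jet D" and a: "a \<ge> 0" and b: "b \<ge> 0" shows "D 0 0 \<in> Hs 1 a b"
 by (rule sobolev_1I[OF rc.jet_L2[OF D] rc.jet_L2[OF D] rc.jet_L2[OF D] jet_has_wderiv[OF assms]])

lemma jet_wderiv:
 assumes D: "smooth_jet D" and a: "a \<ge> 0" and b: "b \<ge> 0"
 shows "AE z in Mrc a b. Dx a b (D 0 0) z = D 1 0 z"
  and "AE z in Mrc a b. Dt a b (D 0 0) z = D 0 1 z"
 by (intro rc.wderiv_eq rc.jet_L2 jet_has_wderiv assms)+

definition flat_exp' :: "real => real" where
 "flat_exp' x = (if x > 0 then exp (- inverse x) / x^2 else 0)"

text \<open>It is dominated by the reciprocal of the distance to the end points, so it is harmless against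
 functions that vanish there.\<close>

definition bump' :: "real => real => nat => real => real" where
 "bump' a b n x = n * flat_exp' (n * (x - a) - 1) * flat_exp (n * (b - x) - 1)
   - n * flat_exp' (n * (b - x) - 1) * flat_exp (n * (x - a) - 1)"

lemma bump_DERIV: "(bump a b n has_real_derivative bump' a b n x) (at x)"
proof -
 have f: "(flat_exp has_real_derivative flat_exp' y) (at y)" for y
  unfolding flat_exp'_def by (rule flat_exp_DERIV)
 have "((\<lambda>x. flat_exp (n * (x - a) - 1) * flat_exp (n * (b - x) - 1)) has_real_derivative bump' a b n x) (at x)"
  unfolding bump'_def by (auto intro!: derivative_eq_intros DERIV_chain2[OF f] simp: algebra_simps)
 then show ?thesis unfolding bump_def .
qed

lemma flat_exp'_bound:
 fixes n s :: real
 assumes "s > 0" "n \<ge> 0" shows "\<bar>n * flat_exp' (n * s - 1)\<bar> \<le> 3 / s"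
proof (cases "n * s - 1 > 0")
 case True
 let ?y = "n * s - 1"
 have "flat_exp' ?y * (n * s) \<le> 3" using inverse_exp_bound[OF True] True by (simp add: flat_exp'_def)
 then have "n * flat_exp' ?y \<le> 3 / s" using assms by (simp add: field_simps)
 moreover have "n * flat_exp' ?y \<ge> 0" using assms by (simp add: flat_exp'_def)
 ultimately show ?thesis by simp
next
 case False then show ?thesis using assms by (simp add: flat_exp'_def)
qed

lemma flat_exp'_lim: fixes s :: real assumes "s > 0" shows "(\<lambda>n. real n * flat_exp' (n * s - 1)) \<leadsto> 0"
proof (rule tendsto_sandwich)
 show "\<forall>\<^sub>F n in sequentially. 0 \<le> real n * flat_exp' (n * s - 1)" by (auto simp: flat_exp'_def)
 have "filterlim (\<lambda>n. real n * s - 1) at_top sequentially" using assms by real_asymp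
 then have "\<forall>\<^sub>F n in sequentially. real n * s - 1 > 0" unfolding filterlim_at_top_dense by blast
 then show "\<forall>\<^sub>F n in sequentially. real n * flat_exp' (n * s - 1) \<le> real n / (n * s - 1)^2"
 proof eventually_elim
  fix n assume "real n * s - 1 > 0"
  then have "flat_exp' (n * s - 1) \<le> 1 / (n * s - 1)^2"
   by (auto simp: flat_exp'_def intro!: divide_right_mono)
  then have "real n * flat_exp' (n * s - 1) \<le> real n * (1 / (n * s - 1)^2)" by (rule mult_left_mono) simp
  then show "real n * flat_exp' (n * s - 1) \<le> real n / (n * s - 1)^2" by simp
 qed
 show "(\<lambda>n. real n / (n * s - 1)^2) \<leadsto> 0" using assms by real_asymp
qed simp

lemma bump'_bound: assumes "a < x" "x < b" shows "\<bar>bump' a b n x\<bar> \<le> 3 / (x - a) + 3 / (b - x)"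
proof -
 have "\<bar>n * flat_exp' (n * (x - a) - 1) * flat_exp (n * (b - x) - 1)\<bar> \<le> 3 / (x - a) * 1"
  unfolding abs_mult[of "_ * _" "flat_exp _"] using assms flat_exp'_bound[of "x - a" n] flat_exp_bounds
  by (intro mult_mono) auto
 moreover have "\<bar>n * flat_exp' (n * (b - x) - 1) * flat_exp (n * (x - a) - 1)\<bar> \<le> 3 / (b - x) * 1"
  unfolding abs_mult[of "_ * _" "flat_exp _"] using assms flat_exp'_bound[of "b - x" n] flat_exp_bounds
  by (intro mult_mono) auto
 ultimately show ?thesis unfolding bump'_def by linarith
qed

lemma bump'_lim: assumes "a < x" "x < b" shows "(\<lambda>n. bump' a b n x) \<leadsto> 0"
proof -
 have "(\<lambda>n. n * flat_exp' (n * (x - a) - 1) * flat_exp (n * (b - x) - 1)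
   - n * flat_exp' (n * (b - x) - 1) * flat_exp (n * (x - a) - 1)) \<leadsto> 0 * 1 - 0 * 1"
  using assms by (intro tendsto_intros flat_exp'_lim filterlim_compose[OF flat_exp_tendsto_1] bump_eventually_pos) auto
 then show ?thesis by (simp add: bump'_def)
qed

lemma L2_limit_test:
 assumes u: "u \<in> L2 S" and S: "bounded S" "S \<in> sets borel"
  and m: "\<And>n. g n \<in> borel_measurable (lebesgue_on S)" "h \<in> borel_measurable (lebesgue_on S)"
  and bd: "\<And>n x. x \<in> S ==> \<bar>g n x\<bar> \<le> c" and lim: "\<And>x. x \<in> S ==> (\<lambda>n. g n x) \<leadsto> h x"
 shows "(\<lambda>n. LINT x|lebesgue_on S. u x * g n x) \<leadsto> (LINT x|lebesgue_on S. u x * h x)"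
proof (rule integral_dominated_convergence[where w = "\<lambda>x. \<bar>u x\<bar> * c"])
 note [measurable] = L2_measurable[OF u] m
 show "(\<lambda>x. u x * h x) \<in> borel_measurable (lebesgue_on S)" by measurable
 show "(\<lambda>x. u x * g n x) \<in> borel_measurable (lebesgue_on S)" for n by measurable
 show "integrable (lebesgue_on S) (\<lambda>x. \<bar>u x\<bar> * c)"
  using L2_integrable[OF u S] by (intro integrable_mult_left integrable_abs)
 show "AE x in lebesgue_on S. (\<lambda>n. u x * g n x) \<leadsto> u x * h x"
  using lim by (auto intro!: AE_I2 tendsto_mult)
 show "AE x in lebesgue_on S. norm (u x * g n x) \<le> \<bar>u x\<bar> * c" for n
  using bd by (auto intro!: AE_I2 mult_left_mono simp: abs_mult)
qed

lemma lipschitz_at_zero: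
 assumes f: "smooth_jet1 f" and z: "f 0 p = 0"
 obtains L where "L \<ge> 0" "\<And>x. x \<in> {0<..<a} ==> \<bar>f 0 x\<bar> \<le> L * \<bar>x - p\<bar>"
proof -
 have c: "continuous_on UNIV (f 1)"
  using f unfolding smooth_jet1_def by (meson DERIV_isCont continuous_at_imp_continuous_on)
 have "bounded ({0<..<a} \<union> {p})" by simp
 then have "bounded (convex hull ({0<..<a} \<union> {p}))" by (rule bounded_convex_hull)
 then obtain L where L: "L \<ge> 0" "\<And>x. x \<in> convex hull ({0<..<a} \<union> {p}) ==> \<bar>f 1 x\<bar> \<le> L"
  using continuous_bounded_on[OF c] by blast
 have "\<bar>f 0 x\<bar> \<le> L * \<bar>x - p\<bar>" if "x \<in> {0<..<a}" for x
 proof -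
  have "norm (f 0 x - f 0 p) \<le> L * norm (x - p)"
  proof (rule field_differentiable_bound)
   show "convex (convex hull ({0<..<a} \<union> {p}))" by (rule convex_convex_hull)
   fix y assume y: "y \<in> convex hull ({0<..<a} \<union> {p})"
   show "(f 0 has_field_derivative f 1 y) (at y within convex hull ({0<..<a} \<union> {p}))"
    using f unfolding smooth_jet1_def by (metis One_nat_def has_field_derivative_at_within)
   show "norm (f 1 y) \<le> L" using L(2)[OF y] by simp
  next
   show "x \<in> convex hull ({0<..<a} \<union> {p})" using that by (intro hull_inc) auto
   show "p \<in> convex hull ({0<..<a} \<union> {p})" by (intro hull_inc) auto
  qed
  then show ?thesis using z by simp
 qed
 then show ?thesis using that L(1) by blast
qed

lemma smooth_jet1_continuous: "smooth_jet1 f ==> continuous_on S (f i)"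
 unfolding smooth_jet1_def by (meson DERIV_isCont continuous_at_imp_continuous_on)

lemma jet1_prod_bump:
 assumes f: "smooth_jet1 f"
 obtains F where "smooth_jet1 F" "F 0 = (\<lambda>x. f 0 x * bump 0 a n x)" "F 1 = (\<lambda>x. f 1 x * bump 0 a n x + f 0 x * bump' 0 a n x)"
proof -
 have "smooth1 (\<lambda>x. f 0 x * bump 0 a n x)" by (intro smooth1_mult smooth1_bump smooth_jet1_smooth1 f)
 then obtain F where F: "smooth_jet1 F" "F 0 = (\<lambda>x. f 0 x * bump 0 a n x)" by (metis smooth1_jet)
 have "F 1 x = f 1 x * bump 0 a n x + f 0 x * bump' 0 a n x" for x
 proof (rule DERIV_unique)
  show "(F 0 has_real_derivative F 1 x) (at x)" using F(1) unfolding smooth_jet1_def by (metis One_nat_def)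
  have "(f 0 has_real_derivative f 1 x) (at x)" using f unfolding smooth_jet1_def by (metis One_nat_def)
  from DERIV_mult[OF this bump_DERIV[of 0 a n x]]
  show "(F 0 has_real_derivative f 1 x * bump 0 a n x + f 0 x * bump' 0 a n x) (at x)"
   unfolding F(2) by (simp add: algebra_simps)
 qed
 then show ?thesis using that[OF F] by (simp add: fun_eq_iff)
qed

text \<open>Test functions need not have compact support: it suffices that they vanish on the two sides that are
 transversal to the differentiation. Multiplying by bumps restores compact support; the extra term
 contains the derivative of a bump, which is at most a constant over the distance to the ends, and the
 test function vanishes there at least linearly, so dominated convergence applies.\<close>

lemma wderiv_x_vanishing_test:
 assumes u: "u \<in> L2 (rc a b)" and v: "v \<in> L2 (rc a b)" and w: "has_wderiv (rc a b) 1 0 u v"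
  and f: "smooth_jet1 f" "f 0 0 = 0" "f 0 a = 0" and g: "smooth_jet1 g"
 shows "(LINT z|Mrc a b. u z * (f 1 (fst z) * g 0 (snd z))) =
  - (LINT z|Mrc a b. v z * (f 0 (fst z) * g 0 (snd z)))"
proof -
 have "\<forall>n. \<exists>F. smooth_jet1 F \<and> F 0 = (\<lambda>x. f 0 x * bump 0 a n x) \<and> F 1 = (\<lambda>x. f 1 x * bump 0 a n x + f 0 x * bump' 0 a n x)"
  using jet1_prod_bump[OF f(1)] by metis
 then obtain F where F: "\<And>n. smooth_jet1 (F n)" "\<And>n. F n 0 = (\<lambda>x. f 0 x * bump 0 a n x)"
  "\<And>n. F n 1 = (\<lambda>x. f 1 x * bump 0 a n x + f 0 x * bump' 0 a n x)" by metis
 have "\<forall>n. \<exists>G. smooth_jet1 G \<and> G 0 = (\<lambda>x. g 0 x * bump 0 b n x)" using jet1_prod_bump[OF g] by metis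
 then obtain G where G: "\<And>n. smooth_jet1 (G n)" "\<And>n. G n 0 = (\<lambda>x. g 0 x * bump 0 b n x)" by metis
 obtain L1 where L1: "L1 \<ge> 0" "\<And>x. x \<in> {0<..<a} ==> \<bar>f 0 x\<bar> \<le> L1 * \<bar>x - 0\<bar>" using lipschitz_at_zero[OF f(1,2)] by blast
 obtain L2' where L2: "L2' \<ge> 0" "\<And>x. x \<in> {0<..<a} ==> \<bar>f 0 x\<bar> \<le> L2' * \<bar>x - a\<bar>" using lipschitz_at_zero[OF f(1,3)] by blast
 obtain M0 where M0: "M0 \<ge> 0" "\<And>x. x \<in> {0<..<a} ==> \<bar>f 0 x\<bar> \<le> M0"
  using continuous_bounded_on[OF smooth_jet1_continuous[OF f(1)], of "{0<..<a}" 0] by auto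
 obtain M1 where M1: "M1 \<ge> 0" "\<And>x. x \<in> {0<..<a} ==> \<bar>f 1 x\<bar> \<le> M1"
  using continuous_bounded_on[OF smooth_jet1_continuous[OF f(1)], of "{0<..<a}" 1] by auto
 obtain MG where MG: "MG \<ge> 0" "\<And>x. x \<in> {0<..<b} ==> \<bar>g 0 x\<bar> \<le> MG"
  using continuous_bounded_on[OF smooth_jet1_continuous[OF g], of "{0<..<b}" 0] by auto
 have m: "(\<lambda>z. p (fst z) * q (snd z)) \<in> borel_measurable (Mrc a b)"
  if "continuous_on UNIV p" "continuous_on UNIV q" for p q :: "real => real"
  by (intro continuous_measurable_lebesgue_on continuous_intros continuous_on_compose2[OF that(1)] continuous_on_compose2[OF that(2)]) auto
 have Gb: "\<bar>G n 0 t\<bar> \<le> MG" if "t \<in> {0<..<b}" for n t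
  unfolding G(2) abs_mult using mult_mono[OF MG(2)[OF that], of "\<bar>bump 0 b n t\<bar>" 1] MG(1) bump_bounds by simp
 have Fb: "\<bar>F n 0 x\<bar> \<le> M0" if "x \<in> {0<..<a}" for n x
  unfolding F(2) abs_mult using mult_mono[OF M0(2)[OF that], of "\<bar>bump 0 a n x\<bar>" 1] M0(1) bump_bounds by simp
 have F'b: "\<bar>F n 1 x\<bar> \<le> M1 + (3 * L1 + 3 * L2')" if x: "x \<in> {0<..<a}" for n x
 proof -
  have "\<bar>f 1 x * bump 0 a n x\<bar> \<le> M1"
   unfolding abs_mult using mult_mono[OF M1(2)[OF x], of "\<bar>bump 0 a n x\<bar>" 1] M1(1) bump_bounds by simp
  moreover have "\<bar>f 0 x * bump' 0 a n x\<bar> \<le> 3 * L1 + 3 * L2'"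
  proof -
   have "\<bar>f 0 x * bump' 0 a n x\<bar> \<le> \<bar>f 0 x\<bar> * (3 / (x - 0) + 3 / (a - x))"
    unfolding abs_mult using x by (intro mult_left_mono bump'_bound) auto
   also have "\<dots> = \<bar>f 0 x\<bar> * 3 / x + \<bar>f 0 x\<bar> * 3 / (a - x)" by (simp add: distrib_left)
   also have "\<bar>f 0 x\<bar> * 3 / x \<le> 3 * L1" using L1(2)[OF x] x by (simp add: pos_divide_le_eq)
   also have "\<bar>f 0 x\<bar> * 3 / (a - x) \<le> 3 * L2'" using L2(2)[OF x] x by (simp add: pos_divide_le_eq)
   finally show ?thesis by simp
  qed
  ultimately show ?thesis unfolding F(3) by linarith
 qed
 have blim: "(\<lambda>n. bump 0 c n x) \<leadsto> 1" if "x \<in> {0<..<c}" for x c using bump_tendsto_1[of 0 x c] that by simp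
 have lim1: "(\<lambda>n. LINT z|Mrc a b. u z * (F n 1 (fst z) * G n 0 (snd z))) \<leadsto>
   (LINT z|Mrc a b. u z * (f 1 (fst z) * g 0 (snd z)))"
 proof (rule L2_limit_test[OF u bounded_rc borel_rc, where c = "(M1 + (3 * L1 + 3 * L2')) * MG"])
  show "(\<lambda>z. F n 1 (fst z) * G n 0 (snd z)) \<in> borel_measurable (Mrc a b)" for n
   by (intro m smooth_jet1_continuous F G)
  show "(\<lambda>z. f 1 (fst z) * g 0 (snd z)) \<in> borel_measurable (Mrc a b)"
   by (intro m smooth_jet1_continuous f g)
  fix z assume z: "z \<in> rc a b"
  then have x: "fst z \<in> {0<..<a}" and t: "snd z \<in> {0<..<b}" by (auto simp: rc_def)
  show "\<bar>F n 1 (fst z) * G n 0 (snd z)\<bar> \<le> (M1 + (3 * L1 + 3 * L2')) * MG" for n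
   unfolding abs_mult using F'b[OF x] Gb[OF t] M1(1) L1(1) L2(1) by (intro mult_mono) auto
  have "(\<lambda>n. (f 1 (fst z) * bump 0 a n (fst z) + f 0 (fst z) * bump' 0 a n (fst z)) * (g 0 (snd z) * bump 0 b n (snd z)))
   \<leadsto> (f 1 (fst z) * 1 + f 0 (fst z) * 0) * (g 0 (snd z) * 1)"
   using x t by (intro tendsto_intros blim bump'_lim) auto
  then show "(\<lambda>n. F n 1 (fst z) * G n 0 (snd z)) \<leadsto> f 1 (fst z) * g 0 (snd z)"
   unfolding F(3) G(2) by simp
 qed
 have lim2: "(\<lambda>n. LINT z|Mrc a b. v z * (F n 0 (fst z) * G n 0 (snd z))) \<leadsto>
   (LINT z|Mrc a b. v z * (f 0 (fst z) * g 0 (snd z)))"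
 proof (rule L2_limit_test[OF v bounded_rc borel_rc, where c = "M0 * MG"])
  show "(\<lambda>z. F n 0 (fst z) * G n 0 (snd z)) \<in> borel_measurable (Mrc a b)" for n
   by (intro m smooth_jet1_continuous F G)
  show "(\<lambda>z. f 0 (fst z) * g 0 (snd z)) \<in> borel_measurable (Mrc a b)"
   by (intro m smooth_jet1_continuous f g)
  fix z assume z: "z \<in> rc a b"
  then have x: "fst z \<in> {0<..<a}" and t: "snd z \<in> {0<..<b}" by (auto simp: rc_def)
  show "\<bar>F n 0 (fst z) * G n 0 (snd z)\<bar> \<le> M0 * MG" for n
   unfolding abs_mult using Fb[OF x] Gb[OF t] M0(1) by (intro mult_mono) auto
  have "(\<lambda>n. (f 0 (fst z) * bump 0 a n (fst z)) * (g 0 (snd z) * bump 0 b n (snd z)))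
   \<leadsto> (f 0 (fst z) * 1) * (g 0 (snd z) * 1)"
   using x t by (intro tendsto_intros blim) auto
  then show "(\<lambda>n. F n 0 (fst z) * G n 0 (snd z)) \<leadsto> f 0 (fst z) * g 0 (snd z)"
   unfolding F(2) G(2) by simp
 qed
 have eq: "(LINT z|Mrc a b. u z * (F n 1 (fst z) * G n 0 (snd z))) =
   - (LINT z|Mrc a b. v z * (F n 0 (fst z) * G n 0 (snd z)))" if n: "n > 0" for n
 proof -
  let ?K = "{0 + inverse (real n) .. a - inverse n} \<times> {0 + inverse (real n) .. b - inverse n}"
  have "compact_support_in (rc a b) (\<lambda>z. F n 0 (fst z) * G n 0 (snd z))"
   unfolding compact_support_in_def
  proof (intro exI[of _ ?K] conjI allI impI)
   show "compact ?K" by (intro compact_Times) auto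
   show "?K \<subseteq> rc a b" unfolding rc_def using bump_support_subset[OF n] by blast
   show "F n 0 (fst z) * G n 0 (snd z) = 0" if "z \<notin> ?K" for z
    using that bump_support[of "fst z" 0 n a] bump_support[of "snd z" 0 n b] unfolding F(2) G(2)
    by (cases z) auto
  qed
  then show ?thesis
   using w smooth_jet_tensor[OF F(1)[of n] G(1)[of n]] unfolding has_wderiv_def by force
 qed
 have "(\<lambda>n. LINT z|Mrc a b. u z * (F n 1 (fst z) * G n 0 (snd z))) \<leadsto>
   - (LINT z|Mrc a b. v z * (f 0 (fst z) * g 0 (snd z)))"
  by (rule Lim_transform_eventually[OF tendsto_minus[OF lim2]])
   (use eq in \<open>auto intro!: eventually_sequentiallyI[of 1]\<close>)
 then show ?thesis using lim1 LIMSEQ_unique by blast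
qed

lemma L2_swap: assumes "u \<in> L2 (rc a b)" shows "(sw u) \<in> L2 (rc b a)"
proof -
 have m: "u \<in> borel_measurable (lebesgue_on ({0<..<a} \<times> {0<..<b}))"
  and i: "integrable (lebesgue_on ({0<..<a} \<times> {0<..<b})) (\<lambda>z. (u z)^2)"
  using assms by (auto simp: L2_def rc_def)
 show ?thesis
  using lebesgue_on_swap(1)[OF _ _ m] lebesgue_on_swap(2)[OF _ _ borel_measurable_integrable[OF i]] i
  by (simp add: L2_def rc_def)
qed

lemma wderiv_t_vanishing_test:
 assumes u: "u \<in> L2 (rc a b)" and v: "v \<in> L2 (rc a b)" and w: "has_wderiv (rc a b) 0 1 u v"
  and f: "smooth_jet1 f" and g: "smooth_jet1 g" "g 0 0 = 0" "g 0 b = 0"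
 shows "(LINT z|Mrc a b. u z * (f 0 (fst z) * g 1 (snd z))) =
  - (LINT z|Mrc a b. v z * (f 0 (fst z) * g 0 (snd z)))"
proof -
 have sw: "(LINT z|lebesgue_on (rc b a). h (prod.swap z) * (g i (fst z) * f 0 (snd z))) =
   (LINT z|Mrc a b. h z * (f 0 (fst z) * g i (snd z)))" if h: "h \<in> L2 (rc a b)" for h i
 proof -
  have "(\<lambda>z. h z * (f 0 (fst z) * g i (snd z))) \<in> borel_measurable (lebesgue_on ({0<..<a} \<times> {0<..<b}))"
   using borel_measurable_integrable[OF rc.jet_test[OF smooth_jet_tensor[OF f g(1)] h, of 0 i]] by (simp add: rc_def)
  from lebesgue_on_swap(3)[OF _ _ this] show ?thesis by (simp add: rc_def mult_ac)
 qed
 show ?thesis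
  using wderiv_x_vanishing_test[OF L2_swap[OF u] L2_swap[OF v] has_wderiv_swap[OF u v w] g f]
  unfolding sw[OF u] sw[OF v] .
qed

subsection \<open>Cosines\<close>

text \<open>These functions have vanishing normal derivative on all sides of the rectangle and are eigenfunctions
 of the Laplace operator, which is why the \<open>H\<^sup>1\<close> product with one of them is a multiple of the
 \<open>L\<^sup>2\<close> product.\<close>

definition cos2 :: "real => real => int => int => pfun" where
 "cos2 a b k l z = cos (k * pi / a * fst z) * cos (l * pi / b * snd z)"

inductive_set cos_span :: "real => real => pfun set" for a b where
 basis: "(\<lambda>z. c * cos2 a b k l z) \<in> cos_span a b"
| add: "f \<in> cos_span a b ==> g \<in> cos_span a b ==> (\<lambda>z. f z + g z) \<in> cos_span a b"

lemma cos2_mult: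
 "cos2 a b k l z * cos2 a b m n z = (1/4) * cos2 a b (k - m) (l - n) z + (1/4) * cos2 a b (k - m) (l + n) z
  + ((1/4) * cos2 a b (k + m) (l - n) z + (1/4) * cos2 a b (k + m) (l + n) z)"
proof -
 have c: "cos (p * pi / c * x) * cos (q * pi / c * x) =
   (cos (of_int (p - q) * pi / c * x) + cos (of_int (p + q) * pi / c * x)) / 2" for p q :: int and c x :: real
  unfolding cos_times_cos by (simp add: algebra_simps diff_divide_distrib add_divide_distrib)
 have "cos2 a b k l z * cos2 a b m n z =
   (cos (k * pi / a * fst z) * cos (m * pi / a * fst z)) * (cos (l * pi / b * snd z) * cos (n * pi / b * snd z))"
  by (simp add: cos2_def)
 then show ?thesis unfolding c cos2_def by (simp add: algebra_simps)
qed

lemma cos_span_mult: assumes "f \<in> cos_span a b" "g \<in> cos_span a b" shows "(\<lambda>z. f z * g z) \<in> cos_span a b"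
 using assms(1)
proof induction
 case f: (basis c k l)
 show ?case using assms(2)
 proof induction
  case (basis d m n)
  have "(\<lambda>z. (c * d / 4) * cos2 a b (k - m) (l - n) z + (c * d / 4) * cos2 a b (k - m) (l + n) z
   + ((c * d / 4) * cos2 a b (k + m) (l - n) z + (c * d / 4) * cos2 a b (k + m) (l + n) z)) \<in> cos_span a b"
   by (intro cos_span.intros)
  moreover have "c * cos2 a b k l z * (d * cos2 a b m n z) =
   (c * d / 4) * cos2 a b (k - m) (l - n) z + (c * d / 4) * cos2 a b (k - m) (l + n) z
   + ((c * d / 4) * cos2 a b (k + m) (l - n) z + (c * d / 4) * cos2 a b (k + m) (l + n) z)" for z
  proof -
   have "c * cos2 a b k l z * (d * cos2 a b m n z) = c * d * (cos2 a b k l z * cos2 a b m n z)" by simp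
   then show ?thesis unfolding cos2_mult by (simp add: algebra_simps)
  qed
  ultimately show ?case by simp
 next
  case (add g h)
  then show ?case using cos_span.add[OF add.IH] by (simp add: distrib_left)
 qed
next
 case (add f h)
 then show ?case using cos_span.add[OF add.IH] by (simp add: distrib_right)
qed

lemma cos_span_continuous: "f \<in> cos_span a b ==> continuous_on S f"
proof (induction rule: cos_span.induct)
 case (basis c k l)
 have "continuous_on S (\<lambda>z. c * (cos (p * fst z) * cos (q * snd z)))" for p q by (intro continuous_intros)
 then show ?case unfolding cos2_def .
qed (rule continuous_on_add)

text \<open>The product formula for cosines makes the span an algebra, and \<open>cos\<close> is injective on \<open>[0, \<pi>]\<close>, so it
 separates points: Stone--Weierstrass.\<close>

lemma cos_span_dense:
 assumes ab: "a > 0" "b > 0" and f: "continuous_on UNIV f" and e: "e > 0"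
 shows "\<exists>g\<in>cos_span a b. \<forall>z\<in>{0..a} \<times> {0..b}. \<bar>f z - g z\<bar> < e"
proof -
 interpret function_ring_on "cos_span a b" "{0..a} \<times> {0..b}"
 proof
  show "compact ({0..a} \<times> {0..b})" by (intro compact_Times) auto
  show "(\<lambda>_. c) \<in> cos_span a b" for c
   using cos_span.basis[of c a b 0 0] by (simp add: cos2_def)
  show "\<exists>g\<in>cos_span a b. g z \<noteq> g w" if "z \<in> {0..a} \<times> {0..b}" "w \<in> {0..a} \<times> {0..b}" "z \<noteq> w" for z w
  proof -
   have inj: "cos (pi / c * x) \<noteq> cos (pi / c * y)" if "c > 0" "x \<in> {0..c}" "y \<in> {0..c}" "x \<noteq> y" for c x y :: real
   proof
    assume eq: "cos (pi / c * x) = cos (pi / c * y)"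
    have "pi / c * x \<in> {0..pi}" "pi / c * y \<in> {0..pi}" using that by (auto simp: field_simps)
    then have "pi / c * x = pi / c * y" using eq cos_inj_pi[of "pi / c * x" "pi / c * y"] by auto
    then show False using that by simp
   qed
   have "fst z \<noteq> fst w \<or> snd z \<noteq> snd w" using \<open>z \<noteq> w\<close> by (auto simp: prod_eq_iff)
   then show ?thesis
   proof
    assume "fst z \<noteq> fst w"
    then have "cos2 a b 1 0 z \<noteq> cos2 a b 1 0 w" using inj[of a "fst z" "fst w"] that ab by (auto simp: cos2_def)
    then show ?thesis using cos_span.basis[of 1 a b 1 0] by (intro bexI[of _ "cos2 a b 1 0"]) auto
   next
    assume "snd z \<noteq> snd w"
    then have "cos2 a b 0 1 z \<noteq> cos2 a b 0 1 w" using inj[of b "snd z" "snd w"] that ab by (auto simp: cos2_def)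
    then show ?thesis using cos_span.basis[of 1 a b 0 1] by (intro bexI[of _ "cos2 a b 0 1"]) auto
   qed
  qed
 qed (auto intro: cos_span_continuous cos_span.add cos_span_mult)
 show ?thesis by (rule Stone_Weierstrass_basic[OF continuous_on_subset[OF f] e]) simp
qed

lemma AE_zero_from_cosines:
 assumes ab: "a > 0" "b > 0" and r: "r \<in> L2 (rc a b)"
  and z: "\<And>k l. (LINT z|Mrc a b. r z * cos2 a b k l z) = 0"
 shows "AE z in Mrc a b. r z = 0"
proof (rule fundamental_lemma_plane[OF rc.open_dom r])
 fix D assume D: "smooth_jet D"
 let ?M = "Mrc a b"
 have rc: "integrable ?M (\<lambda>z. r z * f z)" if "continuous_on UNIV f" for f
  by (intro L2_integrable_mult[OF r] continuous_L2 that bounded_rc borel_rc)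
 have span: "(LINT z|?M. r z * f z) = 0" if "f \<in> cos_span a b" for f
  using that
 proof induction
  case (basis c k l)
  then show ?case using z[of k l] by (simp add: mult.left_commute)
 next
  case (add f g)
  then show ?case using rc[OF cos_span_continuous[of f]] rc[OF cos_span_continuous[of g]] by (simp add: distrib_left)
 qed
 have Dc: "continuous_on UNIV (D 0 0)" by (rule smooth_jet_continuous[OF D])
 have ri: "integrable ?M (\<lambda>z. \<bar>r z\<bar>)" using L2_integrable[OF r bounded_rc borel_rc] by (rule integrable_abs)
 have "\<bar>LINT z|?M. r z * D 0 0 z\<bar> \<le> 0 + e * (LINT z|?M. \<bar>r z\<bar>)" if e: "e > 0" for e
 proof -
  obtain g where g: "g \<in> cos_span a b" "\<And>z. z \<in> {0..a} \<times> {0..b} ==> \<bar>D 0 0 z - g z\<bar> < e"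
   using cos_span_dense[OF ab Dc e] by blast
  have gc: "continuous_on UNIV g" by (rule cos_span_continuous[OF g(1)])
  have "(LINT z|?M. r z * D 0 0 z) = (LINT z|?M. r z * (D 0 0 z - g z))"
   using span[OF g(1)] rc[OF Dc] rc[OF gc] by (simp add: right_diff_distrib)
  also have "\<bar>\<dots>\<bar> \<le> (LINT z|?M. \<bar>r z * (D 0 0 z - g z)\<bar>)" by (rule integral_abs_bound)
  also have "\<dots> \<le> (LINT z|?M. e * \<bar>r z\<bar>)"
  proof (rule integral_mono)
   show "integrable ?M (\<lambda>z. \<bar>r z * (D 0 0 z - g z)\<bar>)"
    by (intro integrable_abs rc continuous_intros Dc gc)
   show "integrable ?M (\<lambda>z. e * \<bar>r z\<bar>)" using ri by simp
   fix z assume "z \<in> space ?M"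
   then have "z \<in> {0..a} \<times> {0..b}" by (auto simp: rc_def)
   from g(2)[OF this] show "\<bar>r z * (D 0 0 z - g z)\<bar> \<le> e * \<bar>r z\<bar>"
    unfolding abs_mult by (subst mult.commute) (intro mult_right_mono, auto)
  qed
  finally show ?thesis using ri by simp
 qed
 note bd = this
 have "\<bar>LINT z|?M. r z * D 0 0 z\<bar> \<le> 0"
 proof (rule field_le_epsilon)
  fix e :: real assume e: "e > 0"
  let ?I = "LINT z|?M. \<bar>r z\<bar>"
  have I: "?I \<ge> 0" by (intro integral_nonneg_AE) auto
  have "?I / (?I + 1) \<le> 1" by (subst divide_le_eq_1_pos) (use I in linarith)+
  from mult_left_mono[OF this, of e] have "e / (?I + 1) * ?I \<le> e" using e by simp
  then show "\<bar>LINT z|?M. r z * D 0 0 z\<bar> \<le> 0 + e" using bd[of "e / (?I + 1)"] I e by auto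
 qed
 then show "(LINT z|?M. r z * D 0 0 z) = 0" by simp
qed

subsection \<open>Density\<close>

lemma sob_inner_1:
 "sob_inner 1 \<Omega> u v = (LINT z|lebesgue_on \<Omega>. wderiv \<Omega> 0 0 u z * wderiv \<Omega> 0 0 v z)
  + (LINT z|lebesgue_on \<Omega>. wderiv \<Omega> 1 0 u z * wderiv \<Omega> 1 0 v z)
  + (LINT z|lebesgue_on \<Omega>. wderiv \<Omega> 0 1 u z * wderiv \<Omega> 0 1 v z)"
 unfolding sob_inner_def sob_index_1 by simp

text \<open>Integration by parts moves the derivatives of r onto the cosine. There are no boundary terms because
 the normal derivative of the cosine vanishes on the sides.\<close>

lemma cos2_orthogonal:
 assumes ab: "a > 0" "b > 0" and r: "r \<in> Hs 1 a b"
 obtains D where "smooth_jet D" "D 0 0 = cos2 a b k l"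
  "sob_inner 1 (rc a b) r (D 0 0) = (1 + (k * pi / a)^2 + (l * pi / b)^2) * (LINT z|Mrc a b. r z * cos2 a b k l z)"
proof -
 let ?M = "Mrc a b"
 have tj: "\<exists>F. smooth_jet1 F \<and> F 0 = (\<lambda>x. cos (c * x)) \<and> F 1 = (\<lambda>x. - c * sin (c * x)) \<and> F 2 = (\<lambda>x. - c\<^sup>2 * cos (c * x))" for c :: real
 proof -
  obtain F where F: "smooth_jet1 F" "F 0 = (\<lambda>x. cos (c * x))" using smooth1_jet[OF smooth1_cos[of c]] by blast
  have d: "(F i has_real_derivative F (Suc i) x) (at x)" for i x using F(1) by (simp add: smooth_jet1_def)
  have 1: "F 1 = (\<lambda>x. - c * sin (c * x))"
  proof
   fix x
   have "(F 0 has_real_derivative - c * sin (c * x)) (at x)" unfolding F(2) by (auto intro!: derivative_eq_intros)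
   then show "F 1 x = - c * sin (c * x)" using d[of 0 x] DERIV_unique by fastforce
  qed
  have 2: "F 2 = (\<lambda>x. - c\<^sup>2 * cos (c * x))"
  proof
   fix x
   have "(F 1 has_real_derivative - c\<^sup>2 * cos (c * x)) (at x)"
    unfolding 1 by (auto intro!: derivative_eq_intros simp: power2_eq_square)
   then show "F 2 x = - c\<^sup>2 * cos (c * x)" using d[of 1 x] DERIV_unique by (fastforce simp: numeral_2_eq_2)
  qed
  show ?thesis using F 1 2 by blast
 qed
 obtain F where F: "smooth_jet1 F" "F 0 = (\<lambda>x. cos (k * pi / a * x))" "F 1 = (\<lambda>x. - (k * pi / a) * sin (k * pi / a * x))"
  "F 2 = (\<lambda>x. - (k * pi / a)\<^sup>2 * cos (k * pi / a * x))" using tj by blast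
 obtain G where G: "smooth_jet1 G" "G 0 = (\<lambda>x. cos (l * pi / b * x))" "G 1 = (\<lambda>x. - (l * pi / b) * sin (l * pi / b * x))"
  "G 2 = (\<lambda>x. - (l * pi / b)\<^sup>2 * cos (l * pi / b * x))" using tj by blast
 let ?D = "\<lambda>i j z. F i (fst z) * G j (snd z)"
 have D: "smooth_jet ?D" by (rule smooth_jet_tensor[OF F(1) G(1)])
 have D00: "?D 0 0 = cos2 a b k l" by (simp add: F G cos2_def fun_eq_iff)
 have D00S: "?D 0 0 \<in> Hs 1 a b" using jet_sobolev_1[OF D] ab by simp
 have rL: "r \<in> L2 (rc a b)" using r by (rule sobolev_L2)
 have rx: "Dx a b r \<in> L2 (rc a b)" "has_wderiv (rc a b) 1 0 r (Dx a b r)"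
  and rt: "Dt a b r \<in> L2 (rc a b)" "has_wderiv (rc a b) 0 1 r (Dt a b r)"
  by (auto intro: wderiv_L2[OF r] has_wderiv_wderiv[OF r])
 have r00: "wderiv (rc a b) 0 0 r \<in> L2 (rc a b)" by (rule wderiv_L2[OF r]) simp
 have F': "smooth_jet1 (\<lambda>i. F (i + 1))" and G': "smooth_jet1 (\<lambda>i. G (i + 1))"
  using smooth_jet1_shift[OF F(1), of 1] smooth_jet1_shift[OF G(1), of 1] by simp_all
 have sink: "sin (of_int m * pi / c * c) = 0" if "c > 0" for m :: int and c :: real
  using that by (simp add: sin_integer_2pi sin_zero_iff_int2)
 have F1: "F 1 0 = 0" "F 1 a = 0" unfolding F(3) sink[OF ab(1)] by simp_all
 have G1: "G 1 0 = 0" "G 1 b = 0" unfolding G(3) sink[OF ab(2)] by simp_all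
 have cong: "(LINT z|?M. p z * wderiv (rc a b) i j (?D 0 0) z) = (LINT z|?M. p' z * ?D i j z)"
  if p: "p \<in> L2 (rc a b)" "p' \<in> L2 (rc a b)" "AE z in ?M. p z = p' z" and q: "AE z in ?M. wderiv (rc a b) i j (?D 0 0) z = ?D i j z"
   and ij: "i + j \<le> 1" for p p' i j
 proof (rule integral_cong_AE)
  show "(\<lambda>z. p z * wderiv (rc a b) i j (?D 0 0) z) \<in> borel_measurable ?M"
   by (rule borel_measurable_integrable[OF L2_integrable_mult[OF p(1) wderiv_L2[OF D00S ij]]])
  show "(\<lambda>z. p' z * ?D i j z) \<in> borel_measurable ?M"
   by (rule borel_measurable_integrable[OF rc.jet_test[OF D p(2)]])
  show "AE z in ?M. p z * wderiv (rc a b) i j (?D 0 0) z = p' z * ?D i j z"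
   using p(3) q by eventually_elim simp
 qed
 have t0: "(LINT z|?M. wderiv (rc a b) 0 0 r z * wderiv (rc a b) 0 0 (?D 0 0) z) = (LINT z|?M. r z * cos2 a b k l z)"
  using cong[OF r00 rL rc.wderiv_00[OF rL] rc.wderiv_00[OF sobolev_L2[OF D00S]]] by (simp add: F(2) G(2) cos2_def)
 have "(LINT z|?M. Dx a b r z * Dx a b (?D 0 0) z) =
   (LINT z|?M. Dx a b r z * (F (0 + 1) (fst z) * G 0 (snd z)))"
  using cong[OF rx(1) rx(1) _ jet_wderiv(1)[OF D]] ab by simp
 also have "\<dots> = - (LINT z|?M. r z * (F (1 + 1) (fst z) * G 0 (snd z)))"
  using wderiv_x_vanishing_test[OF rL rx F' _ _ G(1)] F1 by simp
 also have "\<dots> = (k * pi / a)^2 * (LINT z|?M. r z * cos2 a b k l z)"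
  unfolding one_add_one F(4) G(2) cos2_def by (simp flip: integral_mult_right_zero integral_minus add: mult_ac)
 finally have t1: "(LINT z|?M. Dx a b r z * Dx a b (?D 0 0) z) = \<dots>" .
 have "(LINT z|?M. Dt a b r z * Dt a b (?D 0 0) z) =
   (LINT z|?M. Dt a b r z * (F 0 (fst z) * G (0 + 1) (snd z)))"
  using cong[OF rt(1) rt(1) _ jet_wderiv(2)[OF D]] ab by simp
 also have "\<dots> = - (LINT z|?M. r z * (F 0 (fst z) * G (1 + 1) (snd z)))"
  using wderiv_t_vanishing_test[OF rL rt F(1) G'] G1 by simp
 also have "\<dots> = (l * pi / b)^2 * (LINT z|?M. r z * cos2 a b k l z)"
  unfolding one_add_one F(2) G(4) cos2_def by (simp flip: integral_mult_right_zero integral_minus add: mult_ac)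
 finally have t2: "(LINT z|?M. Dt a b r z * Dt a b (?D 0 0) z) = \<dots>" .
 have "sob_inner 1 (rc a b) r (?D 0 0) = (1 + (k * pi / a)^2 + (l * pi / b)^2) * (LINT z|?M. r z * cos2 a b k l z)"
  unfolding sob_inner_1 t0 t1 t2 by (simp add: algebra_simps)
 then show ?thesis using that[OF D D00] by blast
qed

text \<open>The closure X of the smooth functions is a closed subspace; let g be the element of X that represents
 the product with u. Then \<open>u - g\<close> is orthogonal to all the cosines in \<open>H\<^sup>1\<close>, hence in \<open>L\<^sup>2\<close>, hence it
 vanishes. \<close>

theorem smooth_dense:
 assumes ab: "a > 0" "b > 0" and u: "u \<in> Hs 1 a b"
 obtains D where "\<And>n::nat. smooth_jet (D n)" "(\<lambda>n. hn 1 a b (D n 0 0 - u)) \<leadsto> 0"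
proof -
 let ?V = "Hs 1 a b" and ?n = "hn 1 a b"
 define X where "X = {u \<in> ?V. \<forall>e>0. \<exists>D. smooth_jet D \<and> ?n (D 0 0 - u) < e}"
 have jV: "D 0 0 \<in> ?V" if "smooth_jet D" for D using jet_sobolev_1[OF that] ab by simp
 have jX: "D 0 0 \<in> X" if "smooth_jet D" for D
 proof -
  have "?n (D 0 0 - D 0 0) = 0" proof -
   have "D 0 0 - D 0 0 = (\<lambda>_. 0)" by (simp add: fun_eq_iff)
   then show ?thesis using rc.sob_norm_zero_iff[OF Sob.zero[of 1 a b]] by (simp only:) simp
  qed
  then show ?thesis unfolding X_def using jV[OF that] that by auto
 qed
 have XV: "X \<subseteq> ?V" unfolding X_def by blast
 have Xlin: "(\<lambda>z. p * v z + q * w z) \<in> X" if v: "v \<in> X" and w: "w \<in> X" for p q v w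
 proof -
  have V: "v \<in> ?V" "w \<in> ?V" using v w XV by auto
  have "\<exists>D. smooth_jet D \<and> ?n (D 0 0 - (\<lambda>z. p * v z + q * w z)) < e" if e: "e > 0" for e
  proof -
   define d where "d = e / (2 * (\<bar>p\<bar> + \<bar>q\<bar> + 1))"
   have d: "d > 0" unfolding d_def using e by (intro divide_pos_pos) auto
   obtain D E where D: "smooth_jet D" "?n (D 0 0 - v) < d" and E: "smooth_jet E" "?n (E 0 0 - w) < d"
    using v w d unfolding X_def by blast
   let ?H = "\<lambda>i j z. p * D i j z + q * E i j z"
   have eqH: "?H 0 0 - (\<lambda>z. p * v z + q * w z) = (\<lambda>z. p * (D 0 0 - v) z) + (\<lambda>z. q * (E 0 0 - w) z)"
    by (auto simp: fun_eq_iff algebra_simps)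
   have "?n (?H 0 0 - (\<lambda>z. p * v z + q * w z)) \<le> \<bar>p\<bar> * ?n (D 0 0 - v) + \<bar>q\<bar> * ?n (E 0 0 - w)"
    unfolding eqH using Sob.nrm_triangle[OF Sob.scale Sob.scale, OF Sob.diff[OF jV[OF D(1)] V(1)] Sob.diff[OF jV[OF E(1)] V(2)], of p q]
     Sob.nrm_scale[OF Sob.diff[OF jV[OF D(1)] V(1)], of p] Sob.nrm_scale[OF Sob.diff[OF jV[OF E(1)] V(2)], of q] by simp
   also have "\<dots> \<le> \<bar>p\<bar> * d + \<bar>q\<bar> * d" using D(2) E(2) by (intro add_mono mult_left_mono) auto
   also have "\<dots> = (\<bar>p\<bar> + \<bar>q\<bar>) * d" by (simp add: algebra_simps)
   also have "\<dots> < (2 * (\<bar>p\<bar> + \<bar>q\<bar> + 1)) * d" using d by (intro mult_strict_right_mono) auto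
   also have "\<dots> = e" unfolding d_def by (simp add: field_simps)
   finally have "?n (?H 0 0 - (\<lambda>z. p * v z + q * w z)) < e" .
   moreover have "smooth_jet ?H" by (intro smooth_jet_add smooth_jet_scale D E)
   ultimately show ?thesis by blast
  qed
  then show ?thesis using Sob.lin[OF V] unfolding X_def by blast
 qed
 have Xclosed: "l \<in> X" if f: "\<And>n::nat. f n \<in> X" and l: "l \<in> ?V" and lim: "(\<lambda>n. ?n (f n - l)) \<leadsto> 0" for f l
 proof -
  have "\<exists>D. smooth_jet D \<and> ?n (D 0 0 - l) < e" if e: "e > 0" for e
  proof -
   have "\<forall>\<^sub>F n in sequentially. ?n (f n - l) < e / 2" using lim e by (intro order_tendstoD) auto
   then obtain n where n: "?n (f n - l) < e / 2" by (auto simp: eventually_sequentially)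
   obtain D where D: "smooth_jet D" "?n (D 0 0 - f n) < e / 2" using f[of n] e unfolding X_def by (auto dest!: spec[of _ "e/2"])
   have "?n (D 0 0 - l) \<le> ?n (D 0 0 - f n) + ?n (f n - l)"
    by (rule Sob.nrm_triangle_diff[OF jV[OF D(1)] subsetD[OF XV f[of n]] l])
   then show ?thesis using D n by (intro exI[of _ D]) auto
  qed
  then show ?thesis using l unfolding X_def by blast
 qed
 have "\<exists>g\<in>X. \<forall>h\<in>X. sob_inner 1 (rc a b) g h = sob_inner 1 (rc a b) u h"
 proof (rule Sob.riesz[OF XV _ Xlin Xclosed])
  show "(\<lambda>_. 0) \<in> X" using jX[OF smooth_jet_zero] by simp
  show "\<bar>sob_inner 1 (rc a b) u h\<bar> \<le> ?n u * ?n h" if "h \<in> X" for h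
   using that XV by (intro Sob.cauchy_schwarz u) auto
 qed (use XV u in \<open>auto intro!: Sob.ip_lin2\<close>)
 then obtain g where g: "g \<in> X" "\<And>h. h \<in> X ==> sob_inner 1 (rc a b) g h = sob_inner 1 (rc a b) u h" by blast
 have gV: "g \<in> ?V" using g(1) XV by blast
 let ?r = "u - g"
 have rV: "?r \<in> ?V" by (intro Sob.diff u gV)
 have "AE z in Mrc a b. ?r z = 0"
 proof (rule AE_zero_from_cosines[OF ab sobolev_L2[OF rV]])
  fix k l
  obtain D where D: "smooth_jet D" "D 0 0 = cos2 a b k l"
   "sob_inner 1 (rc a b) ?r (D 0 0) = (1 + (k * pi / a)^2 + (l * pi / b)^2) * (LINT z|Mrc a b. ?r z * cos2 a b k l z)"
   using cos2_orthogonal[OF ab rV] by blast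
  have "sob_inner 1 (rc a b) ?r (D 0 0) = 0"
   using g(2)[OF jX[OF D(1)]] Sob.ip_diff[OF u gV jV[OF D(1)]] by simp
  moreover have "1 + (k * pi / a)^2 + (l * pi / b)^2 > 0" by (intro add_pos_nonneg) auto
  ultimately show "(LINT z|Mrc a b. ?r z * cos2 a b k l z) = 0" using D(3) by simp
 qed
 then have r0: "?n ?r = 0" using rc.sob_norm_zero_iff[OF rV] by simp
 have "\<exists>D. smooth_jet D \<and> ?n (D 0 0 - u) < e" if e: "e > 0" for e
 proof -
  obtain D where D: "smooth_jet D" "?n (D 0 0 - g) < e" using g(1) e unfolding X_def by blast
  have "?n (D 0 0 - u) \<le> ?n (D 0 0 - g) + ?n (g - u)" by (intro Sob.nrm_triangle_diff jV D u gV)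
  then show ?thesis using D r0 Sob.nrm_minus_commute[OF u gV] by (intro exI[of _ D]) auto
 qed
 then have "\<forall>n. \<exists>D. smooth_jet D \<and> ?n (D 0 0 - u) < inverse (real (Suc n))" by simp
 then obtain D where D: "\<And>n. smooth_jet (D n)" "\<And>n. ?n (D n 0 0 - u) < inverse (real (Suc n))" by metis
 have "(\<lambda>n. ?n (D n 0 0 - u)) \<leadsto> 0"
  by (rule tendsto_sandwich[OF _ _ tendsto_const LIMSEQ_inverse_real_of_nat])
   (use less_imp_le[OF D(2)] Sob.nrm_nonneg[OF Sob.diff[OF jV[OF D(1)] u]] in \<open>auto intro!: always_eventually\<close>)
 with D(1) show ?thesis by (rule that)
qed

section \<open>Approximation by smooth functions and traces\<close>

definition smooth_approx :: "real => real => (nat => nat => nat => real \<times> real => real) => pfun => bool" where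
 "smooth_approx a b D u \<longleftrightarrow> (\<forall>n. smooth_jet (D n)) \<and> u \<in> Hs 1 a b \<and> (\<lambda>n. hn 1 a b (D n 0 0 - u)) \<leadsto> 0"

lemma smooth_approx_exists:
 assumes "a > 0" "b > 0" "u \<in> Hs 1 a b" obtains D where "smooth_approx a b D u"
 using smooth_dense[OF assms] assms(3) unfolding smooth_approx_def by metis

lemma smooth_approx_jet: "smooth_approx a b D u ==> smooth_jet (D n)"
 and smooth_approx_sob: "smooth_approx a b D u ==> u \<in> Hs 1 a b"
 by (auto simp: smooth_approx_def)

lemma Lsq_jet: "smooth_jet D ==> D i j \<in> Lsq (Mrc a b)"
 using rc.jet_L2 by (simp add: L2_Lsq)

lemma Lsq_wderiv: "u \<in> Hs k a b ==> i + j \<le> k ==> wderiv (rc a b) i j u \<in> Lsq (Mrc a b)"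
 using wderiv_L2 by (simp add: L2_Lsq)

lemma Lsq_sob: "u \<in> Hs k a b ==> u \<in> Lsq (Mrc a b)"
 using sobolev_L2 by (simp add: L2_Lsq)

lemma smooth_approx_l2:
 assumes ab: "a > 0" "b > 0" and D: "smooth_approx a b D u"
 shows "(\<lambda>n. l2 (Mrc a b) (D n 0 0 - u)) \<leadsto> 0"
  and "(\<lambda>n. l2 (Mrc a b) (D n 1 0 - Dx a b u)) \<leadsto> 0"
  and "(\<lambda>n. l2 (Mrc a b) (D n 0 1 - Dt a b u)) \<leadsto> 0"
proof -
 have J: "smooth_jet (D n)" for n using D by (rule smooth_approx_jet)
 have u: "u \<in> Hs 1 a b" using D by (rule smooth_approx_sob)
 have JS: "D n 0 0 \<in> Hs 1 a b" for n using jet_sobolev_1[OF J] ab by simp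
 have lim: "(\<lambda>n. hn 1 a b (D n 0 0 - u)) \<leadsto> 0" using D by (simp add: smooth_approx_def)
 have key: "(\<lambda>n. l2 (Mrc a b) (D n i j - v)) \<leadsto> 0"
  if ij: "i + j \<le> 1" and ae: "\<And>n. AE z in Mrc a b. wderiv (rc a b) i j (D n 0 0) z = D n i j z"
   and v: "v \<in> Lsq (Mrc a b)" "AE z in Mrc a b. wderiv (rc a b) i j u z = v z" for i j v
 proof (rule tendsto_sandwich[OF _ _ tendsto_const lim])
  have "l2 (Mrc a b) (D n i j - v) \<le> hn 1 a b (D n 0 0 - u)" for n
  proof -
   have "l2 (Mrc a b) (D n i j - v) = l2 (Mrc a b) (wderiv (rc a b) i j (D n 0 0) - wderiv (rc a b) i j u)"
   proof (rule l2_cong_AE)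
    show "AE z in Mrc a b. (D n i j - v) z = (wderiv (rc a b) i j (D n 0 0) - wderiv (rc a b) i j u) z"
     using ae[of n] v(2) by eventually_elim simp
   qed (intro Lsq_measurable Lsq.diff Lsq_jet[OF J] v(1) Lsq_wderiv[OF JS ij] Lsq_wderiv[OF u ij])+
   also have "\<dots> = l2 (Mrc a b) (wderiv (rc a b) i j (D n 0 0 - u))"
    by (rule rc.l2_wderiv_diff[OF JS u ij, symmetric])
   also have "\<dots> \<le> hn 1 a b (D n 0 0 - u)" by (rule l2_wderiv_le_sob_norm[OF ij])
   finally show ?thesis .
  qed
  then show "\<forall>\<^sub>F n in sequentially. l2 (Mrc a b) (D n i j - v) \<le> hn 1 a b (D n 0 0 - u)" by simp
  show "\<forall>\<^sub>F n in sequentially. 0 \<le> l2 (Mrc a b) (D n i j - v)"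
   by (intro always_eventually allI Lsq.nrm_nonneg Lsq.diff Lsq_jet[OF J] v)
 qed
 show "(\<lambda>n. l2 (Mrc a b) (D n 0 0 - u)) \<leadsto> 0"
  by (rule key) (use rc.wderiv_00 rc.jet_L2[OF J] sobolev_L2[OF u] in \<open>auto simp: L2_Lsq\<close>)
 show "(\<lambda>n. l2 (Mrc a b) (D n 1 0 - Dx a b u)) \<leadsto> 0"
  by (rule key) (use jet_wderiv[OF J] ab Lsq_wderiv[OF u, of 1 0] in auto)
 show "(\<lambda>n. l2 (Mrc a b) (D n 0 1 - Dt a b u)) \<leadsto> 0"
  by (rule key) (use jet_wderiv[OF J] ab Lsq_wderiv[OF u, of 0 1] in auto)
qed

lemma ip_tendsto2:
 assumes f: "\<And>n::nat. f n \<in> Lsq M" "p \<in> Lsq M" "(\<lambda>n. l2 M (f n - p)) \<leadsto> 0"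
  and g: "\<And>n::nat. g n \<in> Lsq M" "q \<in> Lsq M" "(\<lambda>n. l2 M (g n - q)) \<leadsto> 0"
 shows "(\<lambda>n. LINT z|M. f n z * g n z) \<leadsto> (LINT z|M. p z * q z)"
proof -
 have "(\<lambda>n. l2 M (f n) * l2 M (g n - q)) \<leadsto> l2 M p * 0"
  by (intro tendsto_mult Lsq.nrm_tendsto f g)
 then have z: "(\<lambda>n. l2 M (f n) * l2 M (g n - q)) \<leadsto> 0" by simp
 have "(\<lambda>n. LINT z|M. f n z * (g n - q) z) \<leadsto> 0"
  by (rule Lim_null_comparison[OF _ z])
   (use Lsq.cauchy_schwarz[OF f(1) Lsq.diff[OF g(1,2)]] in auto)
 from tendsto_add[OF this Lsq.ip_tendsto[OF f g(2)]]
 have "(\<lambda>n. (LINT z|M. f n z * (g n - q) z) + (LINT z|M. f n z * q z)) \<leadsto> (LINT z|M. p z * q z)" by simp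
 moreover have "(LINT z|M. f n z * (g n - q) z) + (LINT z|M. f n z * q z) = (LINT z|M. f n z * g n z)" for n
  using Lsq.ip_diff2[OF g(1)[of n] g(2) f(1)[of n]] by simp
 ultimately show ?thesis by simp
qed

lemma l2_mult_bounded:
 assumes u: "u \<in> Lsq M" and g: "g \<in> borel_measurable M" and b: "AE z in M. \<bar>g z\<bar> \<le> c" and c: "c \<ge> 0"
 shows "l2 M (\<lambda>z. u z * g z) \<le> c * l2 M u"
proof (rule power2_le_imp_le)
 have "(LINT z|M. (u z * g z)^2) \<le> (LINT z|M. c^2 * (u z)^2)"
 proof (rule integral_mono_AE)
  show "integrable M (\<lambda>z. (u z * g z)^2)" using Lsq_bounded_mult[OF u g b] by (simp add: Lsq_def)
  show "integrable M (\<lambda>z. c^2 * (u z)^2)" using u by (simp add: Lsq_def)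
  show "AE z in M. (u z * g z)^2 \<le> c^2 * (u z)^2"
   using b
  proof eventually_elim
   fix z assume "\<bar>g z\<bar> \<le> c"
   then have "(g z)^2 \<le> c^2" by (metis abs_ge_zero power2_abs power_mono)
   then show "(u z * g z)^2 \<le> c^2 * (u z)^2"
    by (simp add: power_mult_distrib mult.commute[of "(u z)^2"] mult_right_mono)
  qed
 qed
 then show "(l2 M (\<lambda>z. u z * g z))^2 \<le> (c * l2 M u)^2" by (simp add: l2_sq power_mult_distrib)
 show "0 \<le> c * l2 M u" using c Lsq.nrm_nonneg[OF u] by simp
qed

lemma l2_mult_bounded_tendsto:
 assumes f: "\<And>n::nat. f n \<in> Lsq M" "p \<in> Lsq M" "(\<lambda>n. l2 M (f n - p)) \<leadsto> 0"
  and g: "g \<in> borel_measurable M" and b: "AE z in M. \<bar>g z\<bar> \<le> c" and c: "c \<ge> 0"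
 shows "(\<lambda>n. l2 M ((\<lambda>z. f n z * g z) - (\<lambda>z. p z * g z))) \<leadsto> 0"
proof (rule tendsto_sandwich[OF _ _ tendsto_const])
 have e: "(\<lambda>z. f n z * g z) - (\<lambda>z. p z * g z) = (\<lambda>z. (f n - p) z * g z)" for n
  by (auto simp: fun_eq_iff algebra_simps)
 show "\<forall>\<^sub>F n in sequentially. l2 M ((\<lambda>z. f n z * g z) - (\<lambda>z. p z * g z)) \<le> c * l2 M (f n - p)"
  unfolding e by (intro always_eventually allI l2_mult_bounded[OF Lsq.diff[OF f(1,2)] g b c])
 show "\<forall>\<^sub>F n in sequentially. 0 \<le> l2 M ((\<lambda>z. f n z * g z) - (\<lambda>z. p z * g z))"
  unfolding e by (intro always_eventually allI Lsq.nrm_nonneg Lsq_bounded_mult[OF Lsq.diff[OF f(1,2)] g b])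
 show "(\<lambda>n. c * l2 M (f n - p)) \<leadsto> 0" using tendsto_mult_left[OF f(3), of c] by simp
qed

subsection \<open>Boundary values on a vertical side\<close>

definition trace_x :: "real => real => real => pfun => (real => real) => bool" where
 "trace_x a b c u g \<longleftrightarrow> has_trace (rc a b) (\<lambda>t. (c, t)) {0<..<b} u g"

lemma jet_side_Lsq: "smooth_jet D ==> (\<lambda>t. D i j (c, t)) \<in> Lsq (Mi b)"
proof -
 assume D: "smooth_jet D"
 have "(\<lambda>t. D i j (c, t)) \<in> L2 {0<..<b}"
  by (intro continuous_L2 continuous_on_compose2[OF smooth_jet_continuous[OF D]] continuous_intros) auto
 then show ?thesis by (simp add: L2_Lsq)
qed

text \<open>Integrate the x-derivative of \<open>(x - p) u\<^sup>2\<close> over the rectangle, where p is the abscissa of the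
 opposite side, so that only the side in question contributes.\<close>

lemma jet_trace_bound:
 assumes D: "smooth_jet D" and a: "a > 0" and c: "c = 0 \<or> c = a" and b: "b > 0"
 shows "(l2 (Mi b) (\<lambda>t. D 0 0 (c, t)))^2 \<le> (1 / a + 1) * (hn 1 a b (D 0 0))^2"
proof -
 let ?p = "a - c"
 let ?F = "\<lambda>z. (fst z - ?p) * (D 0 0 z)^2" and ?F' = "\<lambda>z. (D 0 0 z)^2 + 2 * (fst z - ?p) * (D 0 0 z * D 1 0 z)"
 have JS: "D 0 0 \<in> Hs 1 a b" using jet_sobolev_1[OF D] a b by simp
 have cont: "continuous_on UNIV ?F'" by (intro continuous_intros smooth_jet_continuous[OF D])
 have "(LINT z|Mrc a b. ?F' z) = (LINT t|Mi b. ?F (a, t) - ?F (0, t))"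
 proof (rule green_x_classical[OF _ _ cont])
  show "((\<lambda>x. ?F (x, t)) has_real_derivative ?F' (x, t)) (at x)" for x t
   using smooth_jet_partial_fst[OF D, of 0 0 t x]
   by (auto intro!: derivative_eq_intros simp: algebra_simps power2_eq_square)
 qed (use a in simp)
 also have "\<dots> = (LINT t|Mi b. a * (D 0 0 (c, t))^2)"
  using c by (intro Bochner_Integration.integral_cong) auto
 also have "\<dots> = a * (l2 (Mi b) (\<lambda>t. D 0 0 (c, t)))^2" by (simp add: l2_sq)
 finally have "a * (l2 (Mi b) (\<lambda>t. D 0 0 (c, t)))^2 = (LINT z|Mrc a b. ?F' z)" by simp
 also have "\<dots> \<le> (LINT z|Mrc a b. (1 + a) * (D 0 0 z)^2 + a * (D 1 0 z)^2)"
 proof (rule integral_mono)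
  show "integrable (Mrc a b) ?F'" using L2_integrable[OF continuous_L2[OF cont bounded_rc borel_rc] bounded_rc borel_rc] .
  show "integrable (Mrc a b) (\<lambda>z. (1 + a) * (D 0 0 z)^2 + a * (D 1 0 z)^2)"
   using Lsq_integrable_sq[OF Lsq_jet[OF D]] by simp
  fix z assume "z \<in> space (Mrc a b)"
  then have z: "\<bar>fst z - ?p\<bar> \<le> a" using c by (auto simp: rc_def)
  \<comment> \<open>the factor \<open>x - p\<close> has absolute value at most a on the rectangle\<close>
  have "2 * \<bar>D 0 0 z * D 1 0 z\<bar> \<le> (D 0 0 z)^2 + (D 1 0 z)^2"
   using zero_le_power2[of "\<bar>D 0 0 z\<bar> - \<bar>D 1 0 z\<bar>"] by (simp add: power2_diff abs_mult)
  then have "\<bar>fst z - ?p\<bar> * (2 * \<bar>D 0 0 z * D 1 0 z\<bar>) \<le> a * ((D 0 0 z)^2 + (D 1 0 z)^2)"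
   using z by (intro mult_mono) auto
  moreover have "2 * (fst z - ?p) * (D 0 0 z * D 1 0 z) \<le> \<bar>fst z - ?p\<bar> * (2 * \<bar>D 0 0 z * D 1 0 z\<bar>)"
  proof -
   have "(fst z - ?p) * (D 0 0 z * D 1 0 z) \<le> \<bar>fst z - ?p\<bar> * \<bar>D 0 0 z * D 1 0 z\<bar>"
    unfolding abs_mult[symmetric] by (rule abs_ge_self)
   then show ?thesis unfolding mult.assoc mult.left_commute[of "\<bar>fst z - ?p\<bar>" 2] by (rule mult_left_mono) simp
  qed
  ultimately show "?F' z \<le> (1 + a) * (D 0 0 z)^2 + a * (D 1 0 z)^2" by (simp add: algebra_simps)
 qed
 also have "\<dots> = (1 + a) * (l2 (Mrc a b) (D 0 0))^2 + a * (l2 (Mrc a b) (D 1 0))^2"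
  using Lsq_integrable_sq[OF Lsq_jet[OF D]] by (simp add: l2_sq)
 also have "\<dots> \<le> (1 + a) * (hn 1 a b (D 0 0))^2"
 proof -
  have e: "l2 (Mrc a b) (wderiv (rc a b) 0 0 (D 0 0)) = l2 (Mrc a b) (D 0 0)"
   by (rule l2_cong_AE[OF rc.wderiv_00[OF rc.jet_L2[OF D]] Lsq_measurable[OF Lsq_wderiv[OF JS]] Lsq_measurable[OF Lsq_jet[OF D]]]) simp
  have e': "l2 (Mrc a b) (Dx a b (D 0 0)) = l2 (Mrc a b) (D 1 0)"
   by (rule l2_cong_AE[OF jet_wderiv(1)[OF D]]) (use a b Lsq_measurable[OF Lsq_jet[OF D]] Lsq_measurable[OF Lsq_wderiv[OF JS, of 1 0]] in auto)
  have "a * (l2 (Mrc a b) (D 1 0))^2 \<le> (1 + a) * (l2 (Mrc a b) (D 1 0))^2" by (intro mult_right_mono) auto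
  moreover have "(1 + a) * (l2 (Mrc a b) (Dt a b (D 0 0)))^2 \<ge> 0" using a by simp
  ultimately show ?thesis unfolding sob_norm_1_sq e e' by (simp add: algebra_simps)
 qed
 finally have "a * (l2 (Mi b) (\<lambda>t. D 0 0 (c, t)))^2 \<le> (1 + a) * (hn 1 a b (D 0 0))^2" .
 then show ?thesis using a by (simp add: field_simps)
qed

lemma smooth_approx_sides_close:
 assumes D: "smooth_approx a b D u" and E: "smooth_approx a b E u"
  and ab: "a > 0" "b > 0" and c: "c = 0 \<or> c = a"
 shows "(l2 (Mi b) ((\<lambda>t. D m 0 0 (c, t)) - (\<lambda>t. E n 0 0 (c, t))))^2 \<le>
  (1 / a + 1) * (hn 1 a b (D m 0 0 - u) + hn 1 a b (E n 0 0 - u))^2"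
proof -
 have u: "u \<in> Hs 1 a b" using D by (rule smooth_approx_sob)
 have JS: "F 0 0 \<in> Hs 1 a b" if "smooth_jet F" for F using jet_sobolev_1[OF that] ab by simp
 note DS = JS[OF smooth_approx_jet[OF D, of m]] and ES = JS[OF smooth_approx_jet[OF E, of n]]
 let ?H = "\<lambda>i j z. D m i j z + (-1) * E n i j z"
 have H: "smooth_jet ?H" by (intro smooth_jet_add smooth_jet_scale smooth_approx_jet[OF D] smooth_approx_jet[OF E])
 have e: "?H 0 0 = D m 0 0 - E n 0 0" by (auto simp: fun_eq_iff)
 have "(l2 (Mi b) ((\<lambda>t. D m 0 0 (c, t)) - (\<lambda>t. E n 0 0 (c, t))))^2 = (l2 (Mi b) (\<lambda>t. ?H 0 0 (c, t)))^2"
  by (simp add: fun_diff_def)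
 also have "\<dots> \<le> (1 / a + 1) * (hn 1 a b (?H 0 0))^2" by (rule jet_trace_bound[OF H ab(1) c ab(2)])
 also have "\<dots> \<le> (1 / a + 1) * (hn 1 a b (D m 0 0 - u) + hn 1 a b (E n 0 0 - u))^2"
 proof (intro mult_left_mono power_mono)
  show "hn 1 a b (?H 0 0) \<le> hn 1 a b (D m 0 0 - u) + hn 1 a b (E n 0 0 - u)"
   unfolding e using Sob.nrm_triangle_diff[OF DS u ES] Sob.nrm_minus_commute[OF u ES] by simp
  show "0 \<le> hn 1 a b (?H 0 0)" by (intro Sob.nrm_nonneg JS H)
 qed (use ab in simp)
 finally show ?thesis .
qed

lemma tendsto_0_power2_D: "(\<lambda>n. (f n)^2) \<leadsto> 0 ==> f \<leadsto> (0::real)"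
 using tendsto_real_sqrt[of "\<lambda>n. (f n)^2" 0 sequentially] by (simp add: tendsto_rabs_zero_iff)

lemma trace_x_exists:
 assumes ab: "a > 0" "b > 0" and c: "c = 0 \<or> c = a" and D: "smooth_approx a b D u"
 obtains g where "g \<in> Lsq (Mi b)" "(\<lambda>n. l2 (Mi b) ((\<lambda>t. D n 0 0 (c, t)) - g)) \<leadsto> 0" "trace_x a b c u g"
proof -
 let ?f = "\<lambda>n t. D n 0 0 (c, t)"
 have J: "smooth_jet (D n)" for n using D by (rule smooth_approx_jet)
 have lim: "(\<lambda>n. hn 1 a b (D n 0 0 - u)) \<leadsto> 0" using D by (simp add: smooth_approx_def)
 define K where "K = 1 / a + 1"
 have K: "K > 0" unfolding K_def using ab by (simp add: add_pos_pos)
 have cau: "\<exists>N. \<forall>m\<ge>N. \<forall>n\<ge>N. l2 (Mi b) (?f m - ?f n) < e" if e: "e > 0" for e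
 proof -
  have d: "e / (2 * sqrt K) > 0" using e K by simp
  then have "\<forall>\<^sub>F n in sequentially. hn 1 a b (D n 0 0 - u) < e / (2 * sqrt K)"
   using lim by (intro order_tendstoD(2))
  then obtain N where N: "\<And>n. n \<ge> N ==> hn 1 a b (D n 0 0 - u) < e / (2 * sqrt K)"
   by (auto simp: eventually_sequentially)
  have "l2 (Mi b) (?f m - ?f n) < e" if mn: "m \<ge> N" "n \<ge> N" for m n
  proof (rule power2_less_imp_less)
   have JS: "D k 0 0 - u \<in> Hs 1 a b" for k
    using Sob.diff[OF jet_sobolev_1[OF J] smooth_approx_sob[OF D]] ab by simp
   have "(l2 (Mi b) (?f m - ?f n))^2 \<le> K * (hn 1 a b (D m 0 0 - u) + hn 1 a b (D n 0 0 - u))^2"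
    unfolding K_def by (rule smooth_approx_sides_close[OF D D ab c])
   also have "\<dots> < K * (e / sqrt K)^2"
   proof (intro mult_strict_left_mono power_strict_mono)
    show "hn 1 a b (D m 0 0 - u) + hn 1 a b (D n 0 0 - u) < e / sqrt K"
     using N[OF mn(1)] N[OF mn(2)] by simp
    show "0 \<le> hn 1 a b (D m 0 0 - u) + hn 1 a b (D n 0 0 - u)"
     by (intro add_nonneg_nonneg Sob.nrm_nonneg JS)
   qed (use K in auto)
   also have "\<dots> = e^2" using K by (simp add: power_divide)
   finally show "(l2 (Mi b) (?f m - ?f n))^2 < e^2" .
  qed (use e in simp)
  then show ?thesis by blast
 qed
 obtain g where g: "g \<in> Lsq (Mi b)" "(\<lambda>n. l2 (Mi b) (?f n - g)) \<leadsto> 0"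
  using Lsq_complete[of ?f "Mi b", OF jet_side_Lsq[OF J] cau] by blast
 have "(\<lambda>n. (l2 (Mi b) (?f n - g))^2) \<leadsto> 0^2" by (intro tendsto_intros g)
 then have "(\<lambda>n. LINT t|Mi b. (D n 0 0 (c, t) - g t)^2) \<leadsto> 0" by (simp add: l2_sq)
 then have "trace_x a b c u g"
  unfolding trace_x_def has_trace_def
  using J lim smooth_approx_sob[OF D] g(1) jet_sobolev_1[OF J less_imp_le[OF ab(1)] less_imp_le[OF ab(2)]]
  by (intro conjI exI[of _ D] allI) (simp_all only: L2_Lsq)
 then show ?thesis using that g by blast
qed

lemma trace_xD:
 assumes "trace_x a b c u g"
 shows "g \<in> Lsq (Mi b)" "u \<in> Hs 1 a b"
  and "\<exists>E. smooth_approx a b E u \<and> (\<lambda>n. l2 (Mi b) ((\<lambda>t. E n 0 0 (c, t)) - g)) \<leadsto> 0"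
proof -
 show g: "g \<in> Lsq (Mi b)" "u \<in> Hs 1 a b" using assms by (auto simp: trace_x_def has_trace_def L2_Lsq)
 obtain E where E: "\<And>n. smooth_jet (E n)" "(\<lambda>n. hn 1 a b (E n 0 0 - u)) \<leadsto> 0"
  "(\<lambda>n. LINT s|Mi b. (E n 0 0 (c, s) - g s)^2) \<leadsto> 0"
  using assms by (auto simp: trace_x_def has_trace_def)
 have "(\<lambda>n. (l2 (Mi b) ((\<lambda>t. E n 0 0 (c, t)) - g))^2) \<leadsto> 0" using E(3) by (simp add: l2_sq)
 from tendsto_0_power2_D[OF this] show "\<exists>E. smooth_approx a b E u \<and> (\<lambda>n. l2 (Mi b) ((\<lambda>t. E n 0 0 (c, t)) - g)) \<leadsto> 0"
  using E g(2) by (intro exI[of _ E] conjI) (simp_all add: smooth_approx_def)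
qed

text \<open>Independence of the approximating sequence: any two of them are close on the side by the trace bound.\<close>

lemma trace_x_any_approx:
 assumes ab: "a > 0" "b > 0" and c: "c = 0 \<or> c = a"
  and g: "trace_x a b c u g" and D: "smooth_approx a b D u"
 shows "(\<lambda>n. l2 (Mi b) ((\<lambda>t. D n 0 0 (c, t)) - g)) \<leadsto> 0"
proof -
 obtain E where E: "smooth_approx a b E u" "(\<lambda>n. l2 (Mi b) ((\<lambda>t. E n 0 0 (c, t)) - g)) \<leadsto> 0"
  using trace_xD(3)[OF g] by blast
 note gL = trace_xD(1)[OF g]
 have JD: "(\<lambda>t. D n 0 0 (c, t)) \<in> Lsq (Mi b)" and JE: "(\<lambda>t. E n 0 0 (c, t)) \<in> Lsq (Mi b)" for n
  by (intro jet_side_Lsq smooth_approx_jet[OF D] smooth_approx_jet[OF E(1)])+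
 have "(\<lambda>n. (1 / a + 1) * (hn 1 a b (D n 0 0 - u) + hn 1 a b (E n 0 0 - u))^2) \<leadsto> (1 / a + 1) * (0 + 0)^2"
  using D E(1) by (intro tendsto_intros) (auto simp: smooth_approx_def)
 then have z: "(\<lambda>n. (1 / a + 1) * (hn 1 a b (D n 0 0 - u) + hn 1 a b (E n 0 0 - u))^2) \<leadsto> 0" by simp
 have "(\<lambda>n. (l2 (Mi b) ((\<lambda>t. D n 0 0 (c, t)) - (\<lambda>t. E n 0 0 (c, t))))^2) \<leadsto> 0"
  by (rule tendsto_sandwich[OF _ _ tendsto_const z])
   (use smooth_approx_sides_close[OF D E(1) ab c] in \<open>auto intro!: always_eventually\<close>)
 then have "(\<lambda>n. l2 (Mi b) ((\<lambda>t. D n 0 0 (c, t)) - (\<lambda>t. E n 0 0 (c, t)))) \<leadsto> 0" by (rule tendsto_0_power2_D)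
 from tendsto_add[OF this E(2)]
 have "(\<lambda>n. l2 (Mi b) ((\<lambda>t. D n 0 0 (c, t)) - (\<lambda>t. E n 0 0 (c, t))) + l2 (Mi b) ((\<lambda>t. E n 0 0 (c, t)) - g)) \<leadsto> 0" by simp
 then show ?thesis
  by (rule tendsto_sandwich[OF _ _ tendsto_const, rotated 2])
   (auto intro!: always_eventually Lsq.nrm_triangle_diff Lsq.nrm_nonneg Lsq.diff JD JE gL)
qed

lemma trace_x_unique:
 assumes ab: "a > 0" "b > 0" and c: "c = 0 \<or> c = a" and g: "trace_x a b c u g" "trace_x a b c u h"
 shows "AE t in Mi b. g t = h t"
proof -
 obtain D where D: "smooth_approx a b D u" using trace_xD(3)[OF g(1)] by blast
 note gL = trace_xD(1)[OF g(1)] and hL = trace_xD(1)[OF g(2)]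
 have JD: "(\<lambda>t. D n 0 0 (c, t)) \<in> Lsq (Mi b)" for n by (intro jet_side_Lsq smooth_approx_jet[OF D])
 have "(\<lambda>n. l2 (Mi b) ((\<lambda>t. D n 0 0 (c, t)) - g) + l2 (Mi b) ((\<lambda>t. D n 0 0 (c, t)) - h)) \<leadsto> 0 + 0"
  by (intro tendsto_add trace_x_any_approx[OF ab c _ D] g)
 then have "l2 (Mi b) (g - h) \<le> 0 + 0"
 proof (rule LIMSEQ_le_const)
  have "l2 (Mi b) (g - h) \<le> l2 (Mi b) ((\<lambda>t. D n 0 0 (c, t)) - g) + l2 (Mi b) ((\<lambda>t. D n 0 0 (c, t)) - h)" for n
   using Lsq.nrm_triangle_diff[OF gL JD hL, of n] Lsq.nrm_minus_commute[OF gL JD, of n] by simp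
  then show "\<exists>N. \<forall>n\<ge>N. l2 (Mi b) (g - h) \<le> l2 (Mi b) ((\<lambda>t. D n 0 0 (c, t)) - g) + l2 (Mi b) ((\<lambda>t. D n 0 0 (c, t)) - h)" by blast
 qed
 then have "l2 (Mi b) (g - h) = 0" using Lsq.nrm_nonneg[OF Lsq.diff[OF gL hL]] by simp
 then have "AE t in Mi b. (g - h) t = 0" using l2_zero_iff[OF Lsq.diff[OF gL hL]] by blast
 then show ?thesis by eventually_elim simp
qed

lemma trace_x_bound:
 assumes ab: "a > 0" "b > 0" and c: "c = 0 \<or> c = a" and g: "trace_x a b c u g"
 shows "(LINT t|Mi b. (g t)^2) \<le> (1 / a + 1) * (hn 1 a b u)^2"
proof -
 obtain D where D: "smooth_approx a b D u" using trace_xD(3)[OF g] by blast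
 have J: "smooth_jet (D n)" for n using D by (rule smooth_approx_jet)
 have "(\<lambda>n. (l2 (Mi b) (\<lambda>t. D n 0 0 (c, t)))^2) \<leadsto> (l2 (Mi b) g)^2"
  by (intro tendsto_power Lsq.nrm_tendsto jet_side_Lsq J trace_xD(1)[OF g] trace_x_any_approx[OF ab c g D])
 moreover have "(\<lambda>n. (1 / a + 1) * (hn 1 a b (D n 0 0))^2) \<leadsto> (1 / a + 1) * (hn 1 a b u)^2"
 proof -
  have "(\<lambda>n. hn 1 a b (D n 0 0 - u)) \<leadsto> 0" using D by (simp add: smooth_approx_def)
  from Sob.nrm_tendsto[OF jet_sobolev_1[OF J] smooth_approx_sob[OF D] this] ab
  show ?thesis by (intro tendsto_intros) simp
 qed
 ultimately have "(l2 (Mi b) g)^2 \<le> (1 / a + 1) * (hn 1 a b u)^2"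
  by (rule LIMSEQ_le) (use jet_trace_bound[OF J ab(1) c ab(2)] in auto)
 then show ?thesis by (simp add: l2_sq)
qed

text \<open>For smooth functions this is the fundamental theorem of calculus; both sides are continuous along the
 approximating sequences, the boundary terms by the convergence of the traces.\<close>

theorem green_x:
 assumes ab: "a > 0" "b > 0"
  and u: "trace_x a b 0 u u0" "trace_x a b a u ua" and v: "trace_x a b 0 v v0" "trace_x a b a v va"
  and e: "continuous_on UNIV e" and e': "continuous_on UNIV e'"
  and de: "\<And>x t. ((\<lambda>x. e (x, t)) has_real_derivative e' (x, t)) (at x)"
 shows "(LINT z|Mrc a b. Dx a b u z * (v z * e z)) + (LINT z|Mrc a b. u z * (Dx a b v z * e z))
   + (LINT z|Mrc a b. u z * (v z * e' z)) =
  (LINT t|Mi b. ua t * (va t * e (a, t))) - (LINT t|Mi b. u0 t * (v0 t * e (0, t)))"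
proof -
 obtain D where D: "smooth_approx a b D u" using trace_xD(3)[OF u(1)] by blast
 obtain E where E: "smooth_approx a b E v" using trace_xD(3)[OF v(1)] by blast
 have JD: "smooth_jet (D n)" and JE: "smooth_jet (E n)" for n using D E by (auto intro: smooth_approx_jet)
 have uS: "u \<in> Hs 1 a b" and vS: "v \<in> Hs 1 a b" using u v trace_xD by blast+
 obtain c where c: "c \<ge> 0" "\<And>z. z \<in> rc a b ==> \<bar>e z\<bar> \<le> c" using continuous_bounded_on[OF e bounded_rc] by blast
 obtain c' where c': "c' \<ge> 0" "\<And>z. z \<in> rc a b ==> \<bar>e' z\<bar> \<le> c'" using continuous_bounded_on[OF e' bounded_rc] by blast
 have em: "e \<in> borel_measurable (Mrc a b)" "e' \<in> borel_measurable (Mrc a b)"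
  by (intro continuous_measurable_lebesgue_on e e' borel_rc)+
 have eb: "AE z in Mrc a b. \<bar>e z\<bar> \<le> c" "AE z in Mrc a b. \<bar>e' z\<bar> \<le> c'" using c c' by (auto intro!: AE_I2)
 have es: "continuous_on UNIV (\<lambda>t. e (x, t))" for x by (intro continuous_on_compose2[OF e] continuous_intros) auto
 have esm: "(\<lambda>t. e (x, t)) \<in> borel_measurable (Mi b)" for x by (intro continuous_measurable_lebesgue_on es) auto
 have esb: "\<exists>k\<ge>0. AE t in Mi b. \<bar>e (x, t)\<bar> \<le> k" for x
 proof -
  obtain k where "k \<ge> 0" "\<And>t. t \<in> {0<..<b} ==> \<bar>e (x, t)\<bar> \<le> k" using continuous_bounded_on[OF es, of "{0<..<b}"] by auto
  then show ?thesis by (intro exI[of _ k]) (auto intro!: AE_I2)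
 qed
 have wu: "Dx a b u \<in> Lsq (Mrc a b)" and wv: "Dx a b v \<in> Lsq (Mrc a b)"
  by (intro Lsq_wderiv[OF uS] Lsq_wderiv[OF vS], simp)+
 note lu = smooth_approx_l2[OF ab D] and lv = smooth_approx_l2[OF ab E]
 have L: "(\<lambda>n. (LINT z|Mrc a b. D n 1 0 z * (E n 0 0 z * e z)) + (LINT z|Mrc a b. D n 0 0 z * (E n 1 0 z * e z))
   + (LINT z|Mrc a b. D n 0 0 z * (E n 0 0 z * e' z))) \<leadsto>
   (LINT z|Mrc a b. Dx a b u z * (v z * e z)) + (LINT z|Mrc a b. u z * (Dx a b v z * e z))
   + (LINT z|Mrc a b. u z * (v z * e' z))"
  by (intro tendsto_add ip_tendsto2 Lsq_jet[OF JD] Lsq_sob[OF uS] lu wu Lsq_bounded_mult[OF Lsq_jet[OF JE] em(1) eb(1)]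
    Lsq_bounded_mult[OF Lsq_jet[OF JE] em(2) eb(2)] Lsq_bounded_mult[OF Lsq_sob[OF vS] em(1) eb(1)]
    Lsq_bounded_mult[OF Lsq_sob[OF vS] em(2) eb(2)] Lsq_bounded_mult[OF wv em(1) eb(1)]
    l2_mult_bounded_tendsto[OF Lsq_jet[OF JE] Lsq_sob[OF vS] lv(1) em(1) eb(1) c(1)]
    l2_mult_bounded_tendsto[OF Lsq_jet[OF JE] Lsq_sob[OF vS] lv(1) em(2) eb(2) c'(1)]
    l2_mult_bounded_tendsto[OF Lsq_jet[OF JE] wv lv(2) em(1) eb(1) c(1)])
 have bd: "(\<lambda>n. LINT t|Mi b. D n 0 0 (s, t) * (E n 0 0 (s, t) * e (s, t))) \<leadsto> (LINT t|Mi b. p t * (q t * e (s, t)))"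
  if s: "s = 0 \<or> s = a" and p: "trace_x a b s u p" and q: "trace_x a b s v q" for s p q
 proof -
  obtain k where k: "k \<ge> 0" "AE t in Mi b. \<bar>e (s, t)\<bar> \<le> k" using esb by blast
  show ?thesis
   by (intro ip_tendsto2 jet_side_Lsq JD trace_xD(1)[OF p] trace_x_any_approx[OF ab s p D]
    Lsq_bounded_mult[OF jet_side_Lsq[OF JE] esm k(2)] Lsq_bounded_mult[OF trace_xD(1)[OF q] esm k(2)]
    l2_mult_bounded_tendsto[OF jet_side_Lsq[OF JE] trace_xD(1)[OF q] trace_x_any_approx[OF ab s q E] esm k(2,1)])
 qed
 have R: "(\<lambda>n. (LINT t|Mi b. D n 0 0 (a, t) * (E n 0 0 (a, t) * e (a, t))) - (LINT t|Mi b. D n 0 0 (0, t) * (E n 0 0 (0, t) * e (0, t))))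
   \<leadsto> (LINT t|Mi b. ua t * (va t * e (a, t))) - (LINT t|Mi b. u0 t * (v0 t * e (0, t)))"
  by (intro tendsto_diff bd u v) auto
 have "(LINT z|Mrc a b. D n 1 0 z * (E n 0 0 z * e z)) + (LINT z|Mrc a b. D n 0 0 z * (E n 1 0 z * e z))
   + (LINT z|Mrc a b. D n 0 0 z * (E n 0 0 z * e' z)) =
   (LINT t|Mi b. D n 0 0 (a, t) * (E n 0 0 (a, t) * e (a, t))) - (LINT t|Mi b. D n 0 0 (0, t) * (E n 0 0 (0, t) * e (0, t)))" for n
 proof -
  let ?F' = "\<lambda>z. D n 1 0 z * (E n 0 0 z * e z) + D n 0 0 z * (E n 1 0 z * e z) + D n 0 0 z * (E n 0 0 z * e' z)"
  have cF: "continuous_on UNIV ?F'" by (intro continuous_intros smooth_jet_continuous[OF JD] smooth_jet_continuous[OF JE] e e')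
  have ci: "continuous_on UNIV (\<lambda>z. D n i j z * (E n k l z * h z))" if "continuous_on UNIV h" for i j k l h
   by (intro continuous_intros smooth_jet_continuous[OF JD] smooth_jet_continuous[OF JE] that)
  have i: "integrable (Mrc a b) (\<lambda>z. D n i j z * (E n k l z * e z))" "integrable (Mrc a b) (\<lambda>z. D n i j z * (E n k l z * e' z))" for i j k l
   using L2_integrable[OF continuous_L2[OF ci[OF e] bounded_rc borel_rc] bounded_rc borel_rc]
    L2_integrable[OF continuous_L2[OF ci[OF e'] bounded_rc borel_rc] bounded_rc borel_rc] by blast+
  have j: "integrable (Mi b) (\<lambda>t. D n 0 0 (s, t) * (E n 0 0 (s, t) * e (s, t)))" for s
  proof -
   have "continuous_on UNIV (\<lambda>t. D n 0 0 (s, t) * (E n 0 0 (s, t) * e (s, t)))"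
    by (intro continuous_on_compose2[OF ci[OF e, of 0 0 0 0]] continuous_intros) auto
   then have "(\<lambda>t. D n 0 0 (s, t) * (E n 0 0 (s, t) * e (s, t))) \<in> L2 {0<..<b}" by (rule continuous_L2) auto
   then show ?thesis by (rule L2_integrable) auto
  qed
  have "(LINT z|Mrc a b. ?F' z) = (LINT t|Mi b. D n 0 0 (a, t) * (E n 0 0 (a, t) * e (a, t)) - D n 0 0 (0, t) * (E n 0 0 (0, t) * e (0, t)))"
  proof (rule green_x_classical[where F = "\<lambda>z. D n 0 0 z * (E n 0 0 z * e z)", OF _ _ cF])
   fix x t
   show "((\<lambda>x. D n 0 0 (x, t) * (E n 0 0 (x, t) * e (x, t))) has_real_derivative ?F' (x, t)) (at x)"
    using DERIV_mult[OF smooth_jet_partial_fst[OF JD, of n 0 0 t x] DERIV_mult[OF smooth_jet_partial_fst[OF JE, of n 0 0 t x] de[of t x]]]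
    by (simp add: algebra_simps)
  qed (use ab in simp)
  then show ?thesis using i j by simp
 qed
 then show ?thesis using LIMSEQ_unique[OF L] R by simp
qed

section \<open>Exchanging the variables\<close>

lemma swap_integral:
 fixes f :: "pfun"
 assumes "f \<in> borel_measurable (Mrc a b)" shows "(LINT z|Mrc b a. f (prod.swap z)) = (LINT z|Mrc a b. f z)"
 using lebesgue_on_swap(3)[of "{0<..<a}" "{0<..<b}" f] assms by (simp add: rc_def)

lemma swap_AE: "(AE z in Mrc a b. P z) ==> (AE z in Mrc b a. P (prod.swap z))"
 unfolding rc_def by (rule lebesgue_on_swap(4)) auto

lemma Lsq_swap: "u \<in> Lsq (Mrc a b) ==> (sw u) \<in> Lsq (Mrc b a)"
 using L2_swap by (simp add: L2_Lsq)

lemma l2_swap: "u \<in> Lsq (Mrc a b) ==> l2 (Mrc b a) (sw u) = l2 (Mrc a b) u"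
 using swap_integral[OF borel_measurable_integrable[OF Lsq_integrable_sq]] by (simp add: l2_def)

lemma sobolev_swap:
 assumes u: "u \<in> Hs k a b"
 shows "(sw u) \<in> Hs k b a"
  and "i + j \<le> k ==> AE z in Mrc b a. wderiv (rc b a) j i (sw u) z = wderiv (rc a b) i j u (prod.swap z)"
proof -
 have h: "has_wderiv (rc b a) j i (sw u) (\<lambda>z. wderiv (rc a b) i j u (prod.swap z))" if "i + j \<le> k" for i j
  by (rule has_wderiv_swap[OF sobolev_L2[OF u] wderiv_L2[OF u that] has_wderiv_wderiv[OF u that]])
 show "(sw u) \<in> Hs k b a"
 proof (rule sobolevI[OF L2_swap[OF sobolev_L2[OF u]]])
  fix i j assume "i + j \<le> k"
  then have "j + i \<le> k" by simp
  from h[OF this] L2_swap[OF wderiv_L2[OF u this]] show "\<exists>v\<in>L2 (rc b a). has_wderiv (rc b a) i j (sw u) v" by blast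
 qed
 show "AE z in Mrc b a. wderiv (rc b a) j i (sw u) z = wderiv (rc a b) i j u (prod.swap z)" if "i + j \<le> k"
  by (rule rc.wderiv_eq[OF L2_swap[OF wderiv_L2[OF u that]] h[OF that]])
qed

lemma l2_wderiv_swap:
 assumes u: "u \<in> Hs k a b" and ij: "i + j \<le> k"
 shows "l2 (Mrc b a) (wderiv (rc b a) j i (sw u)) = l2 (Mrc a b) (wderiv (rc a b) i j u)"
proof -
 have ji: "j + i \<le> k" using ij by simp
 have "l2 (Mrc b a) (wderiv (rc b a) j i (sw u)) = l2 (Mrc b a) (\<lambda>z. wderiv (rc a b) i j u (prod.swap z))"
  by (rule l2_cong_AE[OF sobolev_swap(2)[OF u ij] Lsq_measurable[OF Lsq_wderiv[OF sobolev_swap(1)[OF u] ji]]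
    Lsq_measurable[OF Lsq_swap[OF Lsq_wderiv[OF u ij]]]])
 then show ?thesis using l2_swap[OF Lsq_wderiv[OF u ij]] by simp
qed

lemma sob_norm_swap:
 assumes u: "u \<in> Hs 1 a b"
 shows "hn 1 b a (sw u) = hn 1 a b u"
proof -
 have e: "l2 (Mrc b a) (wderiv (rc b a) 0 0 (sw u)) = l2 (Mrc a b) (wderiv (rc a b) 0 0 u)"
  "l2 (Mrc b a) (Dx b a (sw u)) = l2 (Mrc a b) (Dt a b u)"
  "l2 (Mrc b a) (Dt b a (sw u)) = l2 (Mrc a b) (Dx a b u)"
  by (rule l2_wderiv_swap[OF u], simp)+
 have "(hn 1 b a (sw u))^2 = (hn 1 a b u)^2"
  unfolding sob_norm_1_sq e by simp
 then show ?thesis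
  using Sob.nrm_nonneg[OF u] Sob.nrm_nonneg[OF sobolev_swap(1)[OF u]] by (simp add: power2_eq_iff_nonneg)
qed

lemma smooth_approx_swap:
 assumes ab: "a > 0" "b > 0" and D: "smooth_approx a b D u"
 shows "smooth_approx b a (\<lambda>n i j z. D n j i (prod.swap z)) (sw u)"
proof -
 have J: "smooth_jet (D n)" for n using D by (rule smooth_approx_jet)
 have u: "u \<in> Hs 1 a b" using D by (rule smooth_approx_sob)
 have d: "D n 0 0 - u \<in> Hs 1 a b" for n using Sob.diff[OF jet_sobolev_1[OF J] u] ab by simp
 have "hn 1 b a ((\<lambda>z. D n 0 0 (prod.swap z)) - (sw u)) = hn 1 a b (D n 0 0 - u)" for n
  using sob_norm_swap[OF d[of n]] by (simp add: fun_diff_def)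
 then show ?thesis
  using D smooth_jet_swap[OF J] sobolev_swap(1)[OF u] unfolding smooth_approx_def by simp
qed

definition trace_y :: "real => real => real => pfun => (real => real) => bool" where
 "trace_y a b c u g \<longleftrightarrow> has_trace (rc a b) (\<lambda>x. (x, c)) {0<..<a} u g"

text \<open>Horizontal and vertical sides are exchanged by reflecting the plane in the diagonal.\<close>

lemma has_trace_swap:
 assumes ab: "a > 0" "b > 0" and g: "has_trace (rc a b) \<gamma> A u g" shows "has_trace (rc b a) (\<lambda>s. prod.swap (\<gamma> s)) A (sw u) g"
proof -
 obtain E where E: "\<And>n. smooth_jet (E n)" "(\<lambda>n. hn 1 a b (E n 0 0 - u)) \<leadsto> 0"
  "(\<lambda>n. LINT s|lebesgue_on A. (E n 0 0 (\<gamma> s) - g s)^2) \<leadsto> 0" and u: "u \<in> Hs 1 a b" and g: "g \<in> L2 A"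
  using g unfolding has_trace_def by blast
 let ?E = "\<lambda>n i j z. E n j i (prod.swap z)"
 have s: "smooth_approx b a ?E (sw u)"
  by (rule smooth_approx_swap[OF ab]) (use E u in \<open>simp add: smooth_approx_def\<close>)
 have J: "smooth_jet (?E n)" for n using s by (rule smooth_approx_jet)
 have "\<forall>n. smooth_jet (?E n) \<and> ?E n 0 0 \<in> Hs 1 b a"
  using J jet_sobolev_1[OF J less_imp_le[OF ab(2)] less_imp_le[OF ab(1)]] by blast
 moreover have "(\<lambda>n. hn 1 b a (?E n 0 0 - (sw u))) \<leadsto> 0" using s by (simp add: smooth_approx_def)
 moreover have "(\<lambda>n. LINT s|lebesgue_on A. (?E n 0 0 (prod.swap (\<gamma> s)) - g s)^2) \<leadsto> 0" using E(3) by simp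
 ultimately show ?thesis
  unfolding has_trace_def using smooth_approx_sob[OF s] g by (intro conjI exI[of _ ?E])
qed

lemma trace_xy: assumes "a > 0" "b > 0" "trace_x a b c u g" shows "trace_y b a c (sw u) g"
 using has_trace_swap[OF assms(1,2) assms(3)[unfolded trace_x_def]] by (simp add: trace_y_def)

lemma trace_yx: assumes "a > 0" "b > 0" "trace_y a b c u g" shows "trace_x b a c (sw u) g"
 using has_trace_swap[OF assms(1,2) assms(3)[unfolded trace_y_def]] by (simp add: trace_x_def)

lemma trace_y_sob: "trace_y a b c u g ==> u \<in> Hs 1 a b"
 and trace_y_Lsq: "trace_y a b c u g ==> g \<in> Lsq (Mi a)"
 by (simp_all add: trace_y_def has_trace_def L2_Lsq)

lemma trace_x_ex:
 assumes "a > 0" "b > 0" "c = 0 \<or> c = a" "u \<in> Hs 1 a b" obtains g where "trace_x a b c u g"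
 using smooth_approx_exists[OF assms(1,2,4)] trace_x_exists[OF assms(1-3)] by metis

lemma trace_y_ex:
 assumes "a > 0" "b > 0" "c = 0 \<or> c = b" "u \<in> Hs 1 a b" obtains g where "trace_y a b c u g"
proof -
 obtain g where g: "trace_x b a c (sw u) g"
  using trace_x_ex[OF assms(2,1,3) sobolev_swap(1)[OF assms(4)]] by blast
 from trace_xy[OF assms(2,1) g] show ?thesis using that by simp
qed

lemma trace_y_bound:
 assumes "a > 0" "b > 0" "c = 0 \<or> c = b" "trace_y a b c u g"
 shows "(LINT x|Mi a. (g x)^2) \<le> (1 / b + 1) * (hn 1 a b u)^2"
 using trace_x_bound[OF assms(2,1,3) trace_yx[OF assms(1,2,4)]] sob_norm_swap[OF trace_y_sob[OF assms(4)]] by simp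

text \<open>Follows from the horizontal formula applied to the functions with exchanged variables.\<close>

theorem green_y:
 assumes ab: "a > 0" "b > 0"
  and u: "trace_y a b 0 u u0" "trace_y a b b u ub" and v: "trace_y a b 0 v v0" "trace_y a b b v vb"
  and e: "continuous_on UNIV e" and e': "continuous_on UNIV e'"
  and de: "\<And>x t. ((\<lambda>t. e (x, t)) has_real_derivative e' (x, t)) (at t)"
 shows "(LINT z|Mrc a b. Dt a b u z * (v z * e z)) + (LINT z|Mrc a b. u z * (Dt a b v z * e z))
   + (LINT z|Mrc a b. u z * (v z * e' z)) =
  (LINT x|Mi a. ub x * (vb x * e (x, b))) - (LINT x|Mi a. u0 x * (v0 x * e (x, 0)))"
proof -
 have uS: "u \<in> Hs 1 a b" and vS: "v \<in> Hs 1 a b" using u v trace_y_sob by blast+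
 have cs: "continuous_on UNIV (sw h)" if "continuous_on UNIV h" for h :: "pfun"
  by (rule continuous_on_compose2[OF that]) (auto simp: prod.swap_def intro!: continuous_intros)
 have hm: "h \<in> borel_measurable (Mrc a b)" if "continuous_on UNIV h" for h :: "pfun"
  by (intro continuous_measurable_lebesgue_on that borel_rc)
 have hm': "(sw h) \<in> borel_measurable (Mrc b a)" if "continuous_on UNIV h" for h :: "pfun"
  by (intro continuous_measurable_lebesgue_on cs that borel_rc)
 have part: "(LINT z|Mrc b a. Dx b a (sw w) z * (h (prod.swap z) * e (prod.swap z))) = (LINT z|Mrc a b. Dt a b w z * (h z * e z))"
  if w: "w \<in> Hs 1 a b" and h: "h \<in> Hs 1 a b" for w h
 proof -
  note hL = Lsq_sob[OF h]
  have wL: "Dt a b w \<in> Lsq (Mrc a b)" by (rule Lsq_wderiv[OF w]) simp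
  have ws: "AE z in Mrc b a. Dx b a (sw w) z = Dt a b w (prod.swap z)" by (rule sobolev_swap(2)[OF w]) simp
  have "(LINT z|Mrc b a. Dx b a (sw w) z * (h (prod.swap z) * e (prod.swap z))) =
    (LINT z|Mrc b a. Dt a b w (prod.swap z) * (h (prod.swap z) * e (prod.swap z)))"
  proof (rule integral_cong_AE)
   show "AE z in Mrc b a. Dx b a (sw w) z * (h (prod.swap z) * e (prod.swap z)) =
     Dt a b w (prod.swap z) * (h (prod.swap z) * e (prod.swap z))"
    using ws by eventually_elim simp
   show "(\<lambda>z. Dx b a (sw w) z * (h (prod.swap z) * e (prod.swap z))) \<in> borel_measurable (Mrc b a)"
    by (intro borel_measurable_times Lsq_measurable[OF Lsq_wderiv[OF sobolev_swap(1)[OF w]]] Lsq_measurable[OF Lsq_swap[OF hL]] hm'[OF e]) simp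
  qed (intro borel_measurable_times Lsq_measurable[OF Lsq_swap[OF wL]] Lsq_measurable[OF Lsq_swap[OF hL]] hm'[OF e])
  also have "\<dots> = (LINT z|Mrc a b. Dt a b w z * (h z * e z))"
   by (intro swap_integral[of "\<lambda>z. Dt a b w z * (h z * e z)"] borel_measurable_times Lsq_measurable[OF wL] Lsq_measurable[OF hL] hm[OF e])
  finally show ?thesis .
 qed
 have 3: "(LINT z|Mrc b a. u (prod.swap z) * (v (prod.swap z) * e' (prod.swap z))) = (LINT z|Mrc a b. u z * (v z * e' z))"
  by (intro swap_integral[of "\<lambda>z. u z * (v z * e' z)"] borel_measurable_times Lsq_measurable[OF Lsq_sob[OF uS]] Lsq_measurable[OF Lsq_sob[OF vS]] hm[OF e'])
 have "(LINT z|Mrc b a. Dx b a (sw u) z * (v (prod.swap z) * e (prod.swap z)))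
   + (LINT z|Mrc b a. u (prod.swap z) * (Dx b a (sw v) z * e (prod.swap z)))
   + (LINT z|Mrc b a. u (prod.swap z) * (v (prod.swap z) * e' (prod.swap z))) =
  (LINT x|Mi a. ub x * (vb x * e (prod.swap (b, x)))) - (LINT x|Mi a. u0 x * (v0 x * e (prod.swap (0, x))))"
  by (rule green_x[OF ab(2,1) trace_yx[OF ab u(1)] trace_yx[OF ab u(2)] trace_yx[OF ab v(1)] trace_yx[OF ab v(2)] cs[OF e] cs[OF e']])
   (use de in simp)
 then show ?thesis unfolding mult.left_commute[of _ "Dx b a (sw v) _"] mult.left_commute[of _ "Dt a b v _"] part[OF uS vS] part[OF vS uS] 3 by simp
qed

lemma trace_x_cong_AE:
 assumes g: "trace_x a b c u g" and v: "v \<in> Hs 1 a b" and ae: "AE z in Mrc a b. v z = u z"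
  and ab: "a > 0" "b > 0"
 shows "trace_x a b c v g"
proof -
 obtain E where E: "\<And>n. smooth_jet (E n)" "\<And>n. E n 0 0 \<in> Hs 1 a b" "(\<lambda>n. hn 1 a b (E n 0 0 - u)) \<leadsto> 0"
  "(\<lambda>n. LINT s|Mi b. (E n 0 0 (c, s) - g s)^2) \<leadsto> 0" and u: "u \<in> Hs 1 a b" and gL: "g \<in> L2 {0<..<b}"
  using g unfolding trace_x_def has_trace_def by blast
 have "wderiv (rc a b) i j (E n 0 0 - v) = wderiv (rc a b) i j (E n 0 0 - u)" for i j n
 proof (rule rc.wderiv_cong_AE)
  show "AE z in Mrc a b. (E n 0 0 - v) z = (E n 0 0 - u) z" using ae by eventually_elim simp
 qed (intro Lsq_measurable Lsq.diff Lsq_sob[OF E(2)] Lsq_sob[OF u] Lsq_sob[OF v])+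
 then have "hn 1 a b (E n 0 0 - v) = hn 1 a b (E n 0 0 - u)" for n
  unfolding sob_norm_def sob_inner_def by simp
 then have "(\<lambda>n. hn 1 a b (E n 0 0 - v)) \<leadsto> 0" using E(3) by simp
 then show ?thesis unfolding trace_x_def has_trace_def using E(1,2,4) v gL by blast
qed

section \<open>The trace commutes with tangential differentiation\<close>

text \<open>The constant function serves as the second factor in the Green formula.\<close>

lemma trace_x_const_1: assumes "a > 0" "b > 0" shows "trace_x a b c (\<lambda>_. 1) (\<lambda>_. 1)"
  and "AE z in Mrc a b. Dx a b (\<lambda>_. 1) z = 0"
proof -
 let ?D = "\<lambda>i j z. if i = 0 \<and> j = 0 then 1 else (0::real)"
 have J: "smooth_jet ?D" by (simp add: smooth_jet_def case_prod_unfold)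
 have S: "(\<lambda>_. 1) \<in> Hs 1 a b" using jet_sobolev_1[OF J] assms by simp
 have z: "((\<lambda>_. 1) - (\<lambda>_. 1) :: real \<times> real => real) = (\<lambda>_. 0)" by (simp add: fun_eq_iff)
 have "hn 1 a b ((\<lambda>_. 1) - (\<lambda>_. 1)) = 0"
  unfolding z using rc.sob_norm_zero_iff[OF Sob.zero[of 1 a b]] by simp
 then show "trace_x a b c (\<lambda>_. 1) (\<lambda>_. 1)"
  unfolding trace_x_def has_trace_def using S J continuous_L2[of "\<lambda>_. 1" "{0<..<b}"]
  by (intro conjI exI[of _ "\<lambda>n. ?D"]) simp_all
 show "AE z in Mrc a b. Dx a b (\<lambda>_. 1) z = 0" using jet_wderiv(1)[OF J] assms by simp
qed

text \<open>The Green formula with the second factor constant and a weight vanishing on the side \<open>x = a\<close>.\<close>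

lemma green_x_single:
 assumes ab: "a > 0" "b > 0" and u: "trace_x a b 0 u u0"
  and e: "continuous_on UNIV e" and e': "continuous_on UNIV e'"
  and de: "\<And>x t. ((\<lambda>x. e (x, t)) has_real_derivative e' (x, t)) (at x)" and ea: "\<And>t. e (a, t) = 0"
 shows "(LINT z|Mrc a b. Dx a b u z * e z) + (LINT z|Mrc a b. u z * e' z) = - (LINT t|Mi b. u0 t * e (0, t))"
proof -
 have uS: "u \<in> Hs 1 a b" using trace_xD(2)[OF u] .
 obtain ua where ua: "trace_x a b a u ua" using trace_x_ex[OF ab _ uS] by blast
 have "(LINT z|Mrc a b. u z * (Dx a b (\<lambda>_. 1) z * e z)) = (LINT z|Mrc a b. 0)"
 proof (rule integral_cong_AE)
  have "(\<lambda>_. 1) \<in> Hs 1 a b" using trace_xD(2)[OF trace_x_const_1(1)[OF ab]] .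
  then have m: "Dx a b (\<lambda>_. 1) \<in> borel_measurable (Mrc a b)" by (intro Lsq_measurable Lsq_wderiv) auto
  show "(\<lambda>z. u z * (Dx a b (\<lambda>_. 1) z * e z)) \<in> borel_measurable (Mrc a b)"
   by (intro borel_measurable_times[OF Lsq_measurable[OF Lsq_sob[OF uS]]] borel_measurable_times[OF m]
     continuous_measurable_lebesgue_on e borel_rc)
  show "AE z in Mrc a b. u z * (Dx a b (\<lambda>_. 1) z * e z) = 0"
   using trace_x_const_1(2)[OF ab] by eventually_elim simp
 qed simp
 then show ?thesis
  using green_x[OF ab u ua trace_x_const_1(1)[OF ab] trace_x_const_1(1)[OF ab] e e' de] ea by simp
qed

text \<open>Multiply a test function of t by the linear function of x that is 1 at \<open>x = 0\<close> and 0 at \<open>x = a\<close>, and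
 compare the Green formula for u against the derivative of the test function with the one for \<open>u\<^sub>t\<close>
 against the test function: the interior terms are opposite by the definition of weak derivatives.\<close>

lemma trace_x_wderiv:
 assumes ab: "a > 0" "b > 0" and u: "u \<in> Hs 2 a b"
  and g0: "trace_x a b 0 u g0" and g1: "trace_x a b 0 (Dt a b u) g1"
 shows "has_wderiv1 {0<..<b} g0 g1"
 unfolding has_wderiv1_def
proof (intro allI impI)
 fix P assume P: "smooth_jet1 P \<and> compact_support_in {0<..<b} (P 0)"
 then have PJ: "smooth_jet1 P" and P0: "P 0 0 = 0" "P 0 b = 0" unfolding compact_support_in_def by auto
 \<comment> \<open>the cut-off function in x\<close>
 let ?f = "\<lambda>x. (- 1 / a) * x + 1"
 obtain F where F: "smooth_jet1 F" "F 0 = ?f" using smooth1_jet[OF smooth1_poly[of "- 1 / a" 1]] by blast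
 have dF: "(F i has_real_derivative F (Suc i) x) (at x)" for i x using F(1) by (simp add: smooth_jet1_def)
 have F1: "F 1 x = - 1 / a" for x
 proof (rule DERIV_unique)
  show "(F 0 has_real_derivative F 1 x) (at x)" using dF[of 0] by simp
  show "(F 0 has_real_derivative - 1 / a) (at x)" unfolding F(2) using ab by (auto intro!: derivative_eq_intros)
 qed
 have Fa: "F 0 a = 0" "F 0 0 = 1" using ab by (simp_all add: F(2))
 have F': "smooth_jet1 (\<lambda>i. F (i + 1))" by (rule smooth_jet1_shift[OF F(1)])
 have tc: "continuous_on UNIV (\<lambda>z. F i (fst z) * P j (snd z))" for i j
  by (rule smooth_jet_continuous[OF smooth_jet_tensor[OF F(1) PJ]])
 have td: "((\<lambda>x. F 0 (fst (x, t)) * P j (snd (x, t))) has_real_derivative F 1 (fst (x, t)) * P j (snd (x, t))) (at x)" for x t j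
  using DERIV_cmult_right[OF dF[of 0 x], of "P j t"] by simp
 have uL: "u \<in> L2 (rc a b)" by (rule sobolev_L2[OF u])
 have ux: "Dx a b u \<in> L2 (rc a b)" "Dx a b u \<in> Hs 1 a b"
  and ut: "Dt a b u \<in> L2 (rc a b)" "Dt a b u \<in> Hs 1 a b"
  and uxt: "wderiv (rc a b) 1 1 u \<in> L2 (rc a b)"
  by (auto intro!: wderiv_L2[OF u] rc.sobolev_wderiv[OF u])
 have hx: "has_wderiv (rc a b) 0 1 (Dx a b u) (wderiv (rc a b) 1 1 u)"
  by (rule rc.has_wderiv_step[OF has_wderiv_wderiv[OF u]]) (use has_wderiv_wderiv[OF u, of 1 1] in simp_all)
 have ht: "has_wderiv (rc a b) 0 1 u (Dt a b u)" by (rule has_wderiv_wderiv[OF u]) simp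
 have tx: "AE z in Mrc a b. Dx a b (Dt a b u) z = wderiv (rc a b) 1 1 u z"
  using rc.wderiv_wderiv[OF u, of 1 0 0 1] by simp
 have A: "(LINT z|Mrc a b. Dx a b u z * (F 0 (fst z) * P 1 (snd z))) + (LINT z|Mrc a b. u z * (F 1 (fst z) * P 1 (snd z)))
   = - (LINT t|Mi b. g0 t * P 1 t)"
  using green_x_single[OF ab g0 tc tc td] Fa by simp
 have T: "(LINT z|Mrc a b. Dx a b (Dt a b u) z * (F 0 (fst z) * P 0 (snd z)))
   + (LINT z|Mrc a b. Dt a b u z * (F 1 (fst z) * P 0 (snd z))) = - (LINT t|Mi b. g1 t * P 0 t)"
  using green_x_single[OF ab g1 tc tc td] Fa by simp
 have e1: "(LINT z|Mrc a b. Dx a b u z * (F 0 (fst z) * P 1 (snd z))) =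
   - (LINT z|Mrc a b. wderiv (rc a b) 1 1 u z * (F 0 (fst z) * P 0 (snd z)))"
  by (rule wderiv_t_vanishing_test[OF ux(1) uxt hx F(1) PJ P0])
 have e2: "(LINT z|Mrc a b. u z * (F 1 (fst z) * P 1 (snd z))) = - (LINT z|Mrc a b. Dt a b u z * (F 1 (fst z) * P 0 (snd z)))"
  using wderiv_t_vanishing_test[OF uL ut(1) ht F' PJ P0] by simp
 have e3: "(LINT z|Mrc a b. Dx a b (Dt a b u) z * (F 0 (fst z) * P 0 (snd z))) =
   (LINT z|Mrc a b. wderiv (rc a b) 1 1 u z * (F 0 (fst z) * P 0 (snd z)))"
 proof (rule integral_cong_AE)
  show "AE z in Mrc a b. Dx a b (Dt a b u) z * (F 0 (fst z) * P 0 (snd z)) =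
   wderiv (rc a b) 1 1 u z * (F 0 (fst z) * P 0 (snd z))" using tx by eventually_elim simp
  have "Dx a b (Dt a b u) \<in> L2 (rc a b)" by (rule wderiv_L2[OF ut(2)]) simp
  then show "(\<lambda>z. Dx a b (Dt a b u) z * (F 0 (fst z) * P 0 (snd z))) \<in> borel_measurable (Mrc a b)"
   by (intro borel_measurable_times[OF L2_measurable] continuous_measurable_lebesgue_on tc borel_rc)
  show "(\<lambda>z. wderiv (rc a b) 1 1 u z * (F 0 (fst z) * P 0 (snd z))) \<in> borel_measurable (Mrc a b)"
   by (intro borel_measurable_times[OF L2_measurable[OF uxt]] continuous_measurable_lebesgue_on tc borel_rc)
 qed
 show "(LINT t|Mi b. g0 t * P 1 t) = - (LINT t|Mi b. g1 t * P 0 t)"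
  using A T unfolding e1 e2 e3 by simp
qed

lemma trace_y_wderiv:
 assumes ab: "a > 0" "b > 0" and u: "u \<in> Hs 2 a b"
  and g0: "trace_y a b 0 u g0" and g1: "trace_y a b 0 (Dx a b u) g1"
 shows "has_wderiv1 {0<..<a} g0 g1"
proof (rule trace_x_wderiv[OF ab(2,1) sobolev_swap(1)[OF u] trace_yx[OF ab g0]])
 have wS: "Dx a b u \<in> Hs 1 a b" by (rule rc.sobolev_wderiv[OF u]) simp
 have ae: "AE z in Mrc b a. Dt b a (sw u) z = Dx a b u (prod.swap z)"
  by (rule sobolev_swap(2)[OF u]) simp
 have "trace_x b a 0 (\<lambda>z. Dx a b u (prod.swap z)) g1" by (rule trace_yx[OF ab g1])
 moreover have "Dt b a (sw u) \<in> Hs 1 b a"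
  by (rule rc.sobolev_wderiv[OF sobolev_swap(1)[OF u]]) simp
 ultimately show "trace_x b a 0 (Dt b a (sw u)) g1"
  using trace_x_cong_AE[OF _ _ ae] ab by blast
qed

section \<open>Restriction to lines\<close>

lemma AE_slices: "(AE z in Mrc a b. P z) ==> AE x in Mi a. AE t in Mi b. P (x, t)"
 unfolding rc_def by (rule AE_slice) auto

lemma AE_slices': "(AE z in Mrc a b. P z) ==> AE t in Mi b. AE x in Mi a. P (x, t)"
 using AE_slices[OF swap_AE] by simp

lemma AE_from_slices:
 assumes f: "f \<in> borel_measurable (Mrc a b)" and s: "AE x in Mi a. AE t in Mi b. f (x, t) \<le> (0::real)"
 shows "AE z in Mrc a b. f z \<le> 0"
proof -
 let ?h = "\<lambda>z. if f z > 0 then 1 else (0::real)"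
 have hm: "?h \<in> borel_measurable (Mrc a b)" using f by measurable
 have "?h \<in> L2 (rc a b)" by (rule bounded_L2[OF hm _ bounded_rc borel_rc, of 1]) auto
 then have hi: "integrable (Mrc a b) ?h" by (rule L2_integrable[OF _ bounded_rc borel_rc])
 then have hi': "integrable (lebesgue_on ({0<..<a} \<times> {0<..<b})) ?h" by (simp add: rc_def)
 have "AE x in Mi a. (LINT t|Mi b. ?h (x, t)) = 0"
  using s
 proof eventually_elim
  fix x assume "AE t in Mi b. f (x, t) \<le> 0"
  then have "AE t in Mi b. ?h (x, t) = 0" by eventually_elim simp
  then show "(LINT t|Mi b. ?h (x, t)) = 0" by (rule integral_eq_zero_AE)
 qed
 then have "(LINT x|Mi a. LINT t|Mi b. ?h (x, t)) = 0" by (rule integral_eq_zero_AE)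
 then have "(LINT z|Mrc a b. ?h z) = 0" using fubini_lebesgue_on(3)[OF _ _ hi'] by (simp add: rc_def)
 then have "AE z in Mrc a b. ?h z = 0" using integral_nonneg_eq_0_iff_AE[OF hi] by auto
 then show ?thesis by eventually_elim (auto split: if_splits)
qed

lemma AE_from_slices':
 assumes f: "f \<in> borel_measurable (Mrc a b)" and s: "AE t in Mi b. AE x in Mi a. f (x, t) \<le> (0::real)"
 shows "AE z in Mrc a b. f z \<le> 0"
proof -
 have m: "(sw f) \<in> borel_measurable (Mrc b a)"
  using lebesgue_on_swap(1)[of "{0<..<a}" "{0<..<b}" f] f by (simp add: rc_def)
 have "AE z in Mrc b a. f (prod.swap z) \<le> 0" by (rule AE_from_slices[OF m]) (use s in simp)
 from swap_AE[OF this] show ?thesis by simp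
qed

lemma Lsq_Mrc_integrable: "f \<in> Lsq (Mrc a b) ==> integrable (Mrc a b) f"
 by (rule L2_integrable[OF _ bounded_rc borel_rc]) (simp add: L2_Lsq)

lemma Lsq_Mi_integrable: "f \<in> Lsq (Mi a) ==> integrable (Mi a) f"
 by (rule L2_integrable) (auto simp: L2_Lsq)

lemma fubini_rc:
 fixes f :: "pfun"
 assumes f: "integrable (Mrc a b) f"
 shows "AE x in Mi a. integrable (Mi b) (\<lambda>t. f (x, t))"
  and "integrable (Mi a) (\<lambda>x. LINT t|Mi b. f (x, t))"
  and "(LINT x|Mi a. LINT t|Mi b. f (x, t)) = (LINT z|Mrc a b. f z)"
 using fubini_lebesgue_on[of "{0<..<a}" "{0<..<b}" f] f by (simp_all add: rc_def)

lemma fubini_rc':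
 fixes f :: "pfun"
 assumes f: "integrable (Mrc a b) f"
 shows "AE t in Mi b. integrable (Mi a) (\<lambda>x. f (x, t))"
  and "integrable (Mi b) (\<lambda>t. LINT x|Mi a. f (x, t))"
  and "(LINT t|Mi b. LINT x|Mi a. f (x, t)) = (LINT z|Mrc a b. f z)"
proof -
 have i: "integrable (Mrc b a) (sw f)"
  using lebesgue_on_swap(2)[of "{0<..<a}" "{0<..<b}" f] f borel_measurable_integrable[OF f] by (simp add: rc_def)
 show "AE t in Mi b. integrable (Mi a) (\<lambda>x. f (x, t))" "integrable (Mi b) (\<lambda>t. LINT x|Mi a. f (x, t))"
  "(LINT t|Mi b. LINT x|Mi a. f (x, t)) = (LINT z|Mrc a b. f z)"
  using fubini_rc[OF i] swap_integral[OF borel_measurable_integrable[OF f]] by simp_all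
qed

lemma Lsq_slice: assumes f: "f \<in> Lsq (Mrc a b)" shows "AE x in Mi a. (\<lambda>t. f (x, t)) \<in> Lsq (Mi b)"
 using fubini_rc(1)[OF Lsq_Mrc_integrable[OF f]] fubini_rc(1)[OF Lsq_integrable_sq[OF f]]
 by eventually_elim (simp add: Lsq_def)

lemma Lsq_slice': assumes f: "f \<in> Lsq (Mrc a b)" shows "AE t in Mi b. (\<lambda>x. f (x, t)) \<in> Lsq (Mi a)"
 using fubini_rc'(1)[OF Lsq_Mrc_integrable[OF f]] fubini_rc'(1)[OF Lsq_integrable_sq[OF f]]
 by eventually_elim (simp add: Lsq_def)

lemma l2_slice_subseq:
 assumes f: "\<And>n::nat. f n \<in> Lsq (Mrc a b)" "p \<in> Lsq (Mrc a b)" "(\<lambda>n. l2 (Mrc a b) (f n - p)) \<leadsto> 0"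
 obtains r :: "nat => nat" where "strict_mono r"
  "AE t in Mi b. (\<lambda>n. l2 (Mi a) ((\<lambda>x. f (r n) (x, t)) - (\<lambda>x. p (x, t)))) \<leadsto> 0"
proof -
 let ?G = "\<lambda>n t. LINT x|Mi a. (f n (x, t) - p (x, t))^2"
 have i: "integrable (Mrc a b) (\<lambda>z. (f n z - p z)^2)" for n
  using Lsq_integrable_sq[OF Lsq.diff[OF f(1,2)]] by simp
 have "(\<lambda>n. (l2 (Mrc a b) (f n - p))^2) \<leadsto> 0^2" by (intro tendsto_intros f)
 moreover have "(l2 (Mrc a b) (f n - p))^2 = (LINT t|Mi b. norm (?G n t))" for n
  using fubini_rc'(3)[OF i[of n]] by (simp add: l2_sq)
 ultimately have "(\<lambda>n. LINT t|Mi b. norm (?G n t)) \<leadsto> 0" by simp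
 from tendsto_L1_AE_subseq[OF fubini_rc'(2)[OF i] this]
 obtain r where r: "strict_mono r" "AE t in Mi b. (\<lambda>n. ?G (r n) t) \<leadsto> 0" by blast
 have "AE t in Mi b. (\<lambda>n. l2 (Mi a) ((\<lambda>x. f (r n) (x, t)) - (\<lambda>x. p (x, t)))) \<leadsto> 0"
  using r(2)
 proof eventually_elim
  fix t assume "(\<lambda>n. ?G (r n) t) \<leadsto> 0"
  then have "(\<lambda>n. (l2 (Mi a) ((\<lambda>x. f (r n) (x, t)) - (\<lambda>x. p (x, t))))^2) \<leadsto> 0" by (simp add: l2_sq)
  then show "(\<lambda>n. l2 (Mi a) ((\<lambda>x. f (r n) (x, t)) - (\<lambda>x. p (x, t)))) \<leadsto> 0" by (rule tendsto_0_power2_D)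
 qed
 then show ?thesis using that r(1) by blast
qed

lemma AE_fst_rc: assumes "AE x in Mi a. P x" shows "AE z in Mrc a b. P (fst z)"
proof -
 have "AE x in lborel. x \<in> {0<..<a} \<longrightarrow> P x" using assms by (simp add: AE_lebesgue_on_iff)
 then obtain N where N: "N \<in> null_sets lborel" "{x \<in> space lborel. \<not> (x \<in> {0<..<a} \<longrightarrow> P x)} \<subseteq> N"
  by (auto elim!: AE_E simp: null_sets_def)
 have "N \<times> UNIV \<in> null_sets (lborel \<Otimes>\<^sub>M lborel)"
  using lborel.times_in_null_sets1[of N lborel UNIV] N(1) by simp
 then have "N \<times> UNIV \<in> null_sets (lborel :: (real \<times> real) measure)" unfolding lborel_prod .
 then have "AE z :: real \<times> real in lborel. z \<notin> N \<times> UNIV" by (rule AE_not_in)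
 then have "AE z :: real \<times> real in lborel. z \<in> rc a b \<longrightarrow> P (fst z)"
  by eventually_elim (use N(2) in \<open>force simp: rc_def\<close>)
 then show ?thesis by (simp add: AE_lebesgue_on_iff)
qed

lemma measurable_snd_rc:
 fixes G :: "real => real"
 assumes G: "G \<in> borel_measurable (Mi b)" shows "(\<lambda>z. G (snd z)) \<in> borel_measurable (Mrc a b)"
proof -
 obtain G' :: "real => real" where G': "G' \<in> borel_measurable borel" "AE t in Mi b. G t = G' t"
  using lebesgue_on_borel_rep[OF G] by auto
 have m: "(\<lambda>z. G' (snd z)) \<in> borel_measurable (Mrc a b)"
 proof (rule lebesgue_on_borel(3)[OF _ borel_rc])
  have "snd \<in> (borel :: (real \<times> real) measure) \<rightarrow>\<^sub>M borel" by (intro borel_measurable_continuous_onI continuous_intros)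
  then show "(\<lambda>z :: real \<times> real. G' (snd z)) \<in> borel_measurable borel" by (rule measurable_compose[OF _ G'(1)])
 qed
 have "AE z in Mrc a b. G' (snd z) = G (snd z)"
  using swap_AE[OF AE_fst_rc[OF G'(2)]] by eventually_elim simp
 from measurable_lebesgue_on_AE[OF m this borel_rc] show ?thesis .
qed

subsection \<open>Estimates on an interval\<close>

lemma indicator_measurable_Mi: "A \<in> sets borel ==> (indicator A :: real => real) \<in> borel_measurable (Mi b)"
proof -
 assume "A \<in> sets borel"
 then have "(indicator A :: real => real) \<in> borel_measurable borel" by (rule borel_measurable_indicator)
 then show ?thesis by (rule lebesgue_on_borel(3)) simp
qed

lemma integral_subset_abs_le:
 fixes h :: "real => real"
 assumes h: "integrable (Mi b) h" and A: "A \<in> sets borel" "A \<subseteq> {0<..<b}"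
 shows "\<bar>LINT x|lebesgue_on A. h x\<bar> \<le> (LINT x|Mi b. \<bar>h x\<bar>)"
  and "(LINT x|lebesgue_on A. h x) = (LINT x|Mi b. indicator A x * h x)"
  and "integrable (Mi b) (\<lambda>x. indicator A x * h x)"
proof -
 have e: "indicator {0<..<b} x * (indicator A x * h x) = indicator A x * h x" for x
  using A(2) by (auto simp: indicator_def)
 show eq: "(LINT x|lebesgue_on A. h x) = (LINT x|Mi b. indicator A x * h x)"
  using A by (simp add: integral_restrict_space e)
 show i: "integrable (Mi b) (\<lambda>x. indicator A x * h x)"
 proof (rule Bochner_Integration.integrable_bound[OF h])
  note [measurable] = indicator_measurable_Mi[OF A(1), of b]
  show "(\<lambda>x. indicator A x * h x) \<in> borel_measurable (Mi b)"
   using borel_measurable_integrable[OF h] by measurable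
 qed (auto simp: indicator_def)
 have "\<bar>LINT x|Mi b. indicator A x * h x\<bar> \<le> (LINT x|Mi b. \<bar>indicator A x * h x\<bar>)" by (rule integral_abs_bound)
 also have "\<dots> \<le> (LINT x|Mi b. \<bar>h x\<bar>)"
  using i h by (intro integral_mono) (auto simp: indicator_def)
 finally show "\<bar>LINT x|lebesgue_on A. h x\<bar> \<le> (LINT x|Mi b. \<bar>h x\<bar>)" unfolding eq .
qed

lemma continuous_Lsq_Mi: "continuous_on UNIV f ==> f \<in> Lsq (Mi b)"
 using continuous_L2[of f "{0<..<b}"] by (simp add: L2_Lsq)

lemma l2_Mi_const: "b > 0 ==> (LINT x|Mi b. c) = b * (c::real)"
 by (simp add: measure_restrict_space)

text \<open>Average over s the bound of \<open>g(t)\<^sup>2 - g(s)\<^sup>2\<close> by the integral of \<open>2 |g g'|\<close>.\<close>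

lemma sobolev_1d_C1:
 assumes b: "b > 0" and d: "\<And>t. (g has_real_derivative g' t) (at t)" and c: "continuous_on UNIV g'" and t: "t \<in> {0<..<b}"
 shows "(g t)^2 \<le> (1 / b + 1) * ((LINT s|Mi b. (g s)^2) + (LINT s|Mi b. (g' s)^2))"
proof -
 have gc: "continuous_on UNIV g" using d by (meson DERIV_isCont continuous_at_imp_continuous_on)
 let ?h = "\<lambda>s. 2 * g s * g' s" and ?I = "(LINT s|Mi b. (g s)^2) + (LINT s|Mi b. (g' s)^2)"
 have hc: "continuous_on UNIV ?h" by (intro continuous_intros gc c)
 have hi: "integrable (Mi b) ?h" by (rule Lsq_Mi_integrable[OF continuous_Lsq_Mi[OF hc]])
 have gi: "integrable (Mi b) (\<lambda>s. (g s)^2)" "integrable (Mi b) (\<lambda>s. (g' s)^2)"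
  by (intro Lsq_integrable_sq continuous_Lsq_Mi gc c)+
 have dh: "((\<lambda>s. (g s)^2) has_real_derivative ?h s) (at s)" for s
  using d by (auto intro!: derivative_eq_intros)
 have H: "(LINT s|Mi b. \<bar>?h s\<bar>) \<le> ?I"
 proof -
  have "(LINT s|Mi b. \<bar>?h s\<bar>) \<le> (LINT s|Mi b. (g s)^2 + (g' s)^2)"
  proof (rule integral_mono)
   fix s
   have "2 * \<bar>g s * g' s\<bar> \<le> (g s)^2 + (g' s)^2"
    using zero_le_power2[of "\<bar>g s\<bar> - \<bar>g' s\<bar>"] by (simp add: power2_diff abs_mult)
   then show "\<bar>?h s\<bar> \<le> (g s)^2 + (g' s)^2" by (simp add: abs_mult mult.assoc)
  qed (use hi gi in auto)
  then show ?thesis using gi by simp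
 qed
 have key: "(g t)^2 \<le> (g s)^2 + ?I" if s: "s \<in> {0<..<b}" for s
 proof (cases "s \<le> t")
  case True
  have "(g t)^2 - (g s)\<^sup>2 = (LINT x|lebesgue_on {s<..<t}. ?h x)" by (rule ftc_Ioo[OF True dh hc, symmetric])
  also have "\<dots> \<le> (LINT s|Mi b. \<bar>?h s\<bar>)"
   by (rule order_trans[OF abs_ge_self integral_subset_abs_le(1)[OF hi]]) (use s t in auto)
  finally show ?thesis using H by linarith
 next
  case False
  then have ts: "t \<le> s" by simp
  have "(g s)^2 - (g t)\<^sup>2 = (LINT x|lebesgue_on {t<..<s}. ?h x)" by (rule ftc_Ioo[OF ts dh hc, symmetric])
  moreover have "\<bar>LINT x|lebesgue_on {t<..<s}. ?h x\<bar> \<le> (LINT s|Mi b. \<bar>?h s\<bar>)"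
   by (rule integral_subset_abs_le(1)[OF hi]) (use s t in auto)
  ultimately show ?thesis using H by linarith
 qed
 have "(LINT s|Mi b. (g t)^2) \<le> (LINT s|Mi b. (g s)^2 + ?I)"
 proof (rule integral_mono)
  have ci: "integrable (Mi b) (\<lambda>_. k)" for k :: real by (rule Lsq_Mi_integrable[OF continuous_Lsq_Mi]) simp
  then show "integrable (Mi b) (\<lambda>s. (g s)^2 + ?I)" "integrable (Mi b) (\<lambda>s. (g t)^2)" using gi by auto
 qed (use key in auto)
 also have "\<dots> = (LINT s|Mi b. (g s)^2) + (LINT s|Mi b. ?I)"
  by (rule Bochner_Integration.integral_add[OF gi(1) Lsq_Mi_integrable[OF continuous_Lsq_Mi]]) simp
 finally have "b * (g t)^2 \<le> (LINT s|Mi b. (g s)^2) + b * ?I" unfolding l2_Mi_const[OF b] .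
 also have "\<dots> \<le> ?I + b * ?I" by simp
 finally show ?thesis using b by (simp add: field_simps)
qed

lemma sobolev_1d:
 assumes b: "b > 0" and d: "\<And>n t. (g n has_real_derivative g' n t) (at t)" and c: "\<And>n. continuous_on UNIV (g' n)"
  and p: "p \<in> Lsq (Mi b)" "(\<lambda>n::nat. l2 (Mi b) (g n - p)) \<leadsto> 0"
  and k: "k \<in> Lsq (Mi b)" "(\<lambda>n. l2 (Mi b) (g' n - k)) \<leadsto> 0"
 shows "AE t in Mi b. (p t)^2 \<le> (1 / b + 1) * ((LINT s|Mi b. (p s)^2) + (LINT s|Mi b. (k s)^2))"
  and "(\<lambda>n. g n 0) \<leadsto> 0 ==> AE t in Mi b. p t = (LINT s|lebesgue_on {0<..<t}. k s)"
proof -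
 have gc: "continuous_on UNIV (g n)" for n using d by (meson DERIV_isCont continuous_at_imp_continuous_on)
 have gL: "g n \<in> Lsq (Mi b)" "g' n \<in> Lsq (Mi b)" for n by (intro continuous_Lsq_Mi gc c)+
 obtain r where r: "strict_mono r" "AE t in Mi b. (\<lambda>n. g (r n) t) \<leadsto> p t"
  using l2_AE_subseq[OF gL(1) p] by blast
 have "(\<lambda>n. (1 / b + 1) * ((l2 (Mi b) (g n))^2 + (l2 (Mi b) (g' n))^2)) \<leadsto> (1 / b + 1) * ((l2 (Mi b) p)^2 + (l2 (Mi b) k)^2)"
  by (intro tendsto_intros Lsq.nrm_tendsto gL p k)
 from LIMSEQ_subseq_LIMSEQ[OF this r(1)]
 have lim: "(\<lambda>n. (1 / b + 1) * ((l2 (Mi b) (g (r n)))^2 + (l2 (Mi b) (g' (r n)))^2)) \<leadsto> (1 / b + 1) * ((l2 (Mi b) p)^2 + (l2 (Mi b) k)^2)"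
  by (simp add: o_def)
 have "AE t in Mi b. t \<in> {0<..<b}" using AE_space[of "Mi b"] by simp
 with r(2) show "AE t in Mi b. (p t)^2 \<le> (1 / b + 1) * ((LINT s|Mi b. (p s)^2) + (LINT s|Mi b. (k s)^2))"
 proof eventually_elim
  fix t assume t: "(\<lambda>n. g (r n) t) \<leadsto> p t" "t \<in> {0<..<b}"
  have "(p t)^2 \<le> (1 / b + 1) * ((l2 (Mi b) p)^2 + (l2 (Mi b) k)^2)"
   by (rule LIMSEQ_le[OF tendsto_power[OF t(1)] lim]) (use sobolev_1d_C1[OF b d c t(2)] in \<open>auto simp: l2_sq\<close>)
  then show "(p t)^2 \<le> (1 / b + 1) * ((LINT s|Mi b. (p s)^2) + (LINT s|Mi b. (k s)^2))" by (simp add: l2_sq)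
 qed
 assume g0: "(\<lambda>n. g n 0) \<leadsto> 0"
 have "AE t in Mi b. t \<in> {0<..<b}" using AE_space[of "Mi b"] by simp
 with r(2) show "AE t in Mi b. p t = (LINT s|lebesgue_on {0<..<t}. k s)"
 proof eventually_elim
  fix t assume t: "(\<lambda>n. g (r n) t) \<leadsto> p t" "t \<in> {0<..<b}"
  have s: "{0<..<t} \<subseteq> {0<..<b}" "{0<..<t} \<in> sets borel" using t by auto
  have ind: "indicator {0<..<t} \<in> Lsq (Mi b)"
  proof -
   have "indicator {0<..<t} \<in> L2 {0<..<b}"
    by (rule bounded_L2[OF indicator_measurable_Mi[OF s(2)], of 1]) (auto simp: indicator_def)
   then show ?thesis by (simp add: L2_Lsq)
  qed
  have "(\<lambda>n. LINT x|Mi b. g' n x * indicator {0<..<t} x) \<leadsto> (LINT x|Mi b. k x * indicator {0<..<t} x)"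
   by (rule Lsq.ip_tendsto[OF gL(2) k ind])
  then have "(\<lambda>n. LINT x|lebesgue_on {0<..<t}. g' n x) \<leadsto> (LINT x|lebesgue_on {0<..<t}. k x)"
   using integral_subset_abs_le(2)[OF Lsq_Mi_integrable[OF gL(2)] s(2,1)] integral_subset_abs_le(2)[OF Lsq_Mi_integrable[OF k(1)] s(2,1)]
   by (simp add: mult.commute)
  moreover have "(LINT x|lebesgue_on {0<..<t}. g' n x) = g n t - g n 0" for n
   by (rule ftc_Ioo) (use t d c in auto)
  ultimately have "(\<lambda>n. (g n t - g n 0) + g n 0) \<leadsto> (LINT x|lebesgue_on {0<..<t}. k x) + 0"
   by (intro tendsto_add g0) simp
  then have "(\<lambda>n. g n t) \<leadsto> (LINT x|lebesgue_on {0<..<t}. k x)" by simp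
  from LIMSEQ_subseq_LIMSEQ[OF this r(1)] t(1) show "p t = (LINT s|lebesgue_on {0<..<t}. k s)"
   by (intro LIMSEQ_unique[of "\<lambda>n. g (r n) t"]) (simp_all add: o_def)
 qed
qed

text \<open>Cauchy--Schwarz with the weight split evenly: the remaining factor \<open>exp(-2\<mu>(t - s))\<close> has integral at
 most \<open>1/(2\<mu>)\<close>. Here the weight gains a power of the large parameter for a primitive.\<close>

lemma weighted_primitive_bound:
 assumes k: "k \<in> Lsq (Mi b)" and mu: "\<mu> > 0" and t: "t \<in> {0<..<b}"
 shows "(LINT s|lebesgue_on {0<..<t}. k s)^2 * exp (- 2 * \<mu> * t) \<le> (1 / (2 * \<mu>)) * (LINT s|Mi b. (k s)^2 * exp (- 2 * \<mu> * s))"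
proof -
 have s: "{0<..<t} \<subseteq> {0<..<b}" "{0<..<t} \<in> sets borel" using t by auto
 let ?p = "\<lambda>s. k s * exp (- \<mu> * s)" and ?q = "\<lambda>s. indicator {0<..<t} s * exp (- \<mu> * (t - s))"
 have cm: "f \<in> borel_measurable (Mi b)" if "continuous_on UNIV f" for f :: "real => real"
  by (intro continuous_measurable_lebesgue_on that) auto
 have p: "?p \<in> Lsq (Mi b)"
 proof (rule Lsq_bounded_mult[OF k])
  show "(\<lambda>s. exp (- \<mu> * s)) \<in> borel_measurable (Mi b)" by (intro cm continuous_intros)
  show "AE s in Mi b. \<bar>exp (- \<mu> * s)\<bar> \<le> 1" using mu by (auto intro!: AE_I2)
 qed
 have im: "(indicator {0<..<t} :: real => real) \<in> borel_measurable (Mi b)"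
  by (rule indicator_measurable_Mi[OF s(2)])
 have q: "?q \<in> Lsq (Mi b)"
 proof -
  have "?q \<in> L2 {0<..<b}"
  proof (rule bounded_L2)
   show "?q \<in> borel_measurable (Mi b)" by (intro borel_measurable_times im cm continuous_intros)
   show "AE s in Mi b. \<bar>?q s\<bar> \<le> 1" using mu by (auto intro!: AE_I2 simp: indicator_def)
  qed auto
  then show ?thesis by (simp add: L2_Lsq)
 qed
 have "(LINT s|lebesgue_on {0<..<t}. k s) * exp (- \<mu> * t) = (LINT s|Mi b. ?p s * ?q s)"
 proof -
  have "?p s * ?q s = (indicator {0<..<t} s * k s) * exp (- \<mu> * t)" for s
   by (simp add: mult_ac flip: exp_add) (simp add: algebra_simps)
  then have "(\<lambda>s. ?p s * ?q s) = (\<lambda>s. (indicator {0<..<t} s * k s) * exp (- \<mu> * t))" by (rule ext)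
  then show ?thesis using integral_subset_abs_le(2)[OF Lsq_Mi_integrable[OF k] s(2,1)] by (simp only: integral_mult_left_zero)
 qed
 moreover have "exp (- 2 * \<mu> * t) = (exp (- \<mu> * t))^2" by (simp flip: exp_double)
 ultimately have "(LINT s|lebesgue_on {0<..<t}. k s)^2 * exp (- 2 * \<mu> * t) = (LINT s|Mi b. ?p s * ?q s)^2"
  by (simp only: power_mult_distrib[symmetric])
 also have "\<dots> \<le> (LINT s|Mi b. ?p s * ?p s) * (LINT s|Mi b. ?q s * ?q s)"
  by (rule Lsq.cauchy_schwarz_sq[OF p q])
 also have "\<dots> \<le> (LINT s|Mi b. ?p s * ?p s) * (1 / (2 * \<mu>))"
 proof (rule mult_left_mono)
  show "(LINT s|Mi b. ?q s * ?q s) \<le> 1 / (2 * \<mu>)"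
 proof -
  have c: "continuous_on UNIV (\<lambda>s. exp (- 2 * \<mu> * (t - s)))" by (intro continuous_intros)
  have e: "?q s * ?q s = indicator {0<..<t} s * exp (- 2 * \<mu> * (t - s))" for s
   by (simp add: indicator_def flip: exp_add)
  have "(LINT s|Mi b. ?q s * ?q s) = (LINT s|lebesgue_on {0<..<t}. exp (- 2 * \<mu> * (t - s)))"
   unfolding e by (rule integral_subset_abs_le(2)[OF Lsq_Mi_integrable[OF continuous_Lsq_Mi[OF c]] s(2,1), symmetric])
  also have "\<dots> = exp (- 2 * \<mu> * (t - t)) / (2 * \<mu>) - exp (- 2 * \<mu> * (t - 0)) / (2 * \<mu>)"
   by (rule ftc_Ioo) (use t mu c in \<open>auto intro!: derivative_eq_intros\<close>)
  also have "\<dots> \<le> 1 / (2 * \<mu>)" using mu by simp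
  finally show ?thesis .
  qed
 qed simp
 also have "(LINT s|Mi b. ?p s * ?p s) = (LINT s|Mi b. (k s)^2 * exp (- 2 * \<mu> * s))"
  by (intro Bochner_Integration.integral_cong refl) (simp add: power2_eq_square mult_ac flip: exp_add)
 finally show ?thesis by (simp only: mult.commute)
qed

lemma integral_Icc_Ioo:
 fixes k :: "real => real"
 assumes k: "k \<in> Lsq (Mi b)" and t: "t \<in> {0<..<b}"
 shows "(LINT s|lebesgue_on {0..t}. k s) = (LINT s|lebesgue_on {0<..<t}. k s)"
proof -
 have s: "{0<..<t} \<subseteq> {0<..<b}" using t by auto
 have "integrable lebesgue (\<lambda>x. indicator {0<..<b} x * (indicator {0<..<t} x * k x))"
  using integral_subset_abs_le(3)[OF Lsq_Mi_integrable[OF k], of "{0<..<t}"] s by (simp add: integrable_restrict_space)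
 moreover have "indicator {0<..<b} x * (indicator {0<..<t} x * k x) = indicator {0<..<t} x * k x" for x
  using s by (auto simp: indicator_def)
 ultimately have m: "(\<lambda>x. indicator {0<..<t} x * k x) \<in> borel_measurable lebesgue" by (simp add: borel_measurable_integrable)
 have "AE x in lborel. x \<noteq> 0 \<and> x \<noteq> t" by (intro AE_conjI AE_lborel_singleton)
 then have "AE x in lebesgue. x \<noteq> 0 \<and> x \<noteq> t" by (rule AE_completion)
 then have ae: "AE x in lebesgue. indicator {0<..<t} x * k x = indicator {0..t} x * k x"
  by eventually_elim (auto simp: indicator_def)
 have m': "(\<lambda>x. indicator {0..t} x * k x) \<in> borel_measurable lebesgue" by (rule borel_measurable_AE[OF m ae])
 show ?thesis using integral_cong_AE[OF m m' ae] by (simp add: integral_restrict_space)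
qed

subsection \<open>Pointwise bounds for Sobolev functions\<close>

text \<open>Pass to a subsequence of a smooth approximation that converges, together with its x-derivative and its
 boundary values, on almost every line; then the statement is one-dimensional.\<close>

lemma slices_x:
 assumes ab: "a > 0" "b > 0" and u: "u \<in> Hs 1 a b"
 shows "AE t in Mi b. AE x in Mi a. (u (x, t))^2 \<le> (1 / a + 1) * ((LINT s|Mi a. (u (s, t))^2) + (LINT s|Mi a. (Dx a b u (s, t))^2))"
  and "trace_x a b 0 u (\<lambda>_. 0) ==> AE t in Mi b. AE x in Mi a. u (x, t) = (LINT s|lebesgue_on {0<..<x}. Dx a b u (s, t))"
proof -
 obtain D where D: "smooth_approx a b D u" using smooth_approx_exists[OF ab u] by blast
 have J: "smooth_jet (D n)" for n using D by (rule smooth_approx_jet)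
 note l = smooth_approx_l2[OF ab D]
 have uL: "u \<in> Lsq (Mrc a b)" by (rule Lsq_sob[OF u])
 have xL: "Dx a b u \<in> Lsq (Mrc a b)" by (rule Lsq_wderiv[OF u]) simp
 obtain g where g: "trace_x a b 0 u g" using trace_x_ex[OF ab _ u] by blast
 obtain r1 where r1: "strict_mono r1" "AE t in Mi b. (\<lambda>n. l2 (Mi a) ((\<lambda>x. D (r1 n) 0 0 (x, t)) - (\<lambda>x. u (x, t)))) \<leadsto> 0"
  using l2_slice_subseq[OF Lsq_jet[OF J] uL l(1)] by blast
 obtain r2 where r2: "strict_mono r2" "AE t in Mi b. (\<lambda>n. l2 (Mi a) ((\<lambda>x. D (r1 (r2 n)) 1 0 (x, t)) - (\<lambda>x. Dx a b u (x, t)))) \<leadsto> 0"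
  using l2_slice_subseq[OF Lsq_jet[OF J] xL, of "\<lambda>n. r1 n" 1 0] LIMSEQ_subseq_LIMSEQ[OF l(2) r1(1)] by (auto simp: o_def)
 have l3: "(\<lambda>n. l2 (Mi b) ((\<lambda>t. D (r1 (r2 n)) 0 0 (0, t)) - g)) \<leadsto> 0"
  using LIMSEQ_subseq_LIMSEQ[OF LIMSEQ_subseq_LIMSEQ[OF trace_x_any_approx[OF ab _ g D] r1(1)] r2(1)] by (simp add: o_def)
 obtain r3 where r3: "strict_mono r3" "AE t in Mi b. (\<lambda>n. D (r1 (r2 (r3 n))) 0 0 (0, t)) \<leadsto> g t"
  using l2_AE_subseq[OF jet_side_Lsq[OF J] trace_xD(1)[OF g] l3] by blast
 let ?E = "\<lambda>n. D (r1 (r2 (r3 n)))"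
 have all: "AE t in Mi b. (\<lambda>x. u (x, t)) \<in> Lsq (Mi a) \<and> (\<lambda>x. Dx a b u (x, t)) \<in> Lsq (Mi a) \<and>
   (\<lambda>n. l2 (Mi a) ((\<lambda>x. ?E n 0 0 (x, t)) - (\<lambda>x. u (x, t)))) \<leadsto> 0 \<and>
   (\<lambda>n. l2 (Mi a) ((\<lambda>x. ?E n 1 0 (x, t)) - (\<lambda>x. Dx a b u (x, t)))) \<leadsto> 0 \<and> (\<lambda>n. ?E n 0 0 (0, t)) \<leadsto> g t"
  using r1(2) r2(2) r3(2) Lsq_slice'[OF uL] Lsq_slice'[OF xL]
 proof eventually_elim
  fix t assume A: "(\<lambda>n. l2 (Mi a) ((\<lambda>x. D (r1 n) 0 0 (x, t)) - (\<lambda>x. u (x, t)))) \<leadsto> 0"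
   "(\<lambda>n. l2 (Mi a) ((\<lambda>x. D (r1 (r2 n)) 1 0 (x, t)) - (\<lambda>x. Dx a b u (x, t)))) \<leadsto> 0"
   "(\<lambda>n. D (r1 (r2 (r3 n))) 0 0 (0, t)) \<leadsto> g t"
   "(\<lambda>x. u (x, t)) \<in> Lsq (Mi a)" "(\<lambda>x. Dx a b u (x, t)) \<in> Lsq (Mi a)"
  show "(\<lambda>x. u (x, t)) \<in> Lsq (Mi a) \<and> (\<lambda>x. Dx a b u (x, t)) \<in> Lsq (Mi a) \<and>
   (\<lambda>n. l2 (Mi a) ((\<lambda>x. ?E n 0 0 (x, t)) - (\<lambda>x. u (x, t)))) \<leadsto> 0 \<and>
   (\<lambda>n. l2 (Mi a) ((\<lambda>x. ?E n 1 0 (x, t)) - (\<lambda>x. Dx a b u (x, t)))) \<leadsto> 0 \<and> (\<lambda>n. ?E n 0 0 (0, t)) \<leadsto> g t"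
   using A(3-5) LIMSEQ_subseq_LIMSEQ[OF LIMSEQ_subseq_LIMSEQ[OF A(1) r2(1)] r3(1)] LIMSEQ_subseq_LIMSEQ[OF A(2) r3(1)]
   by (simp add: o_def)
 qed
 have dE: "((\<lambda>x. ?E n 0 0 (x, t)) has_real_derivative ?E n 1 0 (x, t)) (at x)" for n x t
  using smooth_jet_partial_fst[OF J, of _ 0 0 t x] by simp
 have cE: "continuous_on UNIV (\<lambda>x. ?E n 1 0 (x, t))" for n t
  by (intro continuous_on_compose2[OF smooth_jet_continuous[OF J]] continuous_intros) auto
 show "AE t in Mi b. AE x in Mi a. (u (x, t))^2 \<le> (1 / a + 1) * ((LINT s|Mi a. (u (s, t))^2) + (LINT s|Mi a. (Dx a b u (s, t))^2))"
  using all
 proof eventually_elim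
  case (elim t)
  show ?case by (rule sobolev_1d(1)[OF ab(1) dE cE]) (use elim in auto)
 qed
 assume "trace_x a b 0 u (\<lambda>_. 0)"
 from trace_x_unique[OF ab _ g this] have "AE t in Mi b. g t = 0" by simp
 with all show "AE t in Mi b. AE x in Mi a. u (x, t) = (LINT s|lebesgue_on {0<..<x}. Dx a b u (s, t))"
 proof eventually_elim
  case (elim t)
  show ?case by (rule sobolev_1d(2)[OF ab(1) dE cE]) (use elim in auto)
 qed
qed

text \<open>Square integrability on almost every line in both directions with uniform bounds. An \<open>H\<^sup>1\<close> function
 has this property although it need not be bounded; it is what the products with primitives need.\<close>

definition mix :: "real => real => pfun => real => bool" where
 "mix a b f K \<longleftrightarrow> f \<in> Lsq (Mrc a b) \<and>
   (AE x in Mi a. (\<lambda>t. f (x, t)) \<in> Lsq (Mi b) \<and> (LINT t|Mi b. (f (x, t))^2) \<le> K) \<and>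
   (AE t in Mi b. (\<lambda>x. f (x, t)) \<in> Lsq (Mi a) \<and> (LINT x|Mi a. (f (x, t))^2) \<le> K)"

lemma mix_half:
 assumes ab: "a > 0" "b > 0" and u: "u \<in> Hs 1 a b"
 shows "AE x in Mi a. (LINT t|Mi b. (u (x, t))^2) \<le> (1 / a + 1) * (hn 1 a b u)^2"
proof -
 have uL: "u \<in> Lsq (Mrc a b)" by (rule Lsq_sob[OF u])
 have xL: "Dx a b u \<in> Lsq (Mrc a b)" by (rule Lsq_wderiv[OF u]) simp
 let ?G = "\<lambda>t. (1 / a + 1) * ((LINT s|Mi a. (u (s, t))^2) + (LINT s|Mi a. (Dx a b u (s, t))^2))"
 note i1 = fubini_rc'(2,3)[OF Lsq_integrable_sq[OF uL]] and i2 = fubini_rc'(2,3)[OF Lsq_integrable_sq[OF xL]]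
 have Gi: "integrable (Mi b) ?G" using i1 i2 by (intro integrable_mult_right Bochner_Integration.integrable_add)
 have GI: "(LINT t|Mi b. ?G t) = (1 / a + 1) * ((l2 (Mrc a b) u)^2 + (l2 (Mrc a b) (Dx a b u))^2)"
  using i1 i2 by (simp add: l2_sq)
 have "AE z in Mrc a b. (u z)^2 - ?G (snd z) \<le> 0"
 proof (rule AE_from_slices')
  show "(\<lambda>z. (u z)^2 - ?G (snd z)) \<in> borel_measurable (Mrc a b)"
   using measurable_snd_rc[OF borel_measurable_integrable[OF Gi], of a] borel_measurable_integrable[OF Lsq_integrable_sq[OF uL]]
   by (rule borel_measurable_diff[rotated])
  show "AE t in Mi b. AE x in Mi a. (u (x, t))^2 - ?G (snd (x, t)) \<le> 0"
   using slices_x(1)[OF ab u] by (simp add: algebra_simps)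
 qed
 from AE_slices[OF this] have s: "AE x in Mi a. AE t in Mi b. (u (x, t))^2 \<le> ?G t" by simp
 have b: "(1 / a + 1) * ((l2 (Mrc a b) u)^2 + (l2 (Mrc a b) (Dx a b u))^2) \<le> (1 / a + 1) * (hn 1 a b u)^2"
 proof (rule mult_left_mono)
  have "l2 (Mrc a b) (wderiv (rc a b) 0 0 u) = l2 (Mrc a b) u"
   by (rule l2_cong_AE[OF rc.wderiv_00[OF sobolev_L2[OF u]] Lsq_measurable[OF Lsq_wderiv[OF u]] Lsq_measurable[OF uL]]) simp
  then show "(l2 (Mrc a b) u)^2 + (l2 (Mrc a b) (Dx a b u))^2 \<le> (hn 1 a b u)^2"
   unfolding sob_norm_1_sq by simp
 qed (use ab in simp)
 show ?thesis using s Lsq_slice[OF uL]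
 proof eventually_elim
  case (elim x)
  have "(LINT t|Mi b. (u (x, t))^2) \<le> (LINT t|Mi b. ?G t)"
   by (rule integral_mono_AE[OF Lsq_integrable_sq[OF elim(2)] Gi elim(1)])
  then show ?case unfolding GI using b by linarith
 qed
qed

lemma sobolev_1_mix:
 assumes ab: "a > 0" "b > 0" and u: "u \<in> Hs 1 a b"
 shows "mix a b u ((1 / a + 1 / b + 1) * (hn 1 a b u)^2)"
proof -
 have uL: "u \<in> Lsq (Mrc a b)" by (rule Lsq_sob[OF u])
 have le: "(1 / a + 1) * (hn 1 a b u)^2 \<le> (1 / a + 1 / b + 1) * (hn 1 a b u)^2"
  "(1 / b + 1) * (hn 1 a b u)^2 \<le> (1 / a + 1 / b + 1) * (hn 1 a b u)^2"
  using ab by (auto intro!: mult_right_mono)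
 have 1: "AE x in Mi a. (\<lambda>t. u (x, t)) \<in> Lsq (Mi b) \<and> (LINT t|Mi b. (u (x, t))^2) \<le> (1 / a + 1 / b + 1) * (hn 1 a b u)^2"
  using mix_half[OF ab u] Lsq_slice[OF uL] by eventually_elim (use le(1) in auto)
 have "AE t in Mi b. (LINT x|Mi a. (u (prod.swap (t, x)))^2) \<le> (1 / b + 1) * (hn 1 b a (sw u))^2"
  by (rule mix_half[OF ab(2,1) sobolev_swap(1)[OF u]])
 then have "AE t in Mi b. (LINT x|Mi a. (u (x, t))^2) \<le> (1 / b + 1) * (hn 1 a b u)^2"
  unfolding sob_norm_swap[OF u] by simp
 then have 2: "AE t in Mi b. (\<lambda>x. u (x, t)) \<in> Lsq (Mi a) \<and> (LINT x|Mi a. (u (x, t))^2) \<le> (1 / a + 1 / b + 1) * (hn 1 a b u)^2"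
  using Lsq_slice'[OF uL] by eventually_elim (use le(2) in auto)
 show ?thesis unfolding mix_def using uL 1 2 by blast
qed

lemma sob_norm_wderiv_le:
 assumes u: "u \<in> Hs m a b" and m: "k + i + j \<le> m"
 shows "hn k a b (wderiv (rc a b) i j u) \<le> hn m a b u"
proof (rule power2_le_imp_le)
 let ?I = "\<lambda>k. {(i, j). i + j \<le> (k::nat)}" and ?f = "\<lambda>(p, q). (p + i, q + j)"
 have "(hn k a b (wderiv (rc a b) i j u))^2 = (\<Sum>p\<in>?I k. case ?f p of (p, q) => (l2 (Mrc a b) (wderiv (rc a b) p q u))^2)"
  unfolding sob_norm_sq_sum
 proof (rule sum.cong[OF refl], clarsimp)
  fix p q assume pq: "p + q \<le> k"
  have w: "wderiv (rc a b) i j u \<in> Hs k a b" by (rule rc.sobolev_wderiv[OF u m])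
  have le: "(p + i) + (q + j) \<le> m" using pq m by simp
  show "(l2 (Mrc a b) (wderiv (rc a b) p q (wderiv (rc a b) i j u)))^2 = (l2 (Mrc a b) (wderiv (rc a b) (p + i) (q + j) u))^2"
   using l2_cong_AE[OF rc.wderiv_wderiv[OF u le] Lsq_measurable[OF Lsq_wderiv[OF w pq]] Lsq_measurable[OF Lsq_wderiv[OF u le]]] by simp
 qed
 also have "\<dots> = (\<Sum>p\<in>?f ` ?I k. case p of (p, q) => (l2 (Mrc a b) (wderiv (rc a b) p q u))^2)"
  by (subst sum.reindex) (auto simp: inj_on_def)
 also have "\<dots> \<le> (\<Sum>p\<in>?I m. case p of (p, q) => (l2 (Mrc a b) (wderiv (rc a b) p q u))^2)"
  using m by (intro sum_mono2 finite_sob_index) auto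
 also have "\<dots> = (hn m a b u)^2" by (simp add: sob_norm_sq_sum)
 finally show "(hn k a b (wderiv (rc a b) i j u))^2 \<le> (hn m a b u)^2" .
 show "0 \<le> hn m a b u" by (rule Sob.nrm_nonneg[OF u])
qed

text \<open>The one-dimensional bound on a line by the function and its x-derivative there, both of which are
 bounded in the square mean uniformly over the lines.\<close>

lemma sobolev_2_bounded:
 assumes ab: "a > 0" "b > 0" and u: "u \<in> Hs 2 a b"
 shows "AE z in Mrc a b. (u z)^2 \<le> 2 * (1 / a + 1 / b + 1)^2 * (hn 2 a b u)^2"
proof -
 let ?K = "1 / a + 1 / b + 1" and ?N = "(hn 2 a b u)^2"
 have u1: "u \<in> Hs 1 a b" by (rule sobolev_mono[OF _ u]) simp
 have ux: "Dx a b u \<in> Hs 1 a b" by (rule rc.sobolev_wderiv[OF u]) simp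
 have ia: "1 / a > 0" "1 / b > 0" using ab by simp_all
 then have K: "?K > 0" "1 / a + 1 \<le> ?K" "1 / a + 1 > 0" by linarith+
 have n1: "?K * (hn 1 a b u)^2 \<le> ?K * ?N"
  using K sob_norm_mono[of 1 2 "rc a b" u] Sob.nrm_nonneg[OF u1] by (intro mult_left_mono power_mono less_imp_le[OF K(1)]) auto
 have "hn 1 a b (Dx a b u) \<le> hn 2 a b u" by (rule sob_norm_wderiv_le[OF u]) simp
 then have n2: "?K * (hn 1 a b (Dx a b u))^2 \<le> ?K * ?N"
  using Sob.nrm_nonneg[OF ux] by (intro mult_left_mono power_mono less_imp_le[OF K(1)]) auto
 have s: "AE t in Mi b. AE x in Mi a. (u (x, t))^2 - 2 * ?K^2 * ?N \<le> 0"
  using slices_x(1)[OF ab u1] sobolev_1_mix[OF ab u1, unfolded mix_def, THEN conjunct2, THEN conjunct2]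
   sobolev_1_mix[OF ab ux, unfolded mix_def, THEN conjunct2, THEN conjunct2]
 proof eventually_elim
  case (elim t)
  have "(LINT s|Mi a. (u (s, t))^2) + (LINT s|Mi a. (Dx a b u (s, t))^2) \<le> 2 * ?K * ?N"
   using elim(2,3) n1 n2 by linarith
  then have "(1 / a + 1) * ((LINT s|Mi a. (u (s, t))^2) + (LINT s|Mi a. (Dx a b u (s, t))^2)) \<le> ?K * (2 * ?K * ?N)"
   using K(2) by (intro mult_mono less_imp_le[OF K(1)]) (auto intro!: add_nonneg_nonneg integral_nonneg_AE)
  then have "(1 / a + 1) * ((LINT s|Mi a. (u (s, t))^2) + (LINT s|Mi a. (Dx a b u (s, t))^2)) \<le> 2 * ?K^2 * ?N"
   by (simp only: power2_eq_square mult_ac)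
  with elim(1) show ?case by (auto elim!: eventually_mono)
 qed
 have "AE z in Mrc a b. (u z)^2 - 2 * ?K^2 * ?N \<le> 0"
  by (rule AE_from_slices'[OF _ s]) (intro borel_measurable_diff borel_measurable_const borel_measurable_power Lsq_measurable Lsq_sob[OF u])
 then show ?thesis by simp
qed

section \<open>The Carleman estimate\<close>

abbreviation wt :: "real => real => pfun" where "wt \<equiv> carleman_weight"

lemma wt_eq: "wt \<alpha> lam z = exp (- 2 * lam * (fst z + \<alpha> * snd z))"
 by (cases z) (simp add: carleman_weight_def)

lemma wt_pos: "wt \<alpha> lam z > 0" by (simp add: wt_eq)

lemma wt_continuous: "continuous_on UNIV (wt \<alpha> lam)"
 unfolding wt_eq[abs_def] by (intro continuous_intros)

lemma wt_measurable: "wt \<alpha> lam \<in> borel_measurable (Mrc a b)"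
 by (intro continuous_measurable_lebesgue_on wt_continuous borel_rc)

lemma wt_le_1: assumes "\<alpha> \<ge> 0" "lam \<ge> 0" "z \<in> rc a b" shows "wt \<alpha> lam z \<le> 1"
 using assms by (auto simp: wt_eq rc_def)

lemma wt_le_1_AE: assumes "\<alpha> \<ge> 0" "lam \<ge> 0" shows "AE z in Mrc a b. \<bar>wt \<alpha> lam z\<bar> \<le> 1"
 using wt_le_1[OF assms] wt_pos[of \<alpha> lam] by (intro AE_I2) (auto simp: less_imp_le)

lemma wt_Lsq_mult: "f \<in> Lsq (Mrc a b) ==> \<alpha> \<ge> 0 ==> lam \<ge> 0 ==> (\<lambda>z. f z * wt \<alpha> lam z) \<in> Lsq (Mrc a b)"
 by (rule Lsq_bounded_mult[OF _ wt_measurable wt_le_1_AE])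

lemma wt_integrable:
 assumes "f \<in> Lsq (Mrc a b)" "g \<in> Lsq (Mrc a b)" "\<alpha> \<ge> 0" "lam \<ge> 0"
 shows "integrable (Mrc a b) (\<lambda>z. f z * g z * wt \<alpha> lam z)"
 using Lsq_integrable_mult[OF assms(1) wt_Lsq_mult[OF assms(2-4)]] by (simp add: mult.assoc)

lemma wt_integrable_sq:
 assumes "f \<in> Lsq (Mrc a b)" "\<alpha> \<ge> 0" "lam \<ge> 0" shows "integrable (Mrc a b) (\<lambda>z. (f z)^2 * wt \<alpha> lam z)"
 using wt_integrable[OF assms(1,1,2,3)] by (simp add: power2_eq_square)

lemma wt_deriv_x: "((\<lambda>x. wt \<alpha> lam (x, t)) has_real_derivative - 2 * lam * wt \<alpha> lam (x, t)) (at x)"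
 unfolding wt_eq by (auto intro!: derivative_eq_intros)

lemma wt_deriv_t: "((\<lambda>t. wt \<alpha> lam (x, t)) has_real_derivative - 2 * lam * \<alpha> * wt \<alpha> lam (x, t)) (at t)"
 unfolding wt_eq by (auto intro!: derivative_eq_intros)

text \<open>The side \<open>x = a\<close> contributes a nonnegative term, which is dropped; the side \<open>x = 0\<close> contributes none.\<close>

lemma weighted_green_x:
 assumes ab: "a > 0" "b > 0" and al: "\<alpha> \<ge> 0" and lam: "lam \<ge> 0" and g: "trace_x a b 0 g (\<lambda>_. 0)"
 shows "2 * lam * (LINT z|Mrc a b. (g z)^2 * wt \<alpha> lam z) \<le> 2 * (LINT z|Mrc a b. Dx a b g z * g z * wt \<alpha> lam z)"
proof -
 have gS: "g \<in> Hs 1 a b" using trace_xD(2)[OF g] .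
 obtain ga where ga: "trace_x a b a g ga" using trace_x_ex[OF ab _ gS] by blast
 have c: "continuous_on UNIV (\<lambda>z. - 2 * lam * wt \<alpha> lam z)" by (intro continuous_intros wt_continuous)
 have "(LINT t|Mi b. ga t * (ga t * wt \<alpha> lam (a, t))) \<ge> 0"
  by (intro integral_nonneg_AE AE_I2) (simp add: wt_pos less_imp_le flip: mult.assoc)
 moreover have "(LINT z|Mrc a b. g z * (g z * (- 2 * lam * wt \<alpha> lam z))) = (- 2 * lam) * (LINT z|Mrc a b. (g z)^2 * wt \<alpha> lam z)"
  by (subst integral_mult_right_zero[symmetric]) (simp add: power2_eq_square mult_ac)
 moreover have "(LINT z|Mrc a b. Dx a b g z * (g z * wt \<alpha> lam z)) = (LINT z|Mrc a b. Dx a b g z * g z * wt \<alpha> lam z)"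
  "(LINT z|Mrc a b. g z * (Dx a b g z * wt \<alpha> lam z)) = (LINT z|Mrc a b. Dx a b g z * g z * wt \<alpha> lam z)"
  by (simp_all add: mult_ac)
 ultimately show ?thesis using green_x[OF ab g ga g ga wt_continuous c wt_deriv_x] by simp
qed

text \<open>\<open>2 \<lambda> p g \<le> p\<^sup>2 + \<lambda>\<^sup>2 g\<^sup>2\<close> for the derivative p of g, combined with the Green formula.\<close>

lemma hardy:
 assumes ab: "a > 0" "b > 0" and al: "\<alpha> \<ge> 0" and lam: "lam > 0" and g: "trace_x a b 0 g (\<lambda>_. 0)"
 shows "lam^2 * (LINT z|Mrc a b. (g z)^2 * wt \<alpha> lam z) \<le> (LINT z|Mrc a b. (Dx a b g z)^2 * wt \<alpha> lam z)"
proof -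
 have lam0: "lam \<ge> 0" using lam by simp
 have gS: "g \<in> Hs 1 a b" using trace_xD(2)[OF g] .
 have gL: "g \<in> Lsq (Mrc a b)" by (rule Lsq_sob[OF gS])
 have xL: "Dx a b g \<in> Lsq (Mrc a b)" by (rule Lsq_wderiv[OF gS]) simp
 let ?p = "Dx a b g" and ?w = "wt \<alpha> lam"
 note i = wt_integrable[OF xL gL al lam0] wt_integrable_sq[OF xL al lam0] wt_integrable_sq[OF gL al lam0]
 have "2 * lam * (LINT z|Mrc a b. ?p z * g z * ?w z) \<le> (LINT z|Mrc a b. (?p z)^2 * ?w z + lam^2 * ((g z)^2 * ?w z))"
 proof -
  have "(LINT z|Mrc a b. 2 * lam * (?p z * g z * ?w z)) \<le> (LINT z|Mrc a b. (?p z)^2 * ?w z + lam^2 * ((g z)^2 * ?w z))"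
  proof (rule integral_mono)
   fix z
   have "0 \<le> (?p z - lam * g z)^2 * ?w z" by (simp add: wt_pos less_imp_le)
   then show "2 * lam * (?p z * g z * ?w z) \<le> (?p z)^2 * ?w z + lam^2 * ((g z)^2 * ?w z)"
    by (simp add: power2_eq_square algebra_simps)
  qed (use i in auto)
  then show ?thesis by simp
 qed
 also have "\<dots> = (LINT z|Mrc a b. (?p z)^2 * ?w z) + lam^2 * (LINT z|Mrc a b. (g z)^2 * ?w z)" using i by simp
 finally have 1: "2 * lam * (LINT z|Mrc a b. ?p z * g z * ?w z) \<le> \<dots>" .
 have "lam * (2 * lam * (LINT z|Mrc a b. (g z)^2 * ?w z)) \<le> lam * (2 * (LINT z|Mrc a b. ?p z * g z * ?w z))"
  by (intro mult_left_mono weighted_green_x[OF ab al lam0 g] lam0)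
 with 1 show ?thesis by (simp add: power2_eq_square)
qed

text \<open>Multiply \<open>f = g\<^sub>x - 2 g\<^sub>t\<close> by \<open>g \<phi>\<close> and integrate by parts. The derivative of the weight in the
 direction \<open>(1, -2)\<close> is \<open>-2\<lambda>(1 - 2\<alpha>)\<phi>\<close>, of a definite sign because \<open>\<alpha> < 1/2\<close>. The bottom side enters
 with the favourable sign and the top side with the unfavourable one.\<close>

lemma transport_estimate:
 assumes b: "b > 0" and al: "\<alpha> \<ge> 0" "\<alpha> < 1/2" and lam: "lam > 0" and g: "trace_x 1 b 0 g (\<lambda>_. 0)"
  and g0: "trace_y 1 b 0 g g0" and gT: "trace_y 1 b b g gT"
  and f: "f \<in> Lsq (Mrc 1 b)" "AE z in Mrc 1 b. f z = Dx 1 b g z - 2 * Dt 1 b g z"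
 shows "(lam^2 * (1 - 2 * \<alpha>) / 2) * (LINT z|Mrc 1 b. (g z)^2 * wt \<alpha> lam z) + lam * (LINT x|Mi 1. (g0 x)^2 * exp (- 2 * lam * x))
  \<le> 1 / (2 * (1 - 2 * \<alpha>)) * (LINT z|Mrc 1 b. (f z)^2 * wt \<alpha> lam z) + lam * exp (- 2 * lam * \<alpha> * b) * (LINT x|Mi 1. (gT x)^2)"
proof -
 have one: "(1::real) > 0" by simp
 have lam0: "lam \<ge> 0" using lam by simp
 let ?d = "1 - 2 * \<alpha>" and ?w = "wt \<alpha> lam"
 have d: "?d > 0" using al by simp
 have gS: "g \<in> Hs 1 1 b" using trace_xD(2)[OF g] .
 have gL: "g \<in> Lsq (Mrc 1 b)" by (rule Lsq_sob[OF gS])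
 have xL: "Dx 1 b g \<in> Lsq (Mrc 1 b)" and tL: "Dt 1 b g \<in> Lsq (Mrc 1 b)"
  by (rule Lsq_wderiv[OF gS], simp)+
 let ?p = "Dx 1 b g" and ?q = "Dt 1 b g"
 let ?G = "LINT z|Mrc 1 b. (g z)^2 * ?w z" and ?F = "LINT z|Mrc 1 b. (f z)^2 * ?w z"
 let ?B0 = "LINT x|Mi 1. (g0 x)^2 * exp (- 2 * lam * x)"
 define BT where "BT = (LINT x|Mi 1. gT x * (gT x * ?w (x, b)))"
 note i = wt_integrable[OF xL gL al(1) lam0] wt_integrable[OF tL gL al(1) lam0] wt_integrable[OF f(1) gL al(1) lam0]
  wt_integrable_sq[OF f(1) al(1) lam0] wt_integrable_sq[OF gL al(1) lam0]
 have x: "2 * lam * ?G \<le> 2 * (LINT z|Mrc 1 b. ?p z * g z * ?w z)" by (rule weighted_green_x[OF one b al(1) lam0 g])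
 have c: "continuous_on UNIV (\<lambda>z. - 2 * lam * \<alpha> * ?w z)" by (intro continuous_intros wt_continuous)
 have t: "2 * (LINT z|Mrc 1 b. ?q z * g z * ?w z) - 2 * lam * \<alpha> * ?G = BT - ?B0"
 proof -
  have "(LINT z|Mrc 1 b. g z * (g z * (- 2 * lam * \<alpha> * ?w z))) = (- 2 * lam * \<alpha>) * ?G"
   by (subst integral_mult_right_zero[symmetric]) (simp add: power2_eq_square mult_ac)
  moreover have "(LINT z|Mrc 1 b. ?q z * (g z * ?w z)) = (LINT z|Mrc 1 b. ?q z * g z * ?w z)"
   "(LINT z|Mrc 1 b. g z * (?q z * ?w z)) = (LINT z|Mrc 1 b. ?q z * g z * ?w z)"
   by (simp_all add: mult_ac)
  moreover have "(LINT x|Mi 1. g0 x * (g0 x * ?w (x, 0))) = ?B0" by (simp add: wt_eq power2_eq_square mult.assoc)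
  ultimately show ?thesis
   using green_y[OF one b g0 gT g0 gT wt_continuous c wt_deriv_t] unfolding BT_def by simp
 qed
 have fg: "(LINT z|Mrc 1 b. f z * g z * ?w z) = (LINT z|Mrc 1 b. ?p z * g z * ?w z) - 2 * (LINT z|Mrc 1 b. ?q z * g z * ?w z)"
 proof -
  have "(LINT z|Mrc 1 b. f z * g z * ?w z) = (LINT z|Mrc 1 b. ?p z * g z * ?w z - 2 * (?q z * g z * ?w z))"
  proof (rule integral_cong_AE)
   show "AE z in Mrc 1 b. f z * g z * ?w z = ?p z * g z * ?w z - 2 * (?q z * g z * ?w z)"
    using f(2)
   proof eventually_elim
    case (elim z)
    show ?case unfolding elim by (simp add: algebra_simps)
   qed
  qed (use i in \<open>auto intro!: borel_measurable_integrable\<close>)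
  then show ?thesis using i by simp
 qed
 \<comment> \<open>Young inequality with the parameter that leaves half of the energy term\<close>
 have am: "2 * (lam * ?d) * (LINT z|Mrc 1 b. f z * g z * ?w z) \<le> ?F + (lam * ?d)^2 * ?G"
 proof -
  have "(LINT z|Mrc 1 b. 2 * (lam * ?d) * (f z * g z * ?w z)) \<le> (LINT z|Mrc 1 b. (f z)^2 * ?w z + (lam * ?d)^2 * ((g z)^2 * ?w z))"
  proof (rule integral_mono)
   fix z
   have "0 \<le> (f z - (lam * ?d) * g z)^2 * ?w z" by (simp add: wt_pos less_imp_le)
   then show "2 * (lam * ?d) * (f z * g z * ?w z) \<le> (f z)^2 * ?w z + (lam * ?d)^2 * ((g z)^2 * ?w z)"
    by (simp add: power2_eq_square algebra_simps)
  qed (use i in auto)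
  then show ?thesis using i by simp
 qed
 have BT: "BT \<le> exp (- 2 * lam * \<alpha> * b) * (LINT x|Mi 1. (gT x)^2)"
 proof -
  have gTL: "gT \<in> Lsq (Mi 1)" by (rule trace_y_Lsq[OF gT])
  have wle: "?w (x, b) \<le> exp (- 2 * lam * \<alpha> * b)" if "x \<in> {0<..<1}" for x
   using that lam by (simp add: wt_eq algebra_simps)
  have wL: "(\<lambda>x. gT x * ?w (x, b)) \<in> Lsq (Mi 1)"
  proof (rule Lsq_bounded_mult[OF gTL])
   show "(\<lambda>x. ?w (x, b)) \<in> borel_measurable (Mi 1)"
    by (intro continuous_measurable_lebesgue_on continuous_on_compose2[OF wt_continuous] continuous_intros) auto
   show "AE x in Mi 1. \<bar>?w (x, b)\<bar> \<le> exp (- 2 * lam * \<alpha> * b)" using wle wt_pos by (auto intro!: AE_I2 simp: less_imp_le)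
  qed
  have "BT \<le> (LINT x|Mi 1. exp (- 2 * lam * \<alpha> * b) * (gT x)^2)"
   unfolding BT_def
  proof (rule integral_mono)
   show "integrable (Mi 1) (\<lambda>x. gT x * (gT x * ?w (x, b)))" by (rule Lsq_integrable_mult[OF gTL wL])
   show "integrable (Mi 1) (\<lambda>x. exp (- 2 * lam * \<alpha> * b) * (gT x)^2)" using Lsq_integrable_sq[OF gTL] by simp
   fix x assume "x \<in> space (Mi 1)"
   then have "x \<in> {0<..<1}" by simp
   from mult_left_mono[OF wle[OF this], of "(gT x)^2"]
   show "gT x * (gT x * ?w (x, b)) \<le> exp (- 2 * lam * \<alpha> * b) * (gT x)^2" by (simp add: power2_eq_square mult_ac)
  qed
  then show ?thesis by simp
 qed
 have "2 * (LINT z|Mrc 1 b. f z * g z * ?w z) \<ge> 2 * lam * ?d * ?G - 2 * BT + 2 * ?B0"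
  using x t unfolding fg by (simp add: algebra_simps)
 then have "lam * ?d * (2 * lam * ?d * ?G - 2 * BT + 2 * ?B0) \<le> lam * ?d * (2 * (LINT z|Mrc 1 b. f z * g z * ?w z))"
  using lam d by (intro mult_left_mono) auto
 with am have "lam * ?d * (2 * lam * ?d * ?G - 2 * BT + 2 * ?B0) \<le> ?F + (lam * ?d)^2 * ?G"
 proof -
  have "lam * ?d * (2 * X) = 2 * (lam * ?d) * X" for X by simp
  with am \<open>lam * ?d * (2 * lam * ?d * ?G - 2 * BT + 2 * ?B0) \<le> _\<close> show ?thesis by linarith
 qed
 then have m: "?d * (lam^2 * ?d * ?G + 2 * lam * ?B0) \<le> ?F + ?d * (2 * lam * BT)"
  by (simp add: algebra_simps power2_eq_square)
 have "lam^2 * ?d / 2 * ?G + lam * ?B0 = (?d * (lam^2 * ?d * ?G + 2 * lam * ?B0)) / (2 * ?d)"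
  using d by (simp add: field_simps)
 also have "\<dots> \<le> (?F + ?d * (2 * lam * BT)) / (2 * ?d)" using m d by (intro divide_right_mono) auto
 also have "\<dots> = 1 / (2 * ?d) * ?F + lam * BT" using d by (simp add: field_simps)
 also have "lam * BT \<le> lam * (exp (- 2 * lam * \<alpha> * b) * (LINT x|Mi 1. (gT x)^2))"
  by (intro mult_left_mono BT lam0)
 finally show ?thesis by simp
qed

lemma trace_x_lin:
 assumes ab: "a > 0" "b > 0" and u: "trace_x a b c u g" and v: "trace_x a b c v h"
 shows "trace_x a b c (\<lambda>z. p * u z + q * v z) (\<lambda>t. p * g t + q * h t)"
proof -
 obtain D where D: "smooth_approx a b D u" "(\<lambda>n. l2 (Mi b) ((\<lambda>t. D n 0 0 (c, t)) - g)) \<leadsto> 0" using trace_xD(3)[OF u] by blast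
 obtain E where E: "smooth_approx a b E v" "(\<lambda>n. l2 (Mi b) ((\<lambda>t. E n 0 0 (c, t)) - h)) \<leadsto> 0" using trace_xD(3)[OF v] by blast
 have JD: "smooth_jet (D n)" and JE: "smooth_jet (E n)" for n using D(1) E(1) by (auto intro: smooth_approx_jet)
 have uS: "u \<in> Hs 1 a b" and vS: "v \<in> Hs 1 a b" using trace_xD(2)[OF u] trace_xD(2)[OF v] .
 have gL: "g \<in> Lsq (Mi b)" and hL: "h \<in> Lsq (Mi b)" using trace_xD(1)[OF u] trace_xD(1)[OF v] .
 let ?H = "\<lambda>n i j z. p * D n i j z + q * E n i j z"
 have H: "smooth_jet (?H n)" for n by (intro smooth_jet_add smooth_jet_scale JD JE)
 note S1 = jet_sobolev_1[OF _ less_imp_le[OF ab(1)] less_imp_le[OF ab(2)]]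
 have l1: "(\<lambda>n. hn 1 a b (?H n 0 0 - (\<lambda>z. p * u z + q * v z))) \<leadsto> 0"
  using D(1) E(1) unfolding smooth_approx_def by (intro Sob.lincomb_tendsto S1 JD JE uS vS) auto
 have "(\<lambda>n. l2 (Mi b) ((\<lambda>t. ?H n 0 0 (c, t)) - (\<lambda>t. p * g t + q * h t))) \<leadsto> 0"
  by (intro Lsq.lincomb_tendsto jet_side_Lsq JD JE gL hL D E)
 then have "(\<lambda>n. (l2 (Mi b) ((\<lambda>t. ?H n 0 0 (c, t)) - (\<lambda>t. p * g t + q * h t)))^2) \<leadsto> 0^2" by (intro tendsto_intros)
 then have l3: "(\<lambda>n. LINT s|Mi b. (?H n 0 0 (c, s) - (p * g s + q * h s))^2) \<leadsto> 0" by (simp add: l2_sq)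
 have "\<forall>n. smooth_jet (?H n) \<and> ?H n 0 0 \<in> Hs 1 a b" by (intro allI conjI H S1[OF H])
 moreover have "(\<lambda>t. p * g t + q * h t) \<in> L2 {0<..<b}" using Lsq.lin[OF gL hL] by (simp add: L2_Lsq)
 ultimately show ?thesis
  unfolding trace_x_def has_trace_def using Sob.lin[OF uS vS] l1 l3 by (intro conjI exI[of _ ?H])
qed

text \<open>Traces are determined almost everywhere only, in both directions.\<close>

lemma trace_x_cong_trace:
 assumes ab: "a > 0" "b > 0" and g: "trace_x a b c u g" and ae: "AE t in Mi b. g t = g' t" and L: "g' \<in> Lsq (Mi b)"
 shows "trace_x a b c u g'"
proof -
 from trace_xD(3)[OF g] obtain E where E: "smooth_approx a b E u" "(\<lambda>n. l2 (Mi b) ((\<lambda>t. E n 0 0 (c, t)) - g)) \<leadsto> 0" by blast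
 have eq: "l2 (Mi b) ((\<lambda>t. E n 0 0 (c, t)) - g) = l2 (Mi b) ((\<lambda>t. E n 0 0 (c, t)) - g')" for n
 proof (rule l2_cong_AE)
  have s: "(\<lambda>t. E n 0 0 (c, t)) \<in> Lsq (Mi b)" by (rule jet_side_Lsq[OF smooth_approx_jet[OF E(1)]])
  show "AE t in Mi b. ((\<lambda>t. E n 0 0 (c, t)) - g) t = ((\<lambda>t. E n 0 0 (c, t)) - g') t" using ae by eventually_elim simp
  show "(\<lambda>t. E n 0 0 (c, t)) - g \<in> borel_measurable (Mi b)" "(\<lambda>t. E n 0 0 (c, t)) - g' \<in> borel_measurable (Mi b)"
   by (rule Lsq_measurable[OF Lsq.diff[OF s trace_xD(1)[OF g]]], rule Lsq_measurable[OF Lsq.diff[OF s L]])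
 qed
 have "(\<lambda>n. (l2 (Mi b) ((\<lambda>t. E n 0 0 (c, t)) - g'))^2) \<leadsto> 0^2" using E(2) unfolding eq by (intro tendsto_power)
 then have lim: "(\<lambda>n. LINT t|Mi b. (E n 0 0 (c, t) - g' t)^2) \<leadsto> 0" unfolding l2_sq by simp
 have Es: "smooth_jet (E n) \<and> E n 0 0 \<in> Hs 1 a b" for n
  by (rule conjI[OF smooth_approx_jet[OF E(1)] jet_sobolev_1[OF smooth_approx_jet[OF E(1)] less_imp_le[OF ab(1)] less_imp_le[OF ab(2)]]])
 have En: "(\<lambda>n. hn 1 a b (E n 0 0 - u)) \<leadsto> 0" using E(1) unfolding smooth_approx_def by blast
 show ?thesis unfolding trace_x_def has_trace_def L2_Lsq
  by (intro conjI trace_xD(2)[OF g] L exI[of _ E] allI Es En lim)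
qed

text \<open>The tangential derivative of a vanishing boundary value vanishes.\<close>

lemma trace_x_zero_wderiv_t:
 assumes ab: "a > 0" "b > 0" and u: "u \<in> Hs 2 a b" and g0: "trace_x a b 0 u (\<lambda>_. 0)"
 shows "trace_x a b 0 (Dt a b u) (\<lambda>_. 0)"
proof -
 have w: "Dt a b u \<in> Hs 1 a b" by (rule rc.sobolev_wderiv[OF u]) simp
 obtain g where g: "trace_x a b 0 (Dt a b u) g" using trace_x_ex[OF ab _ w] by blast
 have h: "has_wderiv1 {0<..<b} (\<lambda>_. 0) g" by (rule trace_x_wderiv[OF ab u g0 g])
 have gL: "g \<in> L2 {0<..<b}" using trace_xD(1)[OF g] by (simp add: L2_Lsq)
 have "AE t in Mi b. g t = 0"
  by (rule fundamental_lemma_line[OF _ gL]) (use h in \<open>auto simp: has_wderiv1_def\<close>)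
 then show ?thesis by (rule trace_x_cong_trace[OF ab g _ Lsq.zero])
qed

lemma trace_t_trace_y:
 assumes "T > 0" "c = 0 \<or> c = T" "u \<in> Hs 1 1 T" shows "trace_y 1 T c u (trace_t T c u)"
proof -
 obtain g where "trace_y 1 T c u g" using trace_y_ex[OF _ assms] by auto
 then show ?thesis unfolding trace_t_def trace_on_def trace_y_def rect_rc
  by (rule someI[where P = "has_trace (rc 1 T) (\<lambda>x. (x, c)) {0<..<1} u"])
qed

text \<open>The operator factors as \<open>(\<partial>\<^sub>x - 2 \<partial>\<^sub>t) \<partial>\<^sub>x\<close>. The transport estimate for \<open>p = u\<^sub>x\<close> has right hand side F, and
 the one for u has right hand side \<open>G = u\<^sub>x - 2 u\<^sub>t\<close>, whose x-derivative is again F, so that G is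
 controlled by F through Hardy's inequality with a gain of \<open>\<lambda>\<^sup>2\<close>; finally \<open>u\<^sub>t = (u\<^sub>x - G)/2\<close>. The same constant serves for every term,
 including the unfavourable ones at \<open>t = T\<close>.\<close>

theorem carleman:
 assumes T: "T > 0" and al: "0 < \<alpha>" "\<alpha> < 1/2" and lam: "lam \<ge> 3 / (1 - 2 * \<alpha>)" "lam \<ge> 1"
  and u: "u \<in> Hs 2 1 T" and u0: "trace_x 1 T 0 u (\<lambda>_. 0)" and p0: "trace_x 1 T 0 (Dx 1 T u) (\<lambda>_. 0)"
 shows "lam * (LINT z|Mrc 1 T. ((Dx 1 T u z)^2 + (Dt 1 T u z)^2) * wt \<alpha> lam z)
   + lam ^ 3 * (LINT z|Mrc 1 T. (u z)^2 * wt \<alpha> lam z)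
   + lam * (LINT x|Mi 1. (trace_t T 0 (Dx 1 T u) x)^2 * exp (- 2 * lam * x))
   + lam ^ 3 * (LINT x|Mi 1. (trace_t T 0 u x)^2 * exp (- 2 * lam * x))
   - lam * exp (- 2 * lam * \<alpha> * T) * (LINT x|Mi 1. (trace_t T T (Dx 1 T u) x)^2)
   - lam ^ 3 * exp (- 2 * lam * \<alpha> * T) * (LINT x|Mi 1. (trace_t T T u x)^2)
  \<le> (1 / (1 - 2 * \<alpha>) + 1) * (LINT z|Mrc 1 T. (wderiv (rc 1 T) 2 0 u z - 2 * wderiv (rc 1 T) 1 1 u z)^2 * wt \<alpha> lam z)"
proof -
 have one: "(1::real) > 0" by simp
 have al0: "\<alpha> \<ge> 0" and lam0: "lam > 0" "lam \<ge> 0" using al lam by auto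
 let ?d = "1 - 2 * \<alpha>" and ?w = "wt \<alpha> lam" and ?M = "Mrc 1 T"
 have d: "?d > 0" using al by simp
 let ?p = "Dx 1 T u" and ?q = "Dt 1 T u"
 let ?F = "\<lambda>z. wderiv (rc 1 T) 2 0 u z - 2 * wderiv (rc 1 T) 1 1 u z" and ?G = "\<lambda>z. 1 * ?p z + (-2) * ?q z"
 have u1: "u \<in> Hs 1 1 T" by (rule sobolev_mono[OF _ u]) simp
 have pS: "?p \<in> Hs 1 1 T" and qS: "?q \<in> Hs 1 1 T" by (rule rc.sobolev_wderiv[OF u], simp)+
 have uL: "u \<in> Lsq ?M" by (rule Lsq_sob[OF u])
 have pL: "?p \<in> Lsq ?M" and qL: "?q \<in> Lsq ?M" and xxL: "wderiv (rc 1 T) 2 0 u \<in> Lsq ?M" and xtL: "wderiv (rc 1 T) 1 1 u \<in> Lsq ?M"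
  by (rule Lsq_wderiv[OF u], simp)+
 have FL: "?F \<in> Lsq ?M" using Lsq.lin[OF xxL xtL, of 1 "-2"] by simp
 have q0: "trace_x 1 T 0 ?q (\<lambda>_. 0)" by (rule trace_x_zero_wderiv_t[OF one T u u0])
 have G0: "trace_x 1 T 0 ?G (\<lambda>_. 0)" using trace_x_lin[OF one T p0 q0, of 1 "-2"] by simp
 have GS: "?G \<in> Hs 1 1 T" by (rule Sob.lin[OF pS qS])
 have GL: "?G \<in> Lsq ?M" by (rule Lsq_sob[OF GS])
 have px: "AE z in ?M. Dx 1 T ?p z = wderiv (rc 1 T) 2 0 u z"
  using rc.wderiv_wderiv[OF u, of 1 1 0 0] by (simp add: numeral_2_eq_2)
 have pt: "AE z in ?M. Dt 1 T ?p z = wderiv (rc 1 T) 1 1 u z"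
  using rc.wderiv_wderiv[OF u, of 0 1 1 0] by simp
 have qx: "AE z in ?M. Dx 1 T ?q z = wderiv (rc 1 T) 1 1 u z"
  using rc.wderiv_wderiv[OF u, of 1 0 0 1] by simp
 have Gx: "AE z in ?M. Dx 1 T ?G z = ?F z"
  using rc.wderiv_lin[OF pS qS, of 1 0 1 "-2", simplified] px[simplified] qx[simplified] by eventually_elim simp
 define IF where "IF = (LINT z|?M. (?F z)^2 * ?w z)"
 define IG where "IG = (LINT z|?M. (?G z)^2 * ?w z)"
 define Ip where "Ip = (LINT z|?M. (?p z)^2 * ?w z)"
 define Iq where "Iq = (LINT z|?M. (?q z)^2 * ?w z)"
 define Iu where "Iu = (LINT z|?M. (u z)^2 * ?w z)"
 have nn: "IF \<ge> 0" "Ip \<ge> 0" "Iu \<ge> 0" "IG \<ge> 0"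
  unfolding IF_def Ip_def Iu_def IG_def by (auto intro!: integral_nonneg_AE AE_I2 simp: wt_pos less_imp_le)
 have IG: "lam^2 * IG \<le> IF"
 proof -
  have "(LINT z|?M. (Dx 1 T ?G z)^2 * ?w z) = IF"
   unfolding IF_def
  proof (rule integral_cong_AE)
   show "AE z in ?M. (Dx 1 T ?G z)^2 * ?w z = (?F z)^2 * ?w z" using Gx by eventually_elim simp
   have "Dx 1 T ?G \<in> Lsq ?M" by (rule Lsq_wderiv[OF GS]) simp
   from borel_measurable_integrable[OF wt_integrable_sq[OF this al0 lam0(2)]]
   show "(\<lambda>z. (Dx 1 T ?G z)^2 * ?w z) \<in> borel_measurable ?M" .
   show "(\<lambda>z. (?F z)^2 * ?w z) \<in> borel_measurable ?M" by (rule borel_measurable_integrable[OF wt_integrable_sq[OF FL al0 lam0(2)]])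
  qed
  then show ?thesis using hardy[OF one T al0 lam0(1) G0] unfolding IG_def by simp
 qed
 define X0 where "X0 = (LINT x|Mi 1. (trace_t T 0 ?p x)^2 * exp (- 2 * lam * x))"
 define Y0 where "Y0 = (LINT x|Mi 1. (trace_t T 0 u x)^2 * exp (- 2 * lam * x))"
 define XT where "XT = exp (- 2 * lam * \<alpha> * T) * (LINT x|Mi 1. (trace_t T T ?p x)^2)"
 define YT where "YT = exp (- 2 * lam * \<alpha> * T) * (LINT x|Mi 1. (trace_t T T u x)^2)"
 have e1: "lam^2 * ?d / 2 * Ip + lam * X0 \<le> 1 / (2 * ?d) * IF + lam * XT"
 proof -
  have pF: "AE z in ?M. ?F z = Dx 1 T ?p z - 2 * Dt 1 T ?p z"
   using px pt by eventually_elim simp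
  have t: "trace_y 1 T 0 ?p (trace_t T 0 ?p)" "trace_y 1 T T ?p (trace_t T T ?p)"
   by (rule trace_t_trace_y[OF T _ pS], simp)+
  show ?thesis
   using transport_estimate[OF T al0 al(2) lam0(1) p0 t FL pF]
   unfolding Ip_def X0_def IF_def XT_def mult.assoc[of lam "exp (- 2 * lam * \<alpha> * T)"] .
 qed
 have e2: "lam^2 * ?d / 2 * Iu + lam * Y0 \<le> 1 / (2 * ?d) * IG + lam * YT"
 proof -
  have uG: "AE z in ?M. ?G z = ?p z - 2 * ?q z" by simp
  have t: "trace_y 1 T 0 u (trace_t T 0 u)" "trace_y 1 T T u (trace_t T T u)"
   by (rule trace_t_trace_y[OF T _ u1], simp)+
  show ?thesis
   using transport_estimate[OF T al0 al(2) lam0(1) u0 t GL uG]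
   unfolding Iu_def Y0_def IG_def YT_def mult.assoc[of lam "exp (- 2 * lam * \<alpha> * T)"] .
 qed
 have Iq: "2 * Iq \<le> Ip + IG"
 proof -
  have "(LINT z|?M. 2 * ((?q z)^2 * ?w z)) \<le> (LINT z|?M. (?p z)^2 * ?w z + (?G z)^2 * ?w z)"
  proof (rule integral_mono)
   fix z
   have "0 \<le> ((?p z)^2 + (?G z)^2 - 2 * (?q z)^2) * ?w z"
   proof (rule mult_nonneg_nonneg)
    have "(?p z)^2 + (?G z)^2 - 2 * (?q z)^2 = 2 * (?p z - ?q z)^2" by (simp add: power2_eq_square algebra_simps)
    then show "0 \<le> (?p z)^2 + (?G z)^2 - 2 * (?q z)^2" by simp
   qed (simp add: wt_pos less_imp_le)
   then show "2 * ((?q z)^2 * ?w z) \<le> (?p z)^2 * ?w z + (?G z)^2 * ?w z" by (simp add: algebra_simps)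
  qed (use wt_integrable_sq[OF qL al0 lam0(2)] wt_integrable_sq[OF pL al0 lam0(2)] wt_integrable_sq[OF GL al0 lam0(2)] in auto)
  then show ?thesis
   unfolding Iq_def Ip_def IG_def
   using wt_integrable_sq[OF qL al0 lam0(2)] wt_integrable_sq[OF pL al0 lam0(2)] wt_integrable_sq[OF GL al0 lam0(2)] by simp
 qed
 \<comment> \<open>the lower bound for \<open>\<lambda>\<close>: the integral of \<open>p\<^sup>2\<close> gets the coefficient \<open>3\<lambda>/2\<close>, of which \<open>\<lambda>/2\<close> is spent on \<open>u\<^sub>t\<close>\<close>
 have ld: "lam * ?d \<ge> 3" using lam(1) d by (simp add: field_simps)
 have "lam * (lam * ?d) \<ge> lam * 3" using ld lam0 by (intro mult_left_mono) auto
 then have f1: "lam^2 * ?d / 2 * Ip \<ge> (3 / 2 * lam) * Ip"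
  using nn by (intro mult_right_mono) (simp_all add: power2_eq_square)
 have "lam ^ 3 * (lam * ?d) \<ge> lam ^ 3 * 3" using ld lam0 by (intro mult_left_mono) auto
 moreover have "lam^2 * (lam^2 * ?d / 2) = lam ^ 3 * (lam * ?d) / 2" by (simp add: power2_eq_square power3_eq_cube)
 moreover have "lam ^ 3 \<ge> 0" using lam0 by simp
 ultimately have "lam^2 * (lam^2 * ?d / 2) \<ge> lam ^ 3" by linarith
 then have "lam ^ 3 * Iu \<le> lam^2 * (lam^2 * ?d / 2) * Iu" using nn by (intro mult_right_mono)
 moreover have "lam^2 * (lam^2 * ?d / 2) * Iu + lam ^ 3 * Y0 \<le> lam^2 * (1 / (2 * ?d) * IG) + lam ^ 3 * YT"
 proof -
  have "lam^2 * (lam^2 * ?d / 2 * Iu + lam * Y0) \<le> lam^2 * (1 / (2 * ?d) * IG + lam * YT)"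
   using e2 by (intro mult_left_mono) auto
  moreover have "lam^2 * (lam * k) = lam ^ 3 * k" for k by (simp add: power2_eq_square power3_eq_cube)
  ultimately show ?thesis unfolding distrib_left mult.assoc[symmetric] by (simp only: mult.assoc[symmetric])
 qed
 moreover have "lam^2 * (1 / (2 * ?d) * IG) \<le> 1 / (2 * ?d) * IF"
  using mult_left_mono[OF IG, of "1 / (2 * ?d)"] d by (simp add: mult_ac)
 ultimately have f2: "lam ^ 3 * Iu + lam ^ 3 * Y0 \<le> 1 / (2 * ?d) * IF + lam ^ 3 * YT" by linarith
 have "lam * IG \<le> lam^2 * IG" using lam nn by (intro mult_right_mono) (auto simp: power2_eq_square)
 moreover have "lam * (2 * Iq) \<le> lam * (Ip + IG)" by (rule mult_left_mono[OF Iq lam0(2)])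
 ultimately have f3: "lam * Iq \<le> lam / 2 * Ip + IF / 2" using IG by (simp add: algebra_simps)
 have "lam * (Ip + Iq) + lam ^ 3 * Iu + lam * X0 + lam ^ 3 * Y0 - lam * XT - lam ^ 3 * YT \<le> (1 / ?d) * IF + IF / 2"
 proof -
  have "1 / (2 * x) * y + 1 / (2 * x) * y = (1 / x) * y" for x y :: real by (cases "x = 0") (auto simp: field_simps)
  then have "1 / (2 * ?d) * IF + 1 / (2 * ?d) * IF = (1 / ?d) * IF" .
  moreover have "lam * (Ip + Iq) = lam * Ip + lam * Iq" by (rule distrib_left)
  moreover have "3 / 2 * lam * Ip = lam * Ip + lam / 2 * Ip" by (simp add: algebra_simps)
  moreover have "k + k = K ==> S = p + q ==> c = p + h ==> e + x \<le> k + x' ==> c \<le> e ==> y + v \<le> k + v' ==>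
    q \<le> h + i ==> S + y + x + v - x' - v' \<le> K + i" for k K S p q c h e x x' y v v' i :: real
   by linarith
  ultimately show ?thesis using e1 f1 f2 f3 by blast
 qed
 also have "\<dots> \<le> (1 / ?d + 1) * IF" using nn(1) by (simp add: algebra_simps)
 finally have fin: "lam * (Ip + Iq) + lam ^ 3 * Iu + lam * X0 + lam ^ 3 * Y0 - lam * XT - lam ^ 3 * YT \<le> (1 / ?d + 1) * IF" .
 have pq: "(LINT z|?M. ((?p z)^2 + (?q z)^2) * ?w z) = Ip + Iq"
  unfolding Ip_def Iq_def using wt_integrable_sq[OF qL al0 lam0(2)] wt_integrable_sq[OF pL al0 lam0(2)]
  by (simp add: distrib_right)
 show ?thesis using fin unfolding pq Iu_def X0_def Y0_def XT_def YT_def IF_def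
  by (simp only: mult.assoc[of _ "exp (- 2 * lam * \<alpha> * T)"])
qed

section \<open>The nonlinear operator\<close>

text \<open>The nonlocal term of the operator is this primitive of the x-derivative.\<close>

definition prim :: "pfun => pfun" where
 "prim k z = (LINT s|lebesgue_on {0..snd z}. k (fst z, s))"

lemma prim_slice:
 assumes k: "k \<in> Lsq (Mrc a b)"
 shows "AE x in Mi a. (\<lambda>t. k (x, t)) \<in> Lsq (Mi b) \<and> (\<forall>t\<in>{0<..<b}. prim k (x, t) = (LINT s|lebesgue_on {0<..<t}. k (x, s)))"
 using Lsq_slice[OF k] by eventually_elim (auto simp: prim_def integral_Icc_Ioo)

text \<open>A parameter integral of a Borel function is measurable; the primitive of a Borel
 representative agrees with the given one on almost every vertical line.\<close>

lemma prim_measurable: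
 assumes k: "k \<in> Lsq (Mrc a b)" shows "prim k \<in> borel_measurable (Mrc a b)"
proof -
 obtain g where g[measurable]: "g \<in> borel_measurable borel" and ae: "AE z in Mrc a b. k z = g z"
  using lebesgue_on_borel_rep[OF Lsq_measurable[OF k] borel_rc] by blast
 define S where "S z = (LINT s|lborel. (if 0 < s \<and> s < snd z then g (fst z, s) else 0))" for z :: "real \<times> real"
 have g'[measurable]: "g \<in> borel_measurable (borel \<Otimes>\<^sub>M borel)" using g by (simp add: borel_prod)
 have "case_prod (\<lambda>(z :: real \<times> real) s. if 0 < s \<and> s < snd z then g (fst z, s) else 0) \<in> borel_measurable ((borel \<Otimes>\<^sub>M borel) \<Otimes>\<^sub>M lborel)"
  unfolding case_prod_unfold by measurable
 from lborel.borel_measurable_lebesgue_integral[OF this]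
 have "S \<in> borel_measurable borel" unfolding S_def[abs_def] by (simp add: borel_prod)
 then have Sm: "S \<in> borel_measurable (Mrc a b)" by (rule lebesgue_on_borel(3)) simp
 have gx: "(\<lambda>t. g (x, t)) \<in> borel_measurable borel" for x
  using measurable_compose[OF _ g', of "\<lambda>t. (x, t)" borel] by simp
 have "AE x in Mi a. \<forall>t\<in>{0<..<b}. S (x, t) = prim k (x, t)"
  using prim_slice[OF k] AE_slices[OF ae]
 proof eventually_elim
  case (elim x)
  show ?case
  proof
   fix t assume t: "t \<in> {0<..<b}"
   have sub: "AE s in lebesgue_on {0<..<t}. k (x, s) = g (x, s)"
    using elim(2) unfolding AE_lebesgue_on_iff[OF borel_open[OF open_greaterThanLessThan]]
    by (rule eventually_mono) (use t in auto)
   have gm: "(\<lambda>s. g (x, s)) \<in> borel_measurable (lebesgue_on {0<..<t})" by (rule lebesgue_on_borel(3)[OF gx]) simp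
   have km: "(\<lambda>s. k (x, s)) \<in> borel_measurable (lebesgue_on {0<..<t})"
    by (rule measurable_lebesgue_on_AE[OF gm]) (use sub in \<open>auto simp: eq_commute\<close>)
   have "prim k (x, t) = (LINT s|lebesgue_on {0<..<t}. k (x, s))" using elim(1) t by blast
   also have "\<dots> = (LINT s|lebesgue_on {0<..<t}. g (x, s))" by (rule integral_cong_AE[OF km gm sub])
   also have "\<dots> = (LINT s|lborel. indicator {0<..<t} s * g (x, s))" by (rule lebesgue_on_borel(2)[OF gx]) simp
   also have "\<dots> = S (x, t)" unfolding S_def by (intro Bochner_Integration.integral_cong) (auto simp: indicator_def)
   finally show "S (x, t) = prim k (x, t)" by simp
  qed
 qed
 from AE_fst_rc[OF this, of b] have "AE z in Mrc a b. S z = prim k z"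
  by (rule AE_mp) (auto intro!: AE_I2 simp: rc_def)
 from measurable_lebesgue_on_AE[OF Sm this borel_rc] show ?thesis .
qed

lemma AE_prim_slice:
 assumes k: "k \<in> Lsq (Mrc a b)"
 shows "AE z in Mrc a b. (\<lambda>t. k (fst z, t)) \<in> Lsq (Mi b) \<and> prim k z = (LINT s|lebesgue_on {0<..<snd z}. k (fst z, s))"
 using AE_fst_rc[OF prim_slice[OF k], of b] by (rule AE_mp) (auto intro!: AE_I2 simp: rc_def)

lemma prim_cong_AE:
 assumes "AE z in Mrc a b. k z = l z" and k: "k \<in> Lsq (Mrc a b)" and l: "l \<in> Lsq (Mrc a b)"
 shows "AE z in Mrc a b. prim k z = prim l z"
proof -
 have sp: "AE z in Mrc a b. z \<in> rc a b" using AE_space[of "Mrc a b"] by simp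
 show ?thesis
  using AE_fst_rc[OF AE_slices[OF assms(1)], of b] AE_prim_slice[OF k] AE_prim_slice[OF l] sp
 proof eventually_elim
  case (elim z)
  have t: "snd z \<in> {0<..<b}" using elim(4) by (auto simp: rc_def)
  have i: "{0<..<snd z} \<in> sets borel" "{0<..<snd z} \<subseteq> {0<..<b}" using t by auto
  have "(LINT s|Mi b. indicator {0<..<snd z} s * k (fst z, s)) = (LINT s|Mi b. indicator {0<..<snd z} s * l (fst z, s))"
  proof (rule integral_cong_AE)
   show "AE s in Mi b. indicator {0<..<snd z} s * k (fst z, s) = indicator {0<..<snd z} s * l (fst z, s)"
    using elim(1) by eventually_elim simp
  qed (use integral_subset_abs_le(3)[OF Lsq_Mi_integrable i] elim(2,3) in \<open>auto intro!: borel_measurable_integrable\<close>)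
  then show ?case
   using elim(2,3) integral_subset_abs_le(2)[OF Lsq_Mi_integrable i, of "\<lambda>s. k (fst z, s)"]
    integral_subset_abs_le(2)[OF Lsq_Mi_integrable i, of "\<lambda>s. l (fst z, s)"] by simp
 qed
qed

lemma Mi_sets: "{0<..<b} \<inter> space lebesgue \<in> sets (lebesgue :: real measure)" by simp

lemma prim_lin_AE:
 assumes k: "k \<in> Lsq (Mrc a b)" and l: "l \<in> Lsq (Mrc a b)"
 shows "AE z in Mrc a b. prim (\<lambda>z. p * k z + q * l z) z = p * prim k z + q * prim l z"
proof -
 have sp: "AE z in Mrc a b. z \<in> rc a b" using AE_space[of "Mrc a b"] by simp
 show ?thesis
  using AE_prim_slice[OF k] AE_prim_slice[OF l] AE_prim_slice[OF Lsq.lin[OF k l, of p q]] sp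
 proof eventually_elim
  case (elim z)
  have t: "snd z \<in> {0<..<b}" using elim(4) by (auto simp: rc_def)
  have i: "{0<..<snd z} \<in> sets borel" "{0<..<snd z} \<subseteq> {0<..<b}" using t by auto
  have int: "integrable (lebesgue_on {0<..<snd z}) f" if "f \<in> Lsq (Mi b)" for f
  proof -
   have eq: "(\<lambda>x. indicator {0<..<b} x *\<^sub>R (indicator {0<..<snd z} x * f x)) = (\<lambda>x. indicator {0<..<snd z} x *\<^sub>R f x :: real)"
    using i(2) by (intro ext) (auto simp: indicator_def)
   show ?thesis
    using integral_subset_abs_le(3)[OF Lsq_Mi_integrable[OF that] i] unfolding integrable_restrict_space[OF Mi_sets[of b]] integrable_restrict_space[OF Mi_sets[of "snd z"]] eq .
  qed
  show ?case using elim(1-3) int[of "\<lambda>s. k (fst z, s)"] int[of "\<lambda>s. l (fst z, s)"] by simp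
 qed
qed

lemma primitive_sq_bound:
 assumes b: "b > 0" and k: "k \<in> Lsq (Mi b)" and t: "t \<in> {0<..<b}"
 shows "(LINT s|lebesgue_on {0<..<t}. k s)^2 \<le> b * (LINT s|Mi b. (k s)^2)"
proof -
 have ka: "(\<lambda>s. \<bar>k s\<bar>) \<in> Lsq (Mi b)" using k borel_measurable_abs[OF Lsq_measurable[OF k]] by (simp add: Lsq_def)
 have o: "(\<lambda>_. 1) \<in> Lsq (Mi b)" by (rule continuous_Lsq_Mi) simp
 have "\<bar>LINT s|lebesgue_on {0<..<t}. k s\<bar> \<le> \<bar>LINT s|Mi b. \<bar>k s\<bar>\<bar>"
 proof -
  have sub: "{0<..<t} \<subseteq> {0<..<b}" using t by auto
  show ?thesis
   by (rule order_trans[OF integral_subset_abs_le(1)[OF Lsq_Mi_integrable[OF k] _ sub] abs_ge_self]) simp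
 qed
 then have "(LINT s|lebesgue_on {0<..<t}. k s)^2 \<le> (LINT s|Mi b. \<bar>k s\<bar> * 1)^2"
  unfolding abs_le_square_iff[symmetric] by simp
 also have "\<dots> \<le> (LINT s|Mi b. \<bar>k s\<bar> * \<bar>k s\<bar>) * (LINT s|Mi b. 1 * 1)" by (rule Lsq.cauchy_schwarz_sq[OF ka o])
 also have "\<dots> = b * (LINT s|Mi b. (k s)^2)" using b by (simp add: power2_eq_square measure_restrict_space)
 finally show ?thesis .
qed

lemma prim_bounded:
 assumes b: "b > 0" and k: "mix a b k K" shows "AE z in Mrc a b. (prim k z)^2 \<le> b * K"
proof -
 have kL: "k \<in> Lsq (Mrc a b)" using k by (simp add: mix_def)
 have sp: "AE z in Mrc a b. z \<in> rc a b" using AE_space[of "Mrc a b"] by simp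
 have "AE x in Mi a. (LINT t|Mi b. (k (x, t))^2) \<le> K" using k unfolding mix_def by (auto elim!: eventually_mono)
 from AE_prim_slice[OF kL] AE_fst_rc[OF this, of b] sp show ?thesis
 proof eventually_elim
  case (elim z)
  have t: "snd z \<in> {0<..<b}" using elim(3) by (auto simp: rc_def)
  have "(prim k z)^2 \<le> b * (LINT s|Mi b. (k (fst z, s))^2)" using primitive_sq_bound[OF b _ t] elim(1) by simp
  also have "\<dots> \<le> b * K" using elim(2) b by (intro mult_left_mono) auto
  finally show ?case .
 qed
qed

lemma mix_Lsq: "mix a b f K ==> f \<in> Lsq (Mrc a b)" by (simp add: mix_def)

text \<open>The bound on lines is inherited by pointwise domination almost everywhere in the plane.\<close>

lemma mix_dom:
 assumes f: "f \<in> borel_measurable (Mrc a b)" and le: "AE z in Mrc a b. (f z)^2 \<le> c * ((g z)^2 + (h z)^2)"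
  and c: "c \<ge> 0" and g: "mix a b g K" and h: "mix a b h L"
 shows "mix a b f (c * (K + L))"
proof -
 note gL = mix_Lsq[OF g] and hL = mix_Lsq[OF h]
 have fL: "f \<in> Lsq (Mrc a b)"
 proof -
  have "integrable (Mrc a b) (\<lambda>z. (f z)^2)"
   by (rule Bochner_Integration.integrable_bound[of _ "\<lambda>z. c * ((g z)^2 + (h z)^2)"])
    (use Lsq_integrable_sq[OF gL] Lsq_integrable_sq[OF hL] f le in \<open>auto elim!: eventually_mono\<close>)
  then show ?thesis using f by (simp add: Lsq_def)
 qed
 have int: "(LINT x|M. (p x)^2) \<le> c * (K + L)"
  if p: "p \<in> Lsq M" and q: "q \<in> Lsq M" "(LINT x|M. (q x)^2) \<le> K" and r: "r \<in> Lsq M" "(LINT x|M. (r x)^2) \<le> L"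
   and le: "AE x in M. (p x)^2 \<le> c * ((q x)^2 + (r x)^2)" for M :: "real measure" and p q r
 proof -
  note i = Lsq_integrable_sq[OF p] Lsq_integrable_sq[OF q(1)] Lsq_integrable_sq[OF r(1)]
  have "(LINT x|M. (p x)^2) \<le> (LINT x|M. c * ((q x)^2 + (r x)^2))" by (rule integral_mono_AE[OF i(1) _ le]) (use i in auto)
  also have "\<dots> = c * ((LINT x|M. (q x)^2) + (LINT x|M. (r x)^2))" using i by simp
  also have "\<dots> \<le> c * (K + L)" using q r c by (intro mult_left_mono) auto
  finally show ?thesis .
 qed
 show ?thesis unfolding mix_def
 proof (intro conjI fL)
  have gx: "AE x in Mi a. (\<lambda>t. g (x, t)) \<in> Lsq (Mi b) \<and> (LINT t|Mi b. (g (x, t))^2) \<le> K"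
   and hx: "AE x in Mi a. (\<lambda>t. h (x, t)) \<in> Lsq (Mi b) \<and> (LINT t|Mi b. (h (x, t))^2) \<le> L"
   and gt: "AE t in Mi b. (\<lambda>x. g (x, t)) \<in> Lsq (Mi a) \<and> (LINT x|Mi a. (g (x, t))^2) \<le> K"
   and ht: "AE t in Mi b. (\<lambda>x. h (x, t)) \<in> Lsq (Mi a) \<and> (LINT x|Mi a. (h (x, t))^2) \<le> L"
   using g h unfolding mix_def by auto
  show "AE x in Mi a. (\<lambda>t. f (x, t)) \<in> Lsq (Mi b) \<and> (LINT t|Mi b. (f (x, t))^2) \<le> c * (K + L)"
   using Lsq_slice[OF fL] gx hx AE_slices[OF le]
  proof eventually_elim
   case (elim x)
   show ?case using int[OF elim(1) conjunct1[OF elim(2)] conjunct2[OF elim(2)] conjunct1[OF elim(3)] conjunct2[OF elim(3)] elim(4)] elim(1) by blast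
  qed
  show "AE t in Mi b. (\<lambda>x. f (x, t)) \<in> Lsq (Mi a) \<and> (LINT x|Mi a. (f (x, t))^2) \<le> c * (K + L)"
   using Lsq_slice'[OF fL] gt ht AE_slices'[OF le]
  proof eventually_elim
   case (elim t)
   show ?case using int[OF elim(1) conjunct1[OF elim(2)] conjunct2[OF elim(2)] conjunct1[OF elim(3)] conjunct2[OF elim(3)] elim(4)] elim(1) by blast
  qed
 qed
qed

subsection \<open>Trilinear weighted estimates\<close>

text \<open>A factor bounded in the square mean along lines may multiply a factor bounded pointwise by the
 line integral of g: the first is integrated along the line, the second leaves the integral. Either
 variable may play the role of the line parameter.\<close>

lemma weighted_product_iterated:
 fixes f H g :: "real => real => real" and \<rho> :: "real => real => real"
 assumes i: "AE x in M. integrable N (\<lambda>t. (f x t * H x t)^2 * \<rho> x t)" "integrable M (\<lambda>x. LINT t|N. (f x t * H x t)^2 * \<rho> x t)"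
  and ig: "integrable M (\<lambda>x. LINT s|N. (g x s)^2 * \<rho> x s)" and \<rho>: "\<And>x t. \<rho> x t \<ge> 0"
  and f: "AE x in M. f x \<in> Lsq N \<and> (LINT t|N. (f x t)^2) \<le> K" and c: "c \<ge> 0"
  and le: "AE x in M. AE t in N. (H x t)^2 * \<rho> x t \<le> c * (LINT s|N. (g x s)^2 * \<rho> x s)"
 shows "(LINT x|M. LINT t|N. (f x t * H x t)^2 * \<rho> x t) \<le> c * K * (LINT x|M. LINT s|N. (g x s)^2 * \<rho> x s)"
proof -
 have "(LINT x|M. LINT t|N. (f x t * H x t)^2 * \<rho> x t) \<le> (LINT x|M. c * K * (LINT s|N. (g x s)^2 * \<rho> x s))"
 proof (rule integral_mono_AE[OF i(2)])
  show "integrable M (\<lambda>x. c * K * (LINT s|N. (g x s)^2 * \<rho> x s))" using ig by simp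
  show "AE x in M. (LINT t|N. (f x t * H x t)^2 * \<rho> x t) \<le> c * K * (LINT s|N. (g x s)^2 * \<rho> x s)"
   using le f i(1)
  proof eventually_elim
   case (elim x)
   let ?G = "LINT s|N. (g x s)^2 * \<rho> x s"
   have G: "?G \<ge> 0" by (intro integral_nonneg_AE AE_I2) (simp add: \<rho>)
   have "(LINT t|N. (f x t * H x t)^2 * \<rho> x t) \<le> (LINT t|N. c * ?G * (f x t)^2)"
   proof (rule integral_mono_AE[OF elim(3)])
    show "integrable N (\<lambda>t. c * ?G * (f x t)^2)" using Lsq_integrable_sq[OF conjunct1[OF elim(2)]] by simp
    show "AE t in N. (f x t * H x t)^2 * \<rho> x t \<le> c * ?G * (f x t)^2"
     using elim(1)
    proof eventually_elim
     case (elim t)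
     from mult_left_mono[OF elim, of "(f x t)^2"] show ?case by (simp add: power_mult_distrib mult_ac)
    qed
   qed
   also have "\<dots> = c * ?G * (LINT t|N. (f x t)^2)" by simp
   also have "\<dots> \<le> c * ?G * K" using elim(2) c G by (intro mult_left_mono) auto
   finally show ?case by (simp add: mult_ac)
  qed
 qed
 then show ?thesis by simp
qed

lemma weighted_product:
 assumes al: "\<alpha> \<ge> 0" "lam \<ge> 0" and f: "mix a b f K" and fH: "(\<lambda>z. f z * H z) \<in> Lsq (Mrc a b)" and g: "g \<in> Lsq (Mrc a b)" and c: "c \<ge> 0"
 shows weighted_product_x: "AE x in Mi a. AE t in Mi b. (H (x, t))^2 * wt \<alpha> lam (x, t) \<le> c * (LINT s|Mi b. (g (x, s))^2 * wt \<alpha> lam (x, s)) ==>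
   (LINT z|Mrc a b. (f z * H z)^2 * wt \<alpha> lam z) \<le> c * K * (LINT z|Mrc a b. (g z)^2 * wt \<alpha> lam z)"
  and weighted_product_t: "AE t in Mi b. AE x in Mi a. (H (x, t))^2 * wt \<alpha> lam (x, t) \<le> c * (LINT s|Mi a. (g (s, t))^2 * wt \<alpha> lam (s, t)) ==>
   (LINT z|Mrc a b. (f z * H z)^2 * wt \<alpha> lam z) \<le> c * K * (LINT z|Mrc a b. (g z)^2 * wt \<alpha> lam z)"
proof -
 note i = wt_integrable_sq[OF fH al] and ig = wt_integrable_sq[OF g al]
 have fx: "AE x in Mi a. (\<lambda>t. f (x, t)) \<in> Lsq (Mi b) \<and> (LINT t|Mi b. (f (x, t))^2) \<le> K"
  and ft: "AE t in Mi b. (\<lambda>x. f (x, t)) \<in> Lsq (Mi a) \<and> (LINT x|Mi a. (f (x, t))^2) \<le> K" using f unfolding mix_def by blast+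
 note p = less_imp_le[OF wt_pos]
 show "(LINT z|Mrc a b. (f z * H z)^2 * wt \<alpha> lam z) \<le> c * K * (LINT z|Mrc a b. (g z)^2 * wt \<alpha> lam z)"
  if "AE x in Mi a. AE t in Mi b. (H (x, t))^2 * wt \<alpha> lam (x, t) \<le> c * (LINT s|Mi b. (g (x, s))^2 * wt \<alpha> lam (x, s))"
  using weighted_product_iterated[OF fubini_rc(1)[OF i] fubini_rc(2)[OF i] fubini_rc(2)[OF ig] p fx c that]
  unfolding fubini_rc(3)[OF i] fubini_rc(3)[OF ig] .
 show "(LINT z|Mrc a b. (f z * H z)^2 * wt \<alpha> lam z) \<le> c * K * (LINT z|Mrc a b. (g z)^2 * wt \<alpha> lam z)"
  if "AE t in Mi b. AE x in Mi a. (H (x, t))^2 * wt \<alpha> lam (x, t) \<le> c * (LINT s|Mi a. (g (s, t))^2 * wt \<alpha> lam (s, t))"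
  using weighted_product_iterated[OF fubini_rc'(1)[OF i] fubini_rc'(2)[OF i] fubini_rc'(2)[OF ig] p ft c that]
  unfolding fubini_rc'(3)[OF i] fubini_rc'(3)[OF ig] .
qed

lemma wt_split: "wt \<alpha> lam (x, t) = exp (- 2 * lam * x) * exp (- 2 * (lam * \<alpha>) * t)"
 by (simp add: wt_eq algebra_simps flip: exp_add)

text \<open>The weight decays in t with rate \<open>2\<lambda>\<alpha>\<close>, so a primitive in t costs the factor \<open>1/(2\<lambda>\<alpha>)\<close> only.\<close>

lemma prim_weighted:
 assumes al: "\<alpha> > 0" "lam > 0" and k: "k \<in> Lsq (Mrc a b)"
 shows "AE x in Mi a. AE t in Mi b. (prim k (x, t))^2 * wt \<alpha> lam (x, t) \<le> 1 / (2 * (lam * \<alpha>)) * (LINT s|Mi b. (k (x, s))^2 * wt \<alpha> lam (x, s))"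
 using prim_slice[OF k]
proof eventually_elim
 case (elim x)
 have "(prim k (x, t))^2 * wt \<alpha> lam (x, t) \<le> 1 / (2 * (lam * \<alpha>)) * (LINT s|Mi b. (k (x, s))^2 * wt \<alpha> lam (x, s))"
  if t: "t \<in> {0<..<b}" for t
 proof -
  have mu: "lam * \<alpha> > 0" using al by simp
  have p: "prim k (x, t) = (LINT s|lebesgue_on {0<..<t}. k (x, s))" using elim t by blast
  have "(prim k (x, t))^2 * wt \<alpha> lam (x, t) = exp (- 2 * lam * x) * ((LINT s|lebesgue_on {0<..<t}. k (x, s))^2 * exp (- 2 * (lam * \<alpha>) * t))"
   unfolding p wt_split by (simp only: mult_ac)
  also have "\<dots> \<le> exp (- 2 * lam * x) * (1 / (2 * (lam * \<alpha>)) * (LINT s|Mi b. (k (x, s))^2 * exp (- 2 * (lam * \<alpha>) * s)))"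
   by (rule mult_left_mono[OF weighted_primitive_bound[OF conjunct1[OF elim] mu t]]) simp
  also have "\<dots> = 1 / (2 * (lam * \<alpha>)) * (LINT s|Mi b. exp (- 2 * lam * x) * ((k (x, s))^2 * exp (- 2 * (lam * \<alpha>) * s)))" by simp
  also have "\<dots> = 1 / (2 * (lam * \<alpha>)) * (LINT s|Mi b. (k (x, s))^2 * wt \<alpha> lam (x, s))"
   unfolding wt_split by (simp only: mult.left_commute)
  finally show ?thesis .
 qed
 then show ?case by (auto intro!: AE_I2)
qed

text \<open>A function vanishing at \<open>x = 0\<close> is the primitive in x of its derivative; the weight decays in x with
 rate \<open>2\<lambda>\<close>.\<close>

lemma zero_trace_weighted:
 assumes ab: "a > 0" "b > 0" and al: "lam > 0" and h: "trace_x a b 0 h (\<lambda>_. 0)"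
 shows "AE t in Mi b. AE x in Mi a. (h (x, t))^2 * wt \<alpha> lam (x, t) \<le> 1 / (2 * lam) * (LINT s|Mi a. (Dx a b h (s, t))^2 * wt \<alpha> lam (s, t))"
proof -
 let ?k = "Dx a b h"
 have hS: "h \<in> Hs 1 a b" using trace_xD(2)[OF h] .
 have kL: "?k \<in> Lsq (Mrc a b)" by (rule Lsq_wderiv[OF hS]) simp
 show ?thesis
  using slices_x(2)[OF ab hS h] Lsq_slice'[OF kL]
 proof eventually_elim
  case (elim t)
  have sp: "AE x in Mi a. x \<in> {0<..<a}" using AE_space[of "Mi a"] by simp
  show ?case using elim(1) sp
  proof eventually_elim
   case e: (elim x)
   have "(h (x, t))^2 * wt \<alpha> lam (x, t) = exp (- 2 * (lam * \<alpha>) * t) * ((LINT s|lebesgue_on {0<..<x}. ?k (s, t))^2 * exp (- 2 * lam * x))"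
    unfolding e(1) wt_split by (simp only: mult_ac)
   also have "\<dots> \<le> exp (- 2 * (lam * \<alpha>) * t) * (1 / (2 * lam) * (LINT s|Mi a. (?k (s, t))^2 * exp (- 2 * lam * s)))"
    by (rule mult_left_mono[OF weighted_primitive_bound[OF elim(2) al e(2)]]) simp
   also have "\<dots> = 1 / (2 * lam) * (LINT s|Mi a. exp (- 2 * (lam * \<alpha>) * t) * ((?k (s, t))^2 * exp (- 2 * lam * s)))" by simp
   also have "\<dots> = 1 / (2 * lam) * (LINT s|Mi a. (?k (s, t))^2 * wt \<alpha> lam (s, t))"
    unfolding wt_split by (simp only: mult_ac)
   finally show ?case .
  qed
 qed
qed

section \<open>Expansion of the functional\<close>

abbreviation "dx T \<equiv> Dx 1 T"
abbreviation "dt T \<equiv> Dt 1 T"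
abbreviation "nS k T \<equiv> hn k 1 T"
abbreviation "S k T \<equiv> Hs k 1 T"

definition Fop :: "real => pfun => pfun" where
 "Fop T w z = wderiv (rc 1 T) 2 0 w z - 2 * wderiv (rc 1 T) 1 1 w z"

text \<open>The bilinear form whose diagonal is the nonlinear part of the operator: the first argument carries
 the local derivatives in the products with the integral, the second one the integral.\<close>

definition Nop :: "real => pfun => pfun => pfun" where
 "Nop T a b z = 2 * dx T a z * prim (dx T b) z - 2 * dx T a z * b z - 2 * dt T a z * prim (dx T b) z"

text \<open>The differential of the operator at w in the direction h.\<close>

definition DL :: "real => pfun => pfun => pfun" where
 "DL T w h z = Fop T h z + Nop T w h z + Nop T h w z"

lemma Lop_eq: "Lop T w z = Fop T w z + Nop T w w z"
 by (cases z) (simp add: Lop_def Fop_def Nop_def prim_def rect_rc Let_def)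

text \<open>The constant of \<open>sobolev_1_mix\<close> on the rectangle with sides 1 and T.\<close>

definition kk :: "real => real" where "kk T = 1 / 1 + 1 / T + 1"
text \<open>The constant in the bounds of the squares of b and of its nonlocal coefficient S(b) by the squared \<open>H\<^sup>2\<close> norm of b.\<close>

definition c0 :: "real => real" where "c0 T = 2 * (kk T)^2 + T * kk T"

lemma kk_pos: "T > 0 ==> kk T > 0" by (simp add: kk_def add_pos_pos)
lemma c0_pos: "T > 0 ==> c0 T > 0" using kk_pos[of T] by (simp add: c0_def add_pos_pos)

lemma D_sob: "u \<in> S 2 T ==> dx T u \<in> S 1 T" "u \<in> S 2 T ==> dt T u \<in> S 1 T"
 by (auto intro: rc.sobolev_wderiv)

lemma D_Lsq: "u \<in> S 2 T ==> dx T u \<in> Lsq (Mrc 1 T)" "u \<in> S 2 T ==> dt T u \<in> Lsq (Mrc 1 T)"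
 by (auto intro: Lsq_wderiv)

lemma Fop_Lsq: "u \<in> S 2 T ==> Fop T u \<in> Lsq (Mrc 1 T)"
 using Lsq.lin[OF Lsq_wderiv[of u 2 1 T 2 0] Lsq_wderiv[of u 2 1 T 1 1], of 1 "-2"] unfolding Fop_def[abs_def] by simp

lemma Fop_l2: assumes u: "u \<in> S 2 T" shows "l2 (Mrc 1 T) (Fop T u) \<le> 3 * nS 2 T u"
proof -
 have L: "wderiv (rc 1 T) 2 0 u \<in> Lsq (Mrc 1 T)" "wderiv (rc 1 T) 1 1 u \<in> Lsq (Mrc 1 T)" by (rule Lsq_wderiv[OF u], simp)+
 have "Fop T u = wderiv (rc 1 T) 2 0 u + (\<lambda>z. (-2) * wderiv (rc 1 T) 1 1 u z)" by (simp add: Fop_def fun_eq_iff)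
 then have "l2 (Mrc 1 T) (Fop T u) \<le> l2 (Mrc 1 T) (wderiv (rc 1 T) 2 0 u) + 2 * l2 (Mrc 1 T) (wderiv (rc 1 T) 1 1 u)"
  using Lsq.nrm_triangle[OF L(1) Lsq.scale[OF L(2)], of "-2"] Lsq.nrm_scale[OF L(2), of "-2"] by simp
 also have "\<dots> \<le> 3 * nS 2 T u"
  using l2_wderiv_le_sob_norm[of 2 0 2 "rc 1 T" u] l2_wderiv_le_sob_norm[of 1 1 2 "rc 1 T" u] by simp
 finally show ?thesis .
qed

lemma mix_mono: assumes f: "mix a b f K" and le: "K \<le> L" shows "mix a b f L"
 unfolding mix_def
proof (intro conjI)
 show "f \<in> Lsq (Mrc a b)" by (rule mix_Lsq[OF f])
 have x: "AE x in Mi a. (\<lambda>t. f (x, t)) \<in> Lsq (Mi b) \<and> (LINT t|Mi b. (f (x, t))^2) \<le> K"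
  and t: "AE t in Mi b. (\<lambda>x. f (x, t)) \<in> Lsq (Mi a) \<and> (LINT x|Mi a. (f (x, t))^2) \<le> K"
  using f unfolding mix_def by auto
 show "AE x in Mi a. (\<lambda>t. f (x, t)) \<in> Lsq (Mi b) \<and> (LINT t|Mi b. (f (x, t))^2) \<le> L"
  using x by (rule eventually_mono) (use le in auto)
 show "AE t in Mi b. (\<lambda>x. f (x, t)) \<in> Lsq (Mi a) \<and> (LINT x|Mi a. (f (x, t))^2) \<le> L"
  using t by (rule eventually_mono) (use le in auto)
qed

lemma D_mix:
 assumes T: "T > 0" and u: "u \<in> S 2 T"
 shows "mix 1 T (dx T u) (kk T * (nS 2 T u)^2)" "mix 1 T (dt T u) (kk T * (nS 2 T u)^2)"
proof -
 have le: "kk T * (nS 1 T (wderiv (rc 1 T) i j u))^2 \<le> kk T * (nS 2 T u)^2" if "i + j = 1" for i j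
  using that Sob.nrm_nonneg[OF rc.sobolev_wderiv[OF u, of 1 i j]] sob_norm_wderiv_le[OF u, of 1 i j]
  by (intro mult_left_mono power_mono less_imp_le[OF kk_pos[OF T]]) auto
 show "mix 1 T (dx T u) (kk T * (nS 2 T u)^2)" "mix 1 T (dt T u) (kk T * (nS 2 T u)^2)"
  using sobolev_1_mix[OF zero_less_one T D_sob(1)[OF u]] sobolev_1_mix[OF zero_less_one T D_sob(2)[OF u]] le[of 1 0] le[of 0 1]
  unfolding kk_def by (auto intro: mix_mono)
qed

lemma prim_dx_Lsq_measurable: "u \<in> S 2 T ==> prim (dx T u) \<in> borel_measurable (Mrc 1 T)"
 by (rule prim_measurable[OF D_Lsq(1)])

lemma coefficient_bound:
 assumes T: "T > 0" and b: "b \<in> S 2 T"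
 shows "AE z in Mrc 1 T. (prim (dx T b) z)^2 \<le> c0 T * (nS 2 T b)^2 \<and> (b z)^2 \<le> c0 T * (nS 2 T b)^2"
proof -
 have 1: "T * (kk T * (nS 2 T b)^2) \<le> c0 T * (nS 2 T b)^2" and 2: "2 * (kk T)^2 * (nS 2 T b)^2 \<le> c0 T * (nS 2 T b)^2"
  using T kk_pos[OF T] by (auto simp: c0_def distrib_right mult.assoc)
 show ?thesis
  using prim_bounded[OF T D_mix(1)[OF T b]] sobolev_2_bounded[OF zero_less_one T b, folded kk_def]
  by eventually_elim (use 1 2 in auto)
qed

lemma Nop_measurable: assumes "a \<in> S 2 T" "b \<in> S 2 T" shows "Nop T a b \<in> borel_measurable (Mrc 1 T)"
proof -
 have [measurable]: "dx T a \<in> borel_measurable (Mrc 1 T)" "dt T a \<in> borel_measurable (Mrc 1 T)" "b \<in> borel_measurable (Mrc 1 T)"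
  by (intro Lsq_measurable D_Lsq assms Lsq_sob[OF assms(2)])+
 have [measurable]: "prim (dx T b) \<in> borel_measurable (Mrc 1 T)" by (rule prim_dx_Lsq_measurable[OF assms(2)])
 show ?thesis unfolding Nop_def[abs_def] by measurable
qed

lemma sq_sum3: "(x + y + z)^2 \<le> 3 * (x^2 + y^2 + z^2)" for x y z :: real
proof -
 have "0 \<le> (x - y)^2 + (y - z)^2 + (z - x)^2" by simp
 then show ?thesis by (simp add: power2_eq_square algebra_simps)
qed

lemma Nop_sq_le: "(Nop T a b z)^2 \<le> 12 * ((dx T a z * prim (dx T b) z)^2 + (dx T a z * b z)^2 + (dt T a z * prim (dx T b) z)^2)"
 using sq_sum3[of "2 * dx T a z * prim (dx T b) z" "- 2 * dx T a z * b z" "- 2 * dt T a z * prim (dx T b) z"]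
 by (simp add: Nop_def power_mult_distrib)

text \<open>The coefficients coming from the second argument are bounded functions, since \<open>H\<^sup>2\<close> functions and
 primitives of \<open>H\<^sup>1\<close> functions are.\<close>

lemma Nop_bound:
 assumes T: "T > 0" and a: "a \<in> S 2 T" and b: "b \<in> S 2 T"
 shows "AE z in Mrc 1 T. (Nop T a b z)^2 \<le> 24 * c0 T * (nS 2 T b)^2 * ((dx T a z)^2 + (dt T a z)^2)"
 using coefficient_bound[OF T b]
proof eventually_elim
 case (elim z)
 let ?c = "c0 T * (nS 2 T b)^2"
 have c: "?c \<ge> 0" using c0_pos[OF T] by simp
 have m: "(p * q)^2 \<le> p^2 * ?c" if "q^2 \<le> ?c" for p q :: real
  unfolding power_mult_distrib by (rule mult_left_mono[OF that]) simp
 have "(Nop T a b z)^2 \<le> 12 * ((dx T a z)^2 * ?c + (dx T a z)^2 * ?c + (dt T a z)^2 * ?c)"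
  by (rule order_trans[OF Nop_sq_le]) (use m elim in \<open>intro mult_left_mono add_mono; simp\<close>)
 also have "\<dots> \<le> 24 * ?c * ((dx T a z)^2 + (dt T a z)^2)"
 proof -
  have "(dt T a z)^2 * ?c \<ge> 0" using c by simp
  then show ?thesis by (simp add: algebra_simps)
 qed
 finally show ?case by (simp add: mult.assoc)
qed

lemma Nop_Lsq:
 assumes T: "T > 0" and a: "a \<in> S 2 T" and b: "b \<in> S 2 T" shows "Nop T a b \<in> Lsq (Mrc 1 T)"
 and "(l2 (Mrc 1 T) (Nop T a b))^2 \<le> 48 * c0 T * (nS 2 T b)^2 * (nS 2 T a)^2"
proof -
 let ?c = "24 * c0 T * (nS 2 T b)^2"
 have c: "?c \<ge> 0" using c0_pos[OF T] by simp
 show L: "Nop T a b \<in> Lsq (Mrc 1 T)"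
  using mix_Lsq[OF mix_dom[OF Nop_measurable[OF a b] Nop_bound[OF T a b] c D_mix[OF T a]]] .
 note i = Lsq_integrable_sq[OF D_Lsq(1)[OF a]] Lsq_integrable_sq[OF D_Lsq(2)[OF a]]
 have "(l2 (Mrc 1 T) (Nop T a b))^2 \<le> (LINT z|Mrc 1 T. ?c * ((dx T a z)^2 + (dt T a z)^2))"
  unfolding l2_sq by (rule integral_mono_AE[OF Lsq_integrable_sq[OF L] _ Nop_bound[OF T a b]]) (use i in simp)
 also have "\<dots> = ?c * ((l2 (Mrc 1 T) (dx T a))^2 + (l2 (Mrc 1 T) (dt T a))^2)" using i by (simp add: l2_sq)
 also have "\<dots> \<le> ?c * ((nS 2 T a)^2 + (nS 2 T a)^2)"
  using l2_wderiv_le_sob_norm[of 1 0 2 "rc 1 T" a] l2_wderiv_le_sob_norm[of 0 1 2 "rc 1 T" a] Lsq.nrm_nonneg[OF D_Lsq(1)[OF a]] Lsq.nrm_nonneg[OF D_Lsq(2)[OF a]]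
  by (intro mult_left_mono[OF _ c] add_mono power_mono) auto
 finally show "(l2 (Mrc 1 T) (Nop T a b))^2 \<le> 48 * c0 T * (nS 2 T b)^2 * (nS 2 T a)^2" by (simp add: mult_ac)
qed

lemma Fop_lin:
 assumes u: "u \<in> S 2 T" and v: "v \<in> S 2 T"
 shows "AE z in Mrc 1 T. Fop T (\<lambda>z. p * u z + q * v z) z = p * Fop T u z + q * Fop T v z"
 using rc.wderiv_lin[OF u v, of 2 0 p q, simplified] rc.wderiv_lin[OF u v, of 1 1 p q, simplified]
 by eventually_elim (simp add: Fop_def algebra_simps)

lemma prim_dx_lin:
 assumes u: "u \<in> S 2 T" and v: "v \<in> S 2 T"
 shows "AE z in Mrc 1 T. prim (dx T (\<lambda>z. p * u z + q * v z)) z = p * prim (dx T u) z + q * prim (dx T v) z"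
proof -
 have ae: "AE z in Mrc 1 T. dx T (\<lambda>z. p * u z + q * v z) z = p * dx T u z + q * dx T v z"
  by (rule rc.wderiv_lin[OF u v]) simp
 show ?thesis
  using prim_cong_AE[OF ae D_Lsq(1)[OF Sob.lin[OF u v]] Lsq.lin[OF D_Lsq(1)[OF u] D_Lsq(1)[OF v]]]
   prim_lin_AE[OF D_Lsq(1)[OF u] D_Lsq(1)[OF v], of p q]
  by eventually_elim simp
qed

lemma Nop_lin:
 assumes u: "u \<in> S 2 T" and v: "v \<in> S 2 T" and w: "w \<in> S 2 T"
 shows "AE z in Mrc 1 T. Nop T (\<lambda>z. p * u z + q * v z) w z = p * Nop T u w z + q * Nop T v w z"
  and "AE z in Mrc 1 T. Nop T w (\<lambda>z. p * u z + q * v z) z = p * Nop T w u z + q * Nop T w v z"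
proof -
 have x: "AE z in Mrc 1 T. dx T (\<lambda>z. p * u z + q * v z) z = p * dx T u z + q * dx T v z"
  and t: "AE z in Mrc 1 T. dt T (\<lambda>z. p * u z + q * v z) z = p * dt T u z + q * dt T v z"
  by (rule rc.wderiv_lin[OF u v], simp)+
 show "AE z in Mrc 1 T. Nop T (\<lambda>z. p * u z + q * v z) w z = p * Nop T u w z + q * Nop T v w z"
  using x t
 proof eventually_elim
  case (elim z) show ?case unfolding Nop_def elim by (simp add: algebra_simps)
 qed
 show "AE z in Mrc 1 T. Nop T w (\<lambda>z. p * u z + q * v z) z = p * Nop T w u z + q * Nop T w v z"
  using prim_dx_lin[OF u v, of p q]
 proof eventually_elim
  case (elim z) show ?case unfolding Nop_def elim by (simp add: algebra_simps)
 qed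
qed

lemma DL_lin:
 assumes u: "u \<in> S 2 T" and v: "v \<in> S 2 T" and w: "w \<in> S 2 T"
 shows "AE z in Mrc 1 T. DL T w (\<lambda>z. p * u z + q * v z) z = p * DL T w u z + q * DL T w v z"
 using Fop_lin[OF u v, of p q] Nop_lin[OF u v w, of p q]
proof eventually_elim
 case (elim z) show ?case unfolding DL_def elim by (simp add: algebra_simps)
qed

lemma DL_Lsq:
 assumes T: "T > 0" and w: "w \<in> S 2 T" and h: "h \<in> S 2 T"
 shows "DL T w h \<in> Lsq (Mrc 1 T)"
proof -
 have "DL T w h = Fop T h + Nop T w h + Nop T h w" by (simp add: DL_def fun_eq_iff)
 then show ?thesis using Lsq.add[OF Lsq.add[OF Fop_Lsq[OF h] Nop_Lsq(1)[OF T w h]] Nop_Lsq(1)[OF T h w]] by simp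
qed

lemma Lop_Lsq: assumes T: "T > 0" and w: "w \<in> S 2 T" shows "Lop T w \<in> Lsq (Mrc 1 T)"
proof -
 have "Lop T w = Fop T w + Nop T w w" by (simp add: Lop_eq fun_eq_iff)
 then show ?thesis using Lsq.add[OF Fop_Lsq[OF w] Nop_Lsq(1)[OF T w w]] by simp
qed

lemma Lop_add:
 assumes w: "w \<in> S 2 T" and h: "h \<in> S 2 T"
 shows "AE z in Mrc 1 T. Lop T (w + h) z = Lop T w z + (DL T w h z + Nop T h h z)"
proof -
 have wh: "w + h = (\<lambda>z. 1 * w z + 1 * h z)" by (simp add: fun_eq_iff)
 have whS: "(\<lambda>z. 1 * w z + 1 * h z) \<in> S 2 T" by (rule Sob.lin[OF w h])
 show ?thesis
  using Fop_lin[OF w h, of 1 1] Nop_lin(1)[OF w h whS, of 1 1] Nop_lin(2)[OF w h w, of 1 1] Nop_lin(2)[OF w h h, of 1 1]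
 proof eventually_elim
  case (elim z) show ?case unfolding Lop_eq wh elim DL_def by simp
 qed
qed

text \<open>The term of first order in h of the expansion of the functional at w.\<close>

definition lin_part :: "real => real => real => real => pfun => pfun => real" where
 "lin_part T \<alpha> lam \<beta> w h = 2 * (LINT z|Mrc 1 T. Lop T w z * DL T w h z * wt \<alpha> lam z) + 2 * \<beta> * sob_inner 3 (rc 1 T) w h"

text \<open>Everything of second or higher order in h: the square of the increment of the operator, which reaches the
 fourth order, the product of L(w) with the quadratic term of that increment, and the penalty.\<close>

definition rem_part :: "real => real => real => real => pfun => pfun => real" where
 "rem_part T \<alpha> lam \<beta> w h = (LINT z|Mrc 1 T. (DL T w h z + Nop T h h z)^2 * wt \<alpha> lam z)
   + 2 * (LINT z|Mrc 1 T. Lop T w z * Nop T h h z * wt \<alpha> lam z) + \<beta> * (nS 3 T h)^2"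

text \<open>The operator is the sum of a linear and a bilinear term, so the expansion is exact.\<close>

lemma J_expand:
 assumes T: "T > 0" and al: "\<alpha> \<ge> 0" "lam \<ge> 0" and w: "w \<in> S 3 T" and h: "h \<in> S 3 T"
 shows "J T \<alpha> lam \<beta> (w + h) = J T \<alpha> lam \<beta> w + lin_part T \<alpha> lam \<beta> w h + rem_part T \<alpha> lam \<beta> w h"
proof -
 have w2: "w \<in> S 2 T" and h2: "h \<in> S 2 T" by (rule sobolev_mono[OF _ w], simp, rule sobolev_mono[OF _ h], simp)
 let ?M = "Mrc 1 T" and ?w = "wt \<alpha> lam"
 let ?L = "Lop T w" and ?D = "DL T w h" and ?N = "Nop T h h"
 note L = Lop_Lsq[OF T w2] and D = DL_Lsq[OF T w2 h2] and N = Nop_Lsq(1)[OF T h2 h2]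
 have DN: "(\<lambda>z. ?D z + ?N z) \<in> Lsq ?M" using Lsq.add[OF D N] by (simp add: plus_fun_def)
 note i = wt_integrable[OF L D al] wt_integrable[OF L N al] wt_integrable_sq[OF L al] wt_integrable_sq[OF DN al]
 have "(LINT z|?M. (Lop T (w + h) z)^2 * ?w z) =
   (LINT z|?M. (?L z)^2 * ?w z + 2 * (?L z * ?D z * ?w z) + 2 * (?L z * ?N z * ?w z) + (?D z + ?N z)^2 * ?w z)"
 proof (rule integral_cong_AE)
  show "AE z in ?M. (Lop T (w + h) z)^2 * ?w z =
    (?L z)^2 * ?w z + 2 * (?L z * ?D z * ?w z) + 2 * (?L z * ?N z * ?w z) + (?D z + ?N z)^2 * ?w z"
   using Lop_add[OF w2 h2]
  proof eventually_elim
   case (elim z) show ?case unfolding elim by (simp add: power2_eq_square algebra_simps)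
  qed
  show "(\<lambda>z. (Lop T (w + h) z)^2 * ?w z) \<in> borel_measurable ?M"
   by (rule borel_measurable_integrable[OF wt_integrable_sq[OF Lop_Lsq[OF T Sob.add[OF w2 h2]] al]])
 qed (use i in \<open>auto intro!: borel_measurable_integrable\<close>)
 also have "\<dots> = (LINT z|?M. (?L z)^2 * ?w z) + 2 * (LINT z|?M. ?L z * ?D z * ?w z) + 2 * (LINT z|?M. ?L z * ?N z * ?w z)
   + (LINT z|?M. (?D z + ?N z)^2 * ?w z)" using i by simp
 finally have 1: "(LINT z|?M. (Lop T (w + h) z)^2 * ?w z) = \<dots>" .
 have 2: "(nS 3 T (w + h))^2 = (nS 3 T w)^2 + 2 * sob_inner 3 (rc 1 T) w h + (nS 3 T h)^2"
  unfolding Sob.nrm_sq[OF Sob.add[OF w h]] Sob.nrm_sq[OF w] Sob.nrm_sq[OF h] by (rule Sob.ip_self_expand(1)[OF w h])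
 show ?thesis unfolding J_def rect_rc 1 2 lin_part_def rem_part_def by (simp add: algebra_simps)
qed

lemma lin_part_lin:
 assumes T: "T > 0" and al: "\<alpha> \<ge> 0" "lam \<ge> 0" and w: "w \<in> S 3 T" and u: "u \<in> S 3 T" and v: "v \<in> S 3 T"
 shows "lin_part T \<alpha> lam \<beta> w (\<lambda>z. p * u z + q * v z) = p * lin_part T \<alpha> lam \<beta> w u + q * lin_part T \<alpha> lam \<beta> w v"
proof -
 have 2: "w \<in> S 2 T" "u \<in> S 2 T" "v \<in> S 2 T" using w u v by (auto intro: sobolev_mono[of 2 3])
 let ?M = "Mrc 1 T" and ?w = "wt \<alpha> lam"
 note L = Lop_Lsq[OF T 2(1)] and Du = DL_Lsq[OF T 2(1,2)] and Dv = DL_Lsq[OF T 2(1,3)]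
 note i = wt_integrable[OF L Du al] wt_integrable[OF L Dv al]
 have "(LINT z|?M. Lop T w z * DL T w (\<lambda>z. p * u z + q * v z) z * ?w z) =
   (LINT z|?M. p * (Lop T w z * DL T w u z * ?w z) + q * (Lop T w z * DL T w v z * ?w z))"
 proof (rule integral_cong_AE)
  show "AE z in ?M. Lop T w z * DL T w (\<lambda>z. p * u z + q * v z) z * ?w z =
    p * (Lop T w z * DL T w u z * ?w z) + q * (Lop T w z * DL T w v z * ?w z)"
   using DL_lin[OF 2(2,3,1), of p q]
  proof eventually_elim
   case (elim z) show ?case unfolding elim by (simp add: algebra_simps)
  qed
  show "(\<lambda>z. Lop T w z * DL T w (\<lambda>z. p * u z + q * v z) z * ?w z) \<in> borel_measurable ?M"
   by (rule borel_measurable_integrable[OF wt_integrable[OF L DL_Lsq[OF T 2(1) Sob.lin[OF 2(2,3)]] al]])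
 qed (use i in \<open>auto intro!: borel_measurable_integrable\<close>)
 then show ?thesis using i unfolding lin_part_def Sob.ip_lin2[OF u v w] by (simp add: algebra_simps)
qed

lemma weighted_cauchy_schwarz:
 assumes f: "f \<in> Lsq (Mrc a b)" and g: "g \<in> Lsq (Mrc a b)" and al: "\<alpha> \<ge> 0" "lam \<ge> 0"
 shows "\<bar>LINT z|Mrc a b. f z * g z * wt \<alpha> lam z\<bar> \<le> l2 (Mrc a b) f * l2 (Mrc a b) g"
proof -
 have "\<bar>LINT z|Mrc a b. f z * (g z * wt \<alpha> lam z)\<bar> \<le> l2 (Mrc a b) f * l2 (Mrc a b) (\<lambda>z. g z * wt \<alpha> lam z)"
  by (rule Lsq.cauchy_schwarz[OF f wt_Lsq_mult[OF g al]])
 also have "\<dots> \<le> l2 (Mrc a b) f * (1 * l2 (Mrc a b) g)"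
  by (intro mult_left_mono Lsq.nrm_nonneg[OF f] l2_mult_bounded[OF g wt_measurable wt_le_1_AE[OF al]]) simp
 finally show ?thesis by (simp add: mult.assoc)
qed

definition cN :: "real => real" where "cN T = sqrt (48 * c0 T)"

lemma Nop_l2:
 assumes T: "T > 0" and a: "a \<in> S 2 T" and b: "b \<in> S 2 T"
 shows "l2 (Mrc 1 T) (Nop T a b) \<le> cN T * nS 2 T a * nS 2 T b"
proof (rule power2_le_imp_le)
 have "(cN T)^2 = 48 * c0 T" using c0_pos[OF T] by (simp add: cN_def)
 then have "(cN T * nS 2 T a * nS 2 T b)^2 = 48 * c0 T * (nS 2 T b)^2 * (nS 2 T a)^2" by (simp add: power_mult_distrib)
 then show "(l2 (Mrc 1 T) (Nop T a b))^2 \<le> (cN T * nS 2 T a * nS 2 T b)^2" using Nop_Lsq(2)[OF T a b] by simp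
 show "0 \<le> cN T * nS 2 T a * nS 2 T b"
  using c0_pos[OF T] Sob.nrm_nonneg[OF a] Sob.nrm_nonneg[OF b] by (auto simp: cN_def)
qed

lemma DL_l2:
 assumes T: "T > 0" and w: "w \<in> S 3 T" and h: "h \<in> S 3 T"
 shows "l2 (Mrc 1 T) (DL T w h) \<le> (3 + 2 * cN T * nS 3 T w) * nS 3 T h"
  and "l2 (Mrc 1 T) (Nop T h h) \<le> cN T * (nS 3 T h)^2"
proof -
 have w2: "w \<in> S 2 T" and h2: "h \<in> S 2 T" by (rule sobolev_mono[OF _ w], simp, rule sobolev_mono[OF _ h], simp)
 have n: "0 \<le> nS 2 T w" "nS 2 T w \<le> nS 3 T w" "0 \<le> nS 2 T h" "nS 2 T h \<le> nS 3 T h"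
  by (auto intro: Sob.nrm_nonneg w2 h2 sob_norm_mono)
 have c: "cN T \<ge> 0" using c0_pos[OF T] by (simp add: cN_def)
 have m: "cN T * p * q \<le> cN T * p' * q'" if "0 \<le> p" "p \<le> p'" "0 \<le> q" "q \<le> q'" for p q p' q'
  using that c by (intro mult_mono mult_nonneg_nonneg) auto
 have "DL T w h = Fop T h + Nop T w h + Nop T h w" by (simp add: DL_def fun_eq_iff)
 then have "l2 (Mrc 1 T) (DL T w h) \<le> l2 (Mrc 1 T) (Fop T h) + l2 (Mrc 1 T) (Nop T w h) + l2 (Mrc 1 T) (Nop T h w)"
  using Lsq.nrm_triangle[OF Lsq.add[OF Fop_Lsq[OF h2] Nop_Lsq(1)[OF T w2 h2]] Nop_Lsq(1)[OF T h2 w2]]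
   Lsq.nrm_triangle[OF Fop_Lsq[OF h2] Nop_Lsq(1)[OF T w2 h2]] by simp
 also have "\<dots> \<le> 3 * nS 3 T h + cN T * nS 3 T w * nS 3 T h + cN T * nS 3 T h * nS 3 T w"
  using Fop_l2[OF h2] Nop_l2[OF T w2 h2] Nop_l2[OF T h2 w2] m[OF n] m[OF n(3,4,1,2)] n(4) by linarith
 finally show "l2 (Mrc 1 T) (DL T w h) \<le> (3 + 2 * cN T * nS 3 T w) * nS 3 T h" by (simp add: algebra_simps)
 show "l2 (Mrc 1 T) (Nop T h h) \<le> cN T * (nS 3 T h)^2"
  using Nop_l2[OF T h2 h2] m[OF n(3,4,3,4)] by (simp add: power2_eq_square mult.assoc)
qed

lemma lin_part_bounded:
 assumes T: "T > 0" and al: "\<alpha> \<ge> 0" "lam \<ge> 0" "\<beta> \<ge> 0" and w: "w \<in> S 3 T"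
 shows "\<exists>C. \<forall>h\<in>S 3 T. \<bar>lin_part T \<alpha> lam \<beta> w h\<bar> \<le> C * nS 3 T h"
proof (intro exI ballI)
 fix h assume h: "h \<in> S 3 T"
 have w2: "w \<in> S 2 T" and h2: "h \<in> S 2 T" by (rule sobolev_mono[OF _ w], simp, rule sobolev_mono[OF _ h], simp)
 have "\<bar>LINT z|Mrc 1 T. Lop T w z * DL T w h z * wt \<alpha> lam z\<bar> \<le> l2 (Mrc 1 T) (Lop T w) * l2 (Mrc 1 T) (DL T w h)"
  by (rule weighted_cauchy_schwarz[OF Lop_Lsq[OF T w2] DL_Lsq[OF T w2 h2] al(1,2)])
 also have "\<dots> \<le> l2 (Mrc 1 T) (Lop T w) * ((3 + 2 * cN T * nS 3 T w) * nS 3 T h)"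
  by (intro mult_left_mono DL_l2(1)[OF T w h] Lsq.nrm_nonneg Lop_Lsq T w2)
 finally have 1: "\<bar>LINT z|Mrc 1 T. Lop T w z * DL T w h z * wt \<alpha> lam z\<bar> \<le> \<dots>" .
 have "\<beta> * \<bar>sob_inner 3 (rc 1 T) w h\<bar> \<le> \<beta> * (nS 3 T w * nS 3 T h)"
  by (intro mult_left_mono Sob.cauchy_schwarz w h al)
 then have 2: "\<bar>\<beta> * sob_inner 3 (rc 1 T) w h\<bar> \<le> \<beta> * (nS 3 T w * nS 3 T h)" using al by (simp add: abs_mult)
 show "\<bar>lin_part T \<alpha> lam \<beta> w h\<bar> \<le> (2 * (l2 (Mrc 1 T) (Lop T w) * (3 + 2 * cN T * nS 3 T w)) + 2 * \<beta> * nS 3 T w) * nS 3 T h"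
  unfolding lin_part_def using 1 2 by (simp add: algebra_simps abs_le_iff)
qed

text \<open>The remainder is of second order, which is Frechet differentiability; the restriction to increments of
 norm at most 1 absorbs the terms of third and fourth order.\<close>

lemma rem_part_bounded:
 assumes T: "T > 0" and al: "\<alpha> \<ge> 0" "lam \<ge> 0" "\<beta> \<ge> 0" and w: "w \<in> S 3 T"
 shows "\<exists>C\<ge>0. \<forall>h\<in>S 3 T. nS 3 T h \<le> 1 \<longrightarrow> \<bar>rem_part T \<alpha> lam \<beta> w h\<bar> \<le> C * (nS 3 T h)^2"
proof (intro exI conjI ballI impI)
 let ?k = "3 + 2 * cN T * nS 3 T w + cN T"
 let ?C = "?k^2 + 2 * (l2 (Mrc 1 T) (Lop T w) * cN T) + \<beta>"
 have w2: "w \<in> S 2 T" by (rule sobolev_mono[OF _ w]) simp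
 have c: "cN T \<ge> 0" using c0_pos[OF T] by (simp add: cN_def)
 have LN: "l2 (Mrc 1 T) (Lop T w) \<ge> 0" by (intro Lsq.nrm_nonneg Lop_Lsq T w2)
 show "?C \<ge> 0" using c LN al by simp
 fix h assume h: "h \<in> S 3 T" and h1: "nS 3 T h \<le> 1"
 have h2: "h \<in> S 2 T" by (rule sobolev_mono[OF _ h]) simp
 have hn: "nS 3 T h \<ge> 0" by (rule Sob.nrm_nonneg[OF h])
 let ?DN = "DL T w h + Nop T h h"
 have DN: "?DN \<in> Lsq (Mrc 1 T)" by (rule Lsq.add[OF DL_Lsq[OF T w2 h2] Nop_Lsq(1)[OF T h2 h2]])
 have "l2 (Mrc 1 T) ?DN \<le> (3 + 2 * cN T * nS 3 T w) * nS 3 T h + cN T * (nS 3 T h)^2"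
  using Lsq.nrm_triangle[OF DL_Lsq[OF T w2 h2] Nop_Lsq(1)[OF T h2 h2]] DL_l2[OF T w h] by linarith
 also have "\<dots> \<le> ?k * nS 3 T h"
  using mult_left_mono[OF mult_left_mono[OF h1 hn] c] by (simp add: power2_eq_square algebra_simps)
 finally have l: "l2 (Mrc 1 T) ?DN \<le> ?k * nS 3 T h" .
 have "(LINT z|Mrc 1 T. (DL T w h z + Nop T h h z)^2 * wt \<alpha> lam z) = (LINT z|Mrc 1 T. ?DN z * ?DN z * wt \<alpha> lam z)"
  by (simp add: power2_eq_square)
 then have "\<bar>LINT z|Mrc 1 T. (DL T w h z + Nop T h h z)^2 * wt \<alpha> lam z\<bar> \<le> (l2 (Mrc 1 T) ?DN)^2"
  using weighted_cauchy_schwarz[OF DN DN al(1,2)] by (simp add: power2_eq_square)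
 also have "\<dots> \<le> (?k * nS 3 T h)^2" by (intro power_mono l Lsq.nrm_nonneg DN)
 finally have 1: "\<bar>LINT z|Mrc 1 T. (DL T w h z + Nop T h h z)^2 * wt \<alpha> lam z\<bar> \<le> ?k^2 * (nS 3 T h)^2" by (simp add: power_mult_distrib)
 have "\<bar>LINT z|Mrc 1 T. Lop T w z * Nop T h h z * wt \<alpha> lam z\<bar> \<le> l2 (Mrc 1 T) (Lop T w) * l2 (Mrc 1 T) (Nop T h h)"
  by (rule weighted_cauchy_schwarz[OF Lop_Lsq[OF T w2] Nop_Lsq(1)[OF T h2 h2] al(1,2)])
 also have "\<dots> \<le> l2 (Mrc 1 T) (Lop T w) * (cN T * (nS 3 T h)^2)" by (intro mult_left_mono DL_l2(2)[OF T w h] LN)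
 finally have 2: "\<bar>LINT z|Mrc 1 T. Lop T w z * Nop T h h z * wt \<alpha> lam z\<bar> \<le> \<dots>" .
 have 3: "\<bar>\<beta> * (nS 3 T h)^2\<bar> = \<beta> * (nS 3 T h)^2" using al by simp
 have "\<bar>rem_part T \<alpha> lam \<beta> w h\<bar> \<le> ?k^2 * (nS 3 T h)^2 + 2 * (l2 (Mrc 1 T) (Lop T w) * (cN T * (nS 3 T h)^2)) + \<beta> * (nS 3 T h)^2"
  unfolding rem_part_def using 1 2 3 by linarith
 then show "\<bar>rem_part T \<alpha> lam \<beta> w h\<bar> \<le> ?C * (nS 3 T h)^2" by (simp add: algebra_simps)
qed

section \<open>Weighted estimates of the nonlinear terms\<close>

text \<open>The weighted energy of the first derivatives, which controls every lower order term.\<close>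

abbreviation EE :: "real => real => real => pfun => real" where
 "EE T \<alpha> lam h \<equiv> (LINT z|Mrc 1 T. ((dx T h z)^2 + (dt T h z)^2) * wt \<alpha> lam z)"

lemma EE_integrable:
 assumes h: "h \<in> S 2 T" and al: "\<alpha> \<ge> 0" "lam \<ge> 0"
 shows "integrable (Mrc 1 T) (\<lambda>z. ((dx T h z)^2 + (dt T h z)^2) * wt \<alpha> lam z)"
 using Bochner_Integration.integrable_add[OF wt_integrable_sq[OF D_Lsq(1)[OF h] al] wt_integrable_sq[OF D_Lsq(2)[OF h] al]]
 by (simp add: distrib_right)

lemma EE_nonneg: "EE T \<alpha> lam h \<ge> 0"
 by (intro integral_nonneg_AE AE_I2) (simp add: less_imp_le[OF wt_pos])

lemma dx_sq_le_EE:
 assumes h: "h \<in> S 2 T" and al: "\<alpha> \<ge> 0" "lam \<ge> 0"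
 shows "(LINT z|Mrc 1 T. (dx T h z)^2 * wt \<alpha> lam z) \<le> EE T \<alpha> lam h"
 by (rule integral_mono[OF wt_integrable_sq[OF D_Lsq(1)[OF h] al] EE_integrable[OF h al]])
  (simp add: mult_right_mono less_imp_le[OF wt_pos])

text \<open>Here the increment carries the derivatives and the coefficients are bounded functions.\<close>

lemma Nop_weighted_first:
 assumes T: "T > 0" and a: "a \<in> S 2 T" and b: "b \<in> S 2 T" and al: "\<alpha> \<ge> 0" "lam \<ge> 0"
 shows "(LINT z|Mrc 1 T. (Nop T a b z)^2 * wt \<alpha> lam z) \<le> 24 * c0 T * (nS 2 T b)^2 * EE T \<alpha> lam a"
proof -
 let ?c = "24 * c0 T * (nS 2 T b)^2"
 have "(LINT z|Mrc 1 T. (Nop T a b z)^2 * wt \<alpha> lam z) \<le> (LINT z|Mrc 1 T. ?c * (((dx T a z)^2 + (dt T a z)^2) * wt \<alpha> lam z))"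
 proof (rule integral_mono_AE[OF wt_integrable_sq[OF Nop_Lsq(1)[OF T a b] al]])
  show "integrable (Mrc 1 T) (\<lambda>z. ?c * (((dx T a z)^2 + (dt T a z)^2) * wt \<alpha> lam z))"
   by (rule integrable_mult_right) (use EE_integrable[OF a al] in auto)
  show "AE z in Mrc 1 T. (Nop T a b z)^2 * wt \<alpha> lam z \<le> ?c * (((dx T a z)^2 + (dt T a z)^2) * wt \<alpha> lam z)"
   using Nop_bound[OF T a b]
  proof eventually_elim
   case (elim z)
   from mult_right_mono[OF elim less_imp_le[OF wt_pos[of \<alpha> lam z]]] show ?case by (simp only: mult.assoc)
  qed
 qed
 also have "\<dots> = ?c * EE T \<alpha> lam a" by (rule integral_mult_right_zero)
 finally show ?thesis .
qed

lemma coefficient_Lsq: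
 assumes T: "T > 0" and f: "f \<in> Lsq (Mrc 1 T)" and h: "h \<in> S 2 T"
 shows "(\<lambda>z. f z * prim (dx T h) z) \<in> Lsq (Mrc 1 T)" "(\<lambda>z. f z * h z) \<in> Lsq (Mrc 1 T)"
proof -
 let ?c = "sqrt (c0 T * (nS 2 T h)^2)"
 have ae: "AE z in Mrc 1 T. \<bar>prim (dx T h) z\<bar> \<le> ?c \<and> \<bar>h z\<bar> \<le> ?c"
  using coefficient_bound[OF T h] by eventually_elim (auto intro: real_le_rsqrt)
 have 1: "AE z in Mrc 1 T. \<bar>prim (dx T h) z\<bar> \<le> ?c" and 2: "AE z in Mrc 1 T. \<bar>h z\<bar> \<le> ?c"
  using ae by (auto elim: eventually_mono)
 show "(\<lambda>z. f z * prim (dx T h) z) \<in> Lsq (Mrc 1 T)"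
  by (rule Lsq_bounded_mult[OF f prim_dx_Lsq_measurable[OF h] 1])
 show "(\<lambda>z. f z * h z) \<in> Lsq (Mrc 1 T)"
  by (rule Lsq_bounded_mult[OF f Lsq_measurable[OF Lsq_sob[OF h]] 2])
qed

text \<open>The key gain: in the products in which h occurs undifferentiated or under the integral, h is
 recovered from its x-derivative, at the price of a constant that stays bounded as \<open>\<lambda>\<close> grows, while the
 coefficient f is only required to be square integrable along lines.\<close>

lemma trilinear_weighted:
 assumes T: "T > 0" and f: "mix 1 T f K" and K: "K \<ge> 0" and h: "h \<in> S 2 T" and h0: "trace_x 1 T 0 h (\<lambda>_. 0)"
  and al: "0 < \<alpha>" "\<alpha> \<le> 1" "1 \<le> lam"
 shows "(LINT z|Mrc 1 T. (f z * prim (dx T h) z)^2 * wt \<alpha> lam z) \<le> K / (2 * \<alpha>) * EE T \<alpha> lam h"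
  and "(LINT z|Mrc 1 T. (f z * h z)^2 * wt \<alpha> lam z) \<le> K / (2 * \<alpha>) * EE T \<alpha> lam h"
proof -
 have al': "\<alpha> \<ge> 0" "lam \<ge> 0" "lam > 0" using al by auto
 let ?I = "LINT z|Mrc 1 T. (dx T h z)^2 * wt \<alpha> lam z"
 have I: "?I \<ge> 0" by (intro integral_nonneg_AE AE_I2) (simp add: less_imp_le[OF wt_pos])
 have *: "c * K * ?I \<le> K / (2 * \<alpha>) * EE T \<alpha> lam h" if "c \<ge> 0" "c \<le> 1 / (2 * \<alpha>)" for c
 proof -
  have "c * K * ?I \<le> 1 / (2 * \<alpha>) * K * ?I" using that K I by (intro mult_right_mono) auto
  also have "\<dots> \<le> 1 / (2 * \<alpha>) * K * EE T \<alpha> lam h" using al K by (intro mult_left_mono dx_sq_le_EE[OF h al'(1,2)]) auto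
  finally show ?thesis by simp
 qed
 have "(LINT z|Mrc 1 T. (f z * prim (dx T h) z)^2 * wt \<alpha> lam z) \<le> 1 / (2 * (lam * \<alpha>)) * K * ?I"
  by (rule weighted_product_x[OF al'(1,2) f coefficient_Lsq(1)[OF T mix_Lsq[OF f] h] D_Lsq(1)[OF h] _ prim_weighted[OF al(1) al'(3) D_Lsq(1)[OF h]]])
   (use al in simp)
 also have "\<dots> \<le> K / (2 * \<alpha>) * EE T \<alpha> lam h" by (rule *) (use al in \<open>auto intro!: divide_left_mono\<close>)
 finally show "(LINT z|Mrc 1 T. (f z * prim (dx T h) z)^2 * wt \<alpha> lam z) \<le> K / (2 * \<alpha>) * EE T \<alpha> lam h" .
 have "(LINT z|Mrc 1 T. (f z * h z)^2 * wt \<alpha> lam z) \<le> 1 / (2 * lam) * K * ?I"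
  by (rule weighted_product_t[OF al'(1,2) f coefficient_Lsq(2)[OF T mix_Lsq[OF f] h] D_Lsq(1)[OF h] _ zero_trace_weighted[OF zero_less_one T al'(3) h0]])
   (use al in simp)
 also have "\<dots> \<le> K / (2 * \<alpha>) * EE T \<alpha> lam h"
  by (rule *) (use al in \<open>auto intro!: divide_left_mono\<close>)
 finally show "(LINT z|Mrc 1 T. (f z * h z)^2 * wt \<alpha> lam z) \<le> K / (2 * \<alpha>) * EE T \<alpha> lam h" .
qed

text \<open>Here the derivatives fall on w, which are not bounded functions, and the increment is undifferentiated
 or under the integral.\<close>

lemma Nop_weighted_second:
 assumes T: "T > 0" and w: "w \<in> S 2 T" and h: "h \<in> S 2 T" and h0: "trace_x 1 T 0 h (\<lambda>_. 0)"
  and al: "0 < \<alpha>" "\<alpha> \<le> 1" "1 \<le> lam"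
 shows "(LINT z|Mrc 1 T. (Nop T w h z)^2 * wt \<alpha> lam z) \<le> 18 * kk T / \<alpha> * (nS 2 T w)^2 * EE T \<alpha> lam h"
proof -
 have al': "\<alpha> \<ge> 0" "lam \<ge> 0" using al by auto
 let ?K = "kk T * (nS 2 T w)^2"
 have K: "?K \<ge> 0" using kk_pos[OF T] by simp
 note mx = D_mix(1)[OF T w] and mt = D_mix(2)[OF T w]
 note i = wt_integrable_sq[OF coefficient_Lsq(1)[OF T mix_Lsq[OF mx] h] al'] wt_integrable_sq[OF coefficient_Lsq(2)[OF T mix_Lsq[OF mx] h] al']
  wt_integrable_sq[OF coefficient_Lsq(1)[OF T mix_Lsq[OF mt] h] al']
 let ?P = "prim (dx T h)" and ?w = "wt \<alpha> lam"
 have "(LINT z|Mrc 1 T. (Nop T w h z)^2 * ?w z) \<le> (LINT z|Mrc 1 T. 12 * ((dx T w z * ?P z)^2 * ?w z + (dx T w z * h z)^2 * ?w z + (dt T w z * ?P z)^2 * ?w z))"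
 proof (rule integral_mono[OF wt_integrable_sq[OF Nop_Lsq(1)[OF T w h] al']])
  show "integrable (Mrc 1 T) (\<lambda>z. 12 * ((dx T w z * ?P z)^2 * ?w z + (dx T w z * h z)^2 * ?w z + (dt T w z * ?P z)^2 * ?w z))"
   by (intro integrable_mult_right Bochner_Integration.integrable_add i)
  show "(Nop T w h z)^2 * ?w z \<le> 12 * ((dx T w z * ?P z)^2 * ?w z + (dx T w z * h z)^2 * ?w z + (dt T w z * ?P z)^2 * ?w z)" for z
   using mult_right_mono[OF Nop_sq_le[of T w h z] less_imp_le[OF wt_pos[of \<alpha> lam z]]] by (simp only: distrib_left distrib_right mult.assoc)
 qed
 also have "\<dots> = 12 * ((LINT z|Mrc 1 T. (dx T w z * ?P z)^2 * ?w z) + (LINT z|Mrc 1 T. (dx T w z * h z)^2 * ?w z) + (LINT z|Mrc 1 T. (dt T w z * ?P z)^2 * ?w z))"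
  unfolding integral_mult_right_zero Bochner_Integration.integral_add[OF Bochner_Integration.integrable_add[OF i(1,2)] i(3)]
   Bochner_Integration.integral_add[OF i(1,2)] ..
 also have "\<dots> \<le> 12 * (?K / (2 * \<alpha>) * EE T \<alpha> lam h + ?K / (2 * \<alpha>) * EE T \<alpha> lam h + ?K / (2 * \<alpha>) * EE T \<alpha> lam h)"
  using trilinear_weighted[OF T mx K h h0 al] trilinear_weighted(1)[OF T mt K h h0 al] by (intro mult_left_mono add_mono) auto
 finally show ?thesis using al by (simp add: field_simps)
qed

text \<open>For w in \<open>H\<^sup>3\<close> the second derivatives are in \<open>H\<^sup>1\<close>, hence square integrable along lines.\<close>

lemma Lop_mix:
 assumes T: "T > 0" and w: "w \<in> S 3 T" and D: "nS 3 T w \<le> D"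
 shows "mix 1 T (Lop T w) (32 * kk T * D^2 + 96 * c0 T * kk T * D ^ 4)"
proof -
 have w2: "w \<in> S 2 T" by (rule sobolev_mono[OF _ w]) simp
 have n0: "0 \<le> nS 3 T w" by (rule Sob.nrm_nonneg[OF w])
 have n2: "(nS 2 T w)^2 \<le> D^2"
  using sob_norm_mono[of 2 3 "rc 1 T" w] D Sob.nrm_nonneg[OF w2] by (intro power_mono) auto
 let ?K = "kk T * D^2"
 have le: "kk T * (nS 1 T (wderiv (rc 1 T) i j w))^2 \<le> ?K" if "1 + i + j \<le> 3" for i j
  using sob_norm_wderiv_le[OF w that] Sob.nrm_nonneg[OF rc.sobolev_wderiv[OF w that]] D
  by (intro mult_left_mono power_mono less_imp_le[OF kk_pos[OF T]]) auto
 have m: "mix 1 T (wderiv (rc 1 T) i j w) ?K" if "1 + i + j \<le> 3" for i j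
  using mix_mono[OF sobolev_1_mix[OF zero_less_one T rc.sobolev_wderiv[OF w that], folded kk_def] le[OF that]] .
 have 1: "mix 1 T (Fop T w) (8 * (?K + ?K))"
 proof (rule mix_dom[OF Lsq_measurable[OF Fop_Lsq[OF w2]] _ _ m m])
  show "AE z in Mrc 1 T. (Fop T w z)^2 \<le> 8 * ((wderiv (rc 1 T) 2 0 w z)^2 + (wderiv (rc 1 T) 1 1 w z)^2)"
  proof (intro AE_I2)
   have *: "(p - 2 * q)^2 \<le> 8 * (p^2 + q^2)" for p q :: real
   proof -
    have "8 * (p^2 + q^2) - (p - 2 * q)\<^sup>2 = 3 * p^2 + (2 * p + 2 * q) ^ 2 - 4 * (p * q)" by (simp add: power2_eq_square algebra_simps)
    moreover have "8 * (p^2 + q^2) - (p - 2 * q)\<^sup>2 = 5 * p^2 + 2 * q^2 + 2 * (p + q)^2" by (simp add: power2_eq_square algebra_simps)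
    ultimately show ?thesis by (smt (verit) zero_le_power2)
   qed
   show "(Fop T w z)^2 \<le> 8 * ((wderiv (rc 1 T) 2 0 w z)^2 + (wderiv (rc 1 T) 1 1 w z)^2)" for z
    unfolding Fop_def by (rule *)
  qed
 qed simp_all
 have c: "24 * c0 T * D^2 \<ge> 0" using c0_pos[OF T] by simp
 have 2: "mix 1 T (Nop T w w) (24 * c0 T * D^2 * (?K + ?K))"
 proof (rule mix_dom[OF Nop_measurable[OF w2 w2] _ c m m])
  show "AE z in Mrc 1 T. (Nop T w w z)^2 \<le> 24 * c0 T * D^2 * ((dx T w z)^2 + (dt T w z)^2)"
   using Nop_bound[OF T w2 w2]
  proof eventually_elim
   case (elim z)
   note elim
   also have "24 * c0 T * (nS 2 T w)^2 * ((dx T w z)^2 + (dt T w z)^2) \<le> 24 * c0 T * D^2 * ((dx T w z)^2 + (dt T w z)^2)"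
    using n2 c0_pos[OF T] by (intro mult_right_mono mult_left_mono) auto
   finally show ?case .
  qed
 qed simp_all
 have "mix 1 T (Lop T w) (2 * (8 * (?K + ?K) + 24 * c0 T * D^2 * (?K + ?K)))"
 proof (rule mix_dom[OF Lsq_measurable[OF Lop_Lsq[OF T w2]] _ _ 1 2])
  show "AE z in Mrc 1 T. (Lop T w z)^2 \<le> 2 * ((Fop T w z)^2 + (Nop T w w z)^2)"
   unfolding Lop_eq power2_sum using sum_squares_bound[of "Fop T w _" "Nop T w w _"]
   by (intro AE_I2) (simp add: add_ac)
 qed simp
 then show ?thesis by (simp add: algebra_simps power2_eq_square power4_eq_xxxx)
qed

text \<open>The product of L(w) with the bilinear form of h is split so that each factor L(w) is paired with h
 itself or with its primitive, never with a derivative of h.\<close>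

lemma cubic_term_lower:
 assumes T: "T > 0" and f: "mix 1 T f K" and K: "K \<ge> 0" and h: "h \<in> S 2 T" and h0: "trace_x 1 T 0 h (\<lambda>_. 0)"
  and al: "0 < \<alpha>" "\<alpha> \<le> 1" "1 \<le> lam"
 shows "2 * (LINT z|Mrc 1 T. f z * Nop T h h z * wt \<alpha> lam z) \<ge> - (4 + 3 * K / \<alpha>) * EE T \<alpha> lam h"
proof -
 have al': "\<alpha> \<ge> 0" "lam \<ge> 0" using al by auto
 let ?P = "prim (dx T h)" and ?w = "wt \<alpha> lam"
 note fL = mix_Lsq[OF f]
 note i = EE_integrable[OF h al'] wt_integrable_sq[OF coefficient_Lsq(1)[OF T fL h] al'] wt_integrable_sq[OF coefficient_Lsq(2)[OF T fL h] al']
 have pt: "- (2 * (f * (2 * p * P - 2 * p * u - 2 * q * P))) \<le> 4 * (p^2 + q^2) + 4 * (f * P)^2 + 2 * (f * u)^2" for f p q P u :: real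
 proof -
  have "0 \<le> 2 * (p + f * P)^2 + 2 * (p - f * u)^2 + 2 * (q - f * P)^2 + 2 * q^2" by simp
  then show ?thesis by (simp add: power2_eq_square algebra_simps)
 qed
 have "- 2 * (LINT z|Mrc 1 T. f z * Nop T h h z * ?w z) = (LINT z|Mrc 1 T. - 2 * (f z * Nop T h h z * ?w z))" by simp
 also have "\<dots> \<le> (LINT z|Mrc 1 T. 4 * (((dx T h z)^2 + (dt T h z)^2) * ?w z) + 4 * ((f z * ?P z)^2 * ?w z) + 2 * ((f z * h z)^2 * ?w z))"
 proof (rule integral_mono)
  show "integrable (Mrc 1 T) (\<lambda>z. - 2 * (f z * Nop T h h z * ?w z))"
   by (intro integrable_mult_right wt_integrable[OF fL Nop_Lsq(1)[OF T h h] al'])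
  show "integrable (Mrc 1 T) (\<lambda>z. 4 * (((dx T h z)^2 + (dt T h z)^2) * ?w z) + 4 * ((f z * ?P z)^2 * ?w z) + 2 * ((f z * h z)^2 * ?w z))"
   by (intro integrable_mult_right Bochner_Integration.integrable_add i)
  show "- 2 * (f z * Nop T h h z * ?w z) \<le> 4 * (((dx T h z)^2 + (dt T h z)^2) * ?w z) + 4 * ((f z * ?P z)^2 * ?w z) + 2 * ((f z * h z)^2 * ?w z)" for z
   using mult_right_mono[OF pt[of "f z" "dx T h z" "?P z" "h z" "dt T h z"] less_imp_le[OF wt_pos[of \<alpha> lam z]]]
   unfolding Nop_def by (simp only: distrib_right minus_mult_left mult.assoc)
 qed
 also have "\<dots> = 4 * EE T \<alpha> lam h + 4 * (LINT z|Mrc 1 T. (f z * ?P z)^2 * ?w z) + 2 * (LINT z|Mrc 1 T. (f z * h z)^2 * ?w z)"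
  using i by simp
 also have "\<dots> \<le> 4 * EE T \<alpha> lam h + 4 * (K / (2 * \<alpha>) * EE T \<alpha> lam h) + 2 * (K / (2 * \<alpha>) * EE T \<alpha> lam h)"
  using trilinear_weighted[OF T f K h h0 al] by linarith
 also have "\<dots> = (4 + 3 * K / \<alpha>) * EE T \<alpha> lam h" using al by (simp add: field_simps)
 finally show ?thesis by (simp only: mult_minus_left)
qed

text \<open>The sum of the constants of all terms that are controlled by the weighted energy of the first
 derivatives, for points of norm at most D and increments of norm at most 2D.\<close>

definition Gam :: "real => real => real => real" where
 "Gam T \<alpha> D = 3 * (18 * kk T / \<alpha> * D^2 + 120 * c0 T * D^2) + 4 + 3 * (32 * kk T * D^2 + 96 * c0 T * kk T * D ^ 4) / \<alpha>"

text \<open>\<open>(F + R)\<^sup>2 \<ge> F\<^sup>2/2 - R\<^sup>2\<close> separates the principal part F from the three bilinear terms R.\<close>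

lemma quadratic_part_lower:
 assumes T: "T > 0" and w: "w \<in> S 3 T" "nS 3 T w \<le> D" and h: "h \<in> S 3 T" "nS 3 T h \<le> 2 * D" and h0: "trace_x 1 T 0 h (\<lambda>_. 0)"
  and al: "0 < \<alpha>" "\<alpha> \<le> 1" "1 \<le> lam"
 shows "rem_part T \<alpha> lam \<beta> w h \<ge> 1/2 * (LINT z|Mrc 1 T. (Fop T h z)^2 * wt \<alpha> lam z) - Gam T \<alpha> D * EE T \<alpha> lam h + \<beta> * (nS 3 T h)^2"
proof -
 have al': "\<alpha> \<ge> 0" "lam \<ge> 0" using al by auto
 have w2: "w \<in> S 2 T" and h2: "h \<in> S 2 T" by (rule sobolev_mono[OF _ w(1)], simp, rule sobolev_mono[OF _ h(1)], simp)
 let ?w = "wt \<alpha> lam" and ?E = "EE T \<alpha> lam h"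
 have E: "?E \<ge> 0" by (rule EE_nonneg)
 have nw: "(nS 2 T w)^2 \<le> D^2"
  using sob_norm_mono[of 2 3 "rc 1 T" w] w(2) Sob.nrm_nonneg[OF w2] by (intro power_mono) auto
 have "(nS 2 T h)^2 \<le> (2 * D)^2"
  using sob_norm_mono[of 2 3 "rc 1 T" h] h(2) Sob.nrm_nonneg[OF h2] by (intro power_mono) auto
 then have nh: "(nS 2 T h)^2 \<le> 4 * D^2" by (simp add: power_mult_distrib)
 note N = Nop_Lsq(1)[OF T w2 h2] Nop_Lsq(1)[OF T h2 w2] Nop_Lsq(1)[OF T h2 h2]
 note i = wt_integrable_sq[OF Fop_Lsq[OF h2] al'] wt_integrable_sq[OF N(1) al'] wt_integrable_sq[OF N(2) al'] wt_integrable_sq[OF N(3) al']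
 have pt: "(F + a + b + c)^2 \<ge> 1/2 * F^2 - 3 * (a^2 + b^2 + c^2)" for F a b c :: real
 proof -
  have "(F + (a + b + c))^2 \<ge> 1/2 * F^2 - (a + b + c)\<^sup>2"
  proof -
   have "0 \<le> 1/2 * (F + 2 * (a + b + c))^2" by simp
   then show ?thesis by (simp add: power2_eq_square algebra_simps)
  qed
  then show ?thesis using sq_sum3[of a b c] by (simp add: add.assoc)
 qed
 have "1/2 * (LINT z|Mrc 1 T. (Fop T h z)^2 * ?w z) - 3 * ((LINT z|Mrc 1 T. (Nop T w h z)^2 * ?w z)
   + (LINT z|Mrc 1 T. (Nop T h w z)^2 * ?w z) + (LINT z|Mrc 1 T. (Nop T h h z)^2 * ?w z))
  = (LINT z|Mrc 1 T. 1/2 * ((Fop T h z)^2 * ?w z) - 3 * ((Nop T w h z)^2 * ?w z + (Nop T h w z)^2 * ?w z + (Nop T h h z)^2 * ?w z))"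
  using i by simp
 also have "\<dots> \<le> (LINT z|Mrc 1 T. (DL T w h z + Nop T h h z)^2 * ?w z)"
 proof (rule integral_mono)
  show "integrable (Mrc 1 T) (\<lambda>z. 1/2 * ((Fop T h z)^2 * ?w z) - 3 * ((Nop T w h z)^2 * ?w z + (Nop T h w z)^2 * ?w z + (Nop T h h z)^2 * ?w z))"
   using i by simp
  show "integrable (Mrc 1 T) (\<lambda>z. (DL T w h z + Nop T h h z)^2 * ?w z)"
   using wt_integrable_sq[OF Lsq.add[OF DL_Lsq[OF T w2 h2] N(3)] al'] by simp
  show "1/2 * ((Fop T h z)^2 * ?w z) - 3 * ((Nop T w h z)^2 * ?w z + (Nop T h w z)^2 * ?w z + (Nop T h h z)^2 * ?w z)
    \<le> (DL T w h z + Nop T h h z)^2 * ?w z" for z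
   using mult_right_mono[OF pt[of "Fop T h z" "Nop T w h z" "Nop T h w z" "Nop T h h z"] less_imp_le[OF wt_pos[of \<alpha> lam z]]]
   unfolding DL_def by (simp only: left_diff_distrib distrib_right mult.assoc)
 qed
 finally have 1: "(LINT z|Mrc 1 T. (DL T w h z + Nop T h h z)^2 * ?w z) \<ge> 1/2 * (LINT z|Mrc 1 T. (Fop T h z)^2 * ?w z) - 3 * ((LINT z|Mrc 1 T. (Nop T w h z)^2 * ?w z)
   + (LINT z|Mrc 1 T. (Nop T h w z)^2 * ?w z) + (LINT z|Mrc 1 T. (Nop T h h z)^2 * ?w z))" .
 have 2: "(LINT z|Mrc 1 T. (Nop T w h z)^2 * ?w z) \<le> 18 * kk T / \<alpha> * D^2 * ?E"
  by (rule order_trans[OF Nop_weighted_second[OF T w2 h2 h0 al]]) (use nw kk_pos[OF T] al E in \<open>intro mult_right_mono mult_left_mono; simp\<close>)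
 have 3: "(LINT z|Mrc 1 T. (Nop T h w z)^2 * ?w z) \<le> 24 * c0 T * D^2 * ?E"
  by (rule order_trans[OF Nop_weighted_first[OF T h2 w2 al']]) (use nw c0_pos[OF T] E in \<open>intro mult_right_mono mult_left_mono; simp\<close>)
 have 4: "(LINT z|Mrc 1 T. (Nop T h h z)^2 * ?w z) \<le> 24 * c0 T * (4 * D^2) * ?E"
  by (rule order_trans[OF Nop_weighted_first[OF T h2 h2 al']]) (use nh c0_pos[OF T] E in \<open>intro mult_right_mono mult_left_mono; simp\<close>)
 let ?KL = "32 * kk T * D^2 + 96 * c0 T * kk T * D ^ 4"
 have KL: "?KL \<ge> 0" using kk_pos[OF T] c0_pos[OF T] by simp
 have 5: "2 * (LINT z|Mrc 1 T. Lop T w z * Nop T h h z * ?w z) \<ge> - (4 + 3 * ?KL / \<alpha>) * ?E"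
  by (rule cubic_term_lower[OF T Lop_mix[OF T w] KL h2 h0 al])
 have 6: "Gam T \<alpha> D * ?E = 3 * (18 * kk T / \<alpha> * D^2 * ?E + 24 * c0 T * D^2 * ?E + 24 * c0 T * (4 * D^2) * ?E) + (4 + 3 * ?KL / \<alpha>) * ?E"
  unfolding Gam_def by (simp only: distrib_right mult.assoc) (simp add: algebra_simps)
 have *: "1/2 * f - (3 * (a + b + c) + d) + n \<le> q + r + n"
  if "q \<ge> 1/2 * f - 3 * (a' + b' + c')" "a' \<le> a" "b' \<le> b" "c' \<le> c" "r \<ge> - d" for f a b c d n q r a' b' c' :: real
  using that by (simp add: field_simps)
 show ?thesis unfolding rem_part_def 6 by (rule *[OF 1 2 3 4 5[unfolded mult_minus_left]])
qed

subsection \<open>Absorption by the Carleman estimate\<close>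

text \<open>The reciprocal of the constant in the Carleman estimate.\<close>

definition carl :: "real => real" where "carl \<alpha> = 1 / (1 / (1 - 2 * \<alpha>) + 1)"

lemma carl_pos: "\<alpha> < 1/2 ==> carl \<alpha> > 0" by (simp add: carl_def add_pos_pos)

text \<open>The pure arithmetic of the proof. The energy E has the factor \<open>C\<lambda>\<close> against the fixed G, so a large \<open>\<lambda>\<close>
 absorbs \<open>G E\<close>. The unfavourable terms XT, YT at \<open>t = T\<close> have the factor \<open>e\<^sup>2\<close> with \<open>e = exp(-\<lambda>\<alpha>T)\<close>; one
 factor e beats the powers of \<open>\<lambda>\<close>, the other one is at most \<open>\<beta>/2\<close>.\<close>

lemma absorption:
 fixes C lam E U X Y XT YT k n e G F \<beta> :: real
 assumes F: "F \<ge> C * (lam * E + lam ^ 3 * U + lam * X + lam ^ 3 * Y - lam * e^2 * XT - lam ^ 3 * e^2 * YT)"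
  and pos: "C > 0" "lam \<ge> 1" "E \<ge> 0" "U \<ge> 0" "X \<ge> 0" "Y \<ge> 0" "n \<ge> 0" "e > 0"
  and XT: "XT \<le> k * n" and YT: "YT \<le> k * n" and k: "k \<ge> 0"
  and lam: "C * lam ^ 3 * k * e \<le> 1" "C * lam \<ge> 4 * G" and \<beta>: "\<beta> \<ge> 2 * e"
 shows "1/2 * F - G * E + \<beta> * n \<ge> C / 4 * (E + U + X + Y) + \<beta> / 2 * n"
proof -
 have l3: "lam ^ 3 \<ge> 1" "lam \<le> lam ^ 3" using pos(2) by (simp, metis power_increasing[of 1 3 lam] one_le_numeral power_one_right)
 have "lam * e^2 * XT + lam ^ 3 * e^2 * YT \<le> lam * e^2 * (k * n) + lam ^ 3 * e^2 * (k * n)"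
  using XT YT pos l3 by (intro add_mono mult_left_mono) auto
 also have "\<dots> \<le> lam ^ 3 * e^2 * (k * n) + lam ^ 3 * e^2 * (k * n)"
  using l3 k pos by (intro add_mono mult_right_mono) auto
 finally have "C * (lam * e^2 * XT + lam ^ 3 * e^2 * YT) \<le> C * (2 * (lam ^ 3 * e^2 * (k * n)))"
  using less_imp_le[OF pos(1)] unfolding mult_2[of "lam ^ 3 * e^2 * (k * n)"] by (rule mult_left_mono)
 also have "\<dots> = 2 * e * n * (C * lam ^ 3 * k * e)" by (simp add: power2_eq_square)
 also have "\<dots> \<le> 2 * e * n * 1" using lam(1) pos by (intro mult_left_mono) auto
 also have "\<dots> \<le> \<beta> * n" using \<beta> pos by (simp add: mult_right_mono)
 finally have 1: "C * (lam * e^2 * XT + lam ^ 3 * e^2 * YT) \<le> \<beta> * n" .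
 \<comment> \<open>a quarter of the energy term absorbs G and another quarter survives\<close>
 have 2: "C * lam * E \<ge> 4 * G * E" "C * lam * E \<ge> C * E" "C * (lam ^ 3 * U) \<ge> C * U" "C * (lam * X) \<ge> C * X" "C * (lam ^ 3 * Y) \<ge> C * Y"
 proof -
  show "C * lam * E \<ge> 4 * G * E" using lam(2) pos by (intro mult_right_mono) auto
  have m: "r * x \<ge> x" if "r \<ge> 1" "x \<ge> 0" for r x :: real using mult_right_mono[OF that] by simp
  show "C * lam * E \<ge> C * E" "C * (lam ^ 3 * U) \<ge> C * U" "C * (lam * X) \<ge> C * X" "C * (lam ^ 3 * Y) \<ge> C * Y"
   using pos l3 m unfolding mult.assoc by (intro mult_left_mono; simp)+
 qed
 have 3: "C * U \<ge> 0" "C * X \<ge> 0" "C * Y \<ge> 0" using pos by auto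
 have "F \<ge> C * lam * E + C * (lam ^ 3 * U) + C * (lam * X) + C * (lam ^ 3 * Y) - C * (lam * e^2 * XT + lam ^ 3 * e^2 * YT)"
  using F by (simp add: algebra_simps)
 then have "F \<ge> C * lam * E + C * U + C * X + C * Y - \<beta> * n" using 1 2 by linarith
 then show ?thesis using 2(1,2) 3 by (simp add: field_simps)
qed

lemma trace_t_T_bound:
 assumes T: "T > 0" and u: "u \<in> S 1 T" and n: "nS 1 T u \<le> N"
 shows "(LINT x|Mi 1. (trace_t T T u x)^2) \<le> (1 / T + 1) * N^2"
proof -
 have "(LINT x|Mi 1. (trace_t T T u x)^2) \<le> (1 / T + 1) * (nS 1 T u)^2"
  by (rule trace_y_bound[OF zero_less_one T _ trace_t_trace_y[OF T _ u]]) simp_all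
 also have "\<dots> \<le> (1 / T + 1) * N^2" using T n Sob.nrm_nonneg[OF u] by (intro mult_left_mono power_mono) auto
 finally show ?thesis .
qed

abbreviation lower_energy :: "real => real => real => pfun => real" where
 "lower_energy T \<alpha> lam h \<equiv> EE T \<alpha> lam h + (LINT z|Mrc 1 T. (h z)^2 * wt \<alpha> lam z)
   + (LINT x|Mi 1. (trace_t T 0 (dx T h) x)^2 * exp (- 2 * lam * x)) + (LINT x|Mi 1. (trace_t T 0 h x)^2 * exp (- 2 * lam * x))"

text \<open>What is required of the large parameter: the Carleman estimate holds, it beats the lower order terms,
 and the exponential beats the powers in the terms at \<open>t = T\<close>.\<close>

definition lam_ok :: "real => real => real => real => bool" where
 "lam_ok T \<alpha> D lam \<longleftrightarrow> lam \<ge> 3 / (1 - 2 * \<alpha>) \<and> lam \<ge> 1 \<and> carl \<alpha> * lam \<ge> 4 * Gam T \<alpha> D \<and>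
   carl \<alpha> * lam ^ 3 * (1 / T + 1) * exp (- lam * \<alpha> * T) \<le> 1"

theorem rem_part_lower:
 assumes T: "T > 0" and w: "w \<in> S 3 T" "nS 3 T w \<le> D" and h: "h \<in> S 3 T" "nS 3 T h \<le> 2 * D"
  and h0: "trace_x 1 T 0 h (\<lambda>_. 0)" and h1: "trace_x 1 T 0 (dx T h) (\<lambda>_. 0)"
  and al: "0 < \<alpha>" "\<alpha> < 1/2" and lam: "lam_ok T \<alpha> D lam" and \<beta>: "\<beta> \<ge> 2 * exp (- lam * \<alpha> * T)"
 shows "rem_part T \<alpha> lam \<beta> w h \<ge> carl \<alpha> / 4 * lower_energy T \<alpha> lam h + \<beta> / 2 * (nS 3 T h)^2"
proof -
 have lam': "lam \<ge> 3 / (1 - 2 * \<alpha>)" "lam \<ge> 1" "carl \<alpha> * lam \<ge> 4 * Gam T \<alpha> D"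
  "carl \<alpha> * lam ^ 3 * (1 / T + 1) * exp (- lam * \<alpha> * T) \<le> 1" using lam by (auto simp: lam_ok_def)
 have h2: "h \<in> S 2 T" and hs1: "h \<in> S 1 T" by (rule sobolev_mono[OF _ h(1)], simp)+
 have al1: "\<alpha> \<le> 1" using al by simp
 let ?P = "lam * EE T \<alpha> lam h + lam ^ 3 * (LINT z|Mrc 1 T. (h z)^2 * wt \<alpha> lam z)
   + lam * (LINT x|Mi 1. (trace_t T 0 (dx T h) x)^2 * exp (- 2 * lam * x))
   + lam ^ 3 * (LINT x|Mi 1. (trace_t T 0 h x)^2 * exp (- 2 * lam * x))
   - lam * (exp (- lam * \<alpha> * T))^2 * (LINT x|Mi 1. (trace_t T T (dx T h) x)^2)
   - lam ^ 3 * (exp (- lam * \<alpha> * T))^2 * (LINT x|Mi 1. (trace_t T T h x)^2)"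
 let ?F = "LINT z|Mrc 1 T. (Fop T h z)^2 * wt \<alpha> lam z"
 have e: "exp (- 2 * lam * \<alpha> * T) = (exp (- lam * \<alpha> * T))^2" by (simp flip: exp_double)
 have "?P \<le> (1 / (1 - 2 * \<alpha>) + 1) * ?F"
  using carleman[OF T al lam'(1,2) h2 h0 h1] unfolding Fop_def e .
 moreover have "1 / (1 - 2 * \<alpha>) + 1 > 0" using al by (simp add: add_pos_pos)
 ultimately have F: "?F \<ge> carl \<alpha> * ?P" unfolding carl_def by (simp add: pos_divide_le_eq mult.commute)
 have XT: "(LINT x|Mi 1. (trace_t T T (dx T h) x)^2) \<le> (1 / T + 1) * (nS 3 T h)^2"
 proof (rule trace_t_T_bound[OF T D_sob(1)[OF h2]])
  show "nS 1 T (dx T h) \<le> nS 3 T h" by (rule sob_norm_wderiv_le[OF h(1)]) simp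
 qed
 have YT: "(LINT x|Mi 1. (trace_t T T h x)^2) \<le> (1 / T + 1) * (nS 3 T h)^2"
  by (rule trace_t_T_bound[OF T hs1 sob_norm_mono]) simp
 have "1/2 * ?F - Gam T \<alpha> D * EE T \<alpha> lam h + \<beta> * (nS 3 T h)^2 \<ge> carl \<alpha> / 4 * lower_energy T \<alpha> lam h + \<beta> / 2 * (nS 3 T h)^2"
  by (rule absorption[OF F carl_pos[OF al(2)] lam'(2) EE_nonneg _ _ _ _ _ XT YT _ lam'(4,3) \<beta>])
   (use T in \<open>auto intro!: integral_nonneg_AE AE_I2 simp: less_imp_le[OF wt_pos]\<close>)
 then show ?thesis using quadratic_part_lower[OF T w h h0 al(1) al1 lam'(2), of \<beta>] by linarith
qed

section \<open>Restriction to the triangle\<close>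

lemma integral_lebesgue_on_superset:
 fixes f :: "'a::euclidean_space => real"
 assumes A: "A \<in> sets borel" "A' \<in> sets borel" "A \<subseteq> A'" and z: "\<And>x. x \<in> A' - A ==> f x = 0"
 shows "(LINT x|lebesgue_on A. f x) = (LINT x|lebesgue_on A'. f x)"
proof -
 have s: "A \<inter> space lebesgue \<in> sets lebesgue" "A' \<inter> space lebesgue \<in> sets lebesgue" using A by auto
 have "(\<lambda>x. indicator A x *\<^sub>R f x) = (\<lambda>x. indicator A' x *\<^sub>R f x)" using z A(3) by (intro ext) (auto simp: indicator_def)
 then show ?thesis unfolding integral_restrict_space[OF s(1)] integral_restrict_space[OF s(2)] by simp
qed

lemma integrable_lebesgue_on_subset:
 fixes f :: "'a::euclidean_space => real"
 assumes A: "A \<in> sets borel" "A' \<in> sets borel" "A \<subseteq> A'" and f: "integrable (lebesgue_on A') f"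
 shows "integrable (lebesgue_on A) f"
proof -
 have s: "A \<inter> space lebesgue \<in> sets lebesgue" "A' \<inter> space lebesgue \<in> sets lebesgue" using A by auto
 have "integrable lebesgue (\<lambda>x. indicator A x *\<^sub>R (indicator A' x *\<^sub>R f x))"
  by (rule integrable_mult_indicator) (use A f integrable_restrict_space[OF s(2), of f] in auto)
 moreover have "(\<lambda>x. indicator A x *\<^sub>R (indicator A' x *\<^sub>R f x)) = (\<lambda>x. indicator A x *\<^sub>R f x)"
  using A(3) by (intro ext) (auto simp: indicator_def)
 ultimately show ?thesis unfolding integrable_restrict_space[OF s(1)] by simp
qed

lemma Lsq_subset:
 fixes f :: "'a::euclidean_space => real"
 assumes A: "A \<in> sets borel" "A' \<in> sets borel" "A \<subseteq> A'" and f: "f \<in> Lsq (lebesgue_on A')"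
 shows "f \<in> Lsq (lebesgue_on A)"
 using measurable_restrict_mono[OF Lsq_measurable[OF f] A(3)] integrable_lebesgue_on_subset[OF A Lsq_integrable_sq[OF f]]
 by (simp add: Lsq_def)

text \<open>On the smaller set the weight is replaced by its lower bound c.\<close>

lemma subset_weighted_le:
 fixes g \<rho> :: "'a::euclidean_space => real"
 assumes A: "A \<in> sets borel" "A' \<in> sets borel" "A \<subseteq> A'" and g: "g \<in> Lsq (lebesgue_on A')"
  and i: "integrable (lebesgue_on A') (\<lambda>x. (g x)^2 * \<rho> x)" and \<rho>: "\<And>x. \<rho> x \<ge> 0" "\<And>x. x \<in> A ==> c \<le> \<rho> x"
 shows "c * (LINT x|lebesgue_on A. (g x)^2) \<le> (LINT x|lebesgue_on A'. (g x)^2 * \<rho> x)"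
proof -
 have iS: "integrable (lebesgue_on A) (\<lambda>x. (g x)^2 * \<rho> x)" by (rule integrable_lebesgue_on_subset[OF A i])
 have s: "A \<inter> space lebesgue \<in> sets lebesgue" "A' \<inter> space lebesgue \<in> sets lebesgue" using A by auto
 have "c * (LINT x|lebesgue_on A. (g x)^2) = (LINT x|lebesgue_on A. c * (g x)^2)" by simp
 also have "\<dots> \<le> (LINT x|lebesgue_on A. (g x)^2 * \<rho> x)"
 proof (rule integral_mono[OF _ iS])
  show "integrable (lebesgue_on A) (\<lambda>x. c * (g x)^2)" using Lsq_integrable_sq[OF Lsq_subset[OF A g]] by simp
  show "c * (g x)^2 \<le> (g x)^2 * \<rho> x" if "x \<in> space (lebesgue_on A)" for x
   using mult_left_mono[OF \<rho>(2)[of x], of "(g x)^2"] that by (simp add: mult.commute)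
 qed
 also have "\<dots> \<le> (LINT x|lebesgue_on A'. (g x)^2 * \<rho> x)"
  unfolding integral_restrict_space[OF s(1)] integral_restrict_space[OF s(2)]
 proof (rule integral_mono)
  show "integrable lebesgue (\<lambda>x. indicator A x *\<^sub>R ((g x)^2 * \<rho> x))" using iS unfolding integrable_restrict_space[OF s(1)] .
  show "integrable lebesgue (\<lambda>x. indicator A' x *\<^sub>R ((g x)^2 * \<rho> x))" using i unfolding integrable_restrict_space[OF s(2)] .
  show "indicator A x *\<^sub>R ((g x)^2 * \<rho> x) \<le> indicator A' x *\<^sub>R ((g x)^2 * \<rho> x)" for x
   using A(3) \<rho>(1)[of x] by (auto simp: indicator_def)
 qed
 finally show ?thesis .
qed

lemma has_wderiv_restrict:
 assumes A: "\<Omega>' \<in> sets borel" "\<Omega> \<in> sets borel" "\<Omega>' \<subseteq> \<Omega>" and h: "has_wderiv \<Omega> i j u v"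
 shows "has_wderiv \<Omega>' i j u v"
 unfolding has_wderiv_def
proof (intro allI impI, elim conjE)
 fix D :: "nat => nat => pfun"
 assume D: "smooth_jet D" and c: "compact_support_in \<Omega>' (D 0 0)"
 from c obtain K where K: "compact K" "K \<subseteq> \<Omega>'" "\<And>z. z \<notin> K ==> D 0 0 z = 0" unfolding compact_support_in_def by blast
 have v: "D i j z = 0" if "z \<in> \<Omega> - \<Omega>'" for i j z
  by (rule smooth_jet_vanish[OF D compact_imp_closed[OF K(1)] K(3)]) (use that K(2) in auto)
 have c': "compact_support_in \<Omega> (D 0 0)" unfolding compact_support_in_def using K A(3) by blast
 have "(LINT z|lebesgue_on \<Omega>. u z * D i j z) = (-1) ^ (i + j) * (LINT z|lebesgue_on \<Omega>. v z * D 0 0 z)"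
  using h D c' unfolding has_wderiv_def by blast
 moreover have "(LINT z|lebesgue_on \<Omega>'. u z * D i j z) = (LINT z|lebesgue_on \<Omega>. u z * D i j z)"
  by (rule integral_lebesgue_on_superset[OF A]) (simp add: v)
 moreover have "(LINT z|lebesgue_on \<Omega>'. v z * D 0 0 z) = (LINT z|lebesgue_on \<Omega>. v z * D 0 0 z)"
  by (rule integral_lebesgue_on_superset[OF A]) (simp add: v)
 ultimately show "(LINT z|lebesgue_on \<Omega>'. u z * D i j z) = (-1) ^ (i + j) * (LINT z|lebesgue_on \<Omega>'. v z * D 0 0 z)" by simp
qed

lemma has_wderiv1_restrict:
 assumes A: "A' \<in> sets borel" "A \<in> sets borel" "A' \<subseteq> A" and h: "has_wderiv1 A u v"
 shows "has_wderiv1 A' u v"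
 unfolding has_wderiv1_def
proof (intro allI impI, elim conjE)
 fix D :: "nat => real => real"
 assume D: "smooth_jet1 D" and c: "compact_support_in A' (D 0)"
 from c obtain K where K: "compact K" "K \<subseteq> A'" "\<And>z. z \<notin> K ==> D 0 z = 0" unfolding compact_support_in_def by blast
 have v: "D 0 z = 0" "D 1 z = 0" if z: "z \<in> A - A'" for z
 proof -
  have zK: "z \<in> - K" using z K(2) by auto
  then show "D 0 z = 0" using K(3) by simp
  have "(D 0 has_real_derivative D 1 z) (at z)" using D unfolding smooth_jet1_def by simp
  moreover have "(D 0 has_real_derivative 0) (at z)"
   by (rule has_field_derivative_transform_within_open[OF DERIV_const[of 0] open_Compl[OF compact_imp_closed[OF K(1)]] zK])
    (use K(3) in auto)
  ultimately show "D 1 z = 0" by (rule DERIV_unique)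
 qed
 have c': "compact_support_in A (D 0)" unfolding compact_support_in_def using K A(3) by blast
 have "(LINT z|lebesgue_on A. u z * D 1 z) = - (LINT z|lebesgue_on A. v z * D 0 z)"
  using h D c' unfolding has_wderiv1_def by blast
 moreover have "(LINT z|lebesgue_on A'. u z * D 1 z) = (LINT z|lebesgue_on A. u z * D 1 z)"
  by (rule integral_lebesgue_on_superset[OF A]) (simp add: v(2)[unfolded One_nat_def])
 moreover have "(LINT z|lebesgue_on A'. v z * D 0 z) = (LINT z|lebesgue_on A. v z * D 0 z)"
  by (rule integral_lebesgue_on_superset[OF A]) (simp add: v(1))
 ultimately show "(LINT z|lebesgue_on A'. u z * D 1 z) = - (LINT z|lebesgue_on A'. v z * D 0 z)" by simp
qed

text \<open>\<open>\<alpha> t < 2 \<alpha>\<close> gives \<open>t < 2 \<le> T\<close>.\<close>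

lemma Tr_subset: fixes T :: real assumes al: "0 < \<alpha>" "\<alpha> < 1/2" and ep: "0 < \<epsilon>" and T: "T \<ge> 2" shows "Tr \<alpha> \<epsilon> \<subseteq> rc 1 T"
proof
 fix z assume "z \<in> Tr \<alpha> \<epsilon>"
 then have z: "fst z + \<alpha> * snd z < 2 * \<alpha> - \<epsilon>" "fst z > 0" "snd z > 0" by (auto simp: Tr_def)
 have "\<alpha> * snd z > 0" using z(3) al(1) by simp
 then have "fst z < 1" using z(1) al(2) ep by linarith
 moreover have "\<alpha> * snd z < \<alpha> * 2" using z(1,2) ep by linarith
 then have "snd z < 2" using al(1) by simp
 ultimately show "z \<in> rc 1 T" using z(2,3) T by (cases z) (auto simp: rc_def)
qed

lemma dom_Tr: fixes T :: real assumes al: "0 < \<alpha>" "\<alpha> < 1/2" and ep: "0 < \<epsilon>" and T: "T \<ge> 2" shows "dom (Tr \<alpha> \<epsilon>)"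
proof
 have "Tr \<alpha> \<epsilon> = {z. fst z + \<alpha> * snd z < 2 * \<alpha> - \<epsilon>} \<inter> {z. 0 < fst z} \<inter> {z. 0 < snd z}" by (auto simp: Tr_def)
 moreover have "open {z :: real \<times> real. fst z + \<alpha> * snd z < 2 * \<alpha> - \<epsilon>}" "open {z :: real \<times> real. 0 < fst z}" "open {z :: real \<times> real. 0 < snd z}"
  by (intro open_Collect_less continuous_intros)+
 ultimately show "open (Tr \<alpha> \<epsilon>)" by auto
 show "bounded (Tr \<alpha> \<epsilon>)" by (rule bounded_subset[OF rc.bounded_dom Tr_subset[OF assms]])
qed

text \<open>The weight is at least \<open>exp(-2\<lambda>(2\<alpha> - \<epsilon>))\<close> on the triangle, and weak derivatives on the rectangle are
 weak derivatives on the triangle.\<close>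

lemma sob_norm_Tr_le:
 assumes T: "T \<ge> 2" and al: "0 < \<alpha>" "\<alpha> < 1/2" and ep: "0 < \<epsilon>" and lam: "lam \<ge> 0" and h: "h \<in> S 2 T"
 shows "exp (- 2 * lam * (2 * \<alpha> - \<epsilon>)) * (sob_norm 1 (Tr \<alpha> \<epsilon>) h)^2 \<le> EE T \<alpha> lam h + (LINT z|Mrc 1 T. (h z)^2 * wt \<alpha> lam z)"
proof -
 interpret Tr: dom "Tr \<alpha> \<epsilon>" by (rule dom_Tr[OF al ep T])
 let ?c = "exp (- 2 * lam * (2 * \<alpha> - \<epsilon>))"
 have al0: "\<alpha> \<ge> 0" using al by simp
 note sub = Tr.borel_dom rc.borel_dom Tr_subset[OF al ep T]
 have w: "?c \<le> wt \<alpha> lam z" if "z \<in> Tr \<alpha> \<epsilon>" for z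
 proof -
  have "fst z + \<alpha> * snd z \<le> 2 * \<alpha> - \<epsilon>" using that by (auto simp: Tr_def)
  from mult_left_mono[OF this, of "2 * lam"] show ?thesis using lam by (simp add: wt_eq)
 qed
 have 1: "?c * (l2 (lebesgue_on (Tr \<alpha> \<epsilon>)) (wderiv (Tr \<alpha> \<epsilon>) i j h))^2 \<le> (LINT z|Mrc 1 T. (wderiv (rc 1 T) i j h z)^2 * wt \<alpha> lam z)"
  if ij: "i + j \<le> 2" for i j
 proof -
  let ?v = "wderiv (rc 1 T) i j h"
  have vL: "?v \<in> Lsq (Mrc 1 T)" by (rule Lsq_wderiv[OF h ij])
  have vT: "?v \<in> Lsq (lebesgue_on (Tr \<alpha> \<epsilon>))" by (rule Lsq_subset[OF sub vL])
  have hw: "has_wderiv (Tr \<alpha> \<epsilon>) i j h ?v" by (rule has_wderiv_restrict[OF sub has_wderiv_wderiv[OF h ij]])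
  have "\<exists>v. v \<in> L2 (Tr \<alpha> \<epsilon>) \<and> has_wderiv (Tr \<alpha> \<epsilon>) i j h v" using vT hw unfolding L2_Lsq by blast
  from someI_ex[OF this] have m: "wderiv (Tr \<alpha> \<epsilon>) i j h \<in> Lsq (lebesgue_on (Tr \<alpha> \<epsilon>))"
   unfolding wderiv_def L2_Lsq by blast
  have ae: "AE z in lebesgue_on (Tr \<alpha> \<epsilon>). wderiv (Tr \<alpha> \<epsilon>) i j h z = ?v z"
   by (rule Tr.wderiv_eq[OF _ hw]) (use vT in \<open>simp add: L2_Lsq\<close>)
  show ?thesis unfolding l2_cong_AE[OF ae Lsq_measurable[OF m] Lsq_measurable[OF vT]] l2_sq
   by (rule subset_weighted_le[OF sub vL wt_integrable_sq[OF vL al0 lam] less_imp_le[OF wt_pos] w])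
 qed
 have h0: "(LINT z|Mrc 1 T. (wderiv (rc 1 T) 0 0 h z)^2 * wt \<alpha> lam z) = (LINT z|Mrc 1 T. (h z)^2 * wt \<alpha> lam z)"
 proof (rule integral_cong_AE)
  show "AE z in Mrc 1 T. (wderiv (rc 1 T) 0 0 h z)^2 * wt \<alpha> lam z = (h z)^2 * wt \<alpha> lam z"
   using rc.wderiv_00[OF sobolev_L2[OF h]] by eventually_elim simp
 qed (auto intro!: borel_measurable_integrable wt_integrable_sq Lsq_sob[OF h] Lsq_wderiv[OF h] al0 lam)
 have EE: "EE T \<alpha> lam h = (LINT z|Mrc 1 T. (dx T h z)^2 * wt \<alpha> lam z) + (LINT z|Mrc 1 T. (dt T h z)^2 * wt \<alpha> lam z)"
  using Bochner_Integration.integral_add[OF wt_integrable_sq[OF D_Lsq(1)[OF h] al0 lam] wt_integrable_sq[OF D_Lsq(2)[OF h] al0 lam]]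
  by (simp only: distrib_right)
 show ?thesis
  unfolding sob_norm_1_sq EE h0[symmetric] distrib_left using 1[of 0 0] 1[of 1 0] 1[of 0 1] by linarith
qed

text \<open>Two weak derivatives differ by a function that is orthogonal to all test functions.\<close>

lemma wderiv1_AE:
 assumes A: "open A" and bA: "bounded A" and v: "v \<in> L2 A" and h: "has_wderiv1 A u v"
 shows "wderiv1 A u \<in> L2 A" "AE x in lebesgue_on A. wderiv1 A u x = v x"
proof -
 have "\<exists>v. v \<in> L2 A \<and> has_wderiv1 A u v" using v h by blast
 from someI_ex[OF this] have w: "wderiv1 A u \<in> L2 A" "has_wderiv1 A u (wderiv1 A u)" unfolding wderiv1_def by blast+
 show "wderiv1 A u \<in> L2 A" by (rule w(1))
 have Ab: "A \<in> sets borel" using A by simp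
 have d: "(\<lambda>x. 1 * wderiv1 A u x + (-1) * v x) \<in> L2 A" by (rule L2_lin[OF w(1) v])
 have "AE x in lebesgue_on A. 1 * wderiv1 A u x + (-1) * v x = 0"
 proof (rule fundamental_lemma_line[OF A d])
  fix D :: "nat => real => real" assume D: "smooth_jet1 D" and c: "compact_support_in A (D 0)"
  have eq: "(LINT x|lebesgue_on A. wderiv1 A u x * D 0 x) = (LINT x|lebesgue_on A. v x * D 0 x)"
   using w(2) h D c unfolding has_wderiv1_def by fastforce
  have cD: "continuous_on UNIV (D 0)"
   using D unfolding smooth_jet1_def by (meson DERIV_isCont continuous_at_imp_continuous_on)
  have DL: "D 0 \<in> L2 A" by (rule continuous_L2[OF cD bA Ab])
  have i: "integrable (lebesgue_on A) (\<lambda>x. wderiv1 A u x * D 0 x)" "integrable (lebesgue_on A) (\<lambda>x. v x * D 0 x)"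
   by (rule L2_integrable_mult[OF w(1) DL], rule L2_integrable_mult[OF v DL])
  show "(LINT x|lebesgue_on A. (1 * wderiv1 A u x + (-1) * v x) * D 0 x) = 0"
   using i eq by (simp add: left_diff_distrib)
 qed
 then show "AE x in lebesgue_on A. wderiv1 A u x = v x" by eventually_elim simp
qed

text \<open>The weak derivative of the trace at \<open>t = 0\<close> is the trace of the x-derivative, which is what the
 Carleman estimate controls.\<close>

lemma H1_norm1_le:
 assumes T: "T > 0" and s: "0 < s" "s \<le> 1" and lam: "lam \<ge> 0" and h: "h \<in> S 2 T"
 shows "exp (- 2 * lam * s) * (H1_norm1 {0<..<s} (trace_t T 0 h))^2 \<le>
  (LINT x|Mi 1. (trace_t T 0 (dx T h) x)^2 * exp (- 2 * lam * x)) + (LINT x|Mi 1. (trace_t T 0 h x)^2 * exp (- 2 * lam * x))"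
proof -
 let ?c = "exp (- 2 * lam * s)" and ?g0 = "trace_t T 0 h" and ?g1 = "trace_t T 0 (dx T h)"
 have h1: "h \<in> S 1 T" by (rule sobolev_mono[OF _ h]) simp
 have t0: "trace_y 1 T 0 h ?g0" and t1: "trace_y 1 T 0 (dx T h) ?g1"
  by (rule trace_t_trace_y[OF T _ h1], simp, rule trace_t_trace_y[OF T _ D_sob(1)[OF h]], simp)
 note L0 = trace_y_Lsq[OF t0] and L1 = trace_y_Lsq[OF t1]
 have sub: "{0<..<s} \<in> sets borel" "{0<..<1::real} \<in> sets borel" "{0<..<s} \<subseteq> {0<..<1}" using s by auto
 have hw: "has_wderiv1 {0<..<s} ?g0 ?g1" by (rule has_wderiv1_restrict[OF sub trace_y_wderiv[OF zero_less_one T h t0 t1]])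
 have L1s: "?g1 \<in> L2 {0<..<s}" unfolding L2_Lsq by (rule Lsq_subset[OF sub L1])
 have bs: "bounded {0<..<s}" by simp
 note w = wderiv1_AE[OF open_greaterThanLessThan bs L1s hw]
 have "(LINT x|lebesgue_on {0<..<s}. (wderiv1 {0<..<s} ?g0 x)^2) = (LINT x|lebesgue_on {0<..<s}. (?g1 x)^2)"
 proof (rule integral_cong_AE)
  show "AE x in lebesgue_on {0<..<s}. (wderiv1 {0<..<s} ?g0 x)^2 = (?g1 x)^2" using w(2) by eventually_elim simp
 qed (use w(1) L1s in \<open>auto simp: L2_def\<close>)
 moreover have "(LINT x|lebesgue_on {0<..<s}. (?g0 x)^2) \<ge> 0" "(LINT x|lebesgue_on {0<..<s}. (?g1 x)^2) \<ge> 0" by auto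
 ultimately have H: "(H1_norm1 {0<..<s} ?g0)^2 = (LINT x|lebesgue_on {0<..<s}. (?g0 x)^2) + (LINT x|lebesgue_on {0<..<s}. (?g1 x)^2)"
  unfolding H1_norm1_def by simp
 have 1: "?c * (LINT x|lebesgue_on {0<..<s}. (g x)^2) \<le> (LINT x|Mi 1. (g x)^2 * exp (- 2 * lam * x))" if g: "g \<in> Lsq (Mi 1)" for g :: "real => real"
 proof (rule subset_weighted_le[OF sub g])
  show "integrable (Mi 1) (\<lambda>x. (g x)^2 * exp (- 2 * lam * x))"
  proof (rule Bochner_Integration.integrable_bound[OF Lsq_integrable_sq[OF g]])
   have "(\<lambda>x. exp (- 2 * lam * x)) \<in> borel_measurable (Mi 1)"
    by (rule continuous_measurable_lebesgue_on) (auto intro!: continuous_intros)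
   then show "(\<lambda>x. (g x)^2 * exp (- 2 * lam * x)) \<in> borel_measurable (Mi 1)" using Lsq_measurable[OF g] by simp
   show "AE x in Mi 1. norm ((g x)^2 * exp (- 2 * lam * x)) \<le> norm ((g x)^2)"
   proof (intro AE_I2)
    fix x assume "x \<in> space (Mi 1)"
    then have "exp (- 2 * lam * x) \<le> 1" using lam by simp
    from mult_left_mono[OF this, of "(g x)^2"] show "norm ((g x)^2 * exp (- 2 * lam * x)) \<le> norm ((g x)^2)" by (simp add: abs_mult)
   qed
  qed
  show "exp (- 2 * lam * s) \<le> exp (- 2 * lam * x)" if "x \<in> {0<..<s}" for x
   using that lam by (auto intro!: mult_left_mono)
 qed simp
 show ?thesis unfolding H distrib_left using 1[OF L0] 1[OF L1] by linarith
qed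

section \<open>The space of increments\<close>

lemma H30_iff: "h \<in> H30 T \<longleftrightarrow> h \<in> S 3 T \<and> trace_x 1 T 0 h (\<lambda>_. 0) \<and> trace_x 1 T 0 (dx T h) (\<lambda>_. 0)"
 using sobolev_mono[of 2 3 h "rc 1 T"] by (auto simp: H30_def H20_def has_trace_x_def trace_x_def rect_rc)

lemma H30_S: "h \<in> H30 T ==> h \<in> S 3 T" by (simp add: H30_iff)

lemma sob_norm_cong_AE:
 assumes "AE z in Mrc a b. u z = v z" "u \<in> borel_measurable (Mrc a b)" "v \<in> borel_measurable (Mrc a b)"
 shows "hn k a b u = hn k a b v"
 unfolding sob_norm_def sob_inner_def rc.wderiv_cong_AE[OF assms] ..

text \<open>The trace of the limit is bounded by the distance to the approximating functions with zero trace.\<close>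

lemma zero_trace_closed:
 assumes T: "T > 0" and f: "\<And>n::nat. trace_x 1 T 0 (f n) (\<lambda>_. 0)" and l: "l \<in> S 1 T" and lim: "(\<lambda>n. nS 1 T (f n - l)) \<leadsto> 0"
 shows "trace_x 1 T 0 l (\<lambda>_. 0)"
proof -
 obtain g where g: "trace_x 1 T 0 l g" using trace_x_ex[OF zero_less_one T _ l, of 0] by auto
 note gL = trace_xD(1)[OF g]
 have b: "(LINT t|Mi T. (g t)^2) \<le> 2 * (nS 1 T (f n - l))^2" for n
 proof -
  have "trace_x 1 T 0 (\<lambda>z. 1 * f n z + (-1) * l z) (\<lambda>t. 1 * 0 + (-1) * g t)" by (rule trace_x_lin[OF zero_less_one T f g])
  from trace_x_bound[OF zero_less_one T _ this]
  have "(LINT t|Mi T. (1 * 0 + (-1) * g t)^2) \<le> (1 / 1 + 1) * (nS 1 T (\<lambda>z. 1 * f n z + (-1) * l z))^2" by simp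
  moreover have "(\<lambda>z. 1 * f n z + (-1) * l z) = f n - l" by (simp add: fun_eq_iff)
  ultimately show ?thesis by simp
 qed
 have "(\<lambda>n. 2 * (nS 1 T (f n - l))^2) \<leadsto> 2 * 0^2" by (intro tendsto_intros lim)
 then have "(LINT t|Mi T. (g t)^2) \<le> 2 * 0^2" by (rule LIMSEQ_le_const) (intro exI[of _ 0] allI impI b)
 then have "(LINT t|Mi T. (g t)^2) \<le> 0" by simp
 then have "l2 (Mi T) g = 0" unfolding l2_sq[symmetric] by simp
 then have "AE t in Mi T. g t = 0" using l2_zero_iff[OF gL] by blast
 then show ?thesis by (rule trace_x_cong_trace[OF zero_less_one T g _ Lsq.zero])
qed

lemma nS_dx_diff:
 assumes u: "u \<in> S 3 T" and v: "v \<in> S 3 T" shows "nS 1 T (dx T u - dx T v) \<le> nS 3 T (u - v)"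
proof -
 have "nS 1 T (dx T u - dx T v) = nS 1 T (dx T (u - v))"
 proof (rule sob_norm_cong_AE)
  show "AE z in Mrc 1 T. (dx T u - dx T v) z = dx T (u - v) z"
   using rc.wderiv_diff[OF u v, of 1 0] by (auto elim: eventually_mono)
  show "dx T u - dx T v \<in> borel_measurable (Mrc 1 T)"
   by (intro Lsq_measurable Lsq.diff Lsq_wderiv[OF u] Lsq_wderiv[OF v]) simp_all
  show "dx T (u - v) \<in> borel_measurable (Mrc 1 T)"
   by (intro Lsq_measurable Lsq_wderiv[OF Sob.diff[OF u v]]) simp
 qed
 also have "\<dots> \<le> nS 3 T (u - v)" by (rule sob_norm_wderiv_le[OF Sob.diff[OF u v]]) simp
 finally show ?thesis .
qed

lemma H30_closed:
 assumes T: "T > 0" and f: "\<And>n::nat. f n \<in> H30 T" and l: "l \<in> S 3 T" and lim: "(\<lambda>n. nS 3 T (f n - l)) \<leadsto> 0"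
 shows "l \<in> H30 T"
proof -
 have f3: "f n \<in> S 3 T" for n using f[of n] by (rule H30_S)
 have l1: "l \<in> S 1 T" and l2: "dx T l \<in> S 1 T" by (rule sobolev_mono[OF _ l], simp, rule rc.sobolev_wderiv[OF l], simp)
 have fl: "f n - l \<in> S 1 T" "dx T (f n) - dx T l \<in> S 1 T" for n
  by (rule sobolev_mono[OF _ Sob.diff[OF f3 l]], simp, rule Sob.diff[OF rc.sobolev_wderiv[OF f3] l2], simp)
 have "(\<lambda>n. nS 1 T (f n - l)) \<leadsto> 0"
  by (rule tendsto_sandwich[OF always_eventually[OF allI[OF Sob.nrm_nonneg[OF fl(1)]]] always_eventually[OF allI[OF sob_norm_mono]] tendsto_const lim]) simp
 from zero_trace_closed[OF T _ l1 this] have 1: "trace_x 1 T 0 l (\<lambda>_. 0)" using f by (simp add: H30_iff)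
 have "(\<lambda>n. nS 1 T (dx T (f n) - dx T l)) \<leadsto> 0"
  by (rule tendsto_sandwich[OF always_eventually[OF allI[OF Sob.nrm_nonneg[OF fl(2)]]] always_eventually[OF allI[OF nS_dx_diff[OF f3 l]]] tendsto_const lim])
 from zero_trace_closed[OF T _ l2 this] have 2: "trace_x 1 T 0 (dx T l) (\<lambda>_. 0)" using f by (simp add: H30_iff)
 show ?thesis using l 1 2 by (simp add: H30_iff)
qed

lemma trace_x_dx_lin:
 assumes T: "T > 0" and u: "u \<in> S 3 T" "trace_x 1 T 0 (dx T u) g" and v: "v \<in> S 3 T" "trace_x 1 T 0 (dx T v) h"
 shows "trace_x 1 T 0 (dx T (\<lambda>z. p * u z + q * v z)) (\<lambda>t. p * g t + q * h t)"
 by (rule trace_x_cong_AE[OF trace_x_lin[OF zero_less_one T u(2) v(2)] rc.sobolev_wderiv[OF Sob.lin[OF u(1) v(1)]] rc.wderiv_lin[OF u(1) v(1)] zero_less_one T])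
  simp_all

lemma H30_lin:
 assumes T: "T > 0" and u: "u \<in> H30 T" and v: "v \<in> H30 T" shows "(\<lambda>z. p * u z + q * v z) \<in> H30 T"
proof -
 have U: "u \<in> S 3 T" "trace_x 1 T 0 u (\<lambda>_. 0)" "trace_x 1 T 0 (dx T u) (\<lambda>_. 0)"
  and V: "v \<in> S 3 T" "trace_x 1 T 0 v (\<lambda>_. 0)" "trace_x 1 T 0 (dx T v) (\<lambda>_. 0)" using u v by (auto simp: H30_iff)
 show ?thesis
  using Sob.lin[OF U(1) V(1), of p q] trace_x_lin[OF zero_less_one T U(2) V(2), of p q] trace_x_dx_lin[OF T U(1,3) V(1,3), of p q]
  by (simp add: H30_iff)
qed

lemma H30_diff: assumes "T > 0" "u \<in> H30 T" "v \<in> H30 T" shows "u - v \<in> H30 T"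
 using H30_lin[OF assms, of 1 "-1"] by (simp add: fun_diff_def)

lemma H30_zero: assumes T: "T > 0" shows "(\<lambda>_. 0) \<in> H30 T"
proof -
 obtain g where g: "trace_x 1 T 0 (\<lambda>_. 0) g" using trace_x_ex[OF zero_less_one T _ Sob.zero, of 0] by auto
 obtain h where h: "trace_x 1 T 0 (dx T (\<lambda>_. 0)) h"
  using trace_x_ex[OF zero_less_one T _ rc.sobolev_wderiv[OF Sob.zero[of 3], of 1 1 0], of 0] by auto
 show ?thesis
  using Sob.zero[of 3 1 T] trace_x_lin[OF zero_less_one T g g, of 0 0] trace_x_dx_lin[OF T Sob.zero h Sob.zero h, of 0 0]
  by (simp add: H30_iff)
qed

text \<open>Two functions with common boundary data differ by an admissible increment. \<close>

lemma trace_diff_H30: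
 assumes T: "T > 0" and u: "u \<in> S 3 T" "trace_x 1 T 0 u g0" "trace_x 1 T 0 (dx T u) g1"
  and v: "v \<in> S 3 T" "trace_x 1 T 0 v g0" "trace_x 1 T 0 (dx T v) g1"
 shows "v - u \<in> H30 T"
proof -
 have e: "v - u = (\<lambda>z. 1 * v z + (-1) * u z)" by (simp add: fun_eq_iff)
 show ?thesis unfolding e
  using Sob.lin[OF v(1) u(1), of 1 "-1"] trace_x_lin[OF zero_less_one T v(2) u(2), of 1 "-1"] trace_x_dx_lin[OF T v(1,3) u(1,3), of 1 "-1"]
  by (simp add: H30_iff)
qed

section \<open>Gradients\<close>

text \<open>The directional form of differentiability, from which uniqueness of the gradient and the first order
 condition at a minimizer are read off.\<close>

lemma has_gradient_directional:
 assumes T: "T > 0" and g: "has_gradient T F w g" and h: "h \<in> H30 T" and e: "e > 0"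
 obtains r where "r > 0" "\<And>t. 0 < t ==> t < r ==> \<bar>F (w + (\<lambda>z. t * h z)) - F w - t * sob_inner 3 (rc 1 T) g h\<bar> \<le> e * t"
proof -
 let ?ip = "sob_inner 3 (rc 1 T)" and ?n = "nS 3 T h"
 have h3: "h \<in> S 3 T" and g3: "g \<in> S 3 T" using h g unfolding has_gradient_def by (auto intro: H30_S)
 have n: "?n \<ge> 0" by (rule Sob.nrm_nonneg[OF h3])
 have e': "e / (?n + 1) > 0" using e n by simp
 obtain \<delta> where \<delta>: "\<delta> > 0" "\<And>k. k \<in> H30 T ==> nS 3 T k < \<delta> ==> \<bar>F (w + k) - F w - ?ip g k\<bar> \<le> e / (?n + 1) * nS 3 T k"
  using g e' unfolding has_gradient_def rect_rc by blast
 have "\<bar>F (w + (\<lambda>z. t * h z)) - F w - t * ?ip g h\<bar> \<le> e * t" if t: "0 < t" "t < \<delta> / (?n + 1)" for t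
 proof -
  have k: "(\<lambda>z. t * h z) \<in> H30 T" using H30_lin[OF T h h, of t 0] by simp
  have kn: "nS 3 T (\<lambda>z. t * h z) = t * ?n" using Sob.nrm_scale[OF h3, of t] t by simp
  have "t * ?n \<le> t * (?n + 1)" using t by simp
  also have "\<dots> < \<delta>" using t n by (simp add: pos_less_divide_eq)
  finally have "\<bar>F (w + (\<lambda>z. t * h z)) - F w - t * ?ip g h\<bar> \<le> e / (?n + 1) * (t * ?n)"
   using \<delta>(2)[OF k] unfolding kn Sob.ip_scale2[OF h3 g3] by simp
  also have "\<dots> \<le> e / (?n + 1) * (t * (?n + 1))" using e n t by (intro mult_left_mono) auto
  also have "\<dots> = e * t" using n by simp
  finally show ?thesis .
 qed
 then show thesis using \<delta>(1) n by (intro that[of "\<delta> / (?n + 1)"]) auto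
qed

text \<open>Small multiples of a fixed increment show that two gradients have the same products with every
 increment. Uniqueness in this sense identifies the gradient picked by the choice operator.\<close>

lemma has_gradient_unique:
 assumes T: "T > 0" and g: "has_gradient T F w g" "has_gradient T F w g'" and h: "h \<in> H30 T"
 shows "sob_inner 3 (rc 1 T) g h = sob_inner 3 (rc 1 T) g' h"
proof (rule ccontr)
 let ?ip = "sob_inner 3 (rc 1 T)"
 assume ne: "?ip g h \<noteq> ?ip g' h"
 define d where "d = \<bar>?ip g h - ?ip g' h\<bar>"
 have d: "d / 3 > 0" using ne by (simp add: d_def)
 obtain r r' where r: "r > 0" "\<And>t. 0 < t ==> t < r ==> \<bar>F (w + (\<lambda>z. t * h z)) - F w - t * ?ip g h\<bar> \<le> d / 3 * t"
  and r': "r' > 0" "\<And>t. 0 < t ==> t < r' ==> \<bar>F (w + (\<lambda>z. t * h z)) - F w - t * ?ip g' h\<bar> \<le> d / 3 * t"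
  using has_gradient_directional[OF T g(1) h d] has_gradient_directional[OF T g(2) h d] by metis
 define t where "t = min r r' / 2"
 have t: "0 < t" "t < r" "t < r'" using r(1) r'(1) by (auto simp: t_def min_def)
 have "\<bar>t * ?ip g h - t * ?ip g' h\<bar> \<le> 2 * (d / 3 * t)" using r(2)[OF t(1,2)] r'(2)[OF t(1,3)] by linarith
 moreover have "\<bar>t * ?ip g h - t * ?ip g' h\<bar> = t * d" using t by (simp add: d_def abs_mult flip: right_diff_distrib)
 ultimately show False using mult_pos_pos[OF t(1) d] by (simp add: mult.commute)
qed

lemma gradient_inner:
 assumes T: "T > 0" and g: "has_gradient T F w g" and h: "h \<in> H30 T"
 shows "sob_inner 3 (rc 1 T) (gradient T F w) h = sob_inner 3 (rc 1 T) g h" "has_gradient T F w (gradient T F w)"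
proof -
 show gr: "has_gradient T F w (gradient T F w)" unfolding gradient_def by (rule someI[of "has_gradient T F w", OF g])
 show "sob_inner 3 (rc 1 T) (gradient T F w) h = sob_inner 3 (rc 1 T) g h" by (rule has_gradient_unique[OF T gr g h])
qed

lemma has_gradient_shift: "has_gradient T (\<lambda>W. F (W + G)) W g \<longleftrightarrow> has_gradient T F (W + G) g"
proof -
 have "W + h + G = W + G + h" for h :: "pfun" by (simp add: fun_eq_iff)
 then show ?thesis unfolding has_gradient_def by (simp only:)
qed

lemma gradient_shift: "gradient T (\<lambda>W. F (W + G)) W = gradient T F (W + G)"
 unfolding gradient_def has_gradient_shift ..

text \<open>The gradient is the Riesz representative of the linear part on the closed subspace of increments.\<close>

lemma J_has_gradient:
 assumes T: "T > 0" and al: "\<alpha> \<ge> 0" "lam \<ge> 0" "\<beta> \<ge> 0" and w: "w \<in> S 3 T"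
 obtains g where "has_gradient T (J T \<alpha> lam \<beta>) w g" "\<And>h. h \<in> H30 T ==> sob_inner 3 (rc 1 T) g h = lin_part T \<alpha> lam \<beta> w h"
proof -
 obtain C where C: "\<And>h. h \<in> S 3 T ==> \<bar>lin_part T \<alpha> lam \<beta> w h\<bar> \<le> C * nS 3 T h" using lin_part_bounded[OF T al w] by blast
 have "\<exists>g\<in>H30 T. \<forall>h\<in>H30 T. sob_inner 3 (rc 1 T) g h = lin_part T \<alpha> lam \<beta> w h"
 proof (rule Sob.riesz)
  show "H30 T \<subseteq> S 3 T" using H30_S by blast
  show "\<bar>lin_part T \<alpha> lam \<beta> w u\<bar> \<le> C * nS 3 T u" if "u \<in> H30 T" for u by (rule C[OF H30_S[OF that]])
  show "lin_part T \<alpha> lam \<beta> w (\<lambda>z. a * u z + b * v z) = a * lin_part T \<alpha> lam \<beta> w u + b * lin_part T \<alpha> lam \<beta> w v"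
   if u: "u \<in> H30 T" and v: "v \<in> H30 T" for u v a b by (rule lin_part_lin[OF T al(1,2) w H30_S[OF u] H30_S[OF v]])
  show "l \<in> H30 T" if "\<And>n::nat. f n \<in> H30 T" "l \<in> S 3 T" "(\<lambda>n. nS 3 T (f n - l)) \<leadsto> 0" for f l
   by (rule H30_closed[OF T that])
 qed (use H30_zero[OF T] H30_lin[OF T] in auto)
 then obtain g where g: "g \<in> H30 T" "\<And>h. h \<in> H30 T ==> sob_inner 3 (rc 1 T) g h = lin_part T \<alpha> lam \<beta> w h" by blast
 obtain K where K: "K \<ge> 0" "\<And>h. h \<in> S 3 T ==> nS 3 T h \<le> 1 ==> \<bar>rem_part T \<alpha> lam \<beta> w h\<bar> \<le> K * (nS 3 T h)^2"
  using rem_part_bounded[OF T al w] by blast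
 have "has_gradient T (J T \<alpha> lam \<beta>) w g" unfolding has_gradient_def rect_rc
 proof (intro conjI g(1) allI impI)
  fix e :: real assume e: "e > 0"
  define r where "r = min 1 (e / (K + 1))"
  have r: "r > 0" using e K by (simp add: r_def)
  have "\<bar>J T \<alpha> lam \<beta> (w + h) - J T \<alpha> lam \<beta> w - sob_inner 3 (rc 1 T) g h\<bar> \<le> e * nS 3 T h"
   if h: "h \<in> H30 T" and hr: "nS 3 T h < r" for h
  proof -
   have h3: "h \<in> S 3 T" by (rule H30_S[OF h])
   have n: "nS 3 T h \<ge> 0" "nS 3 T h \<le> 1" "nS 3 T h \<le> e / (K + 1)" using Sob.nrm_nonneg[OF h3] hr by (auto simp: r_def)
   have "K * nS 3 T h \<le> (K + 1) * (e / (K + 1))" using n K by (intro mult_mono) auto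
   then have Kn: "K * nS 3 T h \<le> e" using K by simp
   have "J T \<alpha> lam \<beta> (w + h) - J T \<alpha> lam \<beta> w - sob_inner 3 (rc 1 T) g h = rem_part T \<alpha> lam \<beta> w h"
    unfolding g(2)[OF h] J_expand[OF T al(1,2) w h3] by simp
   moreover have "\<bar>rem_part T \<alpha> lam \<beta> w h\<bar> \<le> K * nS 3 T h * nS 3 T h" using K(2)[OF h3 n(2)] by (simp add: power2_eq_square)
   moreover have "K * nS 3 T h * nS 3 T h \<le> e * nS 3 T h" by (rule mult_right_mono[OF Kn n(1)])
   ultimately show ?thesis by linarith
  qed
  then show "\<exists>\<delta>>0. \<forall>h\<in>H30 T. nS 3 T h < \<delta> \<longrightarrow> \<bar>J T \<alpha> lam \<beta> (w + h) - J T \<alpha> lam \<beta> w - sob_inner 3 (rc 1 T) g h\<bar> \<le> e * nS 3 T h"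
   using r by (intro exI[of _ r]) blast
 qed
 then show thesis using g(2) by (rule that)
qed

section \<open>Convexity\<close>

text \<open>Formulated for two points of bounded norm that differ by an admissible increment, the bound serves both for
 the closure of B and, after a shift by G, for the closed ball of increments.\<close>

theorem J_convexity_bound:
 assumes T: "T \<ge> 2" and al: "0 < \<alpha>" "\<alpha> < 1/2" and ep: "0 < \<epsilon>" "\<epsilon> < 2 * \<alpha>"
  and lam: "lam_ok T \<alpha> D lam" and \<beta>: "\<beta> \<ge> 2 * exp (- lam * \<alpha> * T)"
  and w1: "w1 \<in> S 3 T" "nS 3 T w1 \<le> D" and w2: "w2 \<in> S 3 T" "nS 3 T w2 \<le> D" and h: "w2 - w1 \<in> H30 T"
 shows "convexity_bound T \<alpha> \<epsilon> lam \<beta> (carl \<alpha> / 4) (J T \<alpha> lam \<beta>) w1 w2"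
proof -
 have T0: "T > 0" using T by simp
 have l0: "lam \<ge> 0" using lam by (simp add: lam_ok_def)
 have \<beta>0: "\<beta> \<ge> 0" using \<beta> exp_ge_zero[of "- lam * \<alpha> * T"] by linarith
 let ?h = "w2 - w1" and ?e = "exp (- 2 * lam * (2 * \<alpha> - \<epsilon>))"
 have hH: "?h \<in> S 3 T" "trace_x 1 T 0 ?h (\<lambda>_. 0)" "trace_x 1 T 0 (dx T ?h) (\<lambda>_. 0)" using h by (auto simp: H30_iff)
 have h2: "?h \<in> S 2 T" by (rule sobolev_mono[OF _ hH(1)]) simp
 have "nS 3 T ?h \<le> nS 3 T (w2 - (\<lambda>_. 0)) + nS 3 T ((\<lambda>_. 0) - w1)" by (rule Sob.nrm_triangle_diff[OF w2(1) Sob.zero w1(1)])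
 also have "\<dots> = nS 3 T w2 + nS 3 T w1"
  using Sob.nrm_minus_commute[OF Sob.zero w1(1)] by (simp add: fun_diff_def)
 finally have hn: "nS 3 T ?h \<le> 2 * D" using w1(2) w2(2) by simp
 obtain g where g: "has_gradient T (J T \<alpha> lam \<beta>) w1 g" "\<And>h. h \<in> H30 T ==> sob_inner 3 (rc 1 T) g h = lin_part T \<alpha> lam \<beta> w1 h"
  by (rule J_has_gradient[OF T0 less_imp_le[OF al(1)] l0 \<beta>0 w1(1)]) blast
 have gr: "sob_inner 3 (rc 1 T) (gradient T (J T \<alpha> lam \<beta>) w1) ?h = lin_part T \<alpha> lam \<beta> w1 ?h"
  using gradient_inner(1)[OF T0 g(1) h] g(2)[OF h] by simp
 have "w1 + ?h = w2" by (simp add: fun_eq_iff)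
 with J_expand[OF T0 less_imp_le[OF al(1)] l0 w1(1) hH(1), of \<beta>]
 have eq: "J T \<alpha> lam \<beta> w2 - J T \<alpha> lam \<beta> w1 - lin_part T \<alpha> lam \<beta> w1 ?h = rem_part T \<alpha> lam \<beta> w1 ?h" by simp
 have low: "rem_part T \<alpha> lam \<beta> w1 ?h \<ge> carl \<alpha> / 4 * lower_energy T \<alpha> lam ?h + \<beta> / 2 * (nS 3 T ?h)^2"
  by (rule rem_part_lower[OF T0 w1 hH(1) hn hH(2,3) al lam \<beta>])
 have s: "0 < 2 * \<alpha> - \<epsilon>" "2 * \<alpha> - \<epsilon> \<le> 1" using ep al by auto
 have "?e * (sob_norm 1 (Tr \<alpha> \<epsilon>) ?h)^2 + ?e * (H1_norm1 {0<..<2 * \<alpha> - \<epsilon>} (trace_t T 0 ?h))^2 \<le> lower_energy T \<alpha> lam ?h"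
  using sob_norm_Tr_le[OF T al ep(1) l0 h2] H1_norm1_le[OF T0 s l0 h2] by linarith
 from mult_left_mono[OF this, of "carl \<alpha> / 4"] carl_pos[OF al(2)]
 have "carl \<alpha> / 4 * ?e * (sob_norm 1 (Tr \<alpha> \<epsilon>) ?h)^2 + carl \<alpha> / 4 * ?e * (H1_norm1 {0<..<2 * \<alpha> - \<epsilon>} (trace_t T 0 ?h))^2 \<le> carl \<alpha> / 4 * lower_energy T \<alpha> lam ?h"
  by (simp only: distrib_left mult.assoc)
 then show ?thesis unfolding convexity_bound_def rect_rc gr eq using low by linarith
qed

section \<open>Strongly convex functionals on convex sets of increments\<close>

text \<open>The inequality for the linearisation, applied at the point between two given points, turns into the
 strong form of convexity: with weights \<open>1 - \<theta>\<close> and \<open>\<theta>\<close> the gradient terms cancel.\<close>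

lemma strong_convexity:
 assumes T: "T > 0" and K: "K \<subseteq> H30 T"
  and cb: "\<And>V W. V \<in> K ==> W \<in> K ==> F W - F V - sob_inner 3 (rc 1 T) (gr V) (W - V) \<ge> b * (nS 3 T (W - V))^2"
  and gr: "\<And>V. V \<in> K ==> gr V \<in> H30 T"
  and V: "V \<in> K" and W: "W \<in> K" and \<theta>: "0 \<le> \<theta>" "\<theta> \<le> 1" and U: "(\<lambda>z. (1 - \<theta>) * V z + \<theta> * W z) \<in> K"
 shows "F (\<lambda>z. (1 - \<theta>) * V z + \<theta> * W z) \<le> (1 - \<theta>) * F V + \<theta> * F W - b * \<theta> * (1 - \<theta>) * (nS 3 T (W - V))^2"
proof -
 define P where "P = (\<lambda>z. (1 - \<theta>) * V z + \<theta> * W z)"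
 have P: "P \<in> K" using U by (simp add: P_def)
 have S3: "V \<in> S 3 T" "W \<in> S 3 T" "gr P \<in> S 3 T" using V W gr[OF P] K by (auto intro: H30_S)
 define D where "D = W - V"
 have D: "D \<in> S 3 T" unfolding D_def by (rule Sob.diff[OF S3(2,1)])
 have e1: "V - P = (\<lambda>z. - \<theta> * D z)" and e2: "W - P = (\<lambda>z. (1 - \<theta>) * D z)"
  by (auto simp: P_def D_def fun_eq_iff algebra_simps)
 let ?g = "sob_inner 3 (rc 1 T) (gr P) D" and ?n = "(nS 3 T D)^2"
 have n: "(nS 3 T (\<lambda>z. c * D z))^2 = c^2 * ?n" for c unfolding Sob.nrm_scale[OF D] by (simp add: power_mult_distrib)
 have 1: "F V - F P + \<theta> * ?g \<ge> b * (\<theta>^2 * ?n)"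
  using cb[OF P V] unfolding e1 n Sob.ip_scale2[OF D S3(3)] by simp
 have 2: "F W - F P - (1 - \<theta>) * ?g \<ge> b * ((1 - \<theta>)^2 * ?n)"
  using cb[OF P W] unfolding e2 n Sob.ip_scale2[OF D S3(3)] .
 have "(1 - \<theta>) * (b * (\<theta>^2 * ?n)) + \<theta> * (b * ((1 - \<theta>)^2 * ?n)) \<le> (1 - \<theta>) * (F V - F P + \<theta> * ?g) + \<theta> * (F W - F P - (1 - \<theta>) * ?g)"
  using \<theta> by (intro add_mono mult_left_mono 1 2) auto
 also have "\<dots> = (1 - \<theta>) * F V + \<theta> * F W - F P" by (simp add: algebra_simps)
 finally have "F P \<le> (1 - \<theta>) * F V + \<theta> * F W - ((1 - \<theta>) * (b * (\<theta>^2 * ?n)) + \<theta> * (b * ((1 - \<theta>)^2 * ?n)))" by linarith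
 also have "(1 - \<theta>) * (b * (\<theta>^2 * ?n)) + \<theta> * (b * ((1 - \<theta>)^2 * ?n)) = b * \<theta> * (1 - \<theta>) * ?n"
  by (simp add: power2_eq_square algebra_simps)
 finally show ?thesis unfolding P_def D_def .
qed

text \<open>The directional derivative at a minimizer towards another point of the convex set cannot be negative.\<close>

lemma variational_inequality:
 assumes T: "T > 0" and g: "has_gradient T F U g" and h: "h \<in> H30 T"
  and min: "\<And>t. 0 < t ==> t < 1 ==> F U \<le> F (U + (\<lambda>z. t * h z))"
 shows "sob_inner 3 (rc 1 T) g h \<ge> 0"
proof (rule ccontr)
 let ?p = "- sob_inner 3 (rc 1 T) g h"
 assume "\<not> sob_inner 3 (rc 1 T) g h \<ge> 0"
 then have p: "?p / 2 > 0" by simp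
 obtain r where r: "r > 0" "\<And>t. 0 < t ==> t < r ==> \<bar>F (U + (\<lambda>z. t * h z)) - F U - t * sob_inner 3 (rc 1 T) g h\<bar> \<le> ?p / 2 * t"
  using has_gradient_directional[OF T g h p] by blast
 define t where "t = min 1 r / 2"
 have t: "0 < t" "t < r" "t < 1" using r(1) by (auto simp: t_def min_def)
 have "t * ?p \<le> ?p / 2 * t" unfolding mult_minus_right using abs_le_D1[OF r(2)[OF t(1,2)]] min[OF t(1,3)] by linarith
 then show False using mult_pos_pos[OF t(1) p] by (simp add: field_simps)
qed

lemma J_continuous:
 assumes T: "T > 0" and al: "\<alpha> \<ge> 0" "lam \<ge> 0" "\<beta> \<ge> 0" and w: "w \<in> S 3 T" and h: "\<And>n::nat. h n \<in> S 3 T"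
  and lim: "(\<lambda>n. nS 3 T (h n)) \<leadsto> 0"
 shows "(\<lambda>n. J T \<alpha> lam \<beta> (w + h n)) \<leadsto> J T \<alpha> lam \<beta> w"
proof -
 obtain C where C: "\<And>h. h \<in> S 3 T ==> \<bar>lin_part T \<alpha> lam \<beta> w h\<bar> \<le> C * nS 3 T h" using lin_part_bounded[OF T al w] by blast
 obtain K where K: "K \<ge> 0" "\<And>h. h \<in> S 3 T ==> nS 3 T h \<le> 1 ==> \<bar>rem_part T \<alpha> lam \<beta> w h\<bar> \<le> K * (nS 3 T h)^2"
  using rem_part_bounded[OF T al w] by blast
 have "(\<lambda>n. J T \<alpha> lam \<beta> (w + h n) - J T \<alpha> lam \<beta> w) \<leadsto> 0"
 proof (rule Lim_null_comparison)
  have "eventually (\<lambda>n. nS 3 T (h n) < 1) sequentially" using order_tendstoD(2)[OF lim zero_less_one] .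
  then show "eventually (\<lambda>n. norm (J T \<alpha> lam \<beta> (w + h n) - J T \<alpha> lam \<beta> w) \<le> C * nS 3 T (h n) + K * (nS 3 T (h n))^2) sequentially"
  proof eventually_elim
   case (elim n)
   show ?case unfolding J_expand[OF T al(1,2) w h] using C[OF h, of n] K(2)[OF h, of n] elim by simp
  qed
  have "(\<lambda>n. C * nS 3 T (h n) + K * (nS 3 T (h n))^2) \<leadsto> C * 0 + K * 0^2" by (intro tendsto_intros lim)
  then show "(\<lambda>n. C * nS 3 T (h n) + K * (nS 3 T (h n))^2) \<leadsto> 0" by simp
 qed
 then show ?thesis by (rule LIM_zero_cancel)
qed

lemma J_nonneg: "\<beta> \<ge> 0 ==> J T \<alpha> lam \<beta> w \<ge> 0"
 unfolding J_def by (intro add_nonneg_nonneg mult_nonneg_nonneg integral_nonneg_AE AE_I2) (auto simp: less_imp_le[OF wt_pos])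

section \<open>Closures of the sets of functions\<close>

lemma H3_closure_seq:
 assumes "w \<in> H3_closure T A"
 obtains v where "\<And>n::nat. v n \<in> A" "\<And>n. nS 3 T (w - v n) < 1 / (real n + 1)" "w \<in> S 3 T"
proof -
 have w: "w \<in> S 3 T" "\<And>e. e > 0 ==> \<exists>v\<in>A. nS 3 T (w - v) < e" using assms by (auto simp: H3_closure_def rect_rc)
 have "\<exists>v\<in>A. nS 3 T (w - v) < 1 / (real n + 1)" for n by (rule w(2)) simp
 then obtain v where "\<And>n::nat. v n \<in> A" "\<And>n. nS 3 T (w - v n) < 1 / (real n + 1)" by metis
 then show thesis using w(1) by (rule that)
qed

lemma inverse_Suc_null: "(\<lambda>n. 1 / (real n + 1)) \<leadsto> 0"
 using LIMSEQ_inverse_real_of_nat by (simp add: inverse_eq_divide add.commute)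

lemma norm_closure_le:
 assumes w: "w \<in> S 3 T" and v: "\<And>n::nat. v n \<in> S 3 T" "\<And>n. nS 3 T (v n) < D" "\<And>n. nS 3 T (w - v n) < 1 / (real n + 1)"
 shows "nS 3 T w \<le> D"
proof -
 have "nS 3 T w \<le> D + 1 / (real n + 1)" for n
  using Sob.nrm_triangle_rev[OF w v(1)[of n]] v(2)[of n] v(3)[of n] by linarith
 moreover have "(\<lambda>n. D + 1 / (real n + 1)) \<leadsto> D + 0" by (intro tendsto_intros inverse_Suc_null)
 ultimately show ?thesis using LIMSEQ_le_const[of "\<lambda>n. D + 1 / (real n + 1)" D "nS 3 T w"] by auto
qed

text \<open>Differences of approximating functions lie in the closed space of increments.\<close>

lemma closure_B:
 assumes T: "T > 0" and w1: "w1 \<in> H3_closure T (B T D p0 p1)" and w2: "w2 \<in> H3_closure T (B T D p0 p1)"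
 shows "w1 \<in> S 3 T" "nS 3 T w1 \<le> D" "w2 - w1 \<in> H30 T"
proof -
 have BD: "v \<in> S 3 T" "trace_x 1 T 0 v p0" "trace_x 1 T 0 (dx T v) p1" "nS 3 T v < D" if "v \<in> B T D p0 p1" for v
  using that by (auto simp: B_def has_trace_x_def trace_x_def rect_rc)
 obtain v1 where v1: "\<And>n::nat. v1 n \<in> B T D p0 p1" "\<And>n. nS 3 T (w1 - v1 n) < 1 / (real n + 1)" and s1: "w1 \<in> S 3 T"
  using H3_closure_seq[OF w1] by blast
 obtain v2 where v2: "\<And>n::nat. v2 n \<in> B T D p0 p1" "\<And>n. nS 3 T (w2 - v2 n) < 1 / (real n + 1)" and s2: "w2 \<in> S 3 T"
  using H3_closure_seq[OF w2] by blast
 note b1 = BD[OF v1(1)] and b2 = BD[OF v2(1)]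
 show "w1 \<in> S 3 T" by (rule s1)
 show "nS 3 T w1 \<le> D" by (rule norm_closure_le[OF s1 b1(1,4) v1(2)])
 show "w2 - w1 \<in> H30 T"
 proof (rule H30_closed[OF T])
  show "v2 n - v1 n \<in> H30 T" for n by (rule trace_diff_H30[OF T b1(1-3) b2(1-3)])
  show "w2 - w1 \<in> S 3 T" by (rule Sob.diff[OF s2 s1])
  have le: "nS 3 T ((v2 n - v1 n) - (w2 - w1)) \<le> 1 / (real n + 1) + 1 / (real n + 1)" for n
  proof -
   have "(v2 n - v1 n) - (w2 - w1) = (v2 n - w2) + (w1 - v1 n)" by (simp add: fun_eq_iff)
   then have "nS 3 T ((v2 n - v1 n) - (w2 - w1)) \<le> nS 3 T (v2 n - w2) + nS 3 T (w1 - v1 n)"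
    using Sob.nrm_triangle[OF Sob.diff[OF b2(1)[of n] s2] Sob.diff[OF s1 b1(1)[of n]]] by (simp only:)
   then show ?thesis using v1(2)[of n] v2(2)[of n] Sob.nrm_minus_commute[OF s2 b2(1)[of n]] by linarith
  qed
  have "(\<lambda>n. 1 / (real n + 1) + 1 / (real n + 1)) \<leadsto> 0 + 0" by (intro tendsto_add inverse_Suc_null)
  then have l: "(\<lambda>n. 1 / (real n + 1) + 1 / (real n + 1)) \<leadsto> 0" by simp
  show "(\<lambda>n. nS 3 T ((v2 n - v1 n) - (w2 - w1))) \<leadsto> 0"
   by (rule tendsto_sandwich[OF always_eventually[OF allI] always_eventually[OF allI[OF le]] tendsto_const l])
    (rule Sob.nrm_nonneg[OF Sob.diff[OF Sob.diff[OF b2(1) b1(1)] Sob.diff[OF s2 s1]]])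
 qed
qed

text \<open>A point of norm D is the limit of its multiples by factors below 1.\<close>

lemma H3_closure_B0:
 assumes T: "T > 0" and D: "D > 0" shows "H3_closure T (B0 T D) = {W \<in> H30 T. nS 3 T W \<le> D}"
proof (intro set_eqI iffI)
 fix W assume "W \<in> H3_closure T (B0 T D)"
 then obtain v where v: "\<And>n::nat. v n \<in> B0 T D" "\<And>n. nS 3 T (W - v n) < 1 / (real n + 1)" and W: "W \<in> S 3 T"
  using H3_closure_seq by blast
 have vH: "v n \<in> H30 T" and vn: "nS 3 T (v n) < D" for n using v(1)[of n] by (auto simp: B0_def rect_rc)
 note v3 = H30_S[OF vH]
 have le: "nS 3 T (v n - W) \<le> 1 / (real n + 1)" for n
  using v(2)[of n] Sob.nrm_minus_commute[OF W v3, of n] by simp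
 have "(\<lambda>n. nS 3 T (v n - W)) \<leadsto> 0"
  by (rule tendsto_sandwich[OF always_eventually[OF allI[OF Sob.nrm_nonneg[OF Sob.diff[OF v3 W]]]] always_eventually[OF allI[OF le]] tendsto_const inverse_Suc_null])
 from H30_closed[OF T vH W this] norm_closure_le[OF W v3 vn v(2)] show "W \<in> {W \<in> H30 T. nS 3 T W \<le> D}" by blast
next
 fix W assume "W \<in> {W \<in> H30 T. nS 3 T W \<le> D}"
 then have W: "W \<in> H30 T" "nS 3 T W \<le> D" by auto
 note W3 = H30_S[OF W(1)]
 have n0: "nS 3 T W \<ge> 0" by (rule Sob.nrm_nonneg[OF W3])
 have "\<exists>v\<in>B0 T D. nS 3 T (W - v) < e" if e: "e > 0" for e
 proof -
  \<comment> \<open>shrinking by the factor \<open>1 - s\<close> moves a point of norm at most D by at most e/2\<close>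
  define s where "s = min 1 (e / (2 * (D + e)))"
  have s: "0 < s" "s \<le> 1" "s \<le> e / (2 * (D + e))" using e D by (auto simp: s_def)
  let ?v = "\<lambda>z. (1 - s) * W z"
  have v: "?v \<in> H30 T" using H30_lin[OF T W(1) W(1), of "1 - s" 0] by simp
  have "(1 - s) * nS 3 T W \<le> (1 - s) * D" using s W(2) by (intro mult_left_mono) auto
  also have "\<dots> < D" using s D by simp
  finally have "nS 3 T ?v < D" unfolding Sob.nrm_scale[OF W3] using s by simp
  moreover have "nS 3 T (W - ?v) < e"
  proof -
   have "W - ?v = (\<lambda>z. s * W z)" by (simp add: fun_eq_iff algebra_simps)
   then have "nS 3 T (W - ?v) = s * nS 3 T W" using Sob.nrm_scale[OF W3, of s] s by simp
   also have "\<dots> \<le> e / (2 * (D + e)) * (D + e)" using s W(2) n0 e D by (intro mult_mono) auto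
   also have "\<dots> = e / 2" using e D by (simp add: field_simps)
   also have "\<dots> < e" using e by simp
   finally show ?thesis .
  qed
  ultimately show ?thesis using v by (intro bexI[of _ ?v]) (auto simp: B0_def rect_rc)
 qed
 then show "W \<in> H3_closure T (B0 T D)" using W3 by (simp add: H3_closure_def rect_rc)
qed

section \<open>Strict convexity and the minimizer\<close>

text \<open>\<open>\<parallel>W + G\<parallel> \<le> 2d + d\<close> is the reason for the radius 3d in the threshold.\<close>

theorem J_convexity_bound_shifted:
 assumes T: "T \<ge> 2" and al: "0 < \<alpha>" "\<alpha> < 1/2" and ep: "0 < \<epsilon>" "\<epsilon> < 2 * \<alpha>" and d: "d > 0"
  and lam: "lam_ok T \<alpha> (3 * d) lam" and \<beta>: "\<beta> \<ge> 2 * exp (- lam * \<alpha> * T)"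
  and G: "G \<in> S 3 T" "nS 3 T G < d" and W1: "W1 \<in> H3_closure T (B0 T (2 * d))" and W2: "W2 \<in> H3_closure T (B0 T (2 * d))"
 shows "convexity_bound T \<alpha> \<epsilon> lam \<beta> (carl \<alpha> / 4) (\<lambda>W. J T \<alpha> lam \<beta> (W + G)) W1 W2"
proof -
 have T0: "T > 0" using T by simp
 have n: "W + G \<in> S 3 T" "nS 3 T (W + G) \<le> 3 * d" if "W \<in> H3_closure T (B0 T (2 * d))" for W
 proof -
  have W: "W \<in> H30 T" "nS 3 T W \<le> 2 * d" using that d by (auto simp: H3_closure_B0[OF T0])
  show "W + G \<in> S 3 T" by (rule Sob.add[OF H30_S[OF W(1)] G(1)])
  show "nS 3 T (W + G) \<le> 3 * d" using Sob.nrm_triangle[OF H30_S[OF W(1)] G(1)] W(2) G(2) by linarith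
 qed
 have e: "(W2 + G) - (W1 + G) = W2 - W1" by (simp add: fun_eq_iff)
 have h: "(W2 + G) - (W1 + G) \<in> H30 T" unfolding e
  using W1 W2 d by (intro H30_diff[OF T0]) (auto simp: H3_closure_B0[OF T0])
 show ?thesis
  using J_convexity_bound[OF T al ep lam \<beta> n[OF W1] n[OF W2] h]
  unfolding convexity_bound_def gradient_shift e .
qed

text \<open>All assertions follow from the bound \<open>\<beta>/2 \<parallel>V - W\<parallel>\<^sup>2\<close> alone, which is strictly positive unless the two
 functions agree almost everywhere.\<close>

theorem strictly_convex_with_unique_minimizer:
 assumes T: "T \<ge> 2" and al: "0 < \<alpha>" "\<alpha> < 1/2" and d: "d > 0"
  and lam: "lam_ok T \<alpha> (3 * d) lam" and \<beta>: "\<beta> \<ge> 2 * exp (- lam * \<alpha> * T)"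
  and G: "G \<in> S 3 T" "nS 3 T G < d"
 defines "K \<equiv> H3_closure T (B0 T (2 * d))" and "I \<equiv> (\<lambda>W. J T \<alpha> lam \<beta> (W + G))"
 shows "strictly_convex_on T K I"
  and "\<exists>W_min. is_minimizer K I W_min \<and> (\<forall>V. is_minimizer K I V \<longrightarrow> (AE z in lebesgue_on (rect T). V z = W_min z)) \<and>
      (\<forall>W\<in>K. H3_inner T (gradient T I W_min) (W - W_min) \<ge> 0)"
proof -
 have T0: "T > 0" using T by simp
 have al0: "\<alpha> \<ge> 0" and l0: "lam \<ge> 0" using al lam by (auto simp: lam_ok_def)
 have \<beta>0: "\<beta> > 0" using \<beta> exp_gt_zero[of "- lam * \<alpha> * T"] by linarith
 have K: "K = {W \<in> H30 T. nS 3 T W \<le> 2 * d}" unfolding K_def by (rule H3_closure_B0[OF T0]) (use d in simp)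
 have KH: "W \<in> H30 T" "W \<in> S 3 T" if "W \<in> K" for W using that unfolding K by (auto intro: H30_S)
 have convex: "(\<lambda>z. (1 - \<theta>) * V z + \<theta> * W z) \<in> K" if V: "V \<in> K" and W: "W \<in> K" and \<theta>: "0 \<le> \<theta>" "\<theta> \<le> 1" for V W \<theta>
 proof -
  let ?v = "\<lambda>z. (1 - \<theta>) * V z" and ?w = "\<lambda>z. \<theta> * W z"
  have "nS 3 T (?v + ?w) \<le> nS 3 T ?v + nS 3 T ?w" by (rule Sob.nrm_triangle[OF Sob.scale[OF KH(2)[OF V]] Sob.scale[OF KH(2)[OF W]]])
  also have "\<dots> = (1 - \<theta>) * nS 3 T V + \<theta> * nS 3 T W" unfolding Sob.nrm_scale[OF KH(2)[OF V]] Sob.nrm_scale[OF KH(2)[OF W]] using \<theta> by simp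
  also have "\<dots> \<le> (1 - \<theta>) * (2 * d) + \<theta> * (2 * d)" using V W \<theta> unfolding K by (intro add_mono mult_left_mono) auto
  also have "\<dots> = 2 * d" by (simp add: algebra_simps)
  finally have "nS 3 T (\<lambda>z. (1 - \<theta>) * V z + \<theta> * W z) \<le> 2 * d" by (simp add: plus_fun_def)
  then show ?thesis using H30_lin[OF T0 KH(1)[OF V] KH(1)[OF W]] unfolding K by blast
 qed
 have grad: "\<exists>g. has_gradient T I W g" if W: "W \<in> K" for W
  using J_has_gradient[OF T0 al0 l0 less_imp_le[OF \<beta>0] Sob.add[OF KH(2)[OF W] G(1)]] unfolding I_def has_gradient_shift by blast
 have gr: "has_gradient T I W (gradient T I W)" if W: "W \<in> K" for W
  unfolding gradient_def by (rule someI_ex[OF grad[OF W]])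
 have grH: "gradient T I W \<in> H30 T" if W: "W \<in> K" for W using gr[OF W] by (simp add: has_gradient_def)
 have cb: "I W - I V - sob_inner 3 (rc 1 T) (gradient T I V) (W - V) \<ge> \<beta> / 2 * (nS 3 T (W - V))^2" if V: "V \<in> K" and W: "W \<in> K" for V W
 proof -
  \<comment> \<open>any admissible \<open>\<epsilon>\<close> will do, since the terms that contain it are dropped\<close>
  have ep: "0 < \<alpha>" "\<alpha> < 2 * \<alpha>" using al by auto
  have "convexity_bound T \<alpha> \<alpha> lam \<beta> (carl \<alpha> / 4) I V W" unfolding I_def
   by (rule J_convexity_bound_shifted[OF T al ep d lam \<beta> G]) (use V W in \<open>simp_all add: K_def\<close>)
  moreover have "carl \<alpha> / 4 * exp (- 2 * lam * (2 * \<alpha> - \<alpha>)) * x^2 \<ge> 0" for x using carl_pos[OF al(2)] by simp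
  ultimately show ?thesis unfolding convexity_bound_def rect_rc by (smt (verit))
 qed
 have strong: "I (\<lambda>z. (1 - \<theta>) * V z + \<theta> * W z) \<le> (1 - \<theta>) * I V + \<theta> * I W - \<beta> / 2 * \<theta> * (1 - \<theta>) * (nS 3 T (W - V))^2"
  if V: "V \<in> K" and W: "W \<in> K" and \<theta>: "0 \<le> \<theta>" "\<theta> \<le> 1" for V W \<theta>
  by (rule strong_convexity[where F = I and gr = "gradient T I" and K = K, OF T0 _ cb grH V W \<theta> convex[OF V W \<theta>]]) (use KH(1) in blast)
 have strict: "I (\<lambda>z. (1 - \<theta>) * V z + \<theta> * W z) < (1 - \<theta>) * I V + \<theta> * I W"
  if V: "V \<in> K" and W: "W \<in> K" and ne: "\<not> (AE z in Mrc 1 T. V z = W z)" and \<theta>: "0 < \<theta>" "\<theta> < 1" for V W \<theta>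
 proof -
  have D: "W - V \<in> S 3 T" by (rule Sob.diff[OF KH(2)[OF W] KH(2)[OF V]])
  have "nS 3 T (W - V) \<noteq> 0"
  proof
   assume "nS 3 T (W - V) = 0"
   then have "AE z in Mrc 1 T. (W - V) z = 0" using rc.sob_norm_zero_iff[OF D] by blast
   then have "AE z in Mrc 1 T. V z = W z" by eventually_elim simp
   then show False using ne by simp
  qed
  then have "\<beta> / 2 * \<theta> * (1 - \<theta>) * (nS 3 T (W - V))^2 > 0" using \<beta>0 \<theta> by simp
  then show ?thesis using strong[OF V W, of \<theta>] \<theta> by linarith
 qed
 show "strictly_convex_on T K I" unfolding strictly_convex_on_def rect_rc
  by (intro ballI impI strict) auto
 have "\<exists>l\<in>K. \<forall>u\<in>K. I l \<le> I u"
 proof (rule Sob.minimizer_exists[where m = 0 and c = "\<beta> / 8"])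
  show "K \<subseteq> S 3 T" using KH(2) by blast
  have "nS 3 T (\<lambda>_. 0) = 0" using rc.sob_norm_zero_iff[OF Sob.zero[of 3 1 T]] by simp
  then have "(\<lambda>_. 0) \<in> K" unfolding K using H30_zero[OF T0] d by simp
  then show "K \<noteq> {}" by blast
  show "0 \<le> I u" for u unfolding I_def by (rule J_nonneg[OF less_imp_le[OF \<beta>0]])
  show "0 < \<beta> / 8" using \<beta>0 by simp
  show "\<exists>w\<in>K. I w \<le> (I u + I v) / 2 - \<beta> / 8 * (nS 3 T (u - v))^2" if u: "u \<in> K" and v: "v \<in> K" for u v
  proof (rule bexI)
   have c: "nS 3 T (u - v) = nS 3 T (v - u)" by (rule Sob.nrm_minus_commute[OF KH(2)[OF u] KH(2)[OF v]])
   show "I (\<lambda>z. (1 - 1/2) * u z + 1/2 * v z) \<le> (I u + I v) / 2 - \<beta> / 8 * (nS 3 T (u - v))^2"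
    using strong[OF u v, of "1/2"] unfolding c by (simp add: field_simps)
   show "(\<lambda>z. (1 - 1/2) * u z + 1/2 * v z) \<in> K" by (rule convex[OF u v]) simp_all
  qed
  fix f :: "nat => pfun" and l
  assume f: "\<And>n. f n \<in> K" and lim: "(\<lambda>n. nS 3 T (f n - l)) \<leadsto> 0"
  { assume l: "l \<in> S 3 T"
   have "l \<in> H30 T" by (rule H30_closed[OF T0 KH(1)[OF f] l lim])
   moreover have "(\<lambda>n. nS 3 T (f n)) \<leadsto> nS 3 T l" by (rule Sob.nrm_tendsto[OF KH(2)[OF f] l lim])
   then have "nS 3 T l \<le> 2 * d" by (rule LIMSEQ_le_const2) (use f K in auto)
   ultimately show "l \<in> K" unfolding K by blast }
  assume l: "l \<in> K"
  have "(\<lambda>n. J T \<alpha> lam \<beta> ((l + G) + (f n - l))) \<leadsto> J T \<alpha> lam \<beta> (l + G)"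
   by (rule J_continuous[OF T0 al0 l0 less_imp_le[OF \<beta>0] Sob.add[OF KH(2)[OF l] G(1)] Sob.diff[OF KH(2)[OF f] KH(2)[OF l]] lim])
  moreover have "(l + G) + (f n - l) = f n + G" for n by (simp add: fun_eq_iff)
  ultimately show "(\<lambda>n. I (f n)) \<leadsto> I l" unfolding I_def by simp
 qed
 then obtain W0 where W0: "W0 \<in> K" "\<And>W. W \<in> K ==> I W0 \<le> I W" by blast
 have uniq: "AE z in Mrc 1 T. V z = W0 z" if V: "is_minimizer K I V" for V
 proof (rule ccontr)
  assume ne: "\<not> (AE z in Mrc 1 T. V z = W0 z)"
  have VK: "V \<in> K" and Vm: "I V \<le> I W0" using V W0(1) by (auto simp: is_minimizer_def)
  have "I (\<lambda>z. (1 - 1/2) * V z + 1/2 * W0 z) < (1 - 1/2) * I V + 1/2 * I W0" by (rule strict[OF VK W0(1) ne]) simp_all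
  also have "\<dots> \<le> I W0" using Vm by simp
  finally show False using W0(2)[OF convex[OF VK W0(1), of "1/2"]] by simp
 qed
 have var: "sob_inner 3 (rc 1 T) (gradient T I W0) (W - W0) \<ge> 0" if W: "W \<in> K" for W
 proof (rule variational_inequality[OF T0 gr[OF W0(1)] H30_diff[OF T0 KH(1)[OF W] KH(1)[OF W0(1)]]])
  fix t :: real assume t: "0 < t" "t < 1"
  have "W0 + (\<lambda>z. t * (W - W0) z) = (\<lambda>z. (1 - t) * W0 z + t * W z)" by (simp add: fun_eq_iff algebra_simps)
  then show "I W0 \<le> I (W0 + (\<lambda>z. t * (W - W0) z))" using W0(2)[OF convex[OF W0(1) W, of t]] t by simp
 qed
 show "\<exists>W_min. is_minimizer K I W_min \<and> (\<forall>V. is_minimizer K I V \<longrightarrow> (AE z in lebesgue_on (rect T). V z = W_min z)) \<and>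
      (\<forall>W\<in>K. H3_inner T (gradient T I W_min) (W - W_min) \<ge> 0)"
  unfolding rect_rc using W0 uniq var by (intro exI[of _ W0]) (auto simp: is_minimizer_def)
qed

section \<open>The parameter threshold and the conclusion\<close>

lemma exponential_threshold:
 assumes T: "T > 0" and al: "\<alpha> > 0" shows "\<exists>N. \<forall>lam\<ge>N. carl \<alpha> * lam ^ 3 * (1 / T + 1) * exp (- lam * \<alpha> * T) \<le> 1"
proof -
 define m where "m = \<alpha> * T"
 have m: "m > 0" using T al by (simp add: m_def)
 have "((\<lambda>x::real. x ^ 3 * exp (- m * x)) \<longlongrightarrow> 0) at_top" using m by real_asymp
 from tendsto_mult_left[OF this, of "carl \<alpha> * (1 / T + 1)"]
 have "((\<lambda>x. carl \<alpha> * (1 / T + 1) * (x ^ 3 * exp (- m * x))) \<longlongrightarrow> 0) at_top" by simp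
 then have "eventually (\<lambda>x. carl \<alpha> * (1 / T + 1) * (x ^ 3 * exp (- m * x)) < 1) at_top" by (rule order_tendstoD(2)) simp
 then obtain N where "\<And>x. x \<ge> N ==> carl \<alpha> * (1 / T + 1) * (x ^ 3 * exp (- m * x)) < 1" unfolding eventually_at_top_linorder by blast
 then show ?thesis by (intro exI[of _ N]) (auto simp: m_def mult_ac intro: less_imp_le)
qed

text \<open>Some value beyond which the exponential beats the powers; it depends on \<open>\<alpha>\<close> and T but not on d.\<close>

definition exp_threshold :: "real => real => real" where
 "exp_threshold T \<alpha> = (SOME N. \<forall>lam\<ge>N. carl \<alpha> * lam ^ 3 * (1 / T + 1) * exp (- lam * \<alpha> * T) \<le> 1)"

definition lam_C :: "real => real" where "lam_C \<alpha> = max 1 (3 / (1 - 2 * \<alpha>))"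

definition lam_conv :: "real => real => real => real" where
 "lam_conv T \<alpha> D = max (lam_C \<alpha>) (max (exp_threshold T \<alpha>) (4 * Gam T \<alpha> D / carl \<alpha>))"

lemma lam_conv_ok:
 assumes T: "T > 0" and al: "0 < \<alpha>" "\<alpha> < 1/2" and lam: "lam \<ge> lam_conv T \<alpha> D" shows "lam_ok T \<alpha> D lam"
proof -
 have l: "lam \<ge> lam_C \<alpha>" "lam \<ge> exp_threshold T \<alpha>" "lam \<ge> 4 * Gam T \<alpha> D / carl \<alpha>" using lam by (auto simp: lam_conv_def)
 have "\<forall>lam\<ge>exp_threshold T \<alpha>. carl \<alpha> * lam ^ 3 * (1 / T + 1) * exp (- lam * \<alpha> * T) \<le> 1"
  unfolding exp_threshold_def by (rule someI_ex[OF exponential_threshold[OF T al(1)]])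
 then have "carl \<alpha> * lam ^ 3 * (1 / T + 1) * exp (- lam * \<alpha> * T) \<le> 1" using l(2) by blast
 moreover have "carl \<alpha> * lam \<ge> 4 * Gam T \<alpha> D" using l(3) carl_pos[OF al(2)] by (simp add: pos_divide_le_eq mult.commute)
 ultimately show ?thesis using l(1) by (simp add: lam_ok_def lam_C_def)
qed

text \<open>All constants grow with the radius D, so the threshold for 3d is at least the one for d.\<close>

lemma lam_conv_mono:
 assumes T: "T > 0" and al: "0 < \<alpha>" "\<alpha> < 1/2" and D: "0 \<le> D" "D \<le> D'" shows "lam_conv T \<alpha> D \<le> lam_conv T \<alpha> D'"
proof -
 have p: "D^2 \<le> D'^2" "D ^ 4 \<le> D' ^ 4" using D by (auto intro: power_mono)
 have k: "kk T \<ge> 0" "c0 T \<ge> 0" using kk_pos[OF T] c0_pos[OF T] by auto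
 have "Gam T \<alpha> D \<le> Gam T \<alpha> D'" unfolding Gam_def
  using p k al by (intro add_mono mult_left_mono divide_right_mono order_refl) auto
 then have "4 * Gam T \<alpha> D / carl \<alpha> \<le> 4 * Gam T \<alpha> D' / carl \<alpha>"
  using carl_pos[OF al(2)] by (intro divide_right_mono) auto
 then show ?thesis unfolding lam_conv_def by (intro max.mono order_refl)
qed

text \<open>Division of the proved estimate by its constant, which is common to all terms.\<close>

lemma carleman_estimate_holds:
 assumes T: "T > 0" and al: "0 < \<alpha>" "\<alpha> < 1/2" shows "carleman_estimate T \<alpha> (carl \<alpha>) (lam_C \<alpha>)"
 unfolding carleman_estimate_def Let_def rect_rc
proof (intro ballI allI impI)
 fix u lam assume u: "u \<in> H20 T" and lam: "lam \<ge> lam_C \<alpha>"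
 have l: "lam \<ge> 3 / (1 - 2 * \<alpha>)" "lam \<ge> 1" using lam by (auto simp: lam_C_def)
 have U: "u \<in> S 2 T" "trace_x 1 T 0 u (\<lambda>_. 0)" "trace_x 1 T 0 (dx T u) (\<lambda>_. 0)"
  using u by (auto simp: H20_def has_trace_x_def trace_x_def rect_rc)
 have A: "1 / (1 - 2 * \<alpha>) + 1 > 0" using al by (simp add: add_pos_pos)
 have *: "F \<ge> C * lam * a + C * lam ^ 3 * b + C * lam * c + C * lam ^ 3 * d - C * lam * e * f - C * lam ^ 3 * e * g"
  if "lam * a + lam ^ 3 * b + lam * c + lam ^ 3 * d - lam * e * f - lam ^ 3 * e * g \<le> A * F" "A > 0" "C = 1 / A" for a b c d e f g F A C :: real
 proof -
  have "C * (lam * a + lam ^ 3 * b + lam * c + lam ^ 3 * d - lam * e * f - lam ^ 3 * e * g) \<le> F"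
   using that by (simp add: pos_divide_le_eq mult.commute)
  then show ?thesis by (simp add: algebra_simps)
 qed
 show "(LINT z|Mrc 1 T. (wderiv (rc 1 T) 2 0 u z - 2 * wderiv (rc 1 T) 1 1 u z)^2 * wt \<alpha> lam z) \<ge>
   carl \<alpha> * lam * (LINT z|Mrc 1 T. ((dx T u z)^2 + (dt T u z)^2) * wt \<alpha> lam z)
   + carl \<alpha> * lam ^ 3 * (LINT z|Mrc 1 T. (u z)^2 * wt \<alpha> lam z)
   + carl \<alpha> * lam * (LINT x|Mi 1. (trace_t T 0 (dx T u) x)^2 * exp (- 2 * lam * x))
   + carl \<alpha> * lam ^ 3 * (LINT x|Mi 1. (trace_t T 0 u x)^2 * exp (- 2 * lam * x))
   - carl \<alpha> * lam * exp (- 2 * lam * \<alpha> * T) * (LINT x|Mi 1. (trace_t T T (dx T u) x)^2)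
   - carl \<alpha> * lam ^ 3 * exp (- 2 * lam * \<alpha> * T) * (LINT x|Mi 1. (trace_t T T u x)^2)"
  by (rule *[OF carleman[OF T al l U] A carl_def])
qed

text \<open>Points of the closure of B have norm at most d and differ by increments.\<close>

lemma J_strict_convexity_holds:
 assumes T: "T \<ge> 2" and al: "0 < \<alpha>" "\<alpha> < 1/2" and ep: "0 < \<epsilon>" "\<epsilon> < 2 * \<alpha>" and d: "d > 0"
 shows "J_strict_convexity T \<alpha> \<epsilon> d (lam_conv T \<alpha> d) (carl \<alpha> / 4)"
 unfolding J_strict_convexity_def
proof (intro allI conjI impI ballI)
 have T0: "T > 0" using T by simp
 fix p0 p1
 show "\<exists>g. has_gradient T (J T \<alpha> lam \<beta>) w g" if lam: "lam > 0" and \<beta>: "\<beta> > 0" and w: "w \<in> H3_closure T (B T d p0 p1)" for lam \<beta> w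
  using J_has_gradient[OF T0 less_imp_le[OF al(1)] less_imp_le[OF lam] less_imp_le[OF \<beta>] closure_B(1)[OF T0 w w]] by blast
 show "convexity_bound T \<alpha> \<epsilon> lam \<beta> (carl \<alpha> / 4) (J T \<alpha> lam \<beta>) w1 w2"
  if lam: "lam \<ge> lam_conv T \<alpha> d" and \<beta>: "\<beta> \<in> {2 * exp (- lam * \<alpha> * T)..<1}"
   and w1: "w1 \<in> H3_closure T (B T d p0 p1)" and w2: "w2 \<in> H3_closure T (B T d p0 p1)" for lam \<beta> w1 w2
  by (rule J_convexity_bound[OF T al ep lam_conv_ok[OF T0 al lam] _ closure_B(1,2)[OF T0 w1 w1] closure_B(1,2)[OF T0 w2 w2] closure_B(3)[OF T0 w1 w2]])
   (use \<beta> in simp)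
qed

theorem theorem4p4:
  fixes T :: real
  assumes "T \<ge> 2"
  shows "\<exists>(C :: real \<Rightarrow> real) (lam0 :: real \<Rightarrow> real)
      (lam1 :: real \<Rightarrow> real \<Rightarrow> real \<Rightarrow> real)
      (C1 :: real \<Rightarrow> real \<Rightarrow> real \<Rightarrow> real) (C1' :: real \<Rightarrow> real \<Rightarrow> real \<Rightarrow> real).
    (\<forall>\<alpha>\<in>{0<..<1/2}. C \<alpha> > 0 \<and> lam0 \<alpha> \<ge> 1 \<and> carleman_estimate T \<alpha> (C \<alpha>) (lam0 \<alpha>)) \<and>
    (\<forall>\<alpha>\<in>{0<..<1/2}. \<forall>\<epsilon>\<in>{0<..<2 * \<alpha>}. \<forall>d>0.
       lam1 \<alpha> \<epsilon> d \<ge> lam0 \<alpha> \<and> C1 \<alpha> \<epsilon> d > 0 \<and>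
       J_strict_convexity T \<alpha> \<epsilon> d (lam1 \<alpha> \<epsilon> d) (C1 \<alpha> \<epsilon> d)) \<and>
    (\<forall>\<alpha>\<in>{0<..<1/2}. \<forall>\<epsilon>\<in>{0<..<2 * \<alpha>}. \<forall>d>0.
       lam1 \<alpha> \<epsilon> (3 * d) \<ge> lam1 \<alpha> \<epsilon> d \<and> C1' \<alpha> \<epsilon> d > 0 \<and>
       (\<forall>a_star u_star p0 p1 \<xi> G_star G.
          admissible_coefficient a_star \<and> solves_wave_problem a_star u_star \<and>
          w_of u_star \<in> B T d (p0_of u_star) (p1_of u_star) \<and>
          \<xi> \<in> {0<..<1} \<and>
          G_star \<in> B T d (p0_of u_star) (p1_of u_star) \<and> G \<in> B T d p0 p1 \<and>
          H3_norm T (G - G_star) < \<xi> \<longrightarrow>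
          (let K = H3_closure T (B0 T (2 * d));
               I = (\<lambda>lam \<beta> W. J T \<alpha> lam \<beta> (W + G));
               lam2 = lam1 \<alpha> \<epsilon> (3 * d)
           in
             (\<forall>lam>0. \<forall>\<beta>>0. \<forall>W\<in>K. \<exists>g. has_gradient T (I lam \<beta>) W g) \<and>
             (\<forall>lam\<ge>lam2. \<forall>\<beta>\<in>{2 * exp (- lam * \<alpha> * T)..<1}.
                strictly_convex_on T K (I lam \<beta>) \<and>
                (\<forall>W1\<in>K. \<forall>W2\<in>K. convexity_bound T \<alpha> \<epsilon> lam \<beta> (C1' \<alpha> \<epsilon> d) (I lam \<beta>) W1 W2) \<and>
                (\<exists>W_min. is_minimizer K (I lam \<beta>) W_min \<and>
                   (\<forall>V. is_minimizer K (I lam \<beta>) V \<longrightarrow>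
                      (AE z in lebesgue_on (rect T). V z = W_min z)) \<and>
                   (\<forall>W\<in>K. H3_inner T (gradient T (I lam \<beta>) W_min) (W - W_min) \<ge> 0))))))"
 unfolding Let_def
proof (rule exI[of _ carl], rule exI[of _ lam_C], rule exI[of _ "\<lambda>\<alpha> \<epsilon> d. lam_conv T \<alpha> d"], rule exI[of _ "\<lambda>\<alpha> \<epsilon> d. carl \<alpha> / 4"],
  rule exI[of _ "\<lambda>\<alpha> \<epsilon> d. carl \<alpha> / 4"], intro conjI ballI allI impI)
 have T0: "T > 0" using assms by simp
 fix \<alpha> :: real assume "\<alpha> \<in> {0<..<1/2}"
 then have al: "0 < \<alpha>" "\<alpha> < 1/2" by auto
 show "carl \<alpha> > 0" by (rule carl_pos[OF al(2)])
 show "lam_C \<alpha> \<ge> 1" by (simp add: lam_C_def)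
 show "carleman_estimate T \<alpha> (carl \<alpha>) (lam_C \<alpha>)" by (rule carleman_estimate_holds[OF T0 al])
 fix \<epsilon> d :: real assume "\<epsilon> \<in> {0<..<2 * \<alpha>}" and d: "d > 0"
 then have ep: "0 < \<epsilon>" "\<epsilon> < 2 * \<alpha>" by auto
 show "lam_conv T \<alpha> d \<ge> lam_C \<alpha>" by (simp add: lam_conv_def)
 show "carl \<alpha> / 4 > 0" "carl \<alpha> / 4 > 0" using carl_pos[OF al(2)] by auto
 show "J_strict_convexity T \<alpha> \<epsilon> d (lam_conv T \<alpha> d) (carl \<alpha> / 4)" by (rule J_strict_convexity_holds[OF assms al ep d])
 show "lam_conv T \<alpha> (3 * d) \<ge> lam_conv T \<alpha> d" by (rule lam_conv_mono[OF T0 al]) (use d in auto)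
 fix a_star u_star p0 p1 \<xi> G_star G
 assume "admissible_coefficient a_star \<and> solves_wave_problem a_star u_star \<and>
     w_of u_star \<in> B T d (p0_of u_star) (p1_of u_star) \<and> \<xi> \<in> {0<..<1} \<and>
     G_star \<in> B T d (p0_of u_star) (p1_of u_star) \<and> G \<in> B T d p0 p1 \<and> H3_norm T (G - G_star) < \<xi>"
 then have G: "G \<in> S 3 T" "nS 3 T G < d" by (auto simp: B_def rect_rc)
 {
  fix lam \<beta> :: real and W assume lam: "lam > 0" and \<beta>: "\<beta> > 0" and W: "W \<in> H3_closure T (B0 T (2 * d))"
  have "W \<in> S 3 T" using W by (simp add: H3_closure_def rect_rc)
  from J_has_gradient[OF T0 less_imp_le[OF al(1)] less_imp_le[OF lam] less_imp_le[OF \<beta>] Sob.add[OF this G(1)]]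
  show "\<exists>g. has_gradient T (\<lambda>W. J T \<alpha> lam \<beta> (W + G)) W g" unfolding has_gradient_shift by blast
 }
 { fix lam \<beta> :: real assume "lam \<ge> lam_conv T \<alpha> (3 * d)" and "\<beta> \<in> {2 * exp (- lam * \<alpha> * T)..<1}"
  then have lam: "lam_ok T \<alpha> (3 * d) lam" and \<beta>: "\<beta> \<ge> 2 * exp (- lam * \<alpha> * T)" using lam_conv_ok[OF T0 al] by auto
  show "strictly_convex_on T (H3_closure T (B0 T (2 * d))) (\<lambda>W. J T \<alpha> lam \<beta> (W + G))"
   by (rule strictly_convex_with_unique_minimizer(1)[OF assms al d lam \<beta> G])
  show "\<exists>W_min. is_minimizer (H3_closure T (B0 T (2 * d))) (\<lambda>W. J T \<alpha> lam \<beta> (W + G)) W_min \<and>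
    (\<forall>V. is_minimizer (H3_closure T (B0 T (2 * d))) (\<lambda>W. J T \<alpha> lam \<beta> (W + G)) V \<longrightarrow> (AE z in lebesgue_on (rect T). V z = W_min z)) \<and>
    (\<forall>W\<in>H3_closure T (B0 T (2 * d)). H3_inner T (gradient T (\<lambda>W. J T \<alpha> lam \<beta> (W + G)) W_min) (W - W_min) \<ge> 0)"
   by (rule strictly_convex_with_unique_minimizer(2)[OF assms al d lam \<beta> G])
  fix W1 W2 assume W: "W1 \<in> H3_closure T (B0 T (2 * d))" "W2 \<in> H3_closure T (B0 T (2 * d))"
  show "convexity_bound T \<alpha> \<epsilon> lam \<beta> (carl \<alpha> / 4) (\<lambda>W. J T \<alpha> lam \<beta> (W + G)) W1 W2"
   by (rule J_convexity_bound_shifted[OF assms al ep d lam \<beta> G W]) }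
qed

end
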